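(* The family $(\mathcal{E}_T)_{T>0}$ of statistical experiments is LAQ at $0$ with scaling $r_{0,T}=\frac1T$, $T>0$, and with $$\Delta_0=\int_0^1\mathcal{W}(t)\,\mathrm{d}\mathcal{W}(t),\qquad J_0=\int_0^1\mathcal{W}(t)^2\,\mathrm{d}t,$$ where $(\mathcal{W}(t))_{t\in[0,1]}$ is a standard Wiener process.
   Context: Setting. On a probability space $(\Omega,\mathcal{A},\mathbb{P})$ let $(W(t))_{t\geq 0}$ be a standard Wiener process and $(X_0(t))_{t\in[-1,0]}$ a fixed continuous stochastic process independent of $W$. For $a\in\mathbb{R}$ let $X^{(a)}=(X^{(a)}(t))_{t\in[-1,\infty)}$ be the pathwise unique continuous solution of $$X(t)=X_0(0)+a\int_0^t\int_{-1}^0 X(s+u)\,\mathrm{d}u\,\mathrm{d}s+W(t)\ (t\geq 0),\qquad X(t)=X_0(t)\ (t\in[-1,0]).$$ For $T>0$ let $\mathbb{P}_{a,T}$ be the law of $(X^{(a)}(t))_{t\in[-1,T]}$ on $(C([-1,T]),\mathcal{B}(C([-1,T])))$; for fixed $T$ these measures, $a \in \mathbb{R}$, are mutually absolutely continuous. Put $\mathcal{E}_T:=\bigl(C([-1,T]),\mathcal{B}(C([-1,T])),\{\mathbb{P}_{a,T}:a\in\mathbb{R}\}\bigr)$, $T>0$. Definition (parameter set $\mathbb{R}$). The family $(\mathcal{E}_T)_{T>0}$ is LAQ (locally asymptotically quadratic) at $a$ with scaling $r_{a,T}\in\mathbb{R}$ and limit $(\Delta_a,J_a)$ if there exist real random variables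 $\Delta_{a,T}$, $J_{a,T}$ ($T>0$) and $\Delta_a$, $J_a$ such that: (1) for every bounded family $h_T\in\mathbb{R}$, $T>0$, $$\log\frac{\mathrm{d}\mathbb{P}_{a+r_{a,T}h_T,T}}{\mathrm{d}\mathbb{P}_{a,T}}\bigl(X^{(a)}|_{[-1,T]}\bigr)=h_T\Delta_{a,T}-\tfrac12 h_T^2J_{a,T}+o_{\mathbb{P}}(1)\quad\text{as }T\to\infty;$$ (2) $(\Delta_{a,T},J_{a,T})\to(\Delta_a,J_a)$ in distribution as $T\to\infty$; (3) $\mathbb{P}(J_a>0)=1$; (4) $\mathbb{E}\exp\{h\Delta_a-\frac12h^2J_a\}=1$ for all $h\in\mathbb{R}$. *)

theory Defs
  imports "HOL-Probability.Probability"
begin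

section \<open>Wiener processes\<close>

text \<open>Processes are curried as time, then sample point. Paths are continuous for every sample point,
  not just almost surely, so that they are random elements of a space of continuous functions.\<close>

definition continuous_process :: "'o measure \<Rightarrow> real set \<Rightarrow> (real \<Rightarrow> 'o \<Rightarrow> real) \<Rightarrow> bool" where
  "continuous_process M I X \<longleftrightarrow>
     (\<forall>t\<in>I. X t \<in> borel_measurable M) \<and> (\<forall>\<omega>\<in>space M. continuous_on I (\<lambda>t. X t \<omega>))"

definition wiener_process :: "'o measure \<Rightarrow> real set \<Rightarrow> (real \<Rightarrow> 'o \<Rightarrow> real) \<Rightarrow> bool" where
  "wiener_process M I W \<longleftrightarrow>
     prob_space M \<and> continuous_process M I W \<and>
     (AE \<omega> in M. W 0 \<omega> = 0) \<and>
     (\<forall>n (t :: nat \<Rightarrow> real). (\<forall>i\<le>n. t i \<in> I) \<and> (\<forall>i<n. t i < t (Suc i)) \<longrightarrow>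
        prob_space.indep_vars M (\<lambda>_. borel) (\<lambda>i \<omega>. W (t (Suc i)) \<omega> - W (t i) \<omega>) {..<n}) \<and>
     (\<forall>s\<in>I. \<forall>t\<in>I. s < t \<longrightarrow>
        distributed M lborel (\<lambda>\<omega>. W t \<omega> - W s \<omega>) (normal_density 0 (sqrt (t - s))))"

section \<open>The Ito integral of a square integrable integrand\<close>

definition natural_filtration :: "'o measure \<Rightarrow> (real \<Rightarrow> 'o \<Rightarrow> real) \<Rightarrow> real \<Rightarrow> 'o measure" where
  "natural_filtration M W t =
     sigma (space M) {W s -` B \<inter> space M | s B. 0 \<le> s \<and> s \<le> t \<and> B \<in> sets borel}"

text \<open>The data \<open>(k, \<tau>, \<xi>)\<close> stand for the simple process with value \<open>\<xi> i\<close> on the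
  interval from \<open>\<tau> i\<close> (exclusive) to \<open>\<tau> (Suc i)\<close> (inclusive), where \<open>0 = \<tau> 0 < \<dots> < \<tau> k = b\<close>.\<close>

definition simple_process ::
  "'o measure \<Rightarrow> (real \<Rightarrow> 'o \<Rightarrow> real) \<Rightarrow> real \<Rightarrow> nat \<Rightarrow> (nat \<Rightarrow> real) \<Rightarrow> (nat \<Rightarrow> 'o \<Rightarrow> real) \<Rightarrow> bool" where
  "simple_process M W b k \<tau> \<xi> \<longleftrightarrow>
     \<tau> 0 = 0 \<and> \<tau> k = b \<and> (\<forall>i<k. \<tau> i < \<tau> (Suc i)) \<and>
     (\<forall>i<k. \<xi> i \<in> borel_measurable (natural_filtration M W (\<tau> i)) \<and>
            integrable M (\<lambda>\<omega>. (\<xi> i \<omega>)\<^sup>2))"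

definition simple_value :: "nat \<Rightarrow> (nat \<Rightarrow> real) \<Rightarrow> (nat \<Rightarrow> 'o \<Rightarrow> real) \<Rightarrow> real \<Rightarrow> 'o \<Rightarrow> real" where
  "simple_value k \<tau> \<xi> t \<omega> = (\<Sum>i<k. \<xi> i \<omega> * indicator {\<tau> i<..\<tau> (Suc i)} t)"

definition simple_integral ::
  "(real \<Rightarrow> 'o \<Rightarrow> real) \<Rightarrow> nat \<Rightarrow> (nat \<Rightarrow> real) \<Rightarrow> (nat \<Rightarrow> 'o \<Rightarrow> real) \<Rightarrow> 'o \<Rightarrow> real" where
  "simple_integral W k \<tau> \<xi> \<omega> = (\<Sum>i<k. \<xi> i \<omega> * (W (\<tau> (Suc i)) \<omega> - W (\<tau> i) \<omega>))"

text \<open>\<open>Y\<close> is a version of the integral of \<open>H\<close> over \<open>[0, b]\<close> against \<open>W\<close>: the mean square limit of the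
  integrals of simple processes approximating \<open>H\<close> in mean square.\<close>

definition has_ito_integral ::
  "'o measure \<Rightarrow> (real \<Rightarrow> 'o \<Rightarrow> real) \<Rightarrow> real \<Rightarrow> (real \<Rightarrow> 'o \<Rightarrow> real) \<Rightarrow> ('o \<Rightarrow> real) \<Rightarrow> bool" where
  "has_ito_integral M W b H Y \<longleftrightarrow>
     Y \<in> borel_measurable M \<and>
     (\<lambda>(t, \<omega>). H t \<omega>) \<in> borel_measurable (restrict_space borel {0..b} \<Otimes>\<^sub>M M) \<and>
     (\<forall>t\<in>{0..b}. H t \<in> borel_measurable (natural_filtration M W t)) \<and>
     (\<exists>k \<tau> \<xi>. (\<forall>n::nat. simple_process M W b (k n) (\<tau> n) (\<xi> n)) \<and>
        (\<lambda>n. \<integral>\<^sup>+\<omega>. (\<integral>\<^sup>+t\<in>{0..b}. ennreal ((H t \<omega> - simple_value (k n) (\<tau> n) (\<xi> n) t \<omega>)\<^sup>2) \<partial>lborel) \<partial>M)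
           \<longlonglongrightarrow> 0 \<and>
        (\<lambda>n. \<integral>\<^sup>+\<omega>. ennreal ((Y \<omega> - simple_integral W (k n) (\<tau> n) (\<xi> n) \<omega>)\<^sup>2) \<partial>M) \<longlonglongrightarrow> 0)"

text \<open>The integral is determined only up to almost sure equality; choose one version.\<close>

definition ito_integral ::
  "'o measure \<Rightarrow> (real \<Rightarrow> 'o \<Rightarrow> real) \<Rightarrow> real \<Rightarrow> (real \<Rightarrow> 'o \<Rightarrow> real) \<Rightarrow> 'o \<Rightarrow> real" where
  "ito_integral M W b H = (SOME Y. has_ito_integral M W b H Y)"

section \<open>The delay equation and its statistical experiments\<close>

definition delay_solution ::
  "'o measure \<Rightarrow> (real \<Rightarrow> 'o \<Rightarrow> real) \<Rightarrow> (real \<Rightarrow> 'o \<Rightarrow> real) \<Rightarrow> real \<Rightarrow> (real \<Rightarrow> 'o \<Rightarrow> real) \<Rightarrow> bool" where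
  "delay_solution M W X0 a X \<longleftrightarrow>
     continuous_process M {-1..} X \<and>
     (AE \<omega> in M.
        (\<forall>t\<in>{-1..0}. X t \<omega> = X0 t \<omega>) \<and>
        (\<forall>t\<ge>0. X t \<omega> = X0 0 \<omega>
           + a * integral {0..t} (\<lambda>s. integral {-1..0} (\<lambda>u. X (s + u) \<omega>)) + W t \<omega>))"

text \<open>\<open>C([-1, T])\<close> with the supremum metric consists of functions that are \<open>undefined\<close> outside
  \<open>[-1, T]\<close>, hence the \<open>restrict\<close> in \<open>path_upto\<close>.\<close>

definition C_metric :: "real \<Rightarrow> (real \<Rightarrow> real) metric" where
  "C_metric T = cfunspace (top_of_set {-1..T}) euclidean_metric"

definition C_borel :: "real \<Rightarrow> (real \<Rightarrow> real) measure" where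
  "C_borel T = sigma (mspace (C_metric T)) {U. openin (mtopology_of (C_metric T)) U}"

definition path_upto :: "(real \<Rightarrow> 'o \<Rightarrow> real) \<Rightarrow> real \<Rightarrow> 'o \<Rightarrow> (real \<Rightarrow> real)" where
  "path_upto X T \<omega> = restrict (\<lambda>t. X t \<omega>) {-1..T}"

definition path_law :: "'o measure \<Rightarrow> (real \<Rightarrow> 'o \<Rightarrow> real) \<Rightarrow> real \<Rightarrow> (real \<Rightarrow> real) measure" where
  "path_law M X T = distr M (C_borel T) (path_upto X T)"

text \<open>\<open>RN_deriv P Q\<close> is the density of \<open>Q\<close> with respect to \<open>P\<close>.\<close>

definition log_likelihood_ratio ::
  "'o measure \<Rightarrow> (real \<Rightarrow> real \<Rightarrow> 'o \<Rightarrow> real) \<Rightarrow> real \<Rightarrow> real \<Rightarrow> real \<Rightarrow> 'o \<Rightarrow> real" where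
  "log_likelihood_ratio M X a' a T \<omega> =
     ln (enn2real (RN_deriv (path_law M (X a) T) (path_law M (X a') T) (path_upto (X a) T \<omega>)))"

section \<open>Local asymptotic quadraticity\<close>

definition tends_to_zero_in_probability ::
  "'o measure \<Rightarrow> ('i \<Rightarrow> 'o \<Rightarrow> real) \<Rightarrow> 'i filter \<Rightarrow> bool" where
  "tends_to_zero_in_probability M R F \<longleftrightarrow>
     (\<forall>\<^sub>F i in F. R i \<in> borel_measurable M) \<and>
     (\<forall>\<epsilon>>0. ((\<lambda>i. measure M {\<omega>\<in>space M. \<epsilon> < \<bar>R i \<omega>\<bar>}) \<longlongrightarrow> 0) F)"

definition tends_in_distribution ::
  "'o measure \<Rightarrow> ('i \<Rightarrow> 'o \<Rightarrow> 'b::topological_space) \<Rightarrow> 'l measure \<Rightarrow> ('l \<Rightarrow> 'b) \<Rightarrow> 'i filter \<Rightarrow> bool" where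
  "tends_in_distribution M Y L Z F \<longleftrightarrow>
     (\<forall>f :: 'b \<Rightarrow> real. continuous_on UNIV f \<and> bounded (range f) \<longrightarrow>
        ((\<lambda>i. \<integral>\<omega>. f (Y i \<omega>) \<partial>M) \<longlongrightarrow> (\<integral>\<omega>. f (Z \<omega>) \<partial>L)) F)"

text \<open>\<open>X a\<close> is the process with parameter \<open>a\<close>, living on \<open>M\<close>; the limit \<open>(\<Delta>, J)\<close> lives on a probability space
  \<open>L\<close> of its own. In the last clause an integral equal to 1 entails integrability.\<close>

definition LAQ ::
  "'o measure \<Rightarrow> (real \<Rightarrow> real \<Rightarrow> 'o \<Rightarrow> real) \<Rightarrow> real \<Rightarrow> (real \<Rightarrow> real)
     \<Rightarrow> 'l measure \<Rightarrow> ('l \<Rightarrow> real) \<Rightarrow> ('l \<Rightarrow> real) \<Rightarrow> bool" where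
  "LAQ M X a r L \<Delta> J \<longleftrightarrow>
     prob_space L \<and> \<Delta> \<in> borel_measurable L \<and> J \<in> borel_measurable L \<and>
     (\<exists>\<Delta>T JT :: real \<Rightarrow> 'o \<Rightarrow> real.
        (\<forall>T>0. \<Delta>T T \<in> borel_measurable M \<and> JT T \<in> borel_measurable M) \<and>
        (\<forall>h :: real \<Rightarrow> real. bounded (h ` {0<..}) \<longrightarrow>
           tends_to_zero_in_probability M
             (\<lambda>T \<omega>. log_likelihood_ratio M X (a + r T * h T) a T \<omega>
                - (h T * \<Delta>T T \<omega> - 1 / 2 * (h T)\<^sup>2 * JT T \<omega>)) at_top) \<and>
        tends_in_distribution M (\<lambda>T \<omega>. (\<Delta>T T \<omega>, JT T \<omega>)) L (\<lambda>\<omega>. (\<Delta> \<omega>, J \<omega>)) at_top) \<and>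
     (AE \<omega> in L. J \<omega> > 0) \<and>
     (\<forall>h :: real. (\<integral>\<omega>. exp (h * \<Delta> \<omega> - 1 / 2 * h\<^sup>2 * J \<omega>) \<partial>L) = 1)"

end

theory Submission
  imports Defs
begin

text \<open>For the parameter \<open>0\<close> the process is \<open>X0 0 + W\<close> after time \<open>0\<close>, and the law for the parameter \<open>a\<close> has
  the Girsanov density \<open>exp (a * S - a\<^sup>2 / 2 * I)\<close> with respect to the law for the parameter \<open>0\<close>. Here, with \<open>Y t\<close> the
  integral of the path over \<open>[t - 1, t]\<close>, \<open>S\<close> is the stochastic integral of \<open>Y\<close> against the path over \<open>[0, T]\<close> and \<open>I\<close> the integral
  of \<open>Y\<^sup>2\<close>. Since \<open>Y\<close> is continuously differentiable, integration by parts turns \<open>S\<close> into a continuous functional of the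
  path (\<open>score\<close>, \<open>information\<close>). With \<open>a = h / T\<close> the log likelihood ratio is exactly
  \<open>h * (S / T) - h\<^sup>2 / 2 * (I / T\<^sup>2)\<close>, almost surely (\<open>log_likelihood_ratio_eq\<close>), and it remains to find the limit law of
  \<open>(S / T, I / T\<^sup>2)\<close> and to study that limit.

  The density is derived without stochastic calculus. On a grid the delay equation becomes an Euler scheme, that is, a chain
  with Gaussian innovations whose drift is determined by the past, and such a drift is removed by shifting normal densities
  (\<open>discrete_girsanov\<close>). The scheme and the discrete log densities converge along each path (\<open>euler_approximates\<close>,
  \<open>grid_log_lik_tendsto\<close>). The limit is taken under a cutoff of the log density, which makes all weights bounded
  (\<open>truncated_girsanov\<close>); the cutoff is removed by monotone convergence (\<open>girsanov_cylinder\<close>). Half spaces generate the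
  Borel sets of the path space (\<open>sets_C_borel\<close>), so this identifies the density on the path space.

  For the limit, \<open>S\<close> is rewritten as half the squared terminal value minus half the integrated squared increments at lag one
  (\<open>score_eq_squares\<close>). The latter obey a law of large numbers, so \<open>S / T\<close> is asymptotically
  \<open>((W T)\<^sup>2 / T - 1) / 2\<close>; likewise \<open>I / T\<^sup>2\<close> is asymptotically the integral of \<open>W\<^sup>2\<close> divided by \<open>T\<^sup>2\<close> (\<open>score_remainder\<close>,
  \<open>information_remainder\<close>). By Brownian scaling the joint law of these two variables is that of \<open>((\<W> 1)\<^sup>2 - 1) / 2\<close> and
  the integral of \<open>\<W>\<^sup>2\<close> over \<open>[0, 1]\<close>, whatever \<open>T\<close> is (\<open>wiener_scaling\<close>).

  The first of these is the Ito integral of \<open>\<W>\<close> against itself. For every simple process the mean square error of its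
  integral equals its mean square distance from the Wiener process (\<open>simple_integral_error\<close>, \<open>simple_value_error\<close>), which gives
  existence and uniqueness at once (\<open>ito_integral_wiener\<close>). The limit density integrates to \<open>1\<close> because the discrete
  densities for the drift \<open>h\<close> times the current value do and because their mass cannot escape: under the drifted law, terminal
  value and quadratic variation have bounded second moments (\<open>wiener_exponential_moment\<close>).\<close>

section \<open>Riemann sums and time integrals of continuous processes\<close>

text \<open>The sampled values \<open>c j\<close> need not be values of \<open>g\<close>: later they come from an approximating
  path, and \<open>\<epsilon>\<close> collects both the sampling error and the error of the path.\<close>

lemma riemann_error:
  fixes g :: "real \<Rightarrow> real"
  assumes \<delta>: "\<delta> \<ge> 0"
    and err: "\<And>j t. j < N \<Longrightarrow> t \<in> {a + real j * \<delta>..a + real (Suc j) * \<delta>} \<Longrightarrow> \<bar>c j - g t\<bar> \<le> \<epsilon>"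
    and int: "g integrable_on {a..a + real N * \<delta>}"
  shows "\<bar>\<delta> * (\<Sum>j<N. c j) - integral {a..a + real N * \<delta>} g\<bar> \<le> \<epsilon> * (real N * \<delta>)"
  using err int
proof (induction N)
  case 0
  then show ?case by simp
next
  case (Suc N)
  let ?u = "a + real N * \<delta>" and ?v = "a + real (Suc N) * \<delta>"
  have le: "a \<le> ?u" "?u \<le> ?v" using \<delta> by (auto simp: algebra_simps)
  have gi: "g integrable_on {?u..?v}" "g integrable_on {a..?u}"
    using Suc.prems(2) le by (auto intro: integrable_on_subinterval)
  have comb: "integral {a..?v} g = integral {a..?u} g + integral {?u..?v} g"
    using Henstock_Kurzweil_Integration.integral_combine[OF le Suc.prems(2)] by simp
  have len: "?v - ?u = \<delta>" by (simp add: algebra_simps)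
  have "integral {?u..?v} (\<lambda>t. c N - g t) = \<delta> * c N - integral {?u..?v} g"
    using gi(1) le len by (subst Henstock_Kurzweil_Integration.integral_diff) auto
  moreover have "norm (integral {?u..?v} (\<lambda>t. c N - g t)) \<le> \<epsilon> * (?v - ?u)"
  proof (cases "\<delta> = 0")
    case False
    have "\<epsilon> \<ge> 0"
      using Suc.prems(1)[of N ?u] le by fastforce
    show ?thesis
      using has_integral_bound_real[OF \<open>\<epsilon> \<ge> 0\<close> finite.emptyI
        integrable_integral[OF integrable_diff[OF integrable_const_ivl gi(1)], of "c N"]] Suc.prems(1)[of N] le
      by (auto simp: mult.commute)
  qed simp
  moreover have "\<bar>\<delta> * (\<Sum>j<N. c j) - integral {a..?u} g\<bar> \<le> \<epsilon> * (real N * \<delta>)"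
    using Suc.IH Suc.prems(1) gi(2) by auto
  ultimately show ?case
    unfolding comb len by (simp add: algebra_simps)
qed

lemma uniform_modulus:
  fixes f :: "real \<Rightarrow> real"
  assumes "continuous_on {a..b} f" "\<epsilon> > 0"
  obtains d where "d > 0" "\<And>s t. s \<in> {a..b} \<Longrightarrow> t \<in> {a..b} \<Longrightarrow> \<bar>s - t\<bar> < d \<Longrightarrow> \<bar>f s - f t\<bar> < \<epsilon>"
  using compact_uniformly_continuous[OF assms(1) compact_Icc] assms(2)
  unfolding uniformly_continuous_on_def dist_real_def by metis

lemma riemann_sums_tendsto:
  fixes f :: "real \<Rightarrow> real"
  assumes ab: "a \<le> b" and f: "continuous_on {a..b} f"
  shows "(\<lambda>n. (b - a) / real n * (\<Sum>i<n. f (a + real i * ((b - a) / real n)))) \<longlonglongrightarrow> integral {a..b} f"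
proof (rule LIMSEQ_I)
  fix r :: real assume r: "r > 0"
  define \<epsilon> where "\<epsilon> = r / (b - a + 1)"
  have \<epsilon>: "\<epsilon> > 0" using r ab by (auto simp: \<epsilon>_def)
  obtain d where d: "d > 0" "\<And>s t. s \<in> {a..b} \<Longrightarrow> t \<in> {a..b} \<Longrightarrow> \<bar>s - t\<bar> < d \<Longrightarrow> \<bar>f s - f t\<bar> < \<epsilon>"
    using uniform_modulus[OF f \<epsilon>] by blast
  obtain n0 :: nat where n0: "real n0 > (b - a) / d" using reals_Archimedean2 by blast
  have "\<bar>(b - a) / real n * (\<Sum>i<n. f (a + real i * ((b - a) / real n))) - integral {a..b} f\<bar> < r"
    if n: "n \<ge> Suc n0" for n
  proof -
    define \<delta> where "\<delta> = (b - a) / real n"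
    have n1: "real n > 0" "real n > (b - a) / d" using n n0 by linarith+
    have \<delta>: "\<delta> \<ge> 0" "\<delta> < d" "a + real n * \<delta> = b"
      using n1 d ab by (auto simp: \<delta>_def field_simps)
    have le: "a + real i * \<delta> \<le> b" if "i \<le> n" for i
    proof -
      have "real i * \<delta> \<le> real n * \<delta>" using that \<delta>(1) by (intro mult_right_mono) auto
      then show ?thesis using \<delta>(3) by simp
    qed
    have "\<bar>\<delta> * (\<Sum>i<n. f (a + real i * \<delta>)) - integral {a..a + real n * \<delta>} f\<bar> \<le> \<epsilon> * (real n * \<delta>)"
    proof (rule riemann_error)
      fix j t assume j: "j < n" and t: "t \<in> {a + real j * \<delta>..a + real (Suc j) * \<delta>}"
      have *: "0 \<le> real j * \<delta>" using \<delta> by simp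
      show "\<bar>f (a + real j * \<delta>) - f t\<bar> \<le> \<epsilon>"
        using t le[of j] le[of "Suc j"] j \<delta> * order_trans[of a "a + real j * \<delta>" t] by (intro less_imp_le d(2)) (auto simp: algebra_simps add_increasing)
    next
      show "f integrable_on {a..a + real n * \<delta>}" unfolding \<delta>(3) using f by (rule integrable_continuous_real)
    qed (use \<delta> in auto)
    also have "real n * \<delta> = b - a" using \<delta> by simp
    also have "\<epsilon> * (b - a) < r"
    proof -
      have "\<epsilon> * (b - a) < \<epsilon> * (b - a + 1)" using \<epsilon> by simp
      also have "\<dots> = r" using ab by (simp add: \<epsilon>_def)
      finally show ?thesis .
    qed
    finally show ?thesis using \<delta>(3) by (simp add: \<delta>_def)
  qed
  then show "\<exists>no. \<forall>n\<ge>no. norm ((b - a) / real n * (\<Sum>i<n. f (a + real i * ((b - a) / real n))) - integral {a..b} f) < r"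
    by auto
qed

lemma borel_measurable_integral_process:
  fixes f :: "real \<Rightarrow> 'o \<Rightarrow> real"
  assumes meas: "\<And>t. t \<in> {a..b} \<Longrightarrow> f t \<in> borel_measurable M"
    and cont: "\<And>\<omega>. \<omega> \<in> space M \<Longrightarrow> continuous_on {a..b} (\<lambda>t. f t \<omega>)"
  shows "(\<lambda>\<omega>. integral {a..b} (\<lambda>t. f t \<omega>)) \<in> borel_measurable M"
proof (cases "a \<le> b")
  case True
  show ?thesis
  proof (rule borel_measurable_LIMSEQ_real)
    show "(\<lambda>n. (b - a) / real n * (\<Sum>i<n. f (a + real i * ((b - a) / real n)) \<omega>)) \<longlonglongrightarrow> integral {a..b} (\<lambda>t. f t \<omega>)"
      if "\<omega> \<in> space M" for \<omega>
      using riemann_sums_tendsto[OF True cont[OF that]] .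
    fix n :: nat
    have "a + real i * ((b - a) / real n) \<in> {a..b}" if "i < n" for i
    proof -
      have "real i * ((b - a) / real n) \<le> real n * ((b - a) / real n)"
        using that True by (intro mult_right_mono) auto
      then show ?thesis using that True by auto
    qed
    then show "(\<lambda>\<omega>. (b - a) / real n * (\<Sum>i<n. f (a + real i * ((b - a) / real n)) \<omega>)) \<in> borel_measurable M"
      using meas by (intro borel_measurable_times borel_measurable_sum) auto
  qed
qed simp

text \<open>Joint measurability comes from time discretization: rounding the time down to a multiple of
  \<open>1 / Suc n\<close> leaves countably many times, and path continuity removes the rounding. Clipping the time to
  \<open>{a..b}\<close> keeps the rounded times inside the domain of the process.\<close>

lemma borel_measurable_process_clip:
  fixes f :: "real \<Rightarrow> 'o \<Rightarrow> real"
  assumes ab: "a \<le> b" and meas: "\<And>t. t \<in> {a..b} \<Longrightarrow> f t \<in> borel_measurable M"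
    and cont: "\<And>\<omega>. \<omega> \<in> space M \<Longrightarrow> continuous_on {a..b} (\<lambda>t. f t \<omega>)"
  shows "(\<lambda>(t, \<omega>). f (max a (min b t)) \<omega>) \<in> borel_measurable (borel \<Otimes>\<^sub>M M)"
proof (rule borel_measurable_LIMSEQ_real)
  define c where "c t = max a (min b t)" for t :: real
  have cI: "c t \<in> {a..b}" for t using ab by (auto simp: c_def)
  have floor_ge: "t - 1 / real (Suc n) \<le> real_of_int \<lfloor>real (Suc n) * t\<rfloor> / real (Suc n)" for t n
  proof -
    have "(t - 1 / real (Suc n)) * real (Suc n) = real (Suc n) * t - 1"
      by (simp only: left_diff_distrib) (simp add: mult.commute)
    also have "\<dots> \<le> real_of_int \<lfloor>real (Suc n) * t\<rfloor>" by linarith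
    finally show ?thesis by (subst pos_le_divide_eq) auto
  qed
  show "(\<lambda>n. case p of (t, \<omega>) \<Rightarrow> f (c (real_of_int \<lfloor>real (Suc n) * t\<rfloor> / real (Suc n))) \<omega>)
          \<longlonglongrightarrow> (case p of (t, \<omega>) \<Rightarrow> f (max a (min b t)) \<omega>)" if "p \<in> space (borel \<Otimes>\<^sub>M M)" for p
  proof -
    obtain t \<omega> where p: "p = (t, \<omega>)" by (cases p)
    have w: "\<omega> \<in> space M" using that p by (auto simp: space_pair_measure)
    have "(\<lambda>n. real_of_int \<lfloor>real (Suc n) * t\<rfloor> / real (Suc n)) \<longlonglongrightarrow> t"
    proof (rule tendsto_sandwich)
      show "\<forall>\<^sub>F n in sequentially. t - 1 / real (Suc n) \<le> real_of_int \<lfloor>real (Suc n) * t\<rfloor> / real (Suc n)"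
        by (intro always_eventually allI floor_ge)
      show "\<forall>\<^sub>F n in sequentially. real_of_int \<lfloor>real (Suc n) * t\<rfloor> / real (Suc n) \<le> t"
        by (intro always_eventually allI) (simp add: divide_le_eq mult.commute)
      show "(\<lambda>n. t - 1 / real (Suc n)) \<longlonglongrightarrow> t"
        using tendsto_diff[OF tendsto_const LIMSEQ_inverse_real_of_nat, of t] by (simp add: inverse_eq_divide)
    qed auto
    then have "(\<lambda>n. c (real_of_int \<lfloor>real (Suc n) * t\<rfloor> / real (Suc n))) \<longlonglongrightarrow> c t"
      unfolding c_def by (intro tendsto_intros)
    then have "(\<lambda>n. f (c (real_of_int \<lfloor>real (Suc n) * t\<rfloor> / real (Suc n))) \<omega>) \<longlonglongrightarrow> f (c t) \<omega>"
      using cont[OF w] cI by (intro continuous_on_tendsto_compose[OF cont[OF w]]) auto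
    then show ?thesis by (simp add: p c_def)
  qed
  fix n :: nat
  have [measurable]: "(\<lambda>\<omega>. f (c r) \<omega>) \<in> borel_measurable M" for r using meas cI by auto
  have "(\<lambda>p. f (c (real_of_int z / real (Suc n))) (snd p)) \<in> borel_measurable (borel \<Otimes>\<^sub>M M)" for z :: int
    by measurable
  then have "(\<lambda>p. f (c (real_of_int \<lfloor>real (Suc n) * fst p\<rfloor> / real (Suc n))) (snd p)) \<in> borel_measurable (borel \<Otimes>\<^sub>M M)"
    by (rule measurable_compose_countable) measurable
  then show "(\<lambda>p. case p of (t, \<omega>) \<Rightarrow> f (c (real_of_int \<lfloor>real (Suc n) * t\<rfloor> / real (Suc n))) \<omega>) \<in> borel_measurable (borel \<Otimes>\<^sub>M M)"
    by (simp add: case_prod_beta')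
qed

lemma borel_measurable_process_pair:
  fixes f :: "real \<Rightarrow> 'o \<Rightarrow> real"
  assumes ab: "a \<le> b" and meas: "\<And>t. t \<in> {a..b} \<Longrightarrow> f t \<in> borel_measurable M"
    and cont: "\<And>\<omega>. \<omega> \<in> space M \<Longrightarrow> continuous_on {a..b} (\<lambda>t. f t \<omega>)"
  shows "(\<lambda>(t, \<omega>). f t \<omega>) \<in> borel_measurable (restrict_space borel {a..b} \<Otimes>\<^sub>M M)"
proof -
  have "(\<lambda>p. (fst p, snd p)) \<in> measurable (restrict_space borel {a..b} \<Otimes>\<^sub>M M) (borel \<Otimes>\<^sub>M M)"
    by (intro measurable_Pair) (auto intro!: measurable_compose[OF measurable_fst] measurable_restrict_space1)
  from measurable_compose[OF this borel_measurable_process_clip[OF assms]]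
  have "(\<lambda>(t, \<omega>). f (max a (min b t)) \<omega>) \<in> borel_measurable (restrict_space borel {a..b} \<Otimes>\<^sub>M M)"
    by (simp add: case_prod_beta')
  then show ?thesis
    by (rule subst[OF measurable_cong, THEN iffD1, rotated 2])
      (auto simp: space_pair_measure space_restrict_space)
qed

lemma nn_integral_continuous_ivl:
  fixes g :: "real \<Rightarrow> real"
  assumes g: "continuous_on {a..b} g" and nonneg: "\<And>t. t \<in> {a..b} \<Longrightarrow> g t \<ge> 0"
  shows "(\<integral>\<^sup>+t\<in>{a..b}. ennreal (g t) \<partial>lborel) = ennreal (integral {a..b} g)"
proof -
  have "((\<lambda>t. g t) has_integral integral {a..b} g) {a..b}"
    using g by (intro integrable_integral integrable_continuous_real)
  moreover have "set_borel_measurable borel {a..b} g"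
    using g by (rule borel_measurable_continuous_on_indicator[OF _ , unfolded set_borel_measurable_def[symmetric], rotated]) auto
  ultimately show ?thesis
    using nn_integral_has_integral_lebesgue'[of "{a..b}" g "integral {a..b} g"] nonneg
    by (simp add: set_borel_measurable_def)
qed

text \<open>Tonelli's theorem in the form needed for gauge integrals of nonnegative continuous paths.\<close>

lemma expectation_integral_process:
  fixes f :: "real \<Rightarrow> 'o \<Rightarrow> real"
  assumes M: "sigma_finite_measure M" and ab: "a \<le> b" and meas: "\<And>t. t \<in> {a..b} \<Longrightarrow> f t \<in> borel_measurable M"
    and cont: "\<And>\<omega>. \<omega> \<in> space M \<Longrightarrow> continuous_on {a..b} (\<lambda>t. f t \<omega>)"
    and nonneg: "\<And>t \<omega>. t \<in> {a..b} \<Longrightarrow> \<omega> \<in> space M \<Longrightarrow> f t \<omega> \<ge> 0"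
  shows "(\<integral>\<^sup>+\<omega>. ennreal (integral {a..b} (\<lambda>t. f t \<omega>)) \<partial>M) = (\<integral>\<^sup>+t\<in>{a..b}. (\<integral>\<^sup>+\<omega>. ennreal (f t \<omega>) \<partial>M) \<partial>lborel)"
proof -
  interpret sigma_finite_measure M by fact
  interpret pair_sigma_finite lborel M ..
  note [measurable] = borel_measurable_process_clip[OF ab meas cont, simplified]
  have [measurable]: "(\<lambda>(t, \<omega>). f (max a (min b t)) \<omega>) \<in> borel_measurable (lborel \<Otimes>\<^sub>M M)"
    using borel_measurable_process_clip[OF ab meas cont] by simp
  have "(\<integral>\<^sup>+\<omega>. ennreal (integral {a..b} (\<lambda>t. f t \<omega>)) \<partial>M)
      = (\<integral>\<^sup>+\<omega>. (\<integral>\<^sup>+t. ennreal (f (max a (min b t)) \<omega>) * indicator {a..b} t \<partial>lborel) \<partial>M)"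
    by (intro nn_integral_cong, subst nn_integral_continuous_ivl[symmetric])
      (auto intro!: cont nonneg nn_integral_cong split: split_indicator)
  also have "\<dots> = (\<integral>\<^sup>+t. (\<integral>\<^sup>+\<omega>. ennreal (f (max a (min b t)) \<omega>) * indicator {a..b} t \<partial>M) \<partial>lborel)"
    by (rule Fubini') measurable
  also have "\<dots> = (\<integral>\<^sup>+t\<in>{a..b}. (\<integral>\<^sup>+\<omega>. ennreal (f t \<omega>) \<partial>M) \<partial>lborel)"
    by (intro nn_integral_cong) (auto split: split_indicator)
  finally show ?thesis .
qed

lemma expectation_integral_process_le:
  fixes f :: "real \<Rightarrow> 'o \<Rightarrow> real"
  assumes M: "sigma_finite_measure M" and ab: "a \<le> b" and meas: "\<And>t. t \<in> {a..b} \<Longrightarrow> f t \<in> borel_measurable M"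
    and cont: "\<And>\<omega>. \<omega> \<in> space M \<Longrightarrow> continuous_on {a..b} (\<lambda>t. f t \<omega>)"
    and nonneg: "\<And>t \<omega>. t \<in> {a..b} \<Longrightarrow> \<omega> \<in> space M \<Longrightarrow> f t \<omega> \<ge> 0"
    and le: "\<And>t. t \<in> {a..b} \<Longrightarrow> (\<integral>\<^sup>+\<omega>. ennreal (f t \<omega>) \<partial>M) \<le> ennreal C" and C: "0 \<le> C"
  shows "(\<integral>\<^sup>+\<omega>. ennreal (integral {a..b} (\<lambda>t. f t \<omega>)) \<partial>M) \<le> ennreal (C * (b - a))"
proof -
  have "(\<integral>\<^sup>+\<omega>. ennreal (integral {a..b} (\<lambda>t. f t \<omega>)) \<partial>M)
      = (\<integral>\<^sup>+t\<in>{a..b}. (\<integral>\<^sup>+\<omega>. ennreal (f t \<omega>) \<partial>M) \<partial>lborel)"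
    by (rule expectation_integral_process[OF M ab meas cont nonneg])
  also have "\<dots> \<le> (\<integral>\<^sup>+t. ennreal C * indicator {a..b} t \<partial>lborel)"
    by (intro nn_integral_mono) (auto split: split_indicator intro: le)
  also have "\<dots> = ennreal (C * (b - a))"
    using ab C by (simp add: nn_integral_cmult_indicator ennreal_mult)
  finally show ?thesis .
qed

section \<open>The Borel sets of the path space\<close>

lemma mspace_C_metric: "mspace (C_metric T) = {f \<in> extensional {-1..T}. continuous_on {-1..T} f}"
  unfolding C_metric_def
  by (subst compactin_mspace_cfunspace) (auto simp: compact_space_subtopology Pi_def)

lemma mdist_C_metric_le:
  assumes "f \<in> mspace (C_metric T)" "g \<in> mspace (C_metric T)" "T \<ge> -1"
  shows "mdist (C_metric T) f g \<le> a \<longleftrightarrow> (\<forall>t\<in>{-1..T}. \<bar>f t - g t\<bar> \<le> a)"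
  using assms unfolding C_metric_def by (subst cfunspace_mdist_le) (auto simp: dist_real_def)

lemma openin_C_metric_subset: "openin (mtopology_of (C_metric T)) U \<Longrightarrow> U \<subseteq> mspace (C_metric T)"
  using openin_subset by (metis topspace_mtopology_of)

lemma space_C_borel: "space (C_borel T) = mspace (C_metric T)"
  unfolding C_borel_def using openin_C_metric_subset by (intro space_measure_of) blast

lemma sets_C_borel_open:
  "sets (C_borel T) = sigma_sets (mspace (C_metric T)) {U. openin (mtopology_of (C_metric T)) U}"
  unfolding C_borel_def
  by (rule sets_measure_of) (use openin_C_metric_subset in blast)

lemma half_space_in_C_borel:
  assumes T: "T \<ge> -1" and t: "t \<in> {-1..T}"
  shows "{f \<in> mspace (C_metric T). f t \<le> c} \<in> sets (C_borel T)"
proof -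
  interpret Metric_space "mspace (C_metric T)" "mdist (C_metric T)" by (rule Metric_space_mspace_mdist)
  have "openin (mtopology_of (C_metric T)) {f \<in> mspace (C_metric T). f t > c}"
    unfolding mtopology_of_def openin_mtopology
  proof (intro conjI allI impI)
    fix f assume f: "f \<in> {f \<in> mspace (C_metric T). f t > c}"
    have "g t > c" if g: "g \<in> mspace (C_metric T)" "mdist (C_metric T) f g < f t - c" for g
      using mdist_C_metric_le[of f T g "mdist (C_metric T) f g"] f g T t by fastforce
    then show "\<exists>r>0. mball f r \<subseteq> {f \<in> mspace (C_metric T). f t > c}"
      using f by (intro exI[of _ "f t - c"]) (auto simp: in_mball)
  qed auto
  then have "{f \<in> mspace (C_metric T). f t > c} \<in> sets (C_borel T)"
    unfolding sets_C_borel_open by (auto intro: sigma_sets.Basic)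
  from sets.compl_sets[OF this] show ?thesis
    by (rule back_subst[of "\<lambda>A. A \<in> sets (C_borel T)"]) (auto simp: space_C_borel)
qed

text \<open>Used to compare two paths in the supremum metric from countably many evaluations.\<close>

lemma eq_on_rationals_le:
  fixes h :: "real \<Rightarrow> real"
  assumes h: "continuous_on {a..b} h" and ab: "a < b" and le: "\<And>t. t \<in> \<rat> \<inter> {a..b} \<Longrightarrow> h t \<le> c"
    and t: "t \<in> {a..b}"
  shows "h t \<le> c"
proof (rule ccontr)
  assume "\<not> h t \<le> c"
  then obtain d where d: "d > 0" "\<And>s. s \<in> {a..b} \<Longrightarrow> \<bar>s - t\<bar> < d \<Longrightarrow> \<bar>h s - h t\<bar> < h t - c"
    using uniform_modulus[OF h, of "h t - c"] t by (metis diff_gt_0_iff_gt not_le)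
  have "max a (t - d) < min b (t + d)" using ab d t by auto
  from Rats_dense_in_real[OF this] obtain q where q: "q \<in> \<rat>" "max a (t - d) < q" "q < min b (t + d)" by blast
  then have "\<bar>h q - h t\<bar> < h t - c" by (intro d) auto
  moreover have "h q \<le> c" using q by (intro le) auto
  ultimately show False by linarith
qed

text \<open>An open set of paths is a union of tubes around step functions with rational steps and values:
  by uniform continuity each path lies in arbitrarily thin tubes of this kind. There are only countably many tubes, and each
  is cut out by conditions on evaluations at rational times. This replaces separability of the path space.\<close>

lemma sets_C_borel:
  assumes T: "T > 0"
  shows "sets (C_borel T) = sigma_sets (mspace (C_metric T)) {{f \<in> mspace (C_metric T). f t \<le> c} | t c. t \<in> {-1..T}}"
    (is "_ = sigma_sets ?C ?H")
proof
  interpret Metric_space "mspace (C_metric T)" "mdist (C_metric T)" by (rule Metric_space_mspace_mdist)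
  have "?H \<subseteq> sets (C_borel T)" using half_space_in_C_borel T by auto
  then show "sigma_sets ?C ?H \<subseteq> sets (C_borel T)"
    using sets.sigma_sets_subset[of ?H "C_borel T"] by (simp add: space_C_borel)
next
  interpret Metric_space "mspace (C_metric T)" "mdist (C_metric T)" by (rule Metric_space_mspace_mdist)
  define S where "S = sigma ?C ?H"
  have S: "space S = ?C" "sets S = sigma_sets ?C ?H" unfolding S_def by (rule space_measure_of sets_measure_of, blast)+
  have ev [measurable]: "(\<lambda>f. f t) \<in> borel_measurable S" if "t \<in> {-1..T}" for t
    unfolding borel_measurable_iff_le using that by (auto simp: S intro!: sigma_sets.Basic)
  define step :: "nat \<Rightarrow> int list \<Rightarrow> nat \<Rightarrow> real \<Rightarrow> real" where
    "step n zs m t = real_of_int (zs ! nat \<lfloor>real n * (t + 1)\<rfloor>) / real m" for n zs m t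
  define tube :: "nat \<times> int list \<times> nat \<Rightarrow> (real \<Rightarrow> real) set" where
    "tube p = (case p of (n, zs, m) \<Rightarrow> {f \<in> space S. \<forall>t\<in>\<rat> \<inter> {-1..T}. \<bar>f t - step n zs m t\<bar> \<le> 1 / real m})" for p
  have tube_sets: "tube p \<in> sets S" for p
  proof -
    obtain n zs m where p: "p = (n, zs, m)" by (cases p)
    have "{f \<in> space S. \<bar>f t - step n zs m t\<bar> \<le> 1 / real m} \<in> sets S" if "t \<in> \<rat> \<inter> {-1..T}" for t
    proof -
      have [measurable]: "(\<lambda>f. f t) \<in> borel_measurable S" using that by (intro ev) auto
      show ?thesis by measurable
    qed
    then have "{f \<in> space S. \<forall>t\<in>\<rat> \<inter> {-1..T}. \<bar>f t - step n zs m t\<bar> \<le> 1 / real m} \<in> sets S"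
      by (intro sets.sets_Collect_countable_All') (auto intro: countable_Int1 countable_rat)
    then show ?thesis by (simp add: tube_def p)
  qed
  have "U \<in> sets S" if U: "openin (mtopology_of (C_metric T)) U" for U
  proof -
    have UC: "U \<subseteq> ?C" using openin_C_metric_subset[OF U] .
    have "\<exists>p. f \<in> tube p \<and> tube p \<subseteq> U" if f: "f \<in> U" for f
    proof -
      obtain r where r: "r > 0" "mball f r \<subseteq> U" using U f unfolding mtopology_of_def openin_mtopology by blast
      obtain m :: nat where m: "real m > 2 / r" using reals_Archimedean2 by blast
      have m0: "real m > 0" using m r by (smt (verit) divide_pos_pos)
      have mr: "2 / real m < r" using m r m0 by (simp add: field_simps)
      have fC: "f \<in> ?C" and fc: "continuous_on {-1..T} f" using f UC by (auto simp: mspace_C_metric)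
      obtain d where d: "d > 0" "\<And>s t. s \<in> {-1..T} \<Longrightarrow> t \<in> {-1..T} \<Longrightarrow> \<bar>s - t\<bar> < d \<Longrightarrow> \<bar>f s - f t\<bar> < 1 / (2 * real m)"
        using uniform_modulus[OF fc, of "1 / (2 * real m)"] m0 by auto
      obtain n :: nat where n: "real n > 1 / d" using reals_Archimedean2 by blast
      have n0: "real n > 0" using n d by (smt (verit) divide_pos_pos)
      have nd: "1 / real n < d" using n d n0 by (simp add: field_simps)
      (* rounding to multiples of 1 / m costs at most 1 / (2 m), the step in time costs as much again *)
      define zs where "zs = map (\<lambda>j. round (real m * f (real j / real n - 1))) [0..<Suc (nat \<lfloor>real n * (T + 1)\<rfloor>)]"
      have near: "\<bar>f t - step n zs m t\<bar> \<le> 1 / real m" if t: "t \<in> {-1..T}" for t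
      proof -
        define j where "j = nat \<lfloor>real n * (t + 1)\<rfloor>"
        have nt: "0 \<le> real n * (t + 1)" using t n0 by simp
        have j1: "real j \<le> real n * (t + 1)" "real n * (t + 1) < real j + 1"
          using nt unfolding j_def by linarith+
        have "\<lfloor>real n * (t + 1)\<rfloor> \<le> \<lfloor>real n * (T + 1)\<rfloor>" using t n0 by (intro floor_mono mult_left_mono) auto
        then have "j < Suc (nat \<lfloor>real n * (T + 1)\<rfloor>)" unfolding j_def by linarith
        then have st: "step n zs m t = real_of_int (round (real m * f (real j / real n - 1))) / real m"
          unfolding step_def zs_def j_def[symmetric] by (subst nth_map) (auto simp del: upt_Suc)
        define s where "s = real j / real n - 1"
        have s: "s \<in> {-1..T}" "s \<le> t" "t - s < d"
        proof -
          show "s \<le> t" using j1(1) n0 by (simp add: s_def field_simps)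
          then show "s \<in> {-1..T}" using t by (auto simp: s_def)
          have "t + 1 < (real j + 1) / real n" using j1(2) n0 by (simp add: pos_less_divide_eq mult.commute)
          then have "t - s < 1 / real n" by (simp add: s_def add_divide_distrib)
          then show "t - s < d" using nd by simp
        qed
        have "\<bar>f s - f t\<bar> < 1 / (2 * real m)" using s t by (intro d) auto
        moreover have "\<bar>real_of_int (round (real m * f s)) / real m - f s\<bar> \<le> 1 / (2 * real m)"
        proof -
          have "\<bar>real_of_int (round (real m * f s)) - real m * f s\<bar> \<le> 1 / 2" by (rule of_int_round_abs_le)
          moreover have "real_of_int (round (real m * f s)) / real m - f s
              = (real_of_int (round (real m * f s)) - real m * f s) / real m"
            using m0 by (simp add: diff_divide_distrib)
          ultimately show ?thesis using m0 by (simp add: abs_divide pos_divide_le_eq)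
        qed
        moreover have "1 / (2 * real m) + 1 / (2 * real m) = 1 / real m" using m0 by (simp add: field_simps)
        ultimately show ?thesis unfolding st s_def[symmetric] by linarith
      qed
      have "g \<in> U" if g: "g \<in> tube (n, zs, m)" for g
      proof -
        have gC: "g \<in> ?C" and gc: "continuous_on {-1..T} g" using g by (auto simp: tube_def S mspace_C_metric)
        have "\<bar>f t - g t\<bar> \<le> 2 / real m" if t: "t \<in> {-1..T}" for t
        proof (rule eq_on_rationals_le[of "-1" T "\<lambda>t. \<bar>f t - g t\<bar>"])
          show "continuous_on {-1..T} (\<lambda>t. \<bar>f t - g t\<bar>)" using fc gc by (intro continuous_intros)
          fix q assume q: "q \<in> \<rat> \<inter> {-1..T}"
          have "\<bar>g q - step n zs m q\<bar> \<le> 1 / real m" using g q by (auto simp: tube_def)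
          moreover have "2 / real m = 1 / real m + 1 / real m" by simp
          ultimately show "\<bar>f q - g q\<bar> \<le> 2 / real m" using near[of q] q by auto
        qed (use T t in auto)
        then have "mdist (C_metric T) f g \<le> 2 / real m"
          using fC gC T by (subst mdist_C_metric_le) auto
        then show ?thesis using r mr fC gC by (auto simp: in_mball)
      qed
      moreover have "f \<in> tube (n, zs, m)" using near fC by (auto simp: tube_def S)
      ultimately show ?thesis by blast
    qed
    then have "U = (\<Union>p\<in>{p. tube p \<subseteq> U}. tube p)" by blast
    also have "\<dots> \<in> sets S" using tube_sets by (intro sets.countable_UN'') auto
    finally show ?thesis .
  qed
  then have "{U. openin (mtopology_of (C_metric T)) U} \<subseteq> sets S" by auto
  then show "sets (C_borel T) \<subseteq> sigma_sets ?C ?H"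
    unfolding sets_C_borel_open S(2)[symmetric] using sets.sigma_sets_subset[of _ S] S(1) by simp
qed

lemma measurable_eval_C_borel:
  assumes "T \<ge> -1" "t \<in> {-1..T}"
  shows "(\<lambda>f. f t) \<in> borel_measurable (C_borel T)"
  unfolding borel_measurable_iff_le using half_space_in_C_borel[OF assms] by (simp add: space_C_borel)

text \<open>This is what makes the image measure \<open>path_law\<close> meaningful.\<close>

lemma measurable_path_upto:
  assumes T: "T > 0" and X: "continuous_process M {-1..} X"
  shows "path_upto X T \<in> measurable M (C_borel T)"
proof (rule measurable_sigma_sets[OF sets_C_borel[OF T]])
  have cont: "continuous_on {-1..T} (\<lambda>t. X t \<omega>)" if "\<omega> \<in> space M" for \<omega>
    using X that unfolding continuous_process_def by (auto intro: continuous_on_subset)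
  show "path_upto X T \<in> space M \<rightarrow> mspace (C_metric T)"
    using cont by (auto simp: path_upto_def mspace_C_metric cong: continuous_on_cong_simp)
  fix A assume "A \<in> {{f \<in> mspace (C_metric T). f t \<le> c} | t c. t \<in> {-1..T}}"
  then obtain t c where t: "t \<in> {-1..T}" and A: "A = {f \<in> mspace (C_metric T). f t \<le> c}" by blast
  have [measurable]: "X t \<in> borel_measurable M" using X t unfolding continuous_process_def by auto
  have "path_upto X T -` A \<inter> space M = {\<omega> \<in> space M. X t \<omega> \<le> c}"
    using t cont by (auto simp: A path_upto_def mspace_C_metric cong: continuous_on_cong_simp)
  then show "path_upto X T -` A \<inter> space M \<in> sets M" by simp
qed auto

text \<open>Finite intersections of half spaces form a generator that is stable under intersection.\<close>

lemma measure_eqI_C_borel: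
  assumes T: "T > 0" and P: "sets P = sets (C_borel T)" and Q: "sets Q = sets (C_borel T)"
    and fin: "emeasure P (mspace (C_metric T)) \<noteq> \<infinity>"
    and eq: "\<And>J c. finite J \<Longrightarrow> J \<subseteq> {-1..T} \<Longrightarrow>
      emeasure P {f \<in> mspace (C_metric T). \<forall>t\<in>J. f t \<le> c t} = emeasure Q {f \<in> mspace (C_metric T). \<forall>t\<in>J. f t \<le> c t}"
  shows "P = Q"
proof (rule measure_eqI_generator_eq)
  let ?C = "mspace (C_metric T)"
  let ?E = "{{f \<in> ?C. \<forall>t\<in>J. f t \<le> c t} | J c. finite J \<and> J \<subseteq> {-1..T}}"
  show "Int_stable ?E"
  proof (rule Int_stableI)
    fix A B assume "A \<in> ?E" "B \<in> ?E"
    then obtain J c K d where A: "A = {f \<in> ?C. \<forall>t\<in>J. f t \<le> c t}" "finite J" "J \<subseteq> {-1..T}"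
      and B: "B = {f \<in> ?C. \<forall>t\<in>K. f t \<le> d t}" "finite K" "K \<subseteq> {-1..T}" by blast
    let ?e = "\<lambda>t. if t \<in> J then if t \<in> K then min (c t) (d t) else c t else d t"
    have "A \<inter> B = {f \<in> ?C. \<forall>t\<in>J \<union> K. f t \<le> ?e t}"
    proof (intro set_eqI iffI)
      fix f assume f: "f \<in> {f \<in> ?C. \<forall>t\<in>J \<union> K. f t \<le> ?e t}"
      have "f t \<le> c t" if "t \<in> J" for t
      proof -
        have "f t \<le> ?e t" using f that by blast
        then show ?thesis using that by (cases "t \<in> K") auto
      qed
      moreover have "f t \<le> d t" if "t \<in> K" for t
      proof -
        have "f t \<le> ?e t" using f that by blast
        then show ?thesis using that by (cases "t \<in> J") auto
      qed
      ultimately show "f \<in> A \<inter> B" using f A B by auto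
    qed (auto simp: A B)
    then show "A \<inter> B \<in> ?E" using A B by (intro CollectI exI[of _ "J \<union> K"] exI[of _ ?e]) auto
  qed
  show "?E \<subseteq> Pow ?C" by auto
  have gen: "sets (C_borel T) = sigma_sets ?C ?E"
  proof
    have "{{f \<in> ?C. f t \<le> c} | t c. t \<in> {-1..T}} \<subseteq> ?E"
    proof
      fix A assume "A \<in> {{f \<in> ?C. f t \<le> c} | t c. t \<in> {-1..T}}"
      then obtain t c where A: "A = {f \<in> ?C. f t \<le> c}" "t \<in> {-1..T}" by blast
      then show "A \<in> ?E" by (intro CollectI exI[of _ "{t}"] exI[of _ "\<lambda>_. c"]) auto
    qed
    then show "sets (C_borel T) \<subseteq> sigma_sets ?C ?E"
      unfolding sets_C_borel[OF T] by (rule sigma_sets_mono')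
    have "A \<in> sets (C_borel T)" if "A \<in> ?E" for A
    proof -
      obtain J c where A: "A = {f \<in> ?C. \<forall>t\<in>J. f t \<le> c t}" "finite J" "J \<subseteq> {-1..T}" using \<open>A \<in> ?E\<close> by blast
      have "{f \<in> space (C_borel T). \<forall>t\<in>J. f t \<le> c t} \<in> sets (C_borel T)"
        using half_space_in_C_borel[of T] A T by (intro sets.sets_Collect_finite_All) (auto simp: space_C_borel)
      then show ?thesis by (simp add: A space_C_borel)
    qed
    then show "sigma_sets ?C ?E \<subseteq> sets (C_borel T)"
      using sets.sigma_sets_subset[of ?E "C_borel T"] by (auto simp: space_C_borel)
  qed
  show "sets P = sigma_sets ?C ?E" "sets Q = sigma_sets ?C ?E" using P Q gen by auto
  show "emeasure P A = emeasure Q A" if "A \<in> ?E" for A using that eq by blast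
  have "?C \<in> ?E" by (intro CollectI exI[of _ "{}"]) auto
  then show "range (\<lambda>_::nat. ?C) \<subseteq> ?E" by auto
  show "(\<Union>i::nat. ?C) = ?C" by simp
  show "\<And>i::nat. emeasure P ?C \<noteq> \<infinity>" using fin .
qed

section \<open>Gaussian noise and the discrete Girsanov formula\<close>

definition normal_law :: "real \<Rightarrow> real measure" where
  "normal_law v = density lborel (\<lambda>x. ennreal (normal_density 0 (sqrt v) x))"

definition noise :: "real \<Rightarrow> nat \<Rightarrow> (nat \<Rightarrow> real) measure" where
  "noise v N = PiM {..<N} (\<lambda>_. normal_law v)"

lemma sets_normal_law [measurable_cong, simp]: "sets (normal_law v) = sets borel"
  by (simp add: normal_law_def)

lemma space_normal_law [simp]: "space (normal_law v) = UNIV"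
  by (simp add: normal_law_def)

lemma sets_noise [measurable_cong]: "sets (noise v N) = sets (PiM {..<N} (\<lambda>_. borel))"
  unfolding noise_def by (intro sets_PiM_cong) auto

lemma prob_space_normal_law: "v > 0 \<Longrightarrow> prob_space (normal_law v)"
  unfolding normal_law_def by (rule prob_space_normal_density) simp

lemma prob_space_noise: "v > 0 \<Longrightarrow> prob_space (noise v N)"
  unfolding noise_def by (rule prob_space_PiM) (rule prob_space_normal_law)

lemma nn_integral_normal_law:
  "f \<in> borel_measurable borel \<Longrightarrow>
    (\<integral>\<^sup>+x. f x \<partial>normal_law v) = (\<integral>\<^sup>+x. ennreal (normal_density 0 (sqrt v) x) * f x \<partial>lborel)"
  unfolding normal_law_def by (subst nn_integral_density) auto

lemma normal_law_shift:
  fixes f :: "real \<Rightarrow> ennreal"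
  assumes v: "v > 0" and [measurable]: "f \<in> borel_measurable borel"
  shows "(\<integral>\<^sup>+u. f (u + v * b) \<partial>normal_law v) = (\<integral>\<^sup>+u. f u * ennreal (exp (b * u - v * b\<^sup>2 / 2)) \<partial>normal_law v)"
proof -
  have dens: "normal_density 0 (sqrt v) (u - v * b) = normal_density 0 (sqrt v) u * exp (b * u - v * b\<^sup>2 / 2)" for u
  proof -
    have "- (u - v * b)\<^sup>2 / (2 * v) = - u\<^sup>2 / (2 * v) + (b * u - v * b\<^sup>2 / 2)"
      using v by (simp add: field_simps power2_eq_square)
    then show ?thesis using v by (simp add: normal_density_def exp_add[symmetric])
  qed
  have "(\<integral>\<^sup>+u. f (u + v * b) \<partial>normal_law v)
      = (\<integral>\<^sup>+u. ennreal (normal_density 0 (sqrt v) u) * f (u + v * b) \<partial>lborel)"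
    by (subst nn_integral_normal_law) auto
  also have "\<dots> = (\<integral>\<^sup>+u. ennreal (normal_density 0 (sqrt v) (u - v * b)) * f u \<partial>lborel)"
    using nn_integral_real_affine[of "\<lambda>u. ennreal (normal_density 0 (sqrt v) (u - v * b)) * f u" 1 "v * b"]
    by (simp add: add.commute)
  also have "\<dots> = (\<integral>\<^sup>+u. ennreal (normal_density 0 (sqrt v) u) * (f u * ennreal (exp (b * u - v * b\<^sup>2 / 2))) \<partial>lborel)"
    by (intro nn_integral_cong, subst dens) (simp add: ennreal_mult mult_ac)
  also have "\<dots> = (\<integral>\<^sup>+u. f u * ennreal (exp (b * u - v * b\<^sup>2 / 2)) \<partial>normal_law v)"
    by (subst nn_integral_normal_law) auto
  finally show ?thesis .
qed

lemma nn_integral_normal_law_square: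
  assumes v: "v > 0"
  shows "(\<integral>\<^sup>+u. ennreal ((\<alpha> + u)\<^sup>2) \<partial>normal_law v) = ennreal (\<alpha>\<^sup>2 + v)"
proof -
  have s: "sqrt v > 0" using v by simp
  let ?d = "normal_density 0 (sqrt v)"
  have i2: "integrable lborel (\<lambda>x. ?d x * x\<^sup>2)" "(\<integral>x. ?d x * x\<^sup>2 \<partial>lborel) = v"
    using integrable_normal_moment[OF s, of 0 2] integral_normal_moment_even[OF s, of 0 1] v
    by (simp_all add: eval_nat_numeral)
  have i1: "integrable lborel (\<lambda>x. ?d x * x)" "(\<integral>x. ?d x * x \<partial>lborel) = 0"
    using integrable_normal_moment_nz_1[OF s, of 0] integral_normal_moment_nz_1[OF s, of 0] by simp_all
  have i0: "integrable lborel ?d" "(\<integral>x. ?d x \<partial>lborel) = 1"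
    using s by (auto simp: integrable_normal_density integral_normal_density)
  have eq: "?d x * (\<alpha> + x)\<^sup>2 = ?d x * \<alpha>\<^sup>2 + 2 * \<alpha> * (?d x * x) + ?d x * x\<^sup>2" for x
    by (simp add: power2_eq_square algebra_simps)
  have "integrable lborel (\<lambda>x. ?d x * (\<alpha> + x)\<^sup>2)" "(\<integral>x. ?d x * (\<alpha> + x)\<^sup>2 \<partial>lborel) = \<alpha>\<^sup>2 + v"
    unfolding eq using i0 i1 i2 by simp_all
  then have "(\<integral>\<^sup>+x. ennreal (?d x * (\<alpha> + x)\<^sup>2) \<partial>lborel) = ennreal (\<alpha>\<^sup>2 + v)"
    by (subst nn_integral_eq_integral) auto
  then show ?thesis
    by (subst nn_integral_normal_law) (auto simp: ennreal_mult'[symmetric])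
qed

text \<open>The chain \<open>\<eta>\<close> with \<open>\<eta> k = \<xi> k + v * b k \<eta>\<close>, where \<open>b k\<close> looks only at coordinates below
  \<open>k\<close>. The chain is cut off at \<open>k\<close> in the recursive call so that the recursion terminates; for a predictable
  drift the cut has no effect.\<close>

function drifted :: "real \<Rightarrow> (nat \<Rightarrow> (nat \<Rightarrow> real) \<Rightarrow> real) \<Rightarrow> (nat \<Rightarrow> real) \<Rightarrow> nat \<Rightarrow> real" where
  "drifted v b \<xi> k = \<xi> k + v * b k (\<lambda>i. if i < k then drifted v b \<xi> i else 0)"
  by auto
termination by (relation "Wellfounded.measure (\<lambda>(v, b, \<xi>, k). k)") auto

declare drifted.simps [simp del]

text \<open>The logarithm of the Girsanov density of the law of \<open>drifted v b\<close> with respect to the noise.\<close>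

definition log_density :: "real \<Rightarrow> (nat \<Rightarrow> (nat \<Rightarrow> real) \<Rightarrow> real) \<Rightarrow> nat \<Rightarrow> (nat \<Rightarrow> real) \<Rightarrow> real" where
  "log_density v b N z = (\<Sum>k<N. b k z * z k - v * (b k z)\<^sup>2 / 2)"

definition predictable :: "(nat \<Rightarrow> (nat \<Rightarrow> real) \<Rightarrow> real) \<Rightarrow> bool" where
  "predictable b \<longleftrightarrow> (\<forall>k z z'. (\<forall>i<k. z i = z' i) \<longrightarrow> b k z = b k z') \<and>
     (\<forall>k. b k \<in> borel_measurable (PiM {..<k} (\<lambda>_. borel)))"

lemma predictable_cong: "predictable b \<Longrightarrow> (\<And>i. i < k \<Longrightarrow> z i = z' i) \<Longrightarrow> b k z = b k z'"
  unfolding predictable_def by blast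

lemma drifted_eq: "predictable b \<Longrightarrow> drifted v b \<xi> k = \<xi> k + v * b k (drifted v b \<xi>)"
  using predictable_cong[of b k "\<lambda>i. if i < k then drifted v b \<xi> i else 0" "drifted v b \<xi>"]
  by (subst drifted.simps) simp

lemma drifted_cong:
  assumes "predictable b"
  shows "(\<And>i. i \<le> k \<Longrightarrow> \<xi> i = \<xi>' i) \<Longrightarrow> drifted v b \<xi> k = drifted v b \<xi>' k"
proof (induction k rule: less_induct)
  case (less k)
  have "b k (drifted v b \<xi>) = b k (drifted v b \<xi>')"
    using less by (intro predictable_cong[OF assms]) auto
  then show ?case using less.prems by (subst (1 2) drifted_eq[OF assms]) auto
qed

lemma predictable_measurable:
  assumes b: "predictable b" and f: "\<And>i. i < k \<Longrightarrow> (\<lambda>x. f x i) \<in> borel_measurable M"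
  shows "(\<lambda>x. b k (f x)) \<in> borel_measurable M"
proof -
  have "(\<lambda>x. \<lambda>i\<in>{..<k}. f x i) \<in> measurable M (PiM {..<k} (\<lambda>_. borel))"
    using f by (intro measurable_restrict) auto
  moreover have "b k \<in> borel_measurable (PiM {..<k} (\<lambda>_. borel))" using b by (simp add: predictable_def)
  ultimately have "(\<lambda>x. b k (\<lambda>i\<in>{..<k}. f x i)) \<in> borel_measurable M" by (rule measurable_compose)
  moreover have "b k (\<lambda>i\<in>{..<k}. f x i) = b k (f x)" for x by (rule predictable_cong[OF b]) auto
  ultimately show ?thesis by simp
qed

lemma measurable_drifted:
  assumes b: "predictable b"
  shows "(\<And>i. i \<le> k \<Longrightarrow> (\<lambda>x. f x i) \<in> borel_measurable M) \<Longrightarrow> (\<lambda>x. drifted v b (f x) k) \<in> borel_measurable M"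
proof (induction k rule: less_induct)
  case (less k)
  have "(\<lambda>x. b k (drifted v b (f x))) \<in> borel_measurable M"
    using less by (intro predictable_measurable[OF b]) auto
  then show ?case using less.prems by (subst drifted_eq[OF b]) auto
qed

lemma measurable_log_density:
  assumes b: "predictable b" and f: "\<And>i. i < N \<Longrightarrow> (\<lambda>x. f x i) \<in> borel_measurable M"
  shows "(\<lambda>x. log_density v b N (f x)) \<in> borel_measurable M"
  unfolding log_density_def
  using f by (intro borel_measurable_sum borel_measurable_diff borel_measurable_times borel_measurable_divide
      borel_measurable_power predictable_measurable[OF b]) auto

lemma log_density_cong: "predictable b \<Longrightarrow> (\<And>i. i < N \<Longrightarrow> z i = z' i) \<Longrightarrow> log_density v b N z = log_density v b N z'"
  unfolding log_density_def
proof (intro sum.cong refl)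
  fix k assume *: "predictable b" "\<And>i. i < N \<Longrightarrow> z i = z' i" "k \<in> {..<N}"
  have "b k z = b k z'" using * by (intro predictable_cong[OF *(1)]) auto
  moreover have "z k = z' k" using * by auto
  ultimately show "b k z * z k - v * (b k z)\<^sup>2 / 2 = b k z' * z' k - v * (b k z')\<^sup>2 / 2" by simp
qed

text \<open>The drift of a chain with Gaussian innovations is removed one coordinate at a time, from the last one
  backwards: given the past, the drift of the last coordinate is a constant, and translating a centred normal
  law by \<open>v * b\<close> multiplies its density by \<open>exp (b * u - v * b\<^sup>2 / 2)\<close>.\<close>

lemma discrete_girsanov:
  fixes G :: "(nat \<Rightarrow> real) \<Rightarrow> ennreal"
  assumes v: "v > 0" and b: "predictable b"
  shows "G \<in> borel_measurable (PiM {..<N} (\<lambda>_. borel)) \<Longrightarrow>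
    (\<integral>\<^sup>+\<xi>. G (\<lambda>i\<in>{..<N}. drifted v b \<xi> i) \<partial>noise v N) = (\<integral>\<^sup>+\<xi>. G \<xi> * ennreal (exp (log_density v b N \<xi>)) \<partial>noise v N)"
proof (induction N arbitrary: G)
  case 0
  then show ?case
    unfolding noise_def log_density_def
    by (intro nn_integral_cong) (auto simp: space_PiM_empty)
next
  case (Suc N)
  interpret normal: prob_space "normal_law v" by (rule prob_space_normal_law[OF v])
  interpret product_sigma_finite "\<lambda>_::nat. normal_law v" ..
  note [measurable] = Suc.prems
  have G': "G \<in> borel_measurable (PiM (insert N {..<N}) (\<lambda>_. normal_law v))"
    using Suc.prems by (simp add: lessThan_Suc[symmetric] cong: measurable_cong_sets sets_PiM_cong)
  have add: "(\<lambda>(z, y). z(N := y)) \<in> measurable (PiM {..<N} (\<lambda>_. borel) \<Otimes>\<^sub>M borel) (PiM {..<Suc N} (\<lambda>_. borel :: real measure))"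
    using measurable_add_dim[of N "{..<N}" "\<lambda>_. borel :: real measure"] by (simp add: lessThan_Suc)
  have bN [measurable]: "b N \<in> borel_measurable (PiM {..<N} (\<lambda>_. borel))" using b by (simp add: predictable_def)
  have Gadd [measurable]: "(\<lambda>(z, y). G (z(N := y))) \<in> borel_measurable (PiM {..<N} (\<lambda>_. borel) \<Otimes>\<^sub>M borel)"
    using measurable_compose[OF add Suc.prems] by (simp add: case_prod_unfold fun_upd_def)
  define H where "H z = (\<integral>\<^sup>+y. G (z(N := y)) * ennreal (exp (b N z * y - v * (b N z)\<^sup>2 / 2)) \<partial>normal_law v)" for z
  have H [measurable]: "H \<in> borel_measurable (PiM {..<N} (\<lambda>_. borel))"
    unfolding H_def by measurable
  let ?L = "\<lambda>\<xi>. \<lambda>i\<in>{..<Suc N}. drifted v b \<xi> i"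
  have L: "?L \<in> measurable (PiM {..<Suc N} (\<lambda>_. borel)) (PiM {..<Suc N} (\<lambda>_. borel))"
    by (intro measurable_restrict measurable_drifted[OF b] measurable_component_singleton) auto
  have "(\<integral>\<^sup>+\<xi>. G (?L \<xi>) \<partial>noise v (Suc N))
      = (\<integral>\<^sup>+x. (\<integral>\<^sup>+y. G (?L (x(N := y))) \<partial>normal_law v) \<partial>noise v N)"
    unfolding noise_def lessThan_Suc
    using measurable_compose[OF L Suc.prems]
    by (intro product_nn_integral_insert) (auto simp: lessThan_Suc restrict_def cong: measurable_cong_sets sets_PiM_cong)
  also have "\<dots> = (\<integral>\<^sup>+x. H (\<lambda>i\<in>{..<N}. drifted v b x i) \<partial>noise v N)"
  proof (intro nn_integral_cong)
    fix x assume "x \<in> space (noise v N)"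
    define z where "z = (\<lambda>i\<in>{..<N}. drifted v b x i)"
    have zs: "z \<in> space (PiM {..<N} (\<lambda>_. borel :: real measure))" by (simp add: z_def space_PiM)
    have "?L (x(N := y)) = z(N := y + v * b N z)" for y
    proof
      fix i
      have lt: "drifted v b (x(N := y)) j = drifted v b x j" if "j < N" for j
        using that by (intro drifted_cong[OF b]) auto
      have "b N (drifted v b (x(N := y))) = b N z"
        by (rule predictable_cong[OF b]) (simp add: z_def lt)
      then show "?L (x(N := y)) i = (z(N := y + v * b N z)) i"
        using lt[of i] by (auto simp: z_def drifted_eq[OF b, of _ _ N] less_Suc_eq)
    qed
    then have "(\<integral>\<^sup>+y. G (?L (x(N := y))) \<partial>normal_law v) = (\<integral>\<^sup>+y. G (z(N := y + v * b N z)) \<partial>normal_law v)" by simp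
    also have "\<dots> = H z"
      unfolding H_def
    proof (rule normal_law_shift[OF v, of "\<lambda>y. G (z(N := y))"])
      show "(\<lambda>y. G (z(N := y))) \<in> borel_measurable borel"
        using measurable_compose[OF measurable_Pair1'[OF zs] Gadd] by simp
    qed
    finally show "(\<integral>\<^sup>+y. G (?L (x(N := y))) \<partial>normal_law v) = H (\<lambda>i\<in>{..<N}. drifted v b x i)" by (simp add: z_def)
  qed
  also have "\<dots> = (\<integral>\<^sup>+x. H x * ennreal (exp (log_density v b N x)) \<partial>noise v N)"
    by (rule Suc.IH[OF H])
  also have "\<dots> = (\<integral>\<^sup>+x. (\<integral>\<^sup>+y. G (x(N := y)) * ennreal (exp (log_density v b (Suc N) (x(N := y)))) \<partial>normal_law v) \<partial>noise v N)"
  proof (intro nn_integral_cong)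
    fix x assume "x \<in> space (noise v N)"
    then have xs: "x \<in> space (PiM {..<N} (\<lambda>_. borel :: real measure))" by (simp add: noise_def space_PiM)
    have [measurable]: "(\<lambda>y. G (x(N := y))) \<in> borel_measurable borel"
      using measurable_compose[OF measurable_Pair1'[OF xs] Gadd] by simp
    have "log_density v b N (x(N := y)) = log_density v b N x" for y
      by (rule log_density_cong[OF b]) auto
    moreover have "b N (x(N := y)) = b N x" for y
      by (rule predictable_cong[OF b]) auto
    ultimately have "log_density v b (Suc N) (x(N := y)) = log_density v b N x + (b N x * y - v * (b N x)\<^sup>2 / 2)" for y
      unfolding log_density_def by simp
    then show "H x * ennreal (exp (log_density v b N x))
        = (\<integral>\<^sup>+y. G (x(N := y)) * ennreal (exp (log_density v b (Suc N) (x(N := y)))) \<partial>normal_law v)"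
      unfolding H_def by (subst nn_integral_multc[symmetric]) (auto simp: exp_add ennreal_mult mult_ac)
  qed
  also have "\<dots> = (\<integral>\<^sup>+\<xi>. G \<xi> * ennreal (exp (log_density v b (Suc N) \<xi>)) \<partial>noise v (Suc N))"
  proof -
    have "(\<lambda>\<xi>. G \<xi> * ennreal (exp (log_density v b (Suc N) \<xi>))) \<in> borel_measurable (PiM {..<Suc N} (\<lambda>_. borel))"
      by (intro borel_measurable_times_ennreal Suc.prems measurable_compose[OF _ measurable_ennreal]
        borel_measurable_exp measurable_compose[OF _ borel_measurable_exp] measurable_log_density[OF b] measurable_component_singleton) auto
    then show ?thesis
      unfolding noise_def lessThan_Suc
      by (intro product_nn_integral_insert[symmetric]) (auto simp: lessThan_Suc cong: measurable_cong_sets sets_PiM_cong)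
  qed
  finally show ?case .
qed

text \<open>The factor \<open>c\<close> serves Brownian scaling: increments over steps of length \<open>c\<^sup>2 * v\<close>, divided by
  \<open>c\<close>, are noise of variance \<open>v\<close>.\<close>

lemma increments_law:
  assumes W: "wiener_process M I W" and n: "n > 0" and c: "c > 0" and v: "v > 0"
    and t: "\<And>i. i \<le> n \<Longrightarrow> t i \<in> I" and step: "\<And>i. i < n \<Longrightarrow> t (Suc i) - t i = c\<^sup>2 * v"
  shows "distr M (PiM {..<n} (\<lambda>_. borel)) (\<lambda>\<omega>. \<lambda>i\<in>{..<n}. (W (t (Suc i)) \<omega> - W (t i) \<omega>) / c) = noise v n"
proof -
  interpret prob_space M using W by (simp add: wiener_process_def)
  have lt: "t i < t (Suc i)" if "i < n" for i
    using step[OF that] c v by (smt (verit) zero_less_power mult_pos_pos)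
  have meas [measurable]: "W (t i) \<in> borel_measurable M" if "i \<le> n" for i
    using W t[OF that] by (auto simp: wiener_process_def continuous_process_def)
  have "indep_vars (\<lambda>_. borel) (\<lambda>i \<omega>. W (t (Suc i)) \<omega> - W (t i) \<omega>) {..<n}"
    using W t lt unfolding wiener_process_def by blast
  then have "indep_vars (\<lambda>_. borel) (\<lambda>i. (\<lambda>x. x / c) \<circ> (\<lambda>\<omega>. W (t (Suc i)) \<omega> - W (t i) \<omega>)) {..<n}"
    by (rule indep_vars_compose) auto
  then have ind: "indep_vars (\<lambda>_. borel) (\<lambda>i \<omega>. (W (t (Suc i)) \<omega> - W (t i) \<omega>) / c) {..<n}"
    by (simp add: comp_def)
  have law: "distr M borel (\<lambda>\<omega>. (W (t (Suc i)) \<omega> - W (t i) \<omega>) / c) = normal_law v" if "i < n" for i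
  proof -
    have "distributed M lborel (\<lambda>\<omega>. W (t (Suc i)) \<omega> - W (t i) \<omega>) (normal_density 0 (sqrt (t (Suc i) - t i)))"
      using W t[of i] t[of "Suc i"] lt[OF that] that unfolding wiener_process_def by auto
    moreover have "sqrt (t (Suc i) - t i) = c * sqrt v" using step[OF that] c v by (simp add: real_sqrt_mult)
    ultimately have "distributed M lborel (\<lambda>\<omega>. W (t (Suc i)) \<omega> - W (t i) \<omega>) (normal_density 0 (c * sqrt v))" by simp
    from normal_density_affine[OF this, of "1 / c" 0] c v
    have "distributed M lborel (\<lambda>\<omega>. (W (t (Suc i)) \<omega> - W (t i) \<omega>) / c) (normal_density 0 (sqrt v))" by simp
    from distributed_distr_eq_density[OF this] show ?thesis
      by (simp add: normal_law_def cong: distr_cong)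
  qed
  have "distr M (PiM {..<n} (\<lambda>_. borel)) (\<lambda>\<omega>. \<lambda>i\<in>{..<n}. (W (t (Suc i)) \<omega> - W (t i) \<omega>) / c)
      = PiM {..<n} (\<lambda>i. distr M borel (\<lambda>\<omega>. (W (t (Suc i)) \<omega> - W (t i) \<omega>) / c))"
    using ind n by (subst (asm) indep_vars_iff_distr_eq_PiM') auto
  also have "\<dots> = noise v n" unfolding noise_def by (intro PiM_cong) (auto simp: law)
  finally show ?thesis .
qed

section \<open>Score and information of a path and of its grid values\<close>

definition past_mean :: "(real \<Rightarrow> real) \<Rightarrow> real \<Rightarrow> real" where
  "past_mean f t = integral {t - 1..t} f"

text \<open>The stochastic integral of \<open>past_mean f\<close> against \<open>f\<close> over \<open>[0, T]\<close> after integration by parts.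
  Since \<open>past_mean f\<close> has the derivative \<open>f t - f (t - 1)\<close>, this defines it for every single continuous path.\<close>

definition score :: "(real \<Rightarrow> real) \<Rightarrow> real \<Rightarrow> real" where
  "score f T = past_mean f T * f T - past_mean f 0 * f 0 - integral {0..T} (\<lambda>t. f t * (f t - f (t - 1)))"

definition information :: "(real \<Rightarrow> real) \<Rightarrow> real \<Rightarrow> real" where
  "information f T = integral {0..T} (\<lambda>t. (past_mean f t)\<^sup>2)"

text \<open>Grid index \<open>k\<close> stands for the time \<open>k / n - 1\<close>, so that the time \<open>i / n\<close> has index \<open>n + i\<close> and
  \<open>z i, \<dots>, z (i + n - 1)\<close> are the values in the unit of time before it.\<close>

definition grid_mean :: "nat \<Rightarrow> (nat \<Rightarrow> real) \<Rightarrow> nat \<Rightarrow> real" where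
  "grid_mean n z i = (\<Sum>l<n. z (i + l)) / real n"

definition grid_score :: "nat \<Rightarrow> nat \<Rightarrow> (nat \<Rightarrow> real) \<Rightarrow> real" where
  "grid_score n N z = (\<Sum>i<N. grid_mean n z i * (z (n + Suc i) - z (n + i)))"

definition grid_information :: "nat \<Rightarrow> nat \<Rightarrow> (nat \<Rightarrow> real) \<Rightarrow> real" where
  "grid_information n N z = (\<Sum>i<N. (grid_mean n z i)\<^sup>2) / real n"

lemma integral_past_window: "integral {-1..0} (\<lambda>u. f (s + u)) = past_mean f s"
  using integral_shift_Icc_real[of "-1" 0 f s] by (simp add: past_mean_def comp_def)

lemma grid_mean_Suc: "grid_mean n z (Suc i) = grid_mean n z i + (z (n + i) - z i) / real n"
proof -
  have "(\<Sum>l<n. z (Suc i + l)) = (\<Sum>l<n. z (i + l)) + (z (n + i) - z i)"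
    using sum_lessThan_telescope[of "\<lambda>l. z (i + l)" n] by (simp add: sum_subtractf add.commute)
  then show ?thesis by (simp add: grid_mean_def add_divide_distrib)
qed

text \<open>In this form all sums are Riemann sums, so that convergence of paths suffices for convergence of the scores.\<close>

lemma grid_score_by_parts:
  "grid_score n N z = grid_mean n z N * z (n + N) - grid_mean n z 0 * z n
     - (\<Sum>i<N. z (n + Suc i) * (z (n + i) - z i)) / real n"
  unfolding grid_score_def
  by (induction N) (simp_all add: grid_mean_Suc algebra_simps add_divide_distrib diff_divide_distrib)

text \<open>Uniform convergence of the grid functions \<open>c n\<close> to \<open>g\<close> on the cells of the grids of mesh \<open>1 / n\<close>.
  The last cell ends at or before \<open>T\<close>, which need not be a grid point.\<close>

definition grid_tendsto :: "real \<Rightarrow> (nat \<Rightarrow> nat \<Rightarrow> real) \<Rightarrow> (real \<Rightarrow> real) \<Rightarrow> bool" where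
  "grid_tendsto T c g \<longleftrightarrow> (\<forall>\<epsilon>>0. \<forall>\<^sub>F n in sequentially.
     \<forall>j<nat \<lfloor>real n * T\<rfloor>. \<forall>t\<in>{real j / real n..real (Suc j) / real n}. \<bar>c n j - g t\<bar> \<le> \<epsilon>)"

definition approximates :: "real \<Rightarrow> (nat \<Rightarrow> nat \<Rightarrow> real) \<Rightarrow> (real \<Rightarrow> real) \<Rightarrow> bool" where
  "approximates T z f \<longleftrightarrow> (\<forall>\<epsilon>>0. \<forall>\<^sub>F n in sequentially.
     \<forall>k\<le>n + nat \<lfloor>real n * T\<rfloor>. \<bar>z n k - f (real k / real n - 1)\<bar> \<le> \<epsilon>)"

lemma grid_end:
  assumes "n > 0" "T \<ge> 0"
  shows "real (nat \<lfloor>real n * T\<rfloor>) / real n \<le> T" "T \<le> real (Suc (nat \<lfloor>real n * T\<rfloor>)) / real n"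
proof -
  have "0 \<le> real n * T" using assms by simp
  then have "real (nat \<lfloor>real n * T\<rfloor>) \<le> real n * T" "real n * T \<le> real (Suc (nat \<lfloor>real n * T\<rfloor>))"
    by linarith+
  then show "real (nat \<lfloor>real n * T\<rfloor>) / real n \<le> T" "T \<le> real (Suc (nat \<lfloor>real n * T\<rfloor>)) / real n"
    using assms by (auto simp: pos_divide_le_eq pos_le_divide_eq mult.commute)
qed

lemma grid_cell:
  assumes n: "n > 0" and T: "T \<ge> 0" and j: "j < nat \<lfloor>real n * T\<rfloor>"
  shows "real (Suc j) / real n \<le> T" "t \<in> {real j / real n..real (Suc j) / real n} \<Longrightarrow> t \<in> {0..T}"
proof -
  have "real (Suc j) / real n \<le> real (nat \<lfloor>real n * T\<rfloor>) / real n"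
    using j by (intro divide_right_mono) auto
  then show *: "real (Suc j) / real n \<le> T" using grid_end(1)[OF n T] by linarith
  have "0 \<le> real j / real n" by simp
  then show "t \<in> {0..T}" if "t \<in> {real j / real n..real (Suc j) / real n}"
    using * that unfolding atLeastAtMost_iff by linarith
qed

lemma eventually_inverse_less: "d > 0 \<Longrightarrow> \<forall>\<^sub>F n in sequentially. n > 0 \<and> 1 / real n < d"
proof -
  assume d: "d > 0"
  obtain n0 :: nat where n0: "real n0 > 1 / d" using reals_Archimedean2 by blast
  have "n > 0 \<and> 1 / real n < d" if n: "n \<ge> Suc n0" for n
  proof -
    have "real n > 1 / d" "n > 0" using n n0 by linarith+
    then show ?thesis using d by (simp add: field_simps)
  qed
  then show ?thesis unfolding eventually_sequentially by blast
qed

lemma grid_tendsto_const_path: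
  assumes f: "continuous_on {-1..T} f" and T: "T \<ge> 0" and z: "approximates T z f"
    and idx: "\<And>n j. idx n j \<le> n + Suc j"
    and near: "\<And>n j t. n > 0 \<Longrightarrow> t \<in> {real j / real n..real (Suc j) / real n} \<Longrightarrow> \<bar>real (idx n j) / real n - 1 - s t\<bar> \<le> 1 / real n"
    and s: "\<And>t. t \<in> {0..T} \<Longrightarrow> s t \<in> {-1..T}"
  shows "grid_tendsto T (\<lambda>n j. z n (idx n j)) (\<lambda>t. f (s t))"
  unfolding grid_tendsto_def
proof (intro allI impI)
  fix \<epsilon> :: real assume \<epsilon>: "\<epsilon> > 0"
  then have e2: "\<epsilon> / 2 > 0" by simp
  obtain d where d: "d > 0" "\<And>s t. s \<in> {-1..T} \<Longrightarrow> t \<in> {-1..T} \<Longrightarrow> \<bar>s - t\<bar> < d \<Longrightarrow> \<bar>f s - f t\<bar> < \<epsilon> / 2"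
    using uniform_modulus[OF f e2] by blast
  have "\<forall>\<^sub>F n in sequentially. \<forall>k\<le>n + nat \<lfloor>real n * T\<rfloor>. \<bar>z n k - f (real k / real n - 1)\<bar> \<le> \<epsilon> / 2"
    using z e2 unfolding approximates_def by blast
  then show "\<forall>\<^sub>F n in sequentially. \<forall>j<nat \<lfloor>real n * T\<rfloor>. \<forall>t\<in>{real j / real n..real (Suc j) / real n}. \<bar>z n (idx n j) - f (s t)\<bar> \<le> \<epsilon>"
    using eventually_inverse_less[OF d(1)]
  proof eventually_elim
    case (elim n)
    show ?case
    proof (intro allI impI ballI)
      fix j t assume j: "j < nat \<lfloor>real n * T\<rfloor>" and t: "t \<in> {real j / real n..real (Suc j) / real n}"
      have n: "n > 0" using elim by simp
      note jT = grid_cell(1)[OF n T j] and tT = grid_cell(2)[OF n T j t]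
      let ?u = "real (idx n j) / real n - 1"
      have "real (idx n j) / real n \<le> real (n + Suc j) / real n"
        using idx[of n j] n by (intro divide_right_mono) auto
      also have "\<dots> = 1 + real (Suc j) / real n" using n by (simp add: add_divide_distrib)
      finally have u: "?u \<in> {-1..T}" using jT by auto
      have "\<bar>z n (idx n j) - f ?u\<bar> \<le> \<epsilon> / 2" using elim(1) idx[of n j] j by auto
      moreover have "\<bar>f ?u - f (s t)\<bar> < \<epsilon> / 2"
        using u s[OF tT] near[OF n t] elim by (intro d) auto
      ultimately show "\<bar>z n (idx n j) - f (s t)\<bar> \<le> \<epsilon>" by linarith
    qed
  qed
qed

text \<open>Products need bounds on the factors; continuity on the compact interval provides them.\<close>

lemma grid_tendsto_mult:
  assumes c: "grid_tendsto T c g" and c': "grid_tendsto T c' g'" and T: "T \<ge> 0"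
    and g: "continuous_on {0..T} g" and g': "continuous_on {0..T} g'"
  shows "grid_tendsto T (\<lambda>n j. c n j * c' n j) (\<lambda>t. g t * g' t)"
  unfolding grid_tendsto_def
proof (intro allI impI)
  fix \<epsilon> :: real assume \<epsilon>: "\<epsilon> > 0"
  obtain K where K: "\<And>t. t \<in> {0..T} \<Longrightarrow> \<bar>g t\<bar> \<le> K"
    using compact_imp_bounded[OF compact_continuous_image[OF g compact_Icc]] unfolding bounded_iff by fastforce
  obtain K' where K': "\<And>t. t \<in> {0..T} \<Longrightarrow> \<bar>g' t\<bar> \<le> K'"
    using compact_imp_bounded[OF compact_continuous_image[OF g' compact_Icc]] unfolding bounded_iff by fastforce
  have K0: "K \<ge> 0" "K' \<ge> 0" using K[of 0] K'[of 0] T by auto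
  define \<eta> where "\<eta> = min 1 (\<epsilon> / (K + K' + 1))"
  have \<eta>: "\<eta> > 0" "\<eta> \<le> 1" "\<eta> * (K + K' + 1) \<le> \<epsilon>"
  proof -
    show "\<eta> > 0" "\<eta> \<le> 1" using \<epsilon> K0 by (auto simp: \<eta>_def)
    have "\<eta> * (K + K' + 1) \<le> \<epsilon> / (K + K' + 1) * (K + K' + 1)" using K0 by (intro mult_right_mono) (auto simp: \<eta>_def)
    then show "\<eta> * (K + K' + 1) \<le> \<epsilon>" using K0 by simp
  qed
  have "\<forall>\<^sub>F n in sequentially. n > 0 \<and> 1 / real n < 1" by (rule eventually_inverse_less) simp
  with c[unfolded grid_tendsto_def, rule_format, OF \<eta>(1)] c'[unfolded grid_tendsto_def, rule_format, OF \<eta>(1)]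
  show "\<forall>\<^sub>F n in sequentially. \<forall>j<nat \<lfloor>real n * T\<rfloor>. \<forall>t\<in>{real j / real n..real (Suc j) / real n}. \<bar>c n j * c' n j - g t * g' t\<bar> \<le> \<epsilon>"
  proof eventually_elim
    case (elim n)
    show ?case
    proof (intro allI impI ballI)
      fix j t assume j: "j < nat \<lfloor>real n * T\<rfloor>" and t: "t \<in> {real j / real n..real (Suc j) / real n}"
      have n: "n > 0" using elim by simp
      note tT = grid_cell(2)[OF n T j t]
      have a: "\<bar>c n j - g t\<bar> \<le> \<eta>" "\<bar>c' n j - g' t\<bar> \<le> \<eta>" using elim j t by blast+
      have "c n j * c' n j - g t * g' t = (c n j - g t) * (c' n j - g' t) + (c n j - g t) * g' t + g t * (c' n j - g' t)"
        by (simp add: algebra_simps)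
      also have "\<bar>\<dots>\<bar> \<le> \<bar>c n j - g t\<bar> * \<bar>c' n j - g' t\<bar> + \<bar>c n j - g t\<bar> * \<bar>g' t\<bar> + \<bar>g t\<bar> * \<bar>c' n j - g' t\<bar>"
        unfolding abs_mult[symmetric] by linarith
      also have "\<dots> \<le> \<eta> * 1 + \<eta> * K' + K * \<eta>"
        using a \<eta> K[OF tT] K'[OF tT] K0 by (intro add_mono mult_mono) auto
      also have "\<dots> = \<eta> * (K + K' + 1)" by (simp add: algebra_simps)
      finally show "\<bar>c n j * c' n j - g t * g' t\<bar> \<le> \<epsilon>" using \<eta> by linarith
    qed
  qed
qed

lemma grid_tendsto_diff:
  assumes c: "grid_tendsto T c g" and c': "grid_tendsto T c' g'"
  shows "grid_tendsto T (\<lambda>n j. c n j - c' n j) (\<lambda>t. g t - g' t)"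
  unfolding grid_tendsto_def
proof (intro allI impI)
  fix \<epsilon> :: real assume "\<epsilon> > 0"
  then have e: "\<epsilon> / 2 > 0" by simp
  from c[unfolded grid_tendsto_def, rule_format, OF e] c'[unfolded grid_tendsto_def, rule_format, OF e]
  show "\<forall>\<^sub>F n in sequentially. \<forall>j<nat \<lfloor>real n * T\<rfloor>. \<forall>t\<in>{real j / real n..real (Suc j) / real n}.
    \<bar>c n j - c' n j - (g t - g' t)\<bar> \<le> \<epsilon>"
  proof eventually_elim
    case (elim n)
    show ?case
    proof (intro allI impI ballI)
      fix j t assume "j < nat \<lfloor>real n * T\<rfloor>" "t \<in> {real j / real n..real (Suc j) / real n}"
      then have "\<bar>c n j - g t\<bar> \<le> \<epsilon> / 2" "\<bar>c' n j - g' t\<bar> \<le> \<epsilon> / 2" using elim by blast+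
      then show "\<bar>c n j - c' n j - (g t - g' t)\<bar> \<le> \<epsilon>" by linarith
    qed
  qed
qed

lemma grid_end_tendsto:
  assumes T: "T \<ge> 0"
  shows "(\<lambda>n. real (nat \<lfloor>real n * T\<rfloor>) / real n) \<longlonglongrightarrow> T"
proof (rule tendsto_sandwich)
  have pos: "\<forall>\<^sub>F n in sequentially. n > (0::nat)" by (rule eventually_gt_at_top)
  then show "\<forall>\<^sub>F n in sequentially. T - 1 / real n \<le> real (nat \<lfloor>real n * T\<rfloor>) / real n"
  proof eventually_elim
    case (elim n)
    show ?case using grid_end(2)[OF elim T] by (simp add: add_divide_distrib)
  qed
  show "\<forall>\<^sub>F n in sequentially. real (nat \<lfloor>real n * T\<rfloor>) / real n \<le> T"
    using pos by eventually_elim (rule grid_end(1)[OF _ T])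
  show "(\<lambda>n. T - 1 / real n) \<longlonglongrightarrow> T"
    using tendsto_diff[OF tendsto_const lim_1_over_n, of T] by simp
qed auto

lemma grid_tendsto_sum:
  assumes c: "grid_tendsto T c g" and T: "T \<ge> 0" and g: "continuous_on {0..T} g"
  shows "(\<lambda>n. (\<Sum>j<nat \<lfloor>real n * T\<rfloor>. c n j) / real n) \<longlonglongrightarrow> integral {0..T} g"
proof -
  let ?N = "\<lambda>n. nat \<lfloor>real n * T\<rfloor>"
  have gi: "g integrable_on {0..T}" using g by (rule integrable_continuous_real)
  have end_in: "real (?N n) / real n \<in> {0..T}" if "n > 0" for n
    using grid_end(1)[OF that T] by simp
  have "(\<lambda>n. integral {0..real (?N n) / real n} g) \<longlonglongrightarrow> integral {0..T} g"
  proof (rule continuous_on_tendsto_compose[OF indefinite_integral_continuous_1[OF gi] grid_end_tendsto[OF T]])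
    show "\<forall>\<^sub>F n in sequentially. real (?N n) / real n \<in> {0..T}"
      using eventually_gt_at_top[of 0] by eventually_elim (rule end_in)
  qed (use T in auto)
  moreover have "(\<lambda>n. (\<Sum>j<?N n. c n j) / real n - integral {0..real (?N n) / real n} g) \<longlonglongrightarrow> 0"
  proof (rule LIMSEQ_I)
    fix r :: real assume r: "r > 0"
    define \<epsilon> where "\<epsilon> = r / (T + 1)"
    have \<epsilon>: "\<epsilon> > 0" using r T by (simp add: \<epsilon>_def)
    have "\<forall>\<^sub>F n in sequentially. norm ((\<Sum>j<?N n. c n j) / real n - integral {0..real (?N n) / real n} g - 0) < r"
      using c[unfolded grid_tendsto_def, rule_format, OF \<epsilon>] eventually_gt_at_top[of 0]
    proof eventually_elim
      case (elim n)
      have "\<bar>1 / real n * (\<Sum>j<?N n. c n j) - integral {0..0 + real (?N n) * (1 / real n)} g\<bar> \<le> \<epsilon> * (real (?N n) * (1 / real n))"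
      proof (rule riemann_error)
        show "g integrable_on {0..0 + real (?N n) * (1 / real n)}"
          using end_in[OF elim(2)] by (intro integrable_on_subinterval[OF gi]) auto
      qed (use elim in auto)
      also have "\<dots> \<le> \<epsilon> * T" using end_in[OF elim(2)] \<epsilon> by (intro mult_left_mono) auto
      also have "\<dots> < \<epsilon> * (T + 1)" using \<epsilon> by simp
      also have "\<dots> = r" using T by (simp add: \<epsilon>_def)
      finally show ?case by simp
    qed
    then show "\<exists>no. \<forall>n\<ge>no. norm ((\<Sum>j<?N n. c n j) / real n - integral {0..real (?N n) / real n} g - 0) < r"
      by (simp add: eventually_sequentially)
  qed
  ultimately show ?thesis using tendsto_add by fastforce
qed

lemma continuous_past_mean_from:
  assumes f: "continuous_on {a..T} f"
  shows "continuous_on {a + 1..T} (past_mean f)"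
proof -
  have fi: "f integrable_on {a..T}" using f by (rule integrable_continuous_real)
  have F: "continuous_on {a..T} (\<lambda>t. integral {a..t} f)" by (rule indefinite_integral_continuous_1[OF fi])
  have "continuous_on {a + 1..T} (\<lambda>t. integral {a..t} f - integral {a..t - 1} f)"
    by (intro continuous_on_diff continuous_on_subset[OF F] continuous_on_compose2[OF F] continuous_intros) auto
  then show ?thesis
  proof (rule continuous_on_cong[THEN iffD1, OF refl, rotated])
    fix t assume t: "t \<in> {a + 1..T}"
    have "integral {a..t - 1} f + integral {t - 1..t} f = integral {a..t} f"
      using t by (intro Henstock_Kurzweil_Integration.integral_combine integrable_on_subinterval[OF fi]) auto
    then show "integral {a..t} f - integral {a..t - 1} f = past_mean f t" by (simp add: past_mean_def)
  qed
qed

lemma continuous_past_mean: "continuous_on {-1..T} f \<Longrightarrow> continuous_on {0..T} (past_mean f)"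
  using continuous_past_mean_from[of "-1" T f] by simp

lemma grid_mean_approximates:
  assumes f: "continuous_on {-1..T} f" and T: "T \<ge> 0" and z: "approximates T z f" and \<epsilon>: "\<epsilon> > 0"
  shows "\<forall>\<^sub>F n in sequentially. \<forall>i\<le>nat \<lfloor>real n * T\<rfloor>. \<forall>t\<in>{real i / real n..real (Suc i) / real n} \<inter> {0..T}.
    \<bar>grid_mean n (z n) i - past_mean f t\<bar> \<le> \<epsilon>"
proof -
  have e: "\<epsilon> / 2 > 0" "\<epsilon> / 4 > 0" using \<epsilon> by auto
  obtain d where d: "d > 0" "\<And>s t. s \<in> {-1..T} \<Longrightarrow> t \<in> {-1..T} \<Longrightarrow> \<bar>s - t\<bar> < d \<Longrightarrow> \<bar>f s - f t\<bar> < \<epsilon> / 4"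
    using uniform_modulus[OF f e(2)] by blast
  obtain d' where d': "d' > 0" "\<And>s t. s \<in> {0..T} \<Longrightarrow> t \<in> {0..T} \<Longrightarrow> \<bar>s - t\<bar> < d' \<Longrightarrow> \<bar>past_mean f s - past_mean f t\<bar> < \<epsilon> / 2"
    using uniform_modulus[OF continuous_past_mean[OF f] e(1)] by blast
  have "\<forall>\<^sub>F n in sequentially. \<forall>k\<le>n + nat \<lfloor>real n * T\<rfloor>. \<bar>z n k - f (real k / real n - 1)\<bar> \<le> \<epsilon> / 4"
    using z e unfolding approximates_def by blast
  with eventually_inverse_less[OF d(1)] eventually_inverse_less[OF d'(1)]
  show ?thesis
  proof eventually_elim
    case (elim n)
    then have n: "n > 0" by simp
    show ?case
    proof (intro allI impI ballI)
      fix i t assume i: "i \<le> nat \<lfloor>real n * T\<rfloor>" and t: "t \<in> {real i / real n..real (Suc i) / real n} \<inter> {0..T}"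
      have iT: "real i / real n \<le> T"
        using divide_right_mono[of "real i" "real (nat \<lfloor>real n * T\<rfloor>)" "real n"] i grid_end(1)[OF n T] by auto
      let ?a = "real i / real n - 1"
      have len: "?a + real n * (1 / real n) = real i / real n" using n by simp
      have "\<bar>1 / real n * (\<Sum>l<n. z n (i + l)) - integral {?a..?a + real n * (1 / real n)} f\<bar> \<le> \<epsilon> / 2 * (real n * (1 / real n))"
      proof (rule riemann_error)
        fix l u assume l: "l < n" and u: "u \<in> {?a + real l * (1 / real n)..?a + real (Suc l) * (1 / real n)}"
        have node: "real (i + l) / real n - 1 = ?a + real l * (1 / real n)" by (simp add: add_divide_distrib)
        have "real (Suc l) / real n \<le> real n / real n" using l n by (intro divide_right_mono) auto
        then have "real (Suc l) / real n \<le> 1" using n by simp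
        then have "?a + real (Suc l) * (1 / real n) \<le> T" using iT by (simp add: algebra_simps del: of_nat_Suc)
        moreover have "-1 \<le> ?a + real l * (1 / real n)" by simp
        moreover have diff: "\<bar>?a + real l * (1 / real n) - u\<bar> \<le> 1 / real n" using u by (auto simp: add_divide_distrib algebra_simps)
        ultimately have "\<bar>f (?a + real l * (1 / real n)) - f u\<bar> < \<epsilon> / 4"
          using u elim by (intro d) (unfold atLeastAtMost_iff, linarith+)
        moreover have "\<bar>z n (i + l) - f (?a + real l * (1 / real n))\<bar> \<le> \<epsilon> / 4"
          using elim(3)[rule_format, of "i + l"] i l unfolding node by auto
        ultimately show "\<bar>z n (i + l) - f u\<bar> \<le> \<epsilon> / 2" by linarith
      next
        show "f integrable_on {?a..?a + real n * (1 / real n)}"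
          unfolding len using iT by (intro integrable_continuous_real continuous_on_subset[OF f]) auto
      qed (use n in auto)
      then have "\<bar>grid_mean n (z n) i - past_mean f (real i / real n)\<bar> \<le> \<epsilon> / 2"
        unfolding len using n by (simp add: grid_mean_def past_mean_def)
      moreover have "\<bar>past_mean f (real i / real n) - past_mean f t\<bar> < \<epsilon> / 2"
      proof (rule d')
        have "0 \<le> t" "t \<le> T" "real i / real n \<le> t" "t \<le> real i / real n + 1 / real n"
          using IntD1[OF t] IntD2[OF t] by (auto simp: add_divide_distrib)
        then show "\<bar>real i / real n - t\<bar> < d'" "t \<in> {0..T}" using elim by auto
      qed (use iT in auto)
      ultimately show "\<bar>grid_mean n (z n) i - past_mean f t\<bar> \<le> \<epsilon>" by linarith
    qed
  qed
qed

lemma grid_tendsto_grid_mean: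
  assumes f: "continuous_on {-1..T} f" and T: "T \<ge> 0" and z: "approximates T z f"
  shows "grid_tendsto T (\<lambda>n. grid_mean n (z n)) (past_mean f)"
  unfolding grid_tendsto_def
proof (intro allI impI)
  fix \<epsilon> :: real assume \<epsilon>: "\<epsilon> > 0"
  show "\<forall>\<^sub>F n in sequentially. \<forall>j<nat \<lfloor>real n * T\<rfloor>. \<forall>t\<in>{real j / real n..real (Suc j) / real n}. \<bar>grid_mean n (z n) j - past_mean f t\<bar> \<le> \<epsilon>"
    using grid_mean_approximates[OF assms \<epsilon>] eventually_gt_at_top[of 0]
  proof eventually_elim
    case (elim n)
    show ?case
    proof (intro allI impI ballI)
      fix j t assume j: "j < nat \<lfloor>real n * T\<rfloor>" and t: "t \<in> {real j / real n..real (Suc j) / real n}"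
      from grid_cell(2)[OF elim(2) T j t] show "\<bar>grid_mean n (z n) j - past_mean f t\<bar> \<le> \<epsilon>" using elim(1) j t by (meson IntI less_imp_le)
    qed
  qed
qed

lemma approximates_point:
  assumes f: "continuous_on {-1..T} f" and T: "T \<ge> 0" and z: "approximates T z f"
    and t: "t \<in> {-1..T}" and idx: "\<And>n. n > 0 \<Longrightarrow> idx n \<le> n + nat \<lfloor>real n * T\<rfloor>"
    and near: "\<And>n. n > 0 \<Longrightarrow> \<bar>real (idx n) / real n - 1 - t\<bar> \<le> 1 / real n"
  shows "(\<lambda>n. z n (idx n)) \<longlonglongrightarrow> f t"
proof (rule LIMSEQ_I)
  fix r :: real assume r: "r > 0"
  then have e: "r / 2 > 0" by simp
  obtain d where d: "d > 0" "\<And>s t. s \<in> {-1..T} \<Longrightarrow> t \<in> {-1..T} \<Longrightarrow> \<bar>s - t\<bar> < d \<Longrightarrow> \<bar>f s - f t\<bar> < r / 2"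
    using uniform_modulus[OF f e] by blast
  have "\<forall>\<^sub>F n in sequentially. norm (z n (idx n) - f t) < r"
    using z[unfolded approximates_def, rule_format, OF e] eventually_inverse_less[OF d(1)]
  proof eventually_elim
    case (elim n)
    then have n: "n > 0" by simp
    have "real (idx n) / real n \<le> real (n + nat \<lfloor>real n * T\<rfloor>) / real n"
      using idx[OF n] by (intro divide_right_mono) auto
    also have "\<dots> \<le> 1 + T" using grid_end(1)[OF n T] n by (simp add: add_divide_distrib)
    finally have "\<bar>f (real (idx n) / real n - 1) - f t\<bar> < r / 2"
      using t near[OF n] elim by (intro d) auto
    moreover have "\<bar>z n (idx n) - f (real (idx n) / real n - 1)\<bar> \<le> r / 2" using elim idx[OF n] by blast
    ultimately show ?case unfolding real_norm_def by linarith
  qed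
  then show "\<exists>no. \<forall>n\<ge>no. norm (z n (idx n) - f t) < r" by (simp add: eventually_sequentially)
qed

lemma grid_information_tendsto:
  assumes f: "continuous_on {-1..T} f" and T: "T \<ge> 0" and z: "approximates T z f"
  shows "(\<lambda>n. grid_information n (nat \<lfloor>real n * T\<rfloor>) (z n)) \<longlonglongrightarrow> information f T"
proof -
  note c = continuous_past_mean[OF f]
  have "grid_tendsto T (\<lambda>n j. grid_mean n (z n) j * grid_mean n (z n) j) (\<lambda>t. past_mean f t * past_mean f t)"
    by (intro grid_tendsto_mult grid_tendsto_grid_mean assms c)
  from grid_tendsto_sum[OF this T] c show ?thesis
    by (simp add: grid_information_def information_def power2_eq_square continuous_on_mult)
qed

lemma grid_score_tendsto:
  assumes f: "continuous_on {-1..T} f" and T: "T \<ge> 0" and z: "approximates T z f"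
  shows "(\<lambda>n. grid_score n (nat \<lfloor>real n * T\<rfloor>) (z n)) \<longlonglongrightarrow> score f T"
  unfolding grid_score_by_parts score_def
proof (intro tendsto_diff tendsto_mult)
  let ?N = "\<lambda>n. nat \<lfloor>real n * T\<rfloor>"
  have f0: "continuous_on {0..T} f" "continuous_on {0..T} (\<lambda>t. f (t - 1))"
    by (auto intro!: continuous_on_subset[OF f] continuous_on_compose2[OF f] continuous_intros)
  show "(\<lambda>n. z n (n + ?N n)) \<longlonglongrightarrow> f T"
  proof (rule approximates_point[OF f T z])
    show "\<bar>real (n + ?N n) / real n - 1 - T\<bar> \<le> 1 / real n" if "n > 0" for n
      using grid_end[OF that T] that by (simp add: add_divide_distrib)
  qed (use T in auto)
  show "(\<lambda>n. z n n) \<longlonglongrightarrow> f 0"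
    by (rule approximates_point[OF f T z]) (use T in auto)
  have mean: "(\<lambda>n. grid_mean n (z n) (idx n)) \<longlonglongrightarrow> past_mean f t"
    if idx: "\<And>n. idx n \<le> ?N n" and t: "t \<in> {0..T}" and near: "\<And>n. n > 0 \<Longrightarrow> t \<in> {real (idx n) / real n..real (Suc (idx n)) / real n}"
    for idx t
  proof (rule LIMSEQ_I)
    fix r :: real assume r: "r > 0"
    then have e: "r / 2 > 0" by simp
    have "\<forall>\<^sub>F n in sequentially. norm (grid_mean n (z n) (idx n) - past_mean f t) < r"
      using grid_mean_approximates[OF assms e] eventually_gt_at_top[of 0]
    proof eventually_elim
      case (elim n)
      have "\<bar>grid_mean n (z n) (idx n) - past_mean f t\<bar> \<le> r / 2" using elim(1) idx[of n] near[OF elim(2)] t by blast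
      then show ?case using r by simp
    qed
    then show "\<exists>no. \<forall>n\<ge>no. norm (grid_mean n (z n) (idx n) - past_mean f t) < r" by (simp add: eventually_sequentially)
  qed
  show "(\<lambda>n. grid_mean n (z n) (?N n)) \<longlonglongrightarrow> past_mean f T"
    using grid_end[OF _ T] T by (intro mean) auto
  show "(\<lambda>n. grid_mean n (z n) 0) \<longlonglongrightarrow> past_mean f 0"
    using T by (intro mean) auto
  have "grid_tendsto T (\<lambda>n j. z n (n + Suc j) * (z n (n + j) - z n j)) (\<lambda>t. f t * (f t - f (t - 1)))"
  proof (intro grid_tendsto_mult grid_tendsto_diff f0 T continuous_on_diff)
    show "grid_tendsto T (\<lambda>n j. z n (n + Suc j)) f"
      by (rule grid_tendsto_const_path[OF f T z, where s = "\<lambda>t. t"]) (auto simp: add_divide_distrib)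
    show "grid_tendsto T (\<lambda>n j. z n (n + j)) f"
      by (rule grid_tendsto_const_path[OF f T z, where s = "\<lambda>t. t"]) (auto simp: add_divide_distrib)
    show "grid_tendsto T (\<lambda>n j. z n j) (\<lambda>t. f (t - 1))"
      by (rule grid_tendsto_const_path[OF f T z, where s = "\<lambda>t. t - 1"]) (auto simp: add_divide_distrib)
  qed
  moreover have "continuous_on {0..T} (\<lambda>t. f t * (f t - f (t - 1)))"
    by (intro continuous_on_mult continuous_on_diff f0)
  ultimately show "(\<lambda>n. (\<Sum>i<?N n. z n (n + Suc i) * (z n (n + i) - z n i)) / real n) \<longlonglongrightarrow> integral {0..T} (\<lambda>t. f t * (f t - f (t - 1)))"
    using T by (intro grid_tendsto_sum)
qed

text \<open>The Euler scheme for the delay equation converges along every single path. The difference from the path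
  satisfies a discrete Gronwall inequality whose forcing term is the discretization error of \<open>past_mean f\<close>.\<close>

lemma euler_approximates:
  assumes f: "continuous_on {-1..T} f" and T: "T \<ge> 0"
    and eq: "\<And>t. t \<in> {0..T} \<Longrightarrow> f t = f 0 + a * integral {0..t} (past_mean f) + (w t - w 0)"
    and init: "\<And>n k. k \<le> n \<Longrightarrow> z n k = f (real k / real n - 1)"
    and step: "\<And>n i. i < nat \<lfloor>real n * T\<rfloor> \<Longrightarrow>
      z n (n + Suc i) = z n (n + i) + (w (real (Suc i) / real n) - w (real i / real n)) + a * grid_mean n (z n) i / real n"
  shows "approximates T z f"
  unfolding approximates_def
proof (intro allI impI)
  fix \<epsilon> :: real assume \<epsilon>: "\<epsilon> > 0"
  define z0 :: "nat \<Rightarrow> nat \<Rightarrow> real" where "z0 n k = f (real k / real n - 1)" for n k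
  (* chosen so that the Gronwall factor exp (|a| T) turns c into epsilon *)
  define c where "c = \<epsilon> * exp (- \<bar>a\<bar> * T)"
  define \<eta> where "\<eta> = c / (\<bar>a\<bar> * T + 1)"
  have c: "c > 0" using \<epsilon> by (simp add: c_def)
  have aT: "\<bar>a\<bar> * T \<ge> 0" using T by simp
  have \<eta>: "\<eta> > 0" "\<bar>a\<bar> * \<eta> * T \<le> c"
  proof -
    show "\<eta> > 0" using c aT by (simp add: \<eta>_def)
    have "\<bar>a\<bar> * \<eta> * T \<le> \<eta> * (\<bar>a\<bar> * T + 1)" using \<open>\<eta> > 0\<close> by (simp add: algebra_simps)
    also have "\<dots> = c" using aT by (simp add: \<eta>_def)
    finally show "\<bar>a\<bar> * \<eta> * T \<le> c" .
  qed
  have z0: "approximates T z0 f" by (auto simp: approximates_def z0_def)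
  show "\<forall>\<^sub>F n in sequentially. \<forall>k\<le>n + nat \<lfloor>real n * T\<rfloor>. \<bar>z n k - f (real k / real n - 1)\<bar> \<le> \<epsilon>"
    using grid_mean_approximates[OF f T z0 \<eta>(1)] eventually_gt_at_top[of 0]
  proof eventually_elim
    case (elim n)
    let ?N = "nat \<lfloor>real n * T\<rfloor>"
    have n: "n > 0" using elim by simp
    define q where "q = 1 + \<bar>a\<bar> / real n"
    have q: "q \<ge> 1" by (simp add: q_def)
    have zsum: "z n (n + j) = f 0 + (w (real j / real n) - w 0) + a / real n * (\<Sum>i<j. grid_mean n (z n) i)" if "j \<le> ?N" for j
      using that
    proof (induction j)
      case 0
      then show ?case using init[of n n] n by simp
    next
      case (Suc j)
      then show ?case using step[of j n] by (simp add: algebra_simps)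
    qed
    have claim: "\<bar>z n k - z0 n k\<bar> \<le> c * q ^ (k - n)" if "k \<le> n + ?N" for k
      using that
    proof (induction k rule: less_induct)
      case (less k)
      show ?case
      proof (cases "k \<le> n")
        case True
        then show ?thesis using init[of k n] c by (simp add: z0_def)
      next
        case False
        define j where "j = k - n"
        have j: "k = n + j" "j \<ge> 1" using False by (auto simp: j_def)
        have jN: "j \<le> ?N" using less.prems j by simp
        have jT: "real j / real n \<le> T" "0 \<le> real j / real n"
          using divide_right_mono[of "real j" "real ?N" "real n"] jN grid_end(1)[OF n T] by auto
        have near: "\<bar>grid_mean n (z n) i - grid_mean n (z0 n) i\<bar> \<le> c * q ^ i" if i: "i < j" for i
        proof -
          have "\<bar>z n (i + l) - z0 n (i + l)\<bar> \<le> c * q ^ i" if l: "l < n" for l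
          proof -
            have "\<bar>z n (i + l) - z0 n (i + l)\<bar> \<le> c * q ^ (i + l - n)"
              using i l j less.prems by (intro less.IH) auto
            also have "\<dots> \<le> c * q ^ i" using l q c by (intro mult_left_mono power_increasing) auto
            finally show ?thesis .
          qed
          then have "\<bar>\<Sum>l<n. z n (i + l) - z0 n (i + l)\<bar> \<le> (\<Sum>l<n. c * q ^ i)"
            by (intro order_trans[OF sum_abs] sum_mono) auto
          then have "\<bar>(\<Sum>l<n. z n (i + l)) - (\<Sum>l<n. z0 n (i + l))\<bar> / real n \<le> c * q ^ i"
            using n by (simp add: sum_subtractf pos_divide_le_eq mult_ac)
          then show ?thesis using n by (simp add: grid_mean_def diff_divide_distrib[symmetric] abs_divide)
        qed
        have geo: "\<bar>a\<bar> / real n * (\<Sum>i<j. c * q ^ i) = c * (q ^ j - 1)"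
        proof -
          have "(q - 1) * (\<Sum>i<j. q ^ i) = q ^ j - 1" by (rule power_diff_1_eq[symmetric])
          moreover have "\<bar>a\<bar> / real n * (\<Sum>i<j. c * q ^ i) = c * ((q - 1) * (\<Sum>i<j. q ^ i))"
            unfolding sum_distrib_left[symmetric] by (simp add: q_def)
          ultimately show ?thesis by simp
        qed
        have pi: "past_mean f integrable_on {0..real j / real n}"
          using jT by (intro integrable_continuous_real continuous_on_subset[OF continuous_past_mean[OF f]]) auto
        have "\<bar>1 / real n * (\<Sum>i<j. grid_mean n (z0 n) i) - integral {0..0 + real j * (1 / real n)} (past_mean f)\<bar> \<le> \<eta> * (real j * (1 / real n))"
        proof (rule riemann_error)
          fix i t assume i: "i < j" and t: "t \<in> {0 + real i * (1 / real n)..0 + real (Suc i) * (1 / real n)}"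
          have "real (Suc i) / real n \<le> real j / real n" using i by (intro divide_right_mono) auto
          moreover have "0 \<le> real i / real n" by simp
          moreover have ti: "t \<in> {real i / real n..real (Suc i) / real n}" using t by simp
          ultimately have "t \<in> {0..T}" using jT unfolding atLeastAtMost_iff by linarith
          with ti have "t \<in> {real i / real n..real (Suc i) / real n} \<inter> {0..T}" by blast
          then show "\<bar>grid_mean n (z0 n) i - past_mean f t\<bar> \<le> \<eta>" using elim(1) i jN by auto
        qed (use pi in auto)
        also have "\<eta> * (real j * (1 / real n)) \<le> \<eta> * T" using jT \<eta> by (intro mult_left_mono) auto
        finally have R: "\<bar>1 / real n * (\<Sum>i<j. grid_mean n (z0 n) i) - integral {0..real j / real n} (past_mean f)\<bar> \<le> \<eta> * T"
          by simp
        have "z0 n k = f (real j / real n)" using j n by (simp add: z0_def add_divide_distrib)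
        also have "\<dots> = f 0 + a * integral {0..real j / real n} (past_mean f) + (w (real j / real n) - w 0)"
          using jT by (intro eq) auto
        finally have "z n k - z0 n k
          = a / real n * (\<Sum>i<j. grid_mean n (z n) i) - a * integral {0..real j / real n} (past_mean f)"
          using zsum[OF jN] j by simp
        also have "\<dots> = a / real n * (\<Sum>i<j. grid_mean n (z n) i - grid_mean n (z0 n) i)
            + a * (1 / real n * (\<Sum>i<j. grid_mean n (z0 n) i) - integral {0..real j / real n} (past_mean f))"
          by (simp add: sum_subtractf right_diff_distrib)
        finally have split: "z n k - z0 n k = \<dots>" .
        have "\<bar>z n k - z0 n k\<bar> \<le> \<bar>a\<bar> / real n * \<bar>\<Sum>i<j. grid_mean n (z n) i - grid_mean n (z0 n) i\<bar>
            + \<bar>a\<bar> * \<bar>1 / real n * (\<Sum>i<j. grid_mean n (z0 n) i) - integral {0..real j / real n} (past_mean f)\<bar>"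
          unfolding split by (rule order_trans[OF abs_triangle_ineq]) (simp add: abs_mult abs_divide)
        also have "\<dots> \<le> \<bar>a\<bar> / real n * (\<Sum>i<j. c * q ^ i) + \<bar>a\<bar> * (\<eta> * T)"
        proof (rule add_mono)
          have "\<bar>\<Sum>i<j. grid_mean n (z n) i - grid_mean n (z0 n) i\<bar> \<le> (\<Sum>i<j. c * q ^ i)"
            by (rule order_trans[OF sum_abs], rule sum_mono) (simp add: near)
          then show "\<bar>a\<bar> / real n * \<bar>\<Sum>i<j. grid_mean n (z n) i - grid_mean n (z0 n) i\<bar> \<le> \<bar>a\<bar> / real n * (\<Sum>i<j. c * q ^ i)"
            by (rule mult_left_mono) simp
        qed (rule mult_left_mono[OF R], simp)
        also have "\<dots> = c * (q ^ j - 1) + \<bar>a\<bar> * \<eta> * T" unfolding geo by simp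
        also have "\<dots> \<le> c * q ^ j" using \<eta>(2) by (simp add: right_diff_distrib)
        finally show ?thesis using j by simp
      qed
    qed
    show ?case
    proof (intro allI impI)
      fix k assume k: "k \<le> n + ?N"
      have "q ^ (k - n) \<le> q ^ ?N" using k q by (intro power_increasing) auto
      also have "\<dots> \<le> exp (\<bar>a\<bar> / real n) ^ ?N"
        unfolding q_def by (intro power_mono exp_ge_add_one_self) auto
      also have "\<dots> = exp (\<bar>a\<bar> * (real ?N / real n))" by (simp add: exp_of_nat_mult[symmetric] mult.commute)
      also have "\<dots> \<le> exp (\<bar>a\<bar> * T)"
        using mult_left_mono[OF grid_end(1)[OF n T], of "\<bar>a\<bar>"] by simp
      finally have "c * q ^ (k - n) \<le> c * exp (\<bar>a\<bar> * T)" using c by (intro mult_left_mono) auto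
      also have "\<dots> = \<epsilon>" by (simp add: c_def mult.assoc exp_add[symmetric])
      finally show "\<bar>z n k - f (real k / real n - 1)\<bar> \<le> \<epsilon>" using claim[OF k] by (simp add: z0_def)
    qed
  qed
qed

definition log_lik :: "real \<Rightarrow> (real \<Rightarrow> real) \<Rightarrow> real \<Rightarrow> real" where
  "log_lik a f T = a * score f T - a\<^sup>2 / 2 * information f T"

lemma past_mean_cong: "(\<And>s. s \<in> {-1..T} \<Longrightarrow> f s = g s) \<Longrightarrow> t \<in> {0..T} \<Longrightarrow> past_mean f t = past_mean g t"
  unfolding past_mean_def by (intro integral_cong) auto

lemma score_cong:
  assumes eq: "\<And>s. s \<in> {-1..T} \<Longrightarrow> f s = g s" and T: "T \<ge> 0"
  shows "score f T = score g T"
proof -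
  have "integral {0..T} (\<lambda>t. f t * (f t - f (t - 1))) = integral {0..T} (\<lambda>t. g t * (g t - g (t - 1)))"
    by (intro integral_cong) (simp add: eq)
  moreover have "past_mean f T = past_mean g T" "past_mean f 0 = past_mean g 0"
    using T by (auto intro!: past_mean_cong[OF eq])
  ultimately show ?thesis using T by (simp add: score_def eq)
qed

lemma information_cong:
  assumes eq: "\<And>s. s \<in> {-1..T} \<Longrightarrow> f s = g s"
  shows "information f T = information g T"
  unfolding information_def by (intro integral_cong arg_cong[of _ _ "\<lambda>x. x\<^sup>2"] past_mean_cong[OF eq]) auto

context
  fixes N :: "'p measure" and Y :: "real \<Rightarrow> 'p \<Rightarrow> real" and T :: real
  assumes T: "T \<ge> 0" and meas: "\<And>t. t \<in> {-1..T} \<Longrightarrow> Y t \<in> borel_measurable N"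
    and cont: "\<And>x. x \<in> space N \<Longrightarrow> continuous_on {-1..T} (\<lambda>t. Y t x)"
begin

lemma borel_measurable_past_mean: "t \<in> {0..T} \<Longrightarrow> (\<lambda>x. past_mean (\<lambda>t. Y t x) t) \<in> borel_measurable N"
  unfolding past_mean_def
  by (intro borel_measurable_integral_process meas continuous_on_subset[OF cont]) auto

lemma borel_measurable_information: "(\<lambda>x. information (\<lambda>t. Y t x) T) \<in> borel_measurable N"
  unfolding information_def
  by (intro borel_measurable_integral_process borel_measurable_power borel_measurable_past_mean
      continuous_on_power continuous_past_mean cont)

lemma borel_measurable_score: "(\<lambda>x. score (\<lambda>t. Y t x) T) \<in> borel_measurable N"
proof -
  have "(\<lambda>x. integral {0..T} (\<lambda>t. Y t x * (Y t x - Y (t - 1) x))) \<in> borel_measurable N"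
  proof (rule borel_measurable_integral_process)
    fix t assume "t \<in> {0..T}"
    then have [measurable]: "Y t \<in> borel_measurable N" "Y (t - 1) \<in> borel_measurable N" by (auto intro!: meas)
    show "(\<lambda>x. Y t x * (Y t x - Y (t - 1) x)) \<in> borel_measurable N" by measurable
  next
    fix x assume "x \<in> space N"
    note c = cont[OF this]
    show "continuous_on {0..T} (\<lambda>t. Y t x * (Y t x - Y (t - 1) x))"
      by (intro continuous_on_mult continuous_on_diff continuous_on_subset[OF c] continuous_on_compose2[OF c]
          continuous_on_id continuous_on_const) auto
  qed
  moreover have [measurable]: "Y T \<in> borel_measurable N" "Y 0 \<in> borel_measurable N" using T by (auto intro!: meas)
  moreover have "(\<lambda>x. past_mean (\<lambda>t. Y t x) T) \<in> borel_measurable N" "(\<lambda>x. past_mean (\<lambda>t. Y t x) 0) \<in> borel_measurable N"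
    using T by (auto intro!: borel_measurable_past_mean)
  ultimately show ?thesis unfolding score_def by measurable
qed

lemma borel_measurable_log_lik: "(\<lambda>x. log_lik a (\<lambda>t. Y t x) T) \<in> borel_measurable N"
  unfolding log_lik_def
  by (intro borel_measurable_diff borel_measurable_times borel_measurable_score borel_measurable_information borel_measurable_const)

end

section \<open>Discretization of the delay equation\<close>

text \<open>The grid values of a path with initial segment \<open>v\<close> and increments \<open>\<xi>\<close> after time \<open>0\<close>.\<close>

definition grid_path :: "nat \<Rightarrow> (nat \<Rightarrow> real) \<Rightarrow> (nat \<Rightarrow> real) \<Rightarrow> nat \<Rightarrow> real" where
  "grid_path n v \<xi> k = (if k \<le> n then v k else v n + (\<Sum>i<k - n. \<xi> i))"

definition drift :: "real \<Rightarrow> nat \<Rightarrow> (nat \<Rightarrow> real) \<Rightarrow> nat \<Rightarrow> (nat \<Rightarrow> real) \<Rightarrow> real" where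
  "drift a n v i \<xi> = a * grid_mean n (grid_path n v \<xi>) i"

definition grid_log_lik :: "real \<Rightarrow> nat \<Rightarrow> nat \<Rightarrow> (nat \<Rightarrow> real) \<Rightarrow> real" where
  "grid_log_lik a n N z = a * grid_score n N z - a\<^sup>2 / 2 * grid_information n N z"

lemma grid_path_cong: "(\<And>i. i < k - n \<Longrightarrow> \<xi> i = \<xi>' i) \<Longrightarrow> grid_path n v \<xi> k = grid_path n v \<xi>' k"
  by (simp add: grid_path_def)

lemma grid_path_Suc: "grid_path n v \<xi> (n + Suc i) = grid_path n v \<xi> (n + i) + \<xi> i"
  by (simp add: grid_path_def)

lemma measurable_grid_path:
  assumes "\<And>k. k \<le> n \<Longrightarrow> (\<lambda>x. v x k) \<in> borel_measurable N" "\<And>i. i < k - n \<Longrightarrow> (\<lambda>x. \<xi> x i) \<in> borel_measurable N"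
  shows "(\<lambda>x. grid_path n (v x) (\<xi> x) k) \<in> borel_measurable N"
proof (cases "k \<le> n")
  case False
  then show ?thesis using assms by (simp add: grid_path_def)
qed (simp add: grid_path_def assms)

lemma measurable_grid_mean:
  assumes "\<And>l. l < n \<Longrightarrow> (\<lambda>x. z x (i + l)) \<in> borel_measurable N"
  shows "(\<lambda>x. grid_mean n (z x) i) \<in> borel_measurable N"
  unfolding grid_mean_def using assms by (intro borel_measurable_divide borel_measurable_sum) auto

lemma measurable_grid_log_lik:
  assumes z: "\<And>k. k \<le> n + N \<Longrightarrow> (\<lambda>x. z x k) \<in> borel_measurable M"
  shows "(\<lambda>x. grid_log_lik a n N (z x)) \<in> borel_measurable M"
  unfolding grid_log_lik_def grid_score_def grid_information_def
  by (intro borel_measurable_diff borel_measurable_times borel_measurable_sum borel_measurable_divide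
      borel_measurable_power measurable_grid_mean z borel_measurable_const) auto

lemma predictable_drift: "predictable (drift a n v)"
  unfolding predictable_def
proof (intro conjI allI impI)
  fix k and \<xi> \<xi>' :: "nat \<Rightarrow> real" assume eq: "\<forall>i<k. \<xi> i = \<xi>' i"
  have "grid_path n v \<xi> (k + l) = grid_path n v \<xi>' (k + l)" if "l < n" for l
    using that eq by (intro grid_path_cong) auto
  then show "drift a n v k \<xi> = drift a n v k \<xi>'" by (simp add: drift_def grid_mean_def)
next
  fix k
  show "drift a n v k \<in> borel_measurable (PiM {..<k} (\<lambda>_. borel))"
    unfolding drift_def
    by (intro borel_measurable_times borel_measurable_const measurable_grid_mean measurable_grid_path
        measurable_component_singleton) auto
qed

lemma log_density_drift:
  "log_density (1 / real n) (drift a n v) N \<xi> = grid_log_lik a n N (grid_path n v \<xi>)"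
proof -
  have "log_density (1 / real n) (drift a n v) N \<xi>
      = (\<Sum>i<N. a * (grid_mean n (grid_path n v \<xi>) i * \<xi> i) - a\<^sup>2 / 2 * ((grid_mean n (grid_path n v \<xi>) i)\<^sup>2 / real n))"
    unfolding log_density_def drift_def by (intro sum.cong) (auto simp: power_mult_distrib)
  also have "\<dots> = grid_log_lik a n N (grid_path n v \<xi>)"
    unfolding grid_log_lik_def grid_score_def grid_information_def grid_path_Suc sum_subtractf
      sum_distrib_left sum_divide_distrib by simp
  finally show ?thesis .
qed

lemma grid_log_lik_cong:
  assumes "\<And>k. k \<le> n + N \<Longrightarrow> z k = z' k"
  shows "grid_log_lik a n N z = grid_log_lik a n N z'"
proof -
  have "grid_mean n z i = grid_mean n z' i" if "i < N" for i
    unfolding grid_mean_def using that assms by auto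
  then show ?thesis
    unfolding grid_log_lik_def grid_score_def grid_information_def using assms by simp
qed

lemma measurable_drifted_drift:
  assumes v: "\<And>k. k \<le> n \<Longrightarrow> (\<lambda>x. v x k) \<in> borel_measurable N"
  shows "(\<And>i. i \<le> k \<Longrightarrow> (\<lambda>x. \<xi> x i) \<in> borel_measurable N) \<Longrightarrow>
    (\<lambda>x. drifted s (drift a n (v x)) (\<xi> x) k) \<in> borel_measurable N"
proof (induction k rule: less_induct)
  case (less k)
  have "(\<lambda>x. drift a n (v x) k (drifted s (drift a n (v x)) (\<xi> x))) \<in> borel_measurable N"
    unfolding drift_def[of a n _ k]
    using less by (intro borel_measurable_times borel_measurable_const measurable_grid_mean measurable_grid_path v) auto
  then show ?case using less.prems by (subst drifted_eq[OF predictable_drift]) auto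
qed

text \<open>A continuous substitute for the indicator of the negative half line. With large slope it tests \<open>x \<le> 0\<close>; with
  slope \<open>1\<close> it is the cutoff \<open>ramp 1 (l - K)\<close> of a log density \<open>l\<close> at the level \<open>K\<close>.\<close>

definition ramp :: "real \<Rightarrow> real \<Rightarrow> real" where
  "ramp s x = max 0 (min 1 (1 - s * x))"

lemma ramp_bounds: "0 \<le> ramp s x" "ramp s x \<le> 1"
  by (auto simp: ramp_def)

lemma borel_measurable_ramp [measurable]: "ramp s \<in> borel_measurable borel"
  unfolding ramp_def by measurable

lemma tendsto_ramp: "(f \<longlongrightarrow> x) F \<Longrightarrow> ((\<lambda>n. ramp s (f n)) \<longlongrightarrow> ramp s x) F"
  unfolding ramp_def by (intro tendsto_intros)

text \<open>The cutoff bounds the Girsanov weight, which makes dominated convergence applicable although the weights need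
  not have moments of any order above the first.\<close>

lemma ramp_cutoff_exp: "ramp 1 (x - K) * exp x \<le> exp (K + 1)"
proof (cases "x \<le> K + 1")
  case True
  then have "ramp 1 (x - K) * exp x \<le> 1 * exp (K + 1)" by (intro mult_mono) (auto simp: ramp_bounds)
  then show ?thesis by simp
qed (simp add: ramp_def)

lemma ramp_tendsto_indicator: "(\<lambda>m. ramp (real m) x) \<longlonglongrightarrow> (if x \<le> 0 then 1 else 0)"
proof (cases "x \<le> 0")
  case True
  then have "ramp (real m) x = 1" for m by (simp add: ramp_def mult_nonneg_nonpos)
  then show ?thesis using True by simp
next
  case False
  obtain m0 :: nat where m0: "real m0 > 1 / x" using reals_Archimedean2 by blast
  have "ramp (real m) x = 0" if "m \<ge> m0" for m
  proof -
    have "real m > 1 / x" using m0 that by linarith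
    then have "real m * x > 1" using False by (simp add: field_simps)
    then show ?thesis by (simp add: ramp_def)
  qed
  then have "\<forall>\<^sub>F m in sequentially. ramp (real m) x = 0" by (auto simp: eventually_sequentially)
  then show ?thesis using False by (simp add: tendsto_eventually)
qed

lemma ramp_cutoff_tendsto: "(\<lambda>K. ramp 1 (x - real K)) \<longlonglongrightarrow> 1"
proof -
  obtain K0 :: nat where "real K0 > x" using reals_Archimedean2 by blast
  then have "ramp 1 (x - real K) = 1" if "K \<ge> K0" for K using that by (simp add: ramp_def)
  then show ?thesis by (intro tendsto_eventually) (auto simp: eventually_sequentially)
qed

lemma ramp_cutoff_mono: "K \<le> K' \<Longrightarrow> ramp 1 (x - K) \<le> ramp 1 (x - K')"
  by (auto simp: ramp_def)

lemma LIMSEQ_unique_eventually: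
  fixes a b :: "'a::t2_space"
  assumes "f \<longlonglongrightarrow> a" "g \<longlonglongrightarrow> b" "\<forall>\<^sub>F n in sequentially. f n = g n"
  shows "a = b"
  using LIMSEQ_unique[OF assms(1)] tendsto_cong[OF assms(3), of a] assms LIMSEQ_unique[of g] by blast

lemma grid_log_lik_tendsto:
  assumes "continuous_on {-1..T} f" "T \<ge> 0" "approximates T z f"
  shows "(\<lambda>n. grid_log_lik a n (nat \<lfloor>real n * T\<rfloor>) (z n)) \<longlonglongrightarrow> log_lik a f T"
  unfolding grid_log_lik_def log_lik_def
  by (intro tendsto_intros grid_score_tendsto grid_information_tendsto assms)

lemma grid_index:
  assumes T: "T \<ge> 0" and t: "t \<in> {-1..T}"
  shows "nat \<lfloor>real n * (t + 1)\<rfloor> \<le> n + nat \<lfloor>real n * T\<rfloor>"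
    and "n > 0 \<Longrightarrow> \<bar>real (nat \<lfloor>real n * (t + 1)\<rfloor>) / real n - 1 - t\<bar> \<le> 1 / real n"
proof -
  have "real n * t \<le> real n * T" using t by (intro mult_left_mono) auto
  then have "\<lfloor>real n * t\<rfloor> \<le> \<lfloor>real n * T\<rfloor>" by (rule floor_mono)
  moreover have "real n * (t + 1) = real n * t + real_of_int (int n)" by (simp add: algebra_simps)
  then have "\<lfloor>real n * (t + 1)\<rfloor> = \<lfloor>real n * t\<rfloor> + int n" by (simp only: floor_add_int)
  ultimately show "nat \<lfloor>real n * (t + 1)\<rfloor> \<le> n + nat \<lfloor>real n * T\<rfloor>" by linarith
  assume n: "n > 0"
  have "0 \<le> real n * (t + 1)" using t by simp
  then have "real (nat \<lfloor>real n * (t + 1)\<rfloor>) \<le> real n * (t + 1)" "real n * (t + 1) \<le> real (nat \<lfloor>real n * (t + 1)\<rfloor>) + 1"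
    by linarith+
  then have "\<bar>real (nat \<lfloor>real n * (t + 1)\<rfloor>) - real n * (t + 1)\<bar> \<le> 1" by linarith
  then have "\<bar>real (nat \<lfloor>real n * (t + 1)\<rfloor>) - real n * (t + 1)\<bar> / real n \<le> 1 / real n"
    by (rule divide_right_mono) simp
  moreover have "real (nat \<lfloor>real n * (t + 1)\<rfloor>) / real n - 1 - t = (real (nat \<lfloor>real n * (t + 1)\<rfloor>) - real n * (t + 1)) / real n"
    using n by (simp add: field_simps)
  ultimately show "\<bar>real (nat \<lfloor>real n * (t + 1)\<rfloor>) / real n - 1 - t\<bar> \<le> 1 / real n" by (simp add: abs_divide)
qed

locale delay_model = prob_space M for M :: "'o measure" +
  fixes W X0 :: "real \<Rightarrow> 'o \<Rightarrow> real" and X :: "real \<Rightarrow> real \<Rightarrow> 'o \<Rightarrow> real"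
  assumes W: "wiener_process M {0..} W"
    and X0: "continuous_process M {-1..0} X0"
    and indep: "indep_var
           (PiM {-1..0} (\<lambda>_. borel)) (\<lambda>\<omega>. \<lambda>t\<in>{-1..0}. X0 t \<omega>)
           (PiM {0..} (\<lambda>_. borel)) (\<lambda>\<omega>. \<lambda>t\<in>{0..}. W t \<omega>)"
    and sol: "\<And>a. delay_solution M W X0 a (X a)"
begin

lemma W_measurable: "t \<ge> 0 \<Longrightarrow> W t \<in> borel_measurable M"
  using W by (auto simp: wiener_process_def continuous_process_def)

lemma X0_measurable: "t \<in> {-1..0} \<Longrightarrow> X0 t \<in> borel_measurable M"
  using X0 by (auto simp: continuous_process_def)

lemma X_process: "continuous_process M {-1..} (X a)"
  using sol[of a] by (simp add: delay_solution_def)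

lemma X_measurable: "t \<ge> -1 \<Longrightarrow> X a t \<in> borel_measurable M"
  using X_process by (auto simp: continuous_process_def)

lemma X_continuous: "\<omega> \<in> space M \<Longrightarrow> continuous_on {-1..T} (\<lambda>t. X a t \<omega>)"
  using X_process[of a] by (auto simp: continuous_process_def intro: continuous_on_subset)

definition init_grid :: "nat \<Rightarrow> 'o \<Rightarrow> nat \<Rightarrow> real" where
  "init_grid n \<omega> = (\<lambda>k\<in>{..n}. X0 (real k / real n - 1) \<omega>)"

definition increments :: "nat \<Rightarrow> nat \<Rightarrow> 'o \<Rightarrow> nat \<Rightarrow> real" where
  "increments n N \<omega> = (\<lambda>i\<in>{..<N}. W (real (Suc i) / real n) \<omega> - W (real i / real n) \<omega>)"

lemma init_grid_node: "k \<le> n \<Longrightarrow> real k / real n - 1 \<in> {-1..0}"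
  by (cases "n = 0") auto

lemma measurable_init_grid: "init_grid n \<in> measurable M (PiM {..n} (\<lambda>_. borel))"
  unfolding init_grid_def by (intro measurable_restrict X0_measurable init_grid_node) auto

lemma measurable_increments: "increments n N \<in> measurable M (PiM {..<N} (\<lambda>_. borel))"
  unfolding increments_def by (intro measurable_restrict borel_measurable_diff W_measurable) auto

text \<open>Independence of the initial segment and the Wiener process enters only here.\<close>

lemma init_grid_increments_law:
  assumes n: "n > 0" and N: "N > 0"
  shows "distr M (PiM {..n} (\<lambda>_. borel) \<Otimes>\<^sub>M PiM {..<N} (\<lambda>_. borel)) (\<lambda>\<omega>. (init_grid n \<omega>, increments n N \<omega>))
    = distr M (PiM {..n} (\<lambda>_. borel)) (init_grid n) \<Otimes>\<^sub>M noise (1 / real n) N"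
proof -
  have "indep_var (PiM {..n} (\<lambda>_. borel)) ((\<lambda>x. \<lambda>k\<in>{..n}. x (real k / real n - 1)) \<circ> (\<lambda>\<omega>. \<lambda>t\<in>{-1..0}. X0 t \<omega>))
     (PiM {..<N} (\<lambda>_. borel)) ((\<lambda>x. \<lambda>i\<in>{..<N}. x (real (Suc i) / real n) - x (real i / real n)) \<circ> (\<lambda>\<omega>. \<lambda>t\<in>{0..}. W t \<omega>))"
    using init_grid_node by (intro indep_var_compose[OF indep] measurable_restrict borel_measurable_diff measurable_component_singleton) auto
  moreover have "(\<lambda>x. \<lambda>k\<in>{..n}. x (real k / real n - 1)) \<circ> (\<lambda>\<omega>. \<lambda>t\<in>{-1..0}. X0 t \<omega>) = init_grid n"
    using init_grid_node[of _ n] by (auto simp: fun_eq_iff init_grid_def restrict_def)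
  moreover have "(\<lambda>x. \<lambda>i\<in>{..<N}. x (real (Suc i) / real n) - x (real i / real n)) \<circ> (\<lambda>\<omega>. \<lambda>t\<in>{0..}. W t \<omega>) = increments n N"
    by (auto simp: fun_eq_iff increments_def restrict_def)
  ultimately have "indep_var (PiM {..n} (\<lambda>_. borel)) (init_grid n) (PiM {..<N} (\<lambda>_. borel)) (increments n N)" by simp
  moreover have "distr M (PiM {..<N} (\<lambda>_. borel)) (increments n N) = noise (1 / real n) N"
    using increments_law[OF W N zero_less_one, of "1 / real n" "\<lambda>i. real i / real n"] n
    by (simp add: increments_def[abs_def] add_divide_distrib)
  ultimately show ?thesis unfolding indep_var_distribution_eq by simp
qed

lemma nn_integral_grid:
  fixes F :: "(nat \<Rightarrow> real) \<times> (nat \<Rightarrow> real) \<Rightarrow> ennreal"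
  assumes n: "n > 0" and N: "N > 0" and F: "F \<in> borel_measurable (PiM {..n} (\<lambda>_. borel) \<Otimes>\<^sub>M PiM {..<N} (\<lambda>_. borel))"
  shows "(\<integral>\<^sup>+\<omega>. F (init_grid n \<omega>, increments n N \<omega>) \<partial>M)
    = (\<integral>\<^sup>+v. (\<integral>\<^sup>+\<xi>. F (v, \<xi>) \<partial>noise (1 / real n) N) \<partial>distr M (PiM {..n} (\<lambda>_. borel)) (init_grid n))"
proof -
  interpret noise: prob_space "noise (1 / real n) N" using n by (intro prob_space_noise) simp
  note [measurable] = measurable_init_grid measurable_increments
  have F': "F \<in> borel_measurable (distr M (PiM {..n} (\<lambda>_. borel)) (init_grid n) \<Otimes>\<^sub>M noise (1 / real n) N)"
    using F by (rule measurable_cong_sets[THEN equalityD2, THEN subsetD, rotated 2])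
      (auto intro!: sets_pair_measure_cong simp: sets_noise)
  have "(\<integral>\<^sup>+\<omega>. F (init_grid n \<omega>, increments n N \<omega>) \<partial>M)
      = (\<integral>\<^sup>+p. F p \<partial>distr M (PiM {..n} (\<lambda>_. borel) \<Otimes>\<^sub>M PiM {..<N} (\<lambda>_. borel)) (\<lambda>\<omega>. (init_grid n \<omega>, increments n N \<omega>)))"
    using F by (subst nn_integral_distr) auto
  also have "\<dots> = (\<integral>\<^sup>+v. (\<integral>\<^sup>+\<xi>. F (v, \<xi>) \<partial>noise (1 / real n) N) \<partial>distr M (PiM {..n} (\<lambda>_. borel)) (init_grid n))"
    unfolding init_grid_increments_law[OF n N] by (rule noise.nn_integral_fst[OF F', symmetric])
  finally show ?thesis .
qed

definition wiener_grid :: "nat \<Rightarrow> nat \<Rightarrow> 'o \<Rightarrow> nat \<Rightarrow> real" where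
  "wiener_grid n N \<omega> = grid_path n (init_grid n \<omega>) (increments n N \<omega>)"

definition euler_grid :: "real \<Rightarrow> nat \<Rightarrow> nat \<Rightarrow> 'o \<Rightarrow> nat \<Rightarrow> real" where
  "euler_grid a n N \<omega> = grid_path n (init_grid n \<omega>) (drifted (1 / real n) (drift a n (init_grid n \<omega>)) (increments n N \<omega>))"

lemma measurable_wiener_grid: "k \<le> n + N \<Longrightarrow> (\<lambda>\<omega>. wiener_grid n N \<omega> k) \<in> borel_measurable M"
  unfolding wiener_grid_def
  by (intro measurable_grid_path measurable_compose[OF measurable_init_grid] measurable_compose[OF measurable_increments]
      measurable_component_singleton) auto

lemma measurable_euler_grid: "k \<le> n + N \<Longrightarrow> (\<lambda>\<omega>. euler_grid a n N \<omega> k) \<in> borel_measurable M"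
  unfolding euler_grid_def
  by (intro measurable_grid_path measurable_drifted_drift measurable_compose[OF measurable_init_grid] measurable_compose[OF measurable_increments]
      measurable_component_singleton) auto

text \<open>The Euler scheme and the grid values of the driftless process are images of the same noise, given the initial
  segment. Conditioning on that segment is Fubini's theorem for the product law.\<close>

lemma grid_girsanov:
  fixes \<Phi> :: "(nat \<Rightarrow> real) \<Rightarrow> ennreal"
  assumes n: "n > 0" and N: "N > 0" and \<Phi>: "\<Phi> \<in> borel_measurable (PiM {..n + N} (\<lambda>_. borel))"
  shows "(\<integral>\<^sup>+\<omega>. \<Phi> (\<lambda>k\<in>{..n + N}. euler_grid a n N \<omega> k) \<partial>M)
    = (\<integral>\<^sup>+\<omega>. \<Phi> (\<lambda>k\<in>{..n + N}. wiener_grid n N \<omega> k) * ennreal (exp (grid_log_lik a n N (wiener_grid n N \<omega>))) \<partial>M)"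
proof -
  define F1 where "F1 p = \<Phi> (\<lambda>k\<in>{..n + N}. grid_path n (fst p) (drifted (1 / real n) (drift a n (fst p)) (snd p)) k)" for p
  define F2 where "F2 p = \<Phi> (\<lambda>k\<in>{..n + N}. grid_path n (fst p) (snd p) k)
      * ennreal (exp (grid_log_lik a n N (grid_path n (fst p) (snd p))))" for p
  let ?P = "PiM {..n} (\<lambda>_. borel) \<Otimes>\<^sub>M PiM {..<N} (\<lambda>_. borel) :: ((nat \<Rightarrow> real) \<times> (nat \<Rightarrow> real)) measure"
  have v: "(\<lambda>p. fst p k) \<in> borel_measurable ?P" if "k \<le> n" for k
    using that by (intro measurable_compose[OF measurable_fst measurable_component_singleton]) auto
  have x: "(\<lambda>p. snd p k) \<in> borel_measurable ?P" if "k < N" for k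
    using that by (intro measurable_compose[OF measurable_snd measurable_component_singleton]) auto
  have F1: "F1 \<in> borel_measurable ?P"
    unfolding F1_def by (intro measurable_compose[OF _ \<Phi>] measurable_restrict measurable_grid_path measurable_drifted_drift v x) auto
  have gp: "(\<lambda>p. grid_path n (fst p) (snd p) k) \<in> borel_measurable ?P" if "k \<le> n + N" for k
    using that by (intro measurable_grid_path v x) auto
  have F2: "F2 \<in> borel_measurable ?P"
    unfolding F2_def
    by (intro borel_measurable_times_ennreal measurable_compose[OF _ \<Phi>] measurable_restrict gp
        measurable_compose[OF _ measurable_ennreal] measurable_compose[OF _ borel_measurable_exp]
        measurable_grid_log_lik) auto
  have "(\<integral>\<^sup>+\<omega>. \<Phi> (\<lambda>k\<in>{..n + N}. euler_grid a n N \<omega> k) \<partial>M) = (\<integral>\<^sup>+\<omega>. F1 (init_grid n \<omega>, increments n N \<omega>) \<partial>M)"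
    by (simp add: F1_def euler_grid_def)
  also have "\<dots> = (\<integral>\<^sup>+v. (\<integral>\<^sup>+\<xi>. F1 (v, \<xi>) \<partial>noise (1 / real n) N) \<partial>distr M (PiM {..n} (\<lambda>_. borel)) (init_grid n))"
    by (rule nn_integral_grid[OF n N F1])
  also have "\<dots> = (\<integral>\<^sup>+v. (\<integral>\<^sup>+\<xi>. F2 (v, \<xi>) \<partial>noise (1 / real n) N) \<partial>distr M (PiM {..n} (\<lambda>_. borel)) (init_grid n))"
  proof (rule nn_integral_cong)
    fix v assume "v \<in> space (distr M (PiM {..n} (\<lambda>_. borel)) (init_grid n))"
    define G where "G \<xi> = \<Phi> (\<lambda>k\<in>{..n + N}. grid_path n v \<xi> k)" for \<xi>
    have G: "G \<in> borel_measurable (PiM {..<N} (\<lambda>_. borel))"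
      unfolding G_def
      by (intro measurable_compose[OF _ \<Phi>] measurable_restrict measurable_grid_path measurable_component_singleton) auto
    have "F1 (v, \<xi>) = G (\<lambda>i\<in>{..<N}. drifted (1 / real n) (drift a n v) \<xi> i)" for \<xi>
      unfolding F1_def G_def fst_conv snd_conv
      by (intro arg_cong[of _ _ \<Phi>] restrict_ext grid_path_cong) auto
    then show "(\<integral>\<^sup>+\<xi>. F1 (v, \<xi>) \<partial>noise (1 / real n) N) = (\<integral>\<^sup>+\<xi>. F2 (v, \<xi>) \<partial>noise (1 / real n) N)"
      using discrete_girsanov[OF _ predictable_drift G, of "1 / real n" a n v] n
      by (simp add: F2_def G_def log_density_drift)
  qed
  also have "\<dots> = (\<integral>\<^sup>+\<omega>. F2 (init_grid n \<omega>, increments n N \<omega>) \<partial>M)"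
    by (rule nn_integral_grid[OF n N F2, symmetric])
  finally show ?thesis by (simp add: F2_def wiener_grid_def)
qed

lemma X_AE_equation:
  "AE \<omega> in M. (\<forall>t\<in>{-1..0}. X a t \<omega> = X0 t \<omega>) \<and>
     (\<forall>t\<ge>0. X a t \<omega> = X0 0 \<omega> + a * integral {0..t} (past_mean (\<lambda>t. X a t \<omega>)) + W t \<omega>)"
  using sol[of a] unfolding delay_solution_def integral_past_window[of "\<lambda>t. X a t _"] by (simp add: eta_contract_eq)

lemma wiener_grid_approximates:
  assumes T: "T > 0"
  shows "AE \<omega> in M. approximates T (\<lambda>n. wiener_grid n (nat \<lfloor>real n * T\<rfloor>) \<omega>) (\<lambda>t. X 0 t \<omega>)"
  using X_AE_equation[of 0]
proof eventually_elim
  case (elim \<omega>)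
  then have e0: "X 0 t \<omega> = X0 t \<omega>" if "t \<in> {-1..0}" for t using that by blast
  have e1: "X 0 t \<omega> = X0 0 \<omega> + W t \<omega>" if "t \<ge> 0" for t using elim that by simp
  have W0: "W 0 \<omega> = 0" using e0[of 0] e1[of 0] by simp
  have "wiener_grid n (nat \<lfloor>real n * T\<rfloor>) \<omega> k = X 0 (real k / real n - 1) \<omega>"
    if k: "k \<le> n + nat \<lfloor>real n * T\<rfloor>" and n: "n > 0" for n k
  proof (cases "k \<le> n")
    case True
    then show ?thesis using e0 init_grid_node[OF True] by (simp add: wiener_grid_def grid_path_def init_grid_def)
  next
    case False
    define j where "j = k - n"
    have j: "k = n + j" "j \<le> nat \<lfloor>real n * T\<rfloor>" using False k by (auto simp: j_def)
    have "(\<Sum>i<j. increments n (nat \<lfloor>real n * T\<rfloor>) \<omega> i) = (\<Sum>i<j. W (real (Suc i) / real n) \<omega> - W (real i / real n) \<omega>)"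
      using j by (intro sum.cong) (auto simp: increments_def)
    also have "\<dots> = W (real j / real n) \<omega>"
      using W0 by (subst sum_lessThan_telescope[of "\<lambda>i. W (real i / real n) \<omega>"]) simp
    finally show ?thesis using False e1[of "real j / real n"] n
      by (simp add: wiener_grid_def grid_path_def init_grid_def j add_divide_distrib)
  qed
  note eq = this
  show ?case
    unfolding approximates_def
  proof (intro allI impI)
    fix \<epsilon> :: real assume "\<epsilon> > 0"
    show "\<forall>\<^sub>F n in sequentially. \<forall>k\<le>n + nat \<lfloor>real n * T\<rfloor>.
        \<bar>wiener_grid n (nat \<lfloor>real n * T\<rfloor>) \<omega> k - X 0 (real k / real n - 1) \<omega>\<bar> \<le> \<epsilon>"
      using eventually_gt_at_top[of 0] by eventually_elim (simp add: eq \<open>\<epsilon> > 0\<close> less_imp_le)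
  qed
qed

lemma euler_grid_approximates:
  assumes T: "T > 0"
  shows "AE \<omega> in M. approximates T (\<lambda>n. euler_grid a n (nat \<lfloor>real n * T\<rfloor>) \<omega>) (\<lambda>t. X a t \<omega>)"
  using X_AE_equation[of a] AE_space
proof eventually_elim
  case (elim \<omega>)
  then have e0: "X a t \<omega> = X0 t \<omega>" if "t \<in> {-1..0}" for t using that by blast
  have e1: "X a t \<omega> = X0 0 \<omega> + a * integral {0..t} (past_mean (\<lambda>t. X a t \<omega>)) + W t \<omega>" if "t \<ge> 0" for t
    using elim that by blast
  show ?case
  proof (rule euler_approximates)
    show "continuous_on {-1..T} (\<lambda>t. X a t \<omega>)" using elim by (intro X_continuous) simp
    show "X a t \<omega> = X a 0 \<omega> + a * integral {0..t} (past_mean (\<lambda>t. X a t \<omega>)) + (W t \<omega> - W 0 \<omega>)" if "t \<in> {0..T}" for t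
      using e1[of t] e1[of 0] that by simp
    show "euler_grid a n (nat \<lfloor>real n * T\<rfloor>) \<omega> k = X a (real k / real n - 1) \<omega>" if "k \<le> n" for n k
      using that e0 init_grid_node[OF that] by (simp add: euler_grid_def grid_path_def init_grid_def)
    show "euler_grid a n (nat \<lfloor>real n * T\<rfloor>) \<omega> (n + Suc i) = euler_grid a n (nat \<lfloor>real n * T\<rfloor>) \<omega> (n + i)
        + (W (real (Suc i) / real n) \<omega> - W (real i / real n) \<omega>) + a * grid_mean n (euler_grid a n (nat \<lfloor>real n * T\<rfloor>) \<omega>) i / real n"
      if "i < nat \<lfloor>real n * T\<rfloor>" for n i
      unfolding euler_grid_def grid_path_Suc
      using that by (subst drifted_eq[OF predictable_drift]) (simp add: drift_def increments_def)
  qed (use T in auto)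
qed

end

section \<open>The likelihood ratio of the delay equation\<close>

context delay_model
begin

lemma X_integrals_measurable:
  assumes "T > 0"
  shows "(\<lambda>\<omega>. log_lik a (\<lambda>t. X b t \<omega>) T) \<in> borel_measurable M"
    and "(\<lambda>\<omega>. score (\<lambda>t. X b t \<omega>) T) \<in> borel_measurable M"
    and "(\<lambda>\<omega>. information (\<lambda>t. X b t \<omega>) T) \<in> borel_measurable M"
  using assms X_measurable X_continuous
  by (auto intro!: borel_measurable_log_lik borel_measurable_score borel_measurable_information)

text \<open>Passage to the limit in \<open>grid_girsanov\<close>. The test function contains a cutoff of the log density itself,
  so that both integrands are bounded uniformly in the mesh and pathwise convergence is enough.\<close>

lemma truncated_girsanov:
  assumes T: "T > 0" and J: "finite J" "J \<subseteq> {-1..T}"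
  shows "(\<integral>\<^sup>+\<omega>. ennreal ((\<Prod>t\<in>J. ramp s (X a t \<omega> - c t)) * ramp 1 (log_lik a (\<lambda>t. X a t \<omega>) T - K)) \<partial>M)
    = (\<integral>\<^sup>+\<omega>. ennreal ((\<Prod>t\<in>J. ramp s (X 0 t \<omega> - c t)) * ramp 1 (log_lik a (\<lambda>t. X 0 t \<omega>) T - K)
        * exp (log_lik a (\<lambda>t. X 0 t \<omega>) T)) \<partial>M)"
proof -
  define N where "N n = nat \<lfloor>real n * T\<rfloor>" for n
  define idx where "idx n t = nat \<lfloor>real n * (t + 1)\<rfloor>" for n :: nat and t :: real
  define \<phi> where "\<phi> n z = (\<Prod>t\<in>J. ramp s (z (idx n t) - c t)) * ramp 1 (grid_log_lik a n (N n) z - K)" for n z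
  have T0: "T \<ge> 0" using T by simp
  have idx: "idx n t \<le> n + N n" if "t \<in> J" for n t
    using grid_index(1)[OF T0] that J by (auto simp: idx_def N_def)
  have \<phi>_meas: "(\<lambda>x. \<phi> n (z x)) \<in> borel_measurable L"
    if "\<And>k. k \<le> n + N n \<Longrightarrow> (\<lambda>x. z x k) \<in> borel_measurable L" for n and z :: "'x \<Rightarrow> nat \<Rightarrow> real" and L :: "'x measure"
    unfolding \<phi>_def using idx that
    by (intro borel_measurable_times borel_measurable_prod measurable_compose[OF _ borel_measurable_ramp]
        borel_measurable_diff measurable_grid_log_lik) auto
  have prod_bounds: "0 \<le> (\<Prod>t\<in>J. ramp s (f t))" "(\<Prod>t\<in>J. ramp s (f t)) \<le> 1" for f
    using ramp_bounds by (auto intro: prod_nonneg prod_le_1)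
  have \<phi>_bounds: "0 \<le> \<phi> n z" "\<phi> n z \<le> 1" for n z
    unfolding \<phi>_def using prod_bounds ramp_bounds by (auto intro!: mult_nonneg_nonneg mult_le_one)
  have \<phi>_exp: "\<phi> n z * exp (grid_log_lik a n (N n) z) \<le> exp (K + 1)" for n z
  proof -
    have "\<phi> n z * exp (grid_log_lik a n (N n) z)
        = (\<Prod>t\<in>J. ramp s (z (idx n t) - c t)) * (ramp 1 (grid_log_lik a n (N n) z - K) * exp (grid_log_lik a n (N n) z))"
      by (simp add: \<phi>_def)
    also have "\<dots> \<le> 1 * exp (K + 1)"
      using prod_bounds ramp_bounds ramp_cutoff_exp by (intro mult_mono) auto
    finally show ?thesis by simp
  qed
  have lim: "(\<lambda>n. \<phi> n (z n)) \<longlonglongrightarrow> (\<Prod>t\<in>J. ramp s (f t - c t)) * ramp 1 (log_lik a f T - K)"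
    "(\<lambda>n. grid_log_lik a n (N n) (z n)) \<longlonglongrightarrow> log_lik a f T"
    if f: "continuous_on {-1..T} f" and z: "approximates T z f" for f z
  proof -
    show L: "(\<lambda>n. grid_log_lik a n (N n) (z n)) \<longlonglongrightarrow> log_lik a f T"
      unfolding N_def by (rule grid_log_lik_tendsto[OF f T0 z])
    have "(\<lambda>n. z n (idx n t)) \<longlonglongrightarrow> f t" if t: "t \<in> J" for t
      using grid_index[OF T0, of t] J t
      by (intro approximates_point[OF f T0 z]) (auto simp: idx_def)
    then show "(\<lambda>n. \<phi> n (z n)) \<longlonglongrightarrow> (\<Prod>t\<in>J. ramp s (f t - c t)) * ramp 1 (log_lik a f T - K)"
      unfolding \<phi>_def by (intro tendsto_mult tendsto_prod tendsto_ramp tendsto_diff tendsto_const L)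
  qed
  have Xm: "X b t \<in> borel_measurable M" if "t \<in> J" for b t using J that by (intro X_measurable) auto
  have target_meas: "(\<lambda>\<omega>. (\<Prod>t\<in>J. ramp s (X b t \<omega> - c t)) * ramp 1 (log_lik a (\<lambda>t. X b t \<omega>) T - K)) \<in> borel_measurable M" for b
    by (intro borel_measurable_times borel_measurable_prod measurable_compose[OF _ borel_measurable_ramp]
        borel_measurable_diff X_integrals_measurable[OF T] Xm borel_measurable_const)
  let ?E = "\<lambda>n \<omega>. euler_grid a n (N n) \<omega>" and ?W = "\<lambda>n \<omega>. wiener_grid n (N n) \<omega>"
  have "(\<lambda>n. \<integral>\<^sup>+\<omega>. ennreal (\<phi> n (?E n \<omega>)) \<partial>M)
      \<longlonglongrightarrow> (\<integral>\<^sup>+\<omega>. ennreal ((\<Prod>t\<in>J. ramp s (X a t \<omega> - c t)) * ramp 1 (log_lik a (\<lambda>t. X a t \<omega>) T - K)) \<partial>M)"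
  proof (rule nn_integral_dominated_convergence[where w = "\<lambda>_. 1"])
    show "(\<lambda>\<omega>. ennreal (\<phi> n (?E n \<omega>))) \<in> borel_measurable M" for n
      by (intro measurable_compose[OF _ measurable_ennreal] \<phi>_meas measurable_euler_grid)
    show "AE \<omega> in M. (\<lambda>n. ennreal (\<phi> n (?E n \<omega>))) \<longlonglongrightarrow>
        ennreal ((\<Prod>t\<in>J. ramp s (X a t \<omega> - c t)) * ramp 1 (log_lik a (\<lambda>t. X a t \<omega>) T - K))"
      using euler_grid_approximates[OF T] AE_space
      by eventually_elim (auto intro!: tendsto_ennrealI lim X_continuous simp: N_def)
  qed (use \<phi>_bounds emeasure_space_1 target_meas in \<open>auto simp: ennreal_le_1\<close>)
  moreover have "(\<lambda>n. \<integral>\<^sup>+\<omega>. ennreal (\<phi> n (?W n \<omega>) * exp (grid_log_lik a n (N n) (?W n \<omega>))) \<partial>M)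
      \<longlonglongrightarrow> (\<integral>\<^sup>+\<omega>. ennreal ((\<Prod>t\<in>J. ramp s (X 0 t \<omega> - c t)) * ramp 1 (log_lik a (\<lambda>t. X 0 t \<omega>) T - K)
        * exp (log_lik a (\<lambda>t. X 0 t \<omega>) T)) \<partial>M)"
  proof (rule nn_integral_dominated_convergence[where w = "\<lambda>_. ennreal (exp (K + 1))"])
    show "(\<lambda>\<omega>. ennreal (\<phi> n (?W n \<omega>) * exp (grid_log_lik a n (N n) (?W n \<omega>)))) \<in> borel_measurable M" for n
      by (intro measurable_compose[OF _ measurable_ennreal] borel_measurable_times measurable_compose[OF _ borel_measurable_exp]
          \<phi>_meas measurable_wiener_grid measurable_grid_log_lik)
    show "(\<lambda>\<omega>. ennreal ((\<Prod>t\<in>J. ramp s (X 0 t \<omega> - c t)) * ramp 1 (log_lik a (\<lambda>t. X 0 t \<omega>) T - K)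
        * exp (log_lik a (\<lambda>t. X 0 t \<omega>) T))) \<in> borel_measurable M"
      by (intro measurable_compose[OF _ measurable_ennreal] borel_measurable_times[OF target_meas]
          measurable_compose[OF _ borel_measurable_exp] X_integrals_measurable T)
    show "AE \<omega> in M. (\<lambda>n. ennreal (\<phi> n (?W n \<omega>) * exp (grid_log_lik a n (N n) (?W n \<omega>)))) \<longlonglongrightarrow>
        ennreal ((\<Prod>t\<in>J. ramp s (X 0 t \<omega> - c t)) * ramp 1 (log_lik a (\<lambda>t. X 0 t \<omega>) T - K) * exp (log_lik a (\<lambda>t. X 0 t \<omega>) T))"
      using wiener_grid_approximates[OF T] AE_space
    proof eventually_elim
      case (elim \<omega>)
      from lim[OF X_continuous[OF elim(2)] elim(1)] show ?case
        unfolding N_def by (intro tendsto_ennrealI tendsto_mult tendsto_exp)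
    qed
  qed (use \<phi>_exp emeasure_space_1 in \<open>auto intro!: ennreal_leI\<close>)
  moreover have "\<forall>\<^sub>F n in sequentially. (\<integral>\<^sup>+\<omega>. ennreal (\<phi> n (?E n \<omega>)) \<partial>M)
      = (\<integral>\<^sup>+\<omega>. ennreal (\<phi> n (?W n \<omega>) * exp (grid_log_lik a n (N n) (?W n \<omega>))) \<partial>M)"
    using eventually_inverse_less[OF T]
  proof eventually_elim
    case (elim n)
    have n: "n > 0" using elim by simp
    have "1 / real n < T" using elim by simp
    then have "real n * T \<ge> 1" using n by (simp add: pos_divide_less_eq mult.commute)
    then have N: "N n > 0" unfolding N_def by linarith
    have "(\<lambda>z. ennreal (\<phi> n z)) \<in> borel_measurable (PiM {..n + N n} (\<lambda>_. borel))"
      by (intro measurable_compose[OF _ measurable_ennreal] \<phi>_meas measurable_component_singleton) auto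
    from grid_girsanov[OF n N this, of a]
    have "(\<integral>\<^sup>+\<omega>. ennreal (\<phi> n (\<lambda>k\<in>{..n + N n}. ?E n \<omega> k)) \<partial>M)
        = (\<integral>\<^sup>+\<omega>. ennreal (\<phi> n (\<lambda>k\<in>{..n + N n}. ?W n \<omega> k)) * ennreal (exp (grid_log_lik a n (N n) (?W n \<omega>))) \<partial>M)" .
    moreover have "\<phi> n (\<lambda>k\<in>{..n + N n}. z k) = \<phi> n z" for z
    proof -
      have "grid_log_lik a n (N n) (\<lambda>k\<in>{..n + N n}. z k) = grid_log_lik a n (N n) z"
        by (rule grid_log_lik_cong) simp
      moreover have "(\<Prod>t\<in>J. ramp s ((\<lambda>k\<in>{..n + N n}. z k) (idx n t) - c t)) = (\<Prod>t\<in>J. ramp s (z (idx n t) - c t))"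
        using idx by (intro prod.cong) auto
      ultimately show ?thesis by (simp only: \<phi>_def)
    qed
    ultimately show ?case by (simp only: ennreal_mult[OF \<phi>_bounds(1) exp_ge_zero])
  qed
  ultimately show ?thesis
    by (rule LIMSEQ_unique_eventually)
qed

text \<open>The ramps become indicators by dominated convergence, for which the cutoff is still needed; afterwards the
  cutoff is removed by monotone convergence. In particular the density has total mass \<open>1\<close>.\<close>

lemma girsanov_cylinder:
  assumes T: "T > 0" and J: "finite J" "J \<subseteq> {-1..T}"
  shows "(\<integral>\<^sup>+\<omega>. (if \<forall>t\<in>J. X a t \<omega> \<le> c t then 1 else 0) \<partial>M)
    = (\<integral>\<^sup>+\<omega>. (if \<forall>t\<in>J. X 0 t \<omega> \<le> c t then 1 else 0) * ennreal (exp (log_lik a (\<lambda>t. X 0 t \<omega>) T)) \<partial>M)"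
proof -
  define L where "L b \<omega> = log_lik a (\<lambda>t. X b t \<omega>) T" for b \<omega>
  define I where "I b \<omega> = (if \<forall>t\<in>J. X b t \<omega> \<le> c t then 1 else 0 :: real)" for b \<omega>
  have Lm [measurable]: "L b \<in> borel_measurable M" for b
    unfolding L_def[abs_def] by (rule X_integrals_measurable[OF T])
  have Xm [measurable]: "X b t \<in> borel_measurable M" if "t \<in> J" for b t using J that by (intro X_measurable) auto
  have Rm: "(\<lambda>\<omega>. \<Prod>t\<in>J. ramp s (X b t \<omega> - c t)) \<in> borel_measurable M" for b s
    by (intro borel_measurable_prod measurable_compose[OF _ borel_measurable_ramp] borel_measurable_diff Xm borel_measurable_const)
  have lim: "(\<lambda>m. \<Prod>t\<in>J. ramp (real m) (X b t \<omega> - c t)) \<longlonglongrightarrow> I b \<omega>" for b \<omega>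
  proof -
    have "(\<Prod>t\<in>J. if X b t \<omega> - c t \<le> 0 then 1 else 0 :: real) = I b \<omega>"
      unfolding I_def using J by (auto intro!: prod_zero)
    then show ?thesis using tendsto_prod[of J "\<lambda>t m. ramp (real m) (X b t \<omega> - c t)", OF ramp_tendsto_indicator] by simp
  qed
  have Im [measurable]: "I b \<in> borel_measurable M" for b
    by (rule borel_measurable_LIMSEQ_real[OF lim Rm])
  have prod_bounds: "0 \<le> (\<Prod>t\<in>J. ramp s (f t))" "(\<Prod>t\<in>J. ramp s (f t)) \<le> 1" for f s
    using ramp_bounds by (auto intro: prod_nonneg prod_le_1)
  have I_bounds: "0 \<le> I b \<omega>" "I b \<omega> \<le> 1" for b \<omega> by (auto simp: I_def)
  have eqK: "(\<integral>\<^sup>+\<omega>. ennreal (I a \<omega> * ramp 1 (L a \<omega> - K)) \<partial>M)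
      = (\<integral>\<^sup>+\<omega>. ennreal (I 0 \<omega> * ramp 1 (L 0 \<omega> - K) * exp (L 0 \<omega>)) \<partial>M)" for K
  proof (rule LIMSEQ_unique)
    show "(\<lambda>m. \<integral>\<^sup>+\<omega>. ennreal ((\<Prod>t\<in>J. ramp (real m) (X a t \<omega> - c t)) * ramp 1 (L a \<omega> - K)) \<partial>M)
        \<longlonglongrightarrow> (\<integral>\<^sup>+\<omega>. ennreal (I a \<omega> * ramp 1 (L a \<omega> - K)) \<partial>M)"
    proof (rule nn_integral_dominated_convergence[where w = "\<lambda>_. 1"])
      show "AE \<omega> in M. ennreal ((\<Prod>t\<in>J. ramp (real m) (X a t \<omega> - c t)) * ramp 1 (L a \<omega> - K)) \<le> 1" for m
        using prod_bounds ramp_bounds by (auto intro!: mult_le_one simp: ennreal_le_1)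
      show "AE \<omega> in M. (\<lambda>m. ennreal ((\<Prod>t\<in>J. ramp (real m) (X a t \<omega> - c t)) * ramp 1 (L a \<omega> - K)))
          \<longlonglongrightarrow> ennreal (I a \<omega> * ramp 1 (L a \<omega> - K))"
        by (intro AE_I2 tendsto_ennrealI tendsto_mult lim tendsto_const)
      show "(\<lambda>\<omega>. ennreal ((\<Prod>t\<in>J. ramp (real m) (X a t \<omega> - c t)) * ramp 1 (L a \<omega> - K))) \<in> borel_measurable M" for m
        using Rm[of m a] by measurable
    qed (auto simp: emeasure_space_1)
    have "(\<lambda>m. \<integral>\<^sup>+\<omega>. ennreal ((\<Prod>t\<in>J. ramp (real m) (X 0 t \<omega> - c t)) * ramp 1 (L 0 \<omega> - K) * exp (L 0 \<omega>)) \<partial>M)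
        \<longlonglongrightarrow> (\<integral>\<^sup>+\<omega>. ennreal (I 0 \<omega> * ramp 1 (L 0 \<omega> - K) * exp (L 0 \<omega>)) \<partial>M)"
    proof (rule nn_integral_dominated_convergence[where w = "\<lambda>_. ennreal (exp (K + 1))"])
      have "(\<Prod>t\<in>J. ramp (real m) (X 0 t \<omega> - c t)) * (ramp 1 (L 0 \<omega> - K) * exp (L 0 \<omega>)) \<le> 1 * exp (K + 1)" for m \<omega>
        using prod_bounds ramp_bounds ramp_cutoff_exp by (intro mult_mono) auto
      then show "AE \<omega> in M. ennreal ((\<Prod>t\<in>J. ramp (real m) (X 0 t \<omega> - c t)) * ramp 1 (L 0 \<omega> - K) * exp (L 0 \<omega>)) \<le> ennreal (exp (K + 1))" for m
        by (intro AE_I2 ennreal_leI) (simp add: mult.assoc)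
      show "AE \<omega> in M. (\<lambda>m. ennreal ((\<Prod>t\<in>J. ramp (real m) (X 0 t \<omega> - c t)) * ramp 1 (L 0 \<omega> - K) * exp (L 0 \<omega>)))
          \<longlonglongrightarrow> ennreal (I 0 \<omega> * ramp 1 (L 0 \<omega> - K) * exp (L 0 \<omega>))"
        by (intro AE_I2 tendsto_ennrealI tendsto_mult lim tendsto_const)
      show "(\<lambda>\<omega>. ennreal ((\<Prod>t\<in>J. ramp (real m) (X 0 t \<omega> - c t)) * ramp 1 (L 0 \<omega> - K) * exp (L 0 \<omega>))) \<in> borel_measurable M" for m
        using Rm[of m 0] by measurable
    qed (auto simp: emeasure_space_1)
    then show "(\<lambda>m. \<integral>\<^sup>+\<omega>. ennreal ((\<Prod>t\<in>J. ramp (real m) (X a t \<omega> - c t)) * ramp 1 (L a \<omega> - K)) \<partial>M)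
        \<longlonglongrightarrow> (\<integral>\<^sup>+\<omega>. ennreal (I 0 \<omega> * ramp 1 (L 0 \<omega> - K) * exp (L 0 \<omega>)) \<partial>M)"
      unfolding L_def truncated_girsanov[OF T J] .
  qed
  have "(\<integral>\<^sup>+\<omega>. ennreal (I a \<omega>) \<partial>M) = (\<integral>\<^sup>+\<omega>. ennreal (I 0 \<omega> * exp (L 0 \<omega>)) \<partial>M)"
  proof (rule LIMSEQ_unique)
    show "(\<lambda>K. \<integral>\<^sup>+\<omega>. ennreal (I a \<omega> * ramp 1 (L a \<omega> - real K)) \<partial>M) \<longlonglongrightarrow> (\<integral>\<^sup>+\<omega>. ennreal (I a \<omega>) \<partial>M)"
    proof (rule nn_integral_LIMSEQ)
      show "mono (\<lambda>K \<omega>. ennreal (I a \<omega> * ramp 1 (L a \<omega> - real K)))"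
        using I_bounds by (intro monoI le_funI ennreal_leI mult_left_mono ramp_cutoff_mono) auto
      show "(\<lambda>K. ennreal (I a \<omega> * ramp 1 (L a \<omega> - real K))) \<longlonglongrightarrow> ennreal (I a \<omega>)" for \<omega>
        using tendsto_mult[OF tendsto_const[of "I a \<omega>"] ramp_cutoff_tendsto[of "L a \<omega>"]] by (auto intro: tendsto_ennrealI)
    qed auto
    have "(\<lambda>K. \<integral>\<^sup>+\<omega>. ennreal (I 0 \<omega> * ramp 1 (L 0 \<omega> - real K) * exp (L 0 \<omega>)) \<partial>M) \<longlonglongrightarrow> (\<integral>\<^sup>+\<omega>. ennreal (I 0 \<omega> * exp (L 0 \<omega>)) \<partial>M)"
    proof (rule nn_integral_LIMSEQ)
      show "mono (\<lambda>K \<omega>. ennreal (I 0 \<omega> * ramp 1 (L 0 \<omega> - real K) * exp (L 0 \<omega>)))"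
        using I_bounds by (intro monoI le_funI ennreal_leI mult_left_mono mult_right_mono ramp_cutoff_mono) auto
      show "(\<lambda>K. ennreal (I 0 \<omega> * ramp 1 (L 0 \<omega> - real K) * exp (L 0 \<omega>))) \<longlonglongrightarrow> ennreal (I 0 \<omega> * exp (L 0 \<omega>))" for \<omega>
        using tendsto_mult[OF tendsto_mult[OF tendsto_const[of "I 0 \<omega>"] ramp_cutoff_tendsto[of "L 0 \<omega>"]] tendsto_const[of "exp (L 0 \<omega>)"]]
        by (auto intro: tendsto_ennrealI)
    qed auto
    then show "(\<lambda>K. \<integral>\<^sup>+\<omega>. ennreal (I a \<omega> * ramp 1 (L a \<omega> - real K)) \<partial>M) \<longlonglongrightarrow> (\<integral>\<^sup>+\<omega>. ennreal (I 0 \<omega> * exp (L 0 \<omega>)) \<partial>M)"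
      unfolding eqK .
  qed
  then show ?thesis
    by (simp add: I_def L_def ennreal_mult' if_distrib[of ennreal] cong: if_cong)
qed

lemma path_law_density:
  assumes T: "T > 0"
  shows "path_law M (X a) T = density (path_law M (X 0) T) (\<lambda>f. ennreal (exp (log_lik a f T)))"
    and "(\<lambda>f. log_lik a f T) \<in> borel_measurable (C_borel T)"
proof -
  have path [measurable]: "path_upto (X b) T \<in> measurable M (C_borel T)" for b
    by (rule measurable_path_upto[OF T X_process])
  show L [measurable]: "(\<lambda>f. log_lik a f T) \<in> borel_measurable (C_borel T)"
    using T by (intro borel_measurable_log_lik measurable_eval_C_borel) (auto simp: space_C_borel mspace_C_metric)
  have path_val: "path_upto (X b) T \<omega> t = X b t \<omega>" if "t \<in> {-1..T}" for b t \<omega>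
    using that by (simp add: path_upto_def)
  have log_path: "log_lik a (path_upto (X b) T \<omega>) T = log_lik a (\<lambda>t. X b t \<omega>) T" for b \<omega>
    unfolding log_lik_def using T score_cong[of T "path_upto (X b) T \<omega>" "\<lambda>t. X b t \<omega>", OF path_val]
      information_cong[of T "path_upto (X b) T \<omega>" "\<lambda>t. X b t \<omega>", OF path_val] by simp
  show "path_law M (X a) T = density (path_law M (X 0) T) (\<lambda>f. ennreal (exp (log_lik a f T)))"
  proof (rule measure_eqI_C_borel[OF T])
    show "sets (path_law M (X a) T) = sets (C_borel T)" by (simp add: path_law_def)
    show "sets (density (path_law M (X 0) T) (\<lambda>f. ennreal (exp (log_lik a f T)))) = sets (C_borel T)"
      by (simp add: path_law_def)
    interpret P: prob_space "path_law M (X a) T" unfolding path_law_def by (rule prob_space_distr[OF path])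
    show "emeasure (path_law M (X a) T) (mspace (C_metric T)) \<noteq> \<infinity>"
      using P.emeasure_finite by simp
    fix J c assume J: "finite J" "J \<subseteq> {-1..T}"
    let ?A = "{f \<in> mspace (C_metric T). \<forall>t\<in>J. f t \<le> (c t :: real)}"
    have A: "?A \<in> sets (C_borel T)"
    proof -
      have "{f \<in> space (C_borel T). \<forall>t\<in>J. f t \<le> c t} \<in> sets (C_borel T)"
        using half_space_in_C_borel[of T] J T by (intro sets.sets_Collect_finite_All) (auto simp: space_C_borel)
      then show ?thesis by (simp add: space_C_borel)
    qed
    have ind: "indicator ?A (path_upto (X b) T \<omega>) = (if \<forall>t\<in>J. X b t \<omega> \<le> c t then 1 else 0 :: ennreal)"
      if "\<omega> \<in> space M" for b \<omega>
    proof -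
      have "path_upto (X b) T \<omega> \<in> mspace (C_metric T)" using measurable_space[OF path that] by (simp add: space_C_borel)
      then show ?thesis using path_val J by (auto simp: indicator_def subset_eq)
    qed
    have "emeasure (path_law M (X a) T) ?A = (\<integral>\<^sup>+\<omega>. indicator ?A (path_upto (X a) T \<omega>) \<partial>M)"
      using A unfolding path_law_def
      by (subst nn_integral_distr[OF path, symmetric]) auto
    also have "\<dots> = (\<integral>\<^sup>+\<omega>. (if \<forall>t\<in>J. X a t \<omega> \<le> c t then 1 else 0) \<partial>M)"
      by (intro nn_integral_cong ind)
    also have "\<dots> = (\<integral>\<^sup>+\<omega>. (if \<forall>t\<in>J. X 0 t \<omega> \<le> c t then 1 else 0) * ennreal (exp (log_lik a (\<lambda>t. X 0 t \<omega>) T)) \<partial>M)"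
      by (rule girsanov_cylinder[OF T J])
    also have "\<dots> = (\<integral>\<^sup>+\<omega>. ennreal (exp (log_lik a (path_upto (X 0) T \<omega>) T)) * indicator ?A (path_upto (X 0) T \<omega>) \<partial>M)"
      by (intro nn_integral_cong) (simp add: ind log_path mult.commute)
    also have "\<dots> = (\<integral>\<^sup>+f. ennreal (exp (log_lik a f T)) * indicator ?A f \<partial>path_law M (X 0) T)"
      unfolding path_law_def using A by (subst nn_integral_distr) auto
    also have "\<dots> = emeasure (density (path_law M (X 0) T) (\<lambda>f. ennreal (exp (log_lik a f T)))) ?A"
      using A by (subst emeasure_density) (auto simp: path_law_def)
    finally show "emeasure (path_law M (X a) T) ?A = emeasure (density (path_law M (X 0) T) (\<lambda>f. ennreal (exp (log_lik a f T)))) ?A" .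
  qed
qed

text \<open>Almost sure equality for every \<open>T > 0\<close>: the log likelihood ratio is exactly quadratic in the
  parameter, so the remainder of the local expansion vanishes.\<close>

theorem log_likelihood_ratio_eq:
  assumes T: "T > 0"
  shows "AE \<omega> in M. log_likelihood_ratio M X a 0 T \<omega>
      = a * score (\<lambda>t. X 0 t \<omega>) T - a\<^sup>2 / 2 * information (\<lambda>t. X 0 t \<omega>) T"
    and "log_likelihood_ratio M X a 0 T \<in> borel_measurable M"
proof -
  have path [measurable]: "path_upto (X b) T \<in> measurable M (C_borel T)" for b
    by (rule measurable_path_upto[OF T X_process])
  note [measurable] = path_law_density(2)[OF T, of a]
  interpret P: prob_space "path_law M (X 0) T" unfolding path_law_def by (rule prob_space_distr[OF path])
  have [measurable_cong]: "sets (path_law M (X 0) T) = sets (C_borel T)" by (simp add: path_law_def)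
  have "AE f in path_law M (X 0) T. ennreal (exp (log_lik a f T)) = RN_deriv (path_law M (X 0) T) (path_law M (X a) T) f"
    by (rule P.RN_deriv_unique) (auto simp: path_law_density(1)[OF T, of a, symmetric])
  then have "AE \<omega> in M. ennreal (exp (log_lik a (path_upto (X 0) T \<omega>) T))
      = RN_deriv (path_law M (X 0) T) (path_law M (X a) T) (path_upto (X 0) T \<omega>)"
    unfolding path_law_def[of M "X 0"] by (subst (asm) AE_distr_iff) auto
  then show "AE \<omega> in M. log_likelihood_ratio M X a 0 T \<omega>
      = a * score (\<lambda>t. X 0 t \<omega>) T - a\<^sup>2 / 2 * information (\<lambda>t. X 0 t \<omega>) T"
  proof eventually_elim
    case (elim \<omega>)
    have "log_lik a (path_upto (X 0) T \<omega>) T = log_lik a (\<lambda>t. X 0 t \<omega>) T"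
      unfolding log_lik_def using T score_cong[of T "path_upto (X 0) T \<omega>" "\<lambda>t. X 0 t \<omega>"]
        information_cong[of T "path_upto (X 0) T \<omega>" "\<lambda>t. X 0 t \<omega>"] by (simp add: path_upto_def)
    then show ?case unfolding log_likelihood_ratio_def elim[symmetric] by (simp add: log_lik_def)
  qed
  have [measurable]: "RN_deriv (path_law M (X 0) T) (path_law M (X a) T) \<in> borel_measurable (C_borel T)"
    using borel_measurable_RN_deriv by (simp cong: measurable_cong_sets)
  show "log_likelihood_ratio M X a 0 T \<in> borel_measurable M"
    unfolding log_likelihood_ratio_def[abs_def] by measurable
qed

end

section \<open>The Ito integral of a Wiener process against itself\<close>

lemma wiener_process_mono: "wiener_process M I W \<Longrightarrow> I' \<subseteq> I \<Longrightarrow> wiener_process M I' W"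
  unfolding wiener_process_def continuous_process_def
  by (auto intro: continuous_on_subset simp: subset_iff)

lemma wiener_measurable: "wiener_process M I W \<Longrightarrow> t \<in> I \<Longrightarrow> W t \<in> borel_measurable M"
  by (simp add: wiener_process_def continuous_process_def)

lemma wiener_increment_moments:
  assumes W: "wiener_process M I W" and st: "s \<in> I" "t \<in> I" "s < t"
  defines "D \<equiv> \<lambda>\<omega>. W t \<omega> - W s \<omega>"
  shows "integrable M (\<lambda>\<omega>. D \<omega> ^ k)"
    and "(\<integral>\<omega>. D \<omega> \<partial>M) = 0" and "(\<integral>\<omega>. (D \<omega>)\<^sup>2 \<partial>M) = t - s"
    and "(\<integral>\<omega>. D \<omega> ^ 3 \<partial>M) = 0" and "(\<integral>\<omega>. D \<omega> ^ 4 \<partial>M) = 3 * (t - s)\<^sup>2"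
proof -
  interpret prob_space M using W by (simp add: wiener_process_def)
  let ?d = "normal_density 0 (sqrt (t - s))"
  have s: "sqrt (t - s) > 0" using st by simp
  have D: "distributed M lborel D ?d" using W st unfolding wiener_process_def D_def by auto
  have int: "integrable M (\<lambda>\<omega>. g (D \<omega>)) \<longleftrightarrow> integrable lborel (\<lambda>x. ?d x * g x)" if "g \<in> borel_measurable lborel" for g :: "real \<Rightarrow> real"
    using distributed_integrable[OF D that] by simp
  have val: "(\<integral>\<omega>. g (D \<omega>) \<partial>M) = (\<integral>x. ?d x * g x \<partial>lborel)" if "g \<in> borel_measurable lborel" for g :: "real \<Rightarrow> real"
    using distributed_integral[OF D that] by simp
  show "integrable M (\<lambda>\<omega>. D \<omega> ^ k)"
    using integrable_normal_moment[OF s, of 0 k] by (subst int) auto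
  show "(\<integral>\<omega>. D \<omega> \<partial>M) = 0"
    using integral_normal_moment_nz_1[OF s, of 0] by (subst val[of "\<lambda>x. x"]) auto
  show "(\<integral>\<omega>. (D \<omega>)\<^sup>2 \<partial>M) = t - s"
    using integral_normal_moment_even[OF s, of 0 1] st by (subst val) (auto simp: eval_nat_numeral)
  show "(\<integral>\<omega>. D \<omega> ^ 3 \<partial>M) = 0"
    using integral_normal_moment_odd[OF s, of 0 1] by (subst val) (auto simp: eval_nat_numeral)
  have "fact 4 / ((2 / (sqrt (t - s))\<^sup>2)\<^sup>2 * fact 2) = 3 * (t - s)\<^sup>2"
    using st by (simp add: fact_numeral power2_eq_square)
  then show "(\<integral>\<omega>. D \<omega> ^ 4 \<partial>M) = 3 * (t - s)\<^sup>2"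
    using integral_normal_moment_even[OF s, of 0 2] by (subst val) auto
qed

lemma natural_filtration_generators:
  "{W r -` B \<inter> space M | r B. 0 \<le> r \<and> r \<le> t \<and> B \<in> sets borel} \<subseteq> Pow (space M)"
  by auto

lemma space_natural_filtration [simp]: "space (natural_filtration M W t) = space M"
  unfolding natural_filtration_def by (rule space_measure_of[OF natural_filtration_generators])

lemma sets_natural_filtration:
  "sets (natural_filtration M W t) = sigma_sets (space M) {W r -` B \<inter> space M | r B. 0 \<le> r \<and> r \<le> t \<and> B \<in> sets borel}"
  unfolding natural_filtration_def by (rule sets_measure_of[OF natural_filtration_generators])

lemma natural_filtration_mono:
  fixes f :: "'o \<Rightarrow> real"
  shows "s \<le> t \<Longrightarrow> f \<in> borel_measurable (natural_filtration M W s) \<Longrightarrow> f \<in> borel_measurable (natural_filtration M W t)"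
proof (rule measurableI)
  fix A :: "real set" assume st: "s \<le> t" and f: "f \<in> borel_measurable (natural_filtration M W s)" and A: "A \<in> sets borel"
  have "sets (natural_filtration M W s) \<subseteq> sets (natural_filtration M W t)"
    unfolding sets_natural_filtration using st by (intro sigma_sets_mono') force
  then show "f -` A \<inter> space (natural_filtration M W t) \<in> sets (natural_filtration M W t)"
    using measurable_sets[OF f A] by auto
qed auto

lemma natural_filtration_value:
  "0 \<le> s \<Longrightarrow> s \<le> t \<Longrightarrow> W s \<in> borel_measurable (natural_filtration M W t)"
  by (intro measurableI) (auto simp: sets_natural_filtration intro!: sigma_sets.Basic)

text \<open>The values at finitely many times up to \<open>s\<close> are sums of increments over the grid formed by these times,
  \<open>0\<close> and \<open>s\<close>. Adding \<open>t\<close> as one more grid point, the last increment is independent of all others.\<close>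

lemma indep_future_increment_events:
  assumes W: "wiener_process M {0..b} W" and st: "0 \<le> s" "s < t" "t \<le> b"
    and J: "finite J" "J \<subseteq> {0..s}" and B: "\<And>r. r \<in> J \<Longrightarrow> B r \<in> sets borel" and C: "C \<in> sets borel"
  shows "measure M ({\<omega> \<in> space M. \<forall>r\<in>J. W r \<omega> \<in> B r} \<inter> {\<omega> \<in> space M. W t \<omega> - W s \<omega> \<in> C})
    = measure M {\<omega> \<in> space M. \<forall>r\<in>J. W r \<omega> \<in> B r} * measure M {\<omega> \<in> space M. W t \<omega> - W s \<omega> \<in> C}"
proof -
  interpret prob_space M using W by (simp add: wiener_process_def)
  have Wm [measurable]: "W r \<in> borel_measurable M" if "r \<in> {0..b}" for r
    using wiener_measurable[OF W that] .
  (* 0 and s join the grid so that sums of increments start at W 0 = 0 and the last increment runs from s to t *)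
  define xs where "xs = sorted_list_of_set (insert 0 (insert s J))"
  define n where "n = length xs - 1"
  define \<tau> where "\<tau> i = (if i \<le> n then xs ! i else t)" for i
  have fin: "finite (insert 0 (insert s J))" using J by simp
  have xs: "set xs = insert 0 (insert s J)"
    unfolding xs_def by (rule set_sorted_list_of_set[OF fin])
  have len: "length xs = Suc n" using xs by (cases xs) (auto simp: n_def)
  have xs_in: "xs ! i \<in> insert 0 (insert s J)" if "i \<le> n" for i
    using xs len that nth_mem[of i xs] by auto
  have lt: "xs ! i < xs ! j" if "i < j" "j \<le> n" for i j
    using sorted_wrt_nth_less[OF strict_sorted_list_of_set[of "insert 0 (insert s J)"], of i j] len that by (simp add: xs_def)
  have range: "xs ! i \<in> {0..s}" if "i \<le> n" for i using xs_in[OF that] J st by auto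
  have \<tau>0: "\<tau> 0 = 0"
  proof -
    obtain j where "j \<le> n" "xs ! j = 0" using xs len by (metis in_set_conv_nth insertI1 less_Suc_eq_le)
    then show ?thesis using lt[of 0 j] range[of 0] by (cases "j = 0") (auto simp: \<tau>_def)
  qed
  have \<tau>n: "\<tau> n = s"
  proof -
    obtain j where j: "j \<le> n" "xs ! j = s" using xs len by (metis in_set_conv_nth insertI1 insertI2 less_Suc_eq_le)
    then show ?thesis using lt[of j n] range[of n] by (cases "j = n") (auto simp: \<tau>_def)
  qed
  have \<tau>S: "\<tau> (Suc n) = t" by (simp add: \<tau>_def)
  have \<tau>I: "\<tau> i \<in> {0..b}" if "i \<le> Suc n" for i
    using range[of i] st that by (cases "i = Suc n") (auto simp: \<tau>_def)
  have \<tau>lt: "\<tau> i < \<tau> (Suc i)" if "i < Suc n" for i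
    using lt[of i "Suc i"] range[of i] st that by (cases "i = n") (auto simp: \<tau>_def)
  define idx where "idx r = (SOME j. j \<le> n \<and> xs ! j = r)" for r
  have idx: "idx r \<le> n" "\<tau> (idx r) = r" if "r \<in> J" for r
  proof -
    have "\<exists>j. j \<le> n \<and> xs ! j = r" using that xs len by (metis in_set_conv_nth insertI2 less_Suc_eq_le)
    from someI_ex[OF this] have *: "idx r \<le> n \<and> xs ! idx r = r" unfolding idx_def .
    then show "idx r \<le> n" "\<tau> (idx r) = r" by (auto simp: \<tau>_def)
  qed
  define inc where "inc i \<omega> = W (\<tau> (Suc i)) \<omega> - W (\<tau> i) \<omega>" for i \<omega>
  have "\<forall>i\<le>Suc n. \<tau> i \<in> {0..b}" "\<forall>i<Suc n. \<tau> i < \<tau> (Suc i)" using \<tau>I \<tau>lt by auto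
  then have "indep_vars (\<lambda>_. borel) inc {..<Suc n}"
    using W unfolding wiener_process_def inc_def by blast
  then have ind: "indep_var (PiM {..<n} (\<lambda>_. borel)) (\<lambda>\<omega>. restrict (\<lambda>i. inc i \<omega>) {..<n}) (PiM {n} (\<lambda>_. borel)) (\<lambda>\<omega>. restrict (\<lambda>i. inc i \<omega>) {n})"
    by (rule indep_var_restrict) auto
  define S where "S = {x \<in> space (PiM {..<n} (\<lambda>_. borel :: real measure)). \<forall>r\<in>J. (\<Sum>i<idx r. x i) \<in> B r}"
  define R where "R = {x \<in> space (PiM {n} (\<lambda>_. borel :: real measure)). x n \<in> C}"
  have S: "S \<in> sets (PiM {..<n} (\<lambda>_. borel))"
    unfolding S_def
  proof (intro sets.sets_Collect_finite_All J)
    fix r assume r: "r \<in> J"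
    have "(\<lambda>x. \<Sum>i<idx r. x i) \<in> borel_measurable (PiM {..<n} (\<lambda>_. borel :: real measure))"
      using idx[OF r] by (intro borel_measurable_sum measurable_component_singleton) auto
    from measurable_sets[OF this B[OF r]]
    show "{x \<in> space (PiM {..<n} (\<lambda>_. borel)). (\<Sum>i<idx r. x i) \<in> B r} \<in> sets (PiM {..<n} (\<lambda>_. borel))"
      by (simp add: vimage_def Int_def conj_commute)
  qed
  have R: "R \<in> sets (PiM {n} (\<lambda>_. borel))"
    using measurable_sets[OF measurable_component_singleton[of n "{n}" "\<lambda>_. borel :: real measure"] C]
    by (simp add: R_def vimage_def Int_def conj_commute)
  have tel: "(\<Sum>i<j. inc i \<omega>) = W (\<tau> j) \<omega> - W 0 \<omega>" for j \<omega>
    unfolding inc_def using sum_lessThan_telescope[of "\<lambda>i. W (\<tau> i) \<omega>" j] by (simp add: \<tau>0)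
  let ?A = "{\<omega> \<in> space M. \<forall>r\<in>J. W r \<omega> \<in> B r}" and ?A' = "{\<omega> \<in> space M. \<forall>r\<in>J. W r \<omega> - W 0 \<omega> \<in> B r}"
  let ?D = "{\<omega> \<in> space M. W t \<omega> - W s \<omega> \<in> C}"
  have sums: "(\<Sum>i<idx r. restrict (\<lambda>i. inc i \<omega>) {..<n} i) = W r \<omega> - W 0 \<omega>" if "r \<in> J" for r \<omega>
  proof -
    have "(\<Sum>i<idx r. restrict (\<lambda>i. inc i \<omega>) {..<n} i) = (\<Sum>i<idx r. inc i \<omega>)"
      using idx[OF that] by (intro sum.cong) auto
    then show ?thesis using tel[of \<omega> "idx r"] idx[OF that] by simp
  qed
  have preS: "(\<lambda>\<omega>. restrict (\<lambda>i. inc i \<omega>) {..<n}) -` S \<inter> space M = ?A'"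
    by (auto simp: S_def sums[simplified] space_PiM)
  have preR: "(\<lambda>\<omega>. restrict (\<lambda>i. inc i \<omega>) {n}) -` R \<inter> space M = ?D"
    by (auto simp: R_def space_PiM inc_def \<tau>n \<tau>S)
  have pre: "(\<lambda>\<omega>. (restrict (\<lambda>i. inc i \<omega>) {..<n}, restrict (\<lambda>i. inc i \<omega>) {n})) -` (S \<times> R) \<inter> space M = ?A' \<inter> ?D"
    using preS preR by blast
  have "prob (?A' \<inter> ?D) = prob ?A' * prob ?D"
    using indep_varD[OF ind S R] unfolding pre preS preR .
  moreover have As: "?A \<in> events"
  proof (intro sets.sets_Collect_finite_All J)
    fix r assume r: "r \<in> J"
    have "W r \<in> borel_measurable M" using r J st by (intro Wm) auto
    from measurable_sets[OF this B[OF r]] show "{\<omega> \<in> space M. W r \<omega> \<in> B r} \<in> events" by (simp add: vimage_def Int_def conj_commute)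
  qed
  moreover have A's: "?A' \<in> events"
  proof -
    have "(\<lambda>\<omega>. restrict (\<lambda>i. inc i \<omega>) {..<n}) \<in> measurable M (PiM {..<n} (\<lambda>_. borel))"
      using ind by (rule indep_var_rv1)
    from measurable_sets[OF this S] show ?thesis unfolding preS .
  qed
  moreover have Ds: "?D \<in> events"
  proof -
    have "(\<lambda>\<omega>. restrict (\<lambda>i. inc i \<omega>) {n}) \<in> measurable M (PiM {n} (\<lambda>_. borel))"
      using ind by (rule indep_var_rv2)
    from measurable_sets[OF this R] show ?thesis unfolding preR .
  qed
  moreover have W0: "AE \<omega> in M. W 0 \<omega> = 0" using W by (simp add: wiener_process_def)
  have "prob ?A = prob ?A'"
    by (rule measure_eq_AE[OF _ As A's]) (use W0 in eventually_elim, auto)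
  moreover have "prob (?A \<inter> ?D) = prob (?A' \<inter> ?D)"
    by (rule measure_eq_AE[OF _ sets.Int[OF As Ds] sets.Int[OF A's Ds]]) (use W0 in eventually_elim, auto)
  ultimately show ?thesis by simp
qed

text \<open>Events about finitely many times generate the past and are stable under intersection.\<close>

lemma indep_future_increment:
  assumes W: "wiener_process M {0..b} W" and st: "0 \<le> s" "s < t" "t \<le> b"
    and \<zeta>: "\<zeta> \<in> borel_measurable (natural_filtration M W s)"
  shows "prob_space.indep_var M borel \<zeta> borel (\<lambda>\<omega>. W t \<omega> - W s \<omega>)"
proof -
  interpret prob_space M using W by (simp add: wiener_process_def)
  have Wm: "W r \<in> borel_measurable M" if "r \<in> {0..b}" for r
    using wiener_measurable[OF W that] .
  have Dm: "(\<lambda>\<omega>. W t \<omega> - W s \<omega>) \<in> borel_measurable M" using st by (intro borel_measurable_diff Wm) auto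
  let ?P = "{{\<omega> \<in> space M. \<forall>r\<in>J. W r \<omega> \<in> B r} | J B. finite J \<and> J \<subseteq> {0..s} \<and> (\<forall>r\<in>J. B r \<in> sets borel)}"
  let ?Q = "{(\<lambda>\<omega>. W t \<omega> - W s \<omega>) -` C \<inter> space M | C. C \<in> sets borel}"
  have "?P \<subseteq> events"
  proof
    fix A assume "A \<in> ?P"
    then obtain J B where A: "A = {\<omega> \<in> space M. \<forall>r\<in>J. W r \<omega> \<in> B r}" "finite J" "J \<subseteq> {0..s}" "\<forall>r\<in>J. B r \<in> sets borel" by blast
    have "{\<omega> \<in> space M. W r \<omega> \<in> B r} \<in> events" if "r \<in> J" for r
      using measurable_sets[OF Wm, of r "B r"] that A st by (auto simp: vimage_def Int_def conj_commute)
    then show "A \<in> events" unfolding A(1) by (intro sets.sets_Collect_finite_All A(2)) auto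
  qed
  moreover have "?Q \<subseteq> events" using measurable_sets[OF Dm] by auto
  moreover have "prob (A \<inter> D) = prob A * prob D" if A: "A \<in> ?P" and D: "D \<in> ?Q" for A D
  proof -
    obtain J B where A: "A = {\<omega> \<in> space M. \<forall>r\<in>J. W r \<omega> \<in> B r}" "finite J" "J \<subseteq> {0..s}" "\<forall>r\<in>J. B r \<in> sets borel"
      using A by blast
    obtain C where C: "D = (\<lambda>\<omega>. W t \<omega> - W s \<omega>) -` C \<inter> space M" "C \<in> sets borel" using D by blast
    have D': "D = {\<omega> \<in> space M. W t \<omega> - W s \<omega> \<in> C}" using C by auto
    show ?thesis unfolding A(1) D' by (rule indep_future_increment_events[OF W st A(2,3) _ C(2)]) (use A(4) in blast)
  qed
  ultimately have "indep_set ?P ?Q" by (intro indep_setI) auto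
  moreover have "Int_stable ?P"
  proof (rule Int_stableI)
    fix A A' assume "A \<in> ?P" "A' \<in> ?P"
    then obtain J B J' B' where A: "A = {\<omega> \<in> space M. \<forall>r\<in>J. W r \<omega> \<in> B r}" "finite J" "J \<subseteq> {0..s}" "\<forall>r\<in>J. B r \<in> sets borel"
      and A': "A' = {\<omega> \<in> space M. \<forall>r\<in>J'. W r \<omega> \<in> B' r}" "finite J'" "J' \<subseteq> {0..s}" "\<forall>r\<in>J'. B' r \<in> sets borel" by blast
    let ?B = "\<lambda>r. (if r \<in> J then B r else UNIV) \<inter> (if r \<in> J' then B' r else UNIV)"
    have "A \<inter> A' = {\<omega> \<in> space M. \<forall>r\<in>J \<union> J'. W r \<omega> \<in> ?B r}"
      unfolding A(1) A'(1) by auto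
    moreover have "\<forall>r\<in>J \<union> J'. ?B r \<in> sets borel" using A A' by (auto intro!: sets.Int)
    ultimately show "A \<inter> A' \<in> ?P"
      using A A' by (intro CollectI exI[of _ "J \<union> J'"] exI[of _ ?B]) auto
  qed
  moreover have "Int_stable ?Q"
  proof (rule Int_stableI)
    fix A A' assume "A \<in> ?Q" "A' \<in> ?Q"
    then obtain C C' where C: "A = (\<lambda>\<omega>. W t \<omega> - W s \<omega>) -` C \<inter> space M" "C \<in> sets borel"
      "A' = (\<lambda>\<omega>. W t \<omega> - W s \<omega>) -` C' \<inter> space M" "C' \<in> sets borel" by blast
    then show "A \<inter> A' \<in> ?Q" by (intro CollectI exI[of _ "C \<inter> C'"]) auto
  qed
  ultimately have *: "indep_set (sigma_sets (space M) ?P) (sigma_sets (space M) ?Q)"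
    by (rule indep_set_sigma_sets)
  have "sets (natural_filtration M W s) \<subseteq> sigma_sets (space M) ?P"
    unfolding sets_natural_filtration
  proof (rule sigma_sets_mono', rule subsetI)
    fix A assume "A \<in> {W r -` B \<inter> space M | r B. 0 \<le> r \<and> r \<le> s \<and> B \<in> sets borel}"
    then obtain r B where A: "A = W r -` B \<inter> space M" "0 \<le> r" "r \<le> s" "B \<in> sets borel" by blast
    then show "A \<in> ?P" by (intro CollectI exI[of _ "{r}"] exI[of _ "\<lambda>_. B"]) auto
  qed
  then have \<zeta>s: "\<zeta> -` A \<inter> space M \<in> sigma_sets (space M) ?P" if "A \<in> sets borel" for A
    using measurable_sets[OF \<zeta> that] by auto
  have sub: "sigma_sets (space M) ?P \<subseteq> events"
    using \<open>?P \<subseteq> events\<close> by (rule sets.sigma_sets_subset)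
  have "\<zeta> \<in> borel_measurable M"
    by (intro measurableI) (use \<zeta>s sub in auto)
  moreover have \<zeta>_sub: "sigma_sets (space M) {\<zeta> -` A \<inter> space M | A. A \<in> sets borel} \<subseteq> sigma_sets (space M) ?P"
    by (rule sigma_sets_mono) (use \<zeta>s in blast)
  have "indep_set (sigma_sets (space M) {\<zeta> -` A \<inter> space M | A. A \<in> sets borel}) (sigma_sets (space M) ?Q)"
  proof (rule indep_setI)
    show "sigma_sets (space M) {\<zeta> -` A \<inter> space M | A. A \<in> sets borel} \<subseteq> events" using \<zeta>_sub sub by (rule order_trans)
    show "sigma_sets (space M) ?Q \<subseteq> events" using \<open>?Q \<subseteq> events\<close> by (rule sets.sigma_sets_subset)
    fix a b assume "a \<in> sigma_sets (space M) {\<zeta> -` A \<inter> space M | A. A \<in> sets borel}" "b \<in> sigma_sets (space M) ?Q"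
    then show "prob (a \<inter> b) = prob a * prob b" using indep_setD[OF *] \<zeta>_sub by (meson subsetD)
  qed
  ultimately show ?thesis
    unfolding indep_var_eq using Dm by blast
qed

lemma natural_filtration_measurable:
  fixes f :: "'o \<Rightarrow> real"
  assumes W: "wiener_process M {0..b} W" and t: "t \<le> b" and f: "f \<in> borel_measurable (natural_filtration M W t)"
  shows "f \<in> borel_measurable M"
proof (rule measurableI)
  fix A :: "real set" assume A: "A \<in> sets borel"
  have "sets (natural_filtration M W t) \<subseteq> sets M"
    unfolding sets_natural_filtration
    using wiener_measurable[OF W] t by (intro sets.sigma_sets_subset) (auto intro!: measurable_sets)
  then show "f -` A \<inter> space M \<in> sets M" using measurable_sets[OF f A] by auto
qed auto

lemma has_integral_mult_increment_power:
  assumes W: "wiener_process M {0..b} W" and st: "0 \<le> s" "s < t" "t \<le> b"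
    and \<phi>: "\<phi> \<in> borel_measurable (natural_filtration M W s)" "integrable M \<phi>"
  shows "has_bochner_integral M (\<lambda>\<omega>. \<phi> \<omega> * (W t \<omega> - W s \<omega>) ^ k) ((\<integral>\<omega>. \<phi> \<omega> \<partial>M) * (\<integral>\<omega>. (W t \<omega> - W s \<omega>) ^ k \<partial>M))"
proof -
  interpret prob_space M using W by (simp add: wiener_process_def)
  have "indep_var borel ((\<lambda>x. x) \<circ> \<phi>) borel ((\<lambda>x. x ^ k) \<circ> (\<lambda>\<omega>. W t \<omega> - W s \<omega>))"
    by (rule indep_var_compose[OF indep_future_increment[OF W st \<phi>(1)]]) auto
  then have ind: "indep_var borel \<phi> borel (\<lambda>\<omega>. (W t \<omega> - W s \<omega>) ^ k)" by (simp add: comp_def)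
  have int: "integrable M (\<lambda>\<omega>. (W t \<omega> - W s \<omega>) ^ k)"
    using st by (intro wiener_increment_moments(1)[OF W]) auto
  show ?thesis
    unfolding has_bochner_integral_iff
    using indep_var_integrable[OF ind \<phi>(2) int] indep_var_lebesgue_integral[OF ind \<phi>(2) int] by simp
qed

lemma integrable_mult_of_squares:
  fixes f g :: "'o \<Rightarrow> real"
  assumes [measurable]: "f \<in> borel_measurable M" "g \<in> borel_measurable M"
    and int: "integrable M (\<lambda>\<omega>. (f \<omega>)\<^sup>2)" "integrable M (\<lambda>\<omega>. (g \<omega>)\<^sup>2)"
  shows "integrable M (\<lambda>\<omega>. f \<omega> * g \<omega>)"
proof (rule Bochner_Integration.integrable_bound[OF Bochner_Integration.integrable_add[OF int]])
  have "\<bar>x * y\<bar> \<le> \<bar>x\<^sup>2 + y\<^sup>2\<bar>" for x y :: real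
  proof -
    have "2 * (\<bar>x\<bar> * \<bar>y\<bar>) \<le> x\<^sup>2 + y\<^sup>2" using sum_squares_bound[of "\<bar>x\<bar>" "\<bar>y\<bar>"] by simp
    moreover have "0 \<le> \<bar>x\<bar> * \<bar>y\<bar>" by simp
    ultimately show ?thesis unfolding abs_mult by linarith
  qed
  then show "AE \<omega> in M. norm (f \<omega> * g \<omega>) \<le> norm ((f \<omega>)\<^sup>2 + (g \<omega>)\<^sup>2)" by simp
qed measurable

lemma integrable_of_square:
  fixes f :: "'o \<Rightarrow> real"
  assumes "prob_space M" "f \<in> borel_measurable M" "integrable M (\<lambda>\<omega>. (f \<omega>)\<^sup>2)"
  shows "integrable M f"
proof -
  interpret prob_space M by fact
  show ?thesis using integrable_mult_of_squares[of f M "\<lambda>_. 1"] assms by simp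
qed

lemma square_expansion:
  fixes s z D d :: real
  shows "(s + (z * D - (D\<^sup>2 - d) / 2))\<^sup>2
    = s\<^sup>2 + z\<^sup>2 * D ^ 2 + (1/4) * (D ^ 4 - 2 * d * D ^ 2 + d\<^sup>2)
      + 2 * ((s * z) * D ^ 1) - (s * D ^ 2 - d * s) - (z * D ^ 3 - d * (z * D ^ 1))"
proof -
  define q where "q = (D\<^sup>2 - d) / 2"
  have "(s + (z * D - q))\<^sup>2 = s\<^sup>2 + z\<^sup>2 * D\<^sup>2 + q\<^sup>2 + 2 * ((s * z) * D) - s * (2 * q) - (z * D) * (2 * q)"
    by (simp add: power2_eq_square algebra_simps)
  moreover have "2 * q = D\<^sup>2 - d" by (simp add: q_def)
  moreover have "q\<^sup>2 = (1/4) * (D ^ 4 - 2 * d * D ^ 2 + d\<^sup>2)"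
    by (simp add: q_def power_divide power2_diff)
  moreover have "(z * D) * (D\<^sup>2 - d) = z * D ^ 3 - d * (z * D ^ 1)"
    by (simp add: power2_eq_square power3_eq_cube algebra_simps)
  moreover have "s * (D\<^sup>2 - d) = s * D ^ 2 - d * s" by (simp add: algebra_simps)
  ultimately show ?thesis unfolding q_def[symmetric] by simp
qed

text \<open>One step of the martingale computation for \<open>simple_integral_error\<close>: given the past, \<open>D\<close>,
  \<open>D ^ 3\<close> and \<open>D\<^sup>2 - (t - s)\<close> have mean zero, so that all mixed terms vanish and only the variances of \<open>\<zeta> * D\<close> and of
  \<open>(D\<^sup>2 - (t - s)) / 2\<close> are added.\<close>

lemma increment_square_error:
  assumes W: "wiener_process M {0..b} W" and st: "0 \<le> s" "s < t" "t \<le> b"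
    and S: "S \<in> borel_measurable (natural_filtration M W s)" "integrable M (\<lambda>\<omega>. (S \<omega>)\<^sup>2)"
    and \<zeta>: "\<zeta> \<in> borel_measurable (natural_filtration M W s)" "integrable M (\<lambda>\<omega>. (\<zeta> \<omega>)\<^sup>2)"
  shows "has_bochner_integral M
      (\<lambda>\<omega>. (S \<omega> + (\<zeta> \<omega> * (W t \<omega> - W s \<omega>) - ((W t \<omega> - W s \<omega>)\<^sup>2 - (t - s)) / 2))\<^sup>2)
      ((\<integral>\<omega>. (S \<omega>)\<^sup>2 \<partial>M) + ((\<integral>\<omega>. (\<zeta> \<omega>)\<^sup>2 \<partial>M) * (t - s) + (t - s)\<^sup>2 / 2))"
proof -
  interpret prob_space M using W by (simp add: wiener_process_def)
  define D where "D \<omega> = W t \<omega> - W s \<omega>" for \<omega>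
  define \<delta> where "\<delta> = t - s"
  have sI: "s \<in> {0..b}" "t \<in> {0..b}" using st by auto
  note mom = wiener_increment_moments[OF W sI st(2), folded D_def \<delta>_def]
  have sb: "s \<le> b" using st by simp
  have Sm: "S \<in> borel_measurable M" by (rule natural_filtration_measurable[OF W sb S(1)])
  have \<zeta>m: "\<zeta> \<in> borel_measurable M" by (rule natural_filtration_measurable[OF W sb \<zeta>(1)])
  have Si: "integrable M S" by (rule integrable_of_square[OF prob_space_axioms Sm S(2)])
  have \<zeta>i: "integrable M \<zeta>" by (rule integrable_of_square[OF prob_space_axioms \<zeta>m \<zeta>(2)])
  have S\<zeta>i: "integrable M (\<lambda>\<omega>. S \<omega> * \<zeta> \<omega>)" by (rule integrable_mult_of_squares[OF Sm \<zeta>m S(2) \<zeta>(2)])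
  have hb: "has_bochner_integral M (\<lambda>\<omega>. \<phi> \<omega> * D \<omega> ^ k) ((\<integral>\<omega>. \<phi> \<omega> \<partial>M) * (\<integral>\<omega>. D \<omega> ^ k \<partial>M))"
    if "\<phi> \<in> borel_measurable (natural_filtration M W s)" "integrable M \<phi>" for \<phi> k
    using has_integral_mult_increment_power[OF W st that, of k] by (simp add: D_def)
  have hD: "has_bochner_integral M (\<lambda>\<omega>. D \<omega> ^ k) (\<integral>\<omega>. D \<omega> ^ k \<partial>M)" for k
    using mom(1) by (rule has_bochner_integral_integrable)
  have \<zeta>2: "(\<lambda>\<omega>. (\<zeta> \<omega>)\<^sup>2) \<in> borel_measurable (natural_filtration M W s)"
    "(\<lambda>\<omega>. S \<omega> * \<zeta> \<omega>) \<in> borel_measurable (natural_filtration M W s)"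
    by (rule borel_measurable_power[OF \<zeta>(1)], rule borel_measurable_times[OF S(1) \<zeta>(1)])
  have one: "has_bochner_integral M (\<lambda>_. \<delta>\<^sup>2) (\<delta>\<^sup>2)"
    by (simp add: has_bochner_integral_iff prob_space)
  note parts =
    has_bochner_integral_integrable[OF S(2)]
    hb[OF \<zeta>2(1) \<zeta>(2), of 2]
    has_bochner_integral_mult_right[OF has_bochner_integral_add[OF has_bochner_integral_diff[OF hD[of 4]
      has_bochner_integral_mult_right[OF hD[of 2], of "2 * \<delta>"]] one], of "1/4"]
    has_bochner_integral_mult_right[OF hb[OF \<zeta>2(2) S\<zeta>i, of 1], of 2]
    has_bochner_integral_diff[OF hb[OF S(1) Si, of 2] has_bochner_integral_mult_right[OF has_bochner_integral_integrable[OF Si], of \<delta>]]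
    has_bochner_integral_diff[OF hb[OF \<zeta>(1) \<zeta>i, of 3] has_bochner_integral_mult_right[OF hb[OF \<zeta>(1) \<zeta>i, of 1], of \<delta>]]
  have moments: "(\<integral>\<omega>. D \<omega> ^ 2 \<partial>M) = \<delta>" "(\<integral>\<omega>. D \<omega> ^ 4 \<partial>M) = 3 * \<delta>\<^sup>2" "(\<integral>\<omega>. D \<omega> ^ 3 \<partial>M) = 0" "(\<integral>\<omega>. D \<omega> ^ 1 \<partial>M) = 0"
    using mom by auto
  have fourth: "1 / 4 * (3 * \<delta>\<^sup>2 - 2 * \<delta> * \<delta> + \<delta>\<^sup>2) = \<delta>\<^sup>2 / 2"
    by (simp add: power2_eq_square)
  note has_bochner_integral_diff[OF has_bochner_integral_diff[OF has_bochner_integral_add[OF has_bochner_integral_add[OF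
    has_bochner_integral_add[OF parts(1,2)] parts(3)] parts(4)] parts(5)] parts(6)]
  from this[folded square_expansion, unfolded moments fourth]
  have "has_bochner_integral M (\<lambda>\<omega>. (S \<omega> + (\<zeta> \<omega> * D \<omega> - ((D \<omega>)\<^sup>2 - \<delta>) / 2))\<^sup>2)
     ((\<integral>\<omega>. (S \<omega>)\<^sup>2 \<partial>M) + (\<integral>\<omega>. (\<zeta> \<omega>)\<^sup>2 \<partial>M) * \<delta> + \<delta>\<^sup>2 / 2)" by simp
  then show ?thesis
    unfolding D_def[symmetric] \<delta>_def[symmetric] by (simp add: add.assoc)
qed

lemma wiener_square_integrable:
  assumes W: "wiener_process M {0..b} W" and t: "t \<in> {0..b}"
  shows "integrable M (\<lambda>\<omega>. (W t \<omega>)\<^sup>2)" "(\<integral>\<omega>. (W t \<omega>)\<^sup>2 \<partial>M) = t"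
proof -
  interpret prob_space M using W by (simp add: wiener_process_def)
  have b: "0 \<in> {0..b}" using t by auto
  have W0: "AE \<omega> in M. W 0 \<omega> = 0" using W by (simp add: wiener_process_def)
  note [measurable] = wiener_measurable[OF W t] wiener_measurable[OF W b]
  have "integrable M (\<lambda>\<omega>. (W t \<omega>)\<^sup>2) \<and> (\<integral>\<omega>. (W t \<omega>)\<^sup>2 \<partial>M) = t"
  proof (cases "t = 0")
    case True
    have "AE \<omega> in M. (W t \<omega>)\<^sup>2 = 0" using W0 True by auto
    then show ?thesis
      using integrable_cong_AE[of "\<lambda>\<omega>. (W t \<omega>)\<^sup>2" M "\<lambda>_. 0"] integral_cong_AE[of "\<lambda>\<omega>. (W t \<omega>)\<^sup>2" M "\<lambda>_. 0"] True by simp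
  next
    case False
    then have "0 < t" using t by simp
    note mom = wiener_increment_moments[OF W b t this]
    have "AE \<omega> in M. (W t \<omega>)\<^sup>2 = (W t \<omega> - W 0 \<omega>)\<^sup>2" using W0 by eventually_elim simp
    then show ?thesis
      using integrable_cong_AE[of "\<lambda>\<omega>. (W t \<omega>)\<^sup>2" M "\<lambda>\<omega>. (W t \<omega> - W 0 \<omega>)\<^sup>2"]
        integral_cong_AE[of "\<lambda>\<omega>. (W t \<omega>)\<^sup>2" M "\<lambda>\<omega>. (W t \<omega> - W 0 \<omega>)\<^sup>2"] mom(1)[of 2] mom(3) by simp
  qed
  then show "integrable M (\<lambda>\<omega>. (W t \<omega>)\<^sup>2)" "(\<integral>\<omega>. (W t \<omega>)\<^sup>2 \<partial>M) = t" by auto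
qed

lemma integrable_diff_square:
  fixes f g :: "'o \<Rightarrow> real"
  assumes [measurable]: "f \<in> borel_measurable M" "g \<in> borel_measurable M"
    and int: "integrable M (\<lambda>\<omega>. (f \<omega>)\<^sup>2)" "integrable M (\<lambda>\<omega>. (g \<omega>)\<^sup>2)"
  shows "integrable M (\<lambda>\<omega>. (f \<omega> - g \<omega>)\<^sup>2)"
proof -
  have "(f \<omega> - g \<omega>)\<^sup>2 = (f \<omega>)\<^sup>2 - 2 * (f \<omega> * g \<omega>) + (g \<omega>)\<^sup>2" for \<omega>
    by (simp add: power2_diff)
  then show ?thesis using int integrable_mult_of_squares[OF assms] by simp
qed

text \<open>The integral of \<open>W\<close> against itself over \<open>[0, b]\<close>; the term with \<open>W 0\<close> makes the telescoping identity in
  \<open>simple_integral_error\<close> hold at every sample point.\<close>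

definition ito_square :: "(real \<Rightarrow> 'o \<Rightarrow> real) \<Rightarrow> real \<Rightarrow> 'o \<Rightarrow> real" where
  "ito_square W b \<omega> = ((W b \<omega>)\<^sup>2 - (W 0 \<omega>)\<^sup>2 - b) / 2"

text \<open>Common value of the mean square errors of a simple process, as an approximation of \<open>W\<close> and, after
  integration, of \<open>ito_square\<close>.\<close>

definition squared_error :: "'o measure \<Rightarrow> (real \<Rightarrow> 'o \<Rightarrow> real) \<Rightarrow> nat \<Rightarrow> (nat \<Rightarrow> real) \<Rightarrow> (nat \<Rightarrow> 'o \<Rightarrow> real) \<Rightarrow> real" where
  "squared_error M W k \<tau> \<xi> = (\<Sum>i<k. (\<integral>\<omega>. (\<xi> i \<omega> - W (\<tau> i) \<omega>)\<^sup>2 \<partial>M) * (\<tau> (Suc i) - \<tau> i) + (\<tau> (Suc i) - \<tau> i)\<^sup>2 / 2)"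

lemma simple_process_nodes:
  assumes "simple_process M W b k \<tau> \<xi>"
  shows "i < j \<Longrightarrow> j \<le> k \<Longrightarrow> \<tau> i < \<tau> j" "i \<le> j \<Longrightarrow> j \<le> k \<Longrightarrow> \<tau> i \<le> \<tau> j" "i \<le> k \<Longrightarrow> \<tau> i \<in> {0..b}"
proof -
  have step: "\<And>i. i < k \<Longrightarrow> \<tau> i < \<tau> (Suc i)" and ends: "\<tau> 0 = 0" "\<tau> k = b"
    using assms by (auto simp: simple_process_def)
  show lt: "\<tau> i < \<tau> j" if "i < j" "j \<le> k" for i j
    using that
  proof (induction j)
    case (Suc j)
    then show ?case using step[of j] by (cases "i = j") auto
  qed simp
  show le: "\<tau> i \<le> \<tau> j" if "i \<le> j" "j \<le> k" for i j
    using lt[of i j] that by (cases "i = j") auto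
  show "i \<le> k \<Longrightarrow> \<tau> i \<in> {0..b}" using le[of 0 i] le[of i k] ends by simp
qed

lemma simple_process_error:
  assumes W: "wiener_process M {0..b} W" and sp: "simple_process M W b k \<tau> \<xi>" and i: "i < k"
  shows "(\<lambda>\<omega>. \<xi> i \<omega> - W (\<tau> i) \<omega>) \<in> borel_measurable (natural_filtration M W (\<tau> i))"
    and "integrable M (\<lambda>\<omega>. (\<xi> i \<omega> - W (\<tau> i) \<omega>)\<^sup>2)"
    and "\<xi> i \<in> borel_measurable M"
proof -
  have I: "\<tau> i \<in> {0..b}" using simple_process_nodes(3)[OF sp] i by simp
  have \<xi>: "\<xi> i \<in> borel_measurable (natural_filtration M W (\<tau> i))" "integrable M (\<lambda>\<omega>. (\<xi> i \<omega>)\<^sup>2)"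
    using sp i by (auto simp: simple_process_def)
  show "(\<lambda>\<omega>. \<xi> i \<omega> - W (\<tau> i) \<omega>) \<in> borel_measurable (natural_filtration M W (\<tau> i))"
    using \<xi>(1) I by (intro borel_measurable_diff natural_filtration_value) auto
  show \<xi>m: "\<xi> i \<in> borel_measurable M" using natural_filtration_measurable[OF W _ \<xi>(1)] I by auto
  show "integrable M (\<lambda>\<omega>. (\<xi> i \<omega> - W (\<tau> i) \<omega>)\<^sup>2)"
    by (rule integrable_diff_square[OF \<xi>m wiener_measurable[OF W I] \<xi>(2) wiener_square_integrable(1)[OF W I]])
qed

text \<open>Telescoping writes the error as the sum over the steps of
  \<open>(\<xi> i - W (\<tau> i)) * D - (D\<^sup>2 - (\<tau> (Suc i) - \<tau> i)) / 2\<close> with \<open>D\<close> the increment of \<open>W\<close>, and these are orthogonal.\<close>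

lemma simple_integral_error:
  assumes W: "wiener_process M {0..b} W" and sp: "simple_process M W b k \<tau> \<xi>"
  shows "has_bochner_integral M (\<lambda>\<omega>. (simple_integral W k \<tau> \<xi> \<omega> - ito_square W b \<omega>)\<^sup>2) (squared_error M W k \<tau> \<xi>)"
proof -
  define m where "m i \<omega> = (\<xi> i \<omega> - W (\<tau> i) \<omega>) * (W (\<tau> (Suc i)) \<omega> - W (\<tau> i) \<omega>)
      - ((W (\<tau> (Suc i)) \<omega> - W (\<tau> i) \<omega>)\<^sup>2 - (\<tau> (Suc i) - \<tau> i)) / 2" for i \<omega>
  have "(\<lambda>\<omega>. \<Sum>i<j. m i \<omega>) \<in> borel_measurable (natural_filtration M W (\<tau> j)) \<and>
      has_bochner_integral M (\<lambda>\<omega>. (\<Sum>i<j. m i \<omega>)\<^sup>2) (squared_error M W j \<tau> \<xi>)" if "j \<le> k" for j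
    using that
  proof (induction j)
    case 0
    then show ?case by (simp add: squared_error_def has_bochner_integral_zero)
  next
    case (Suc j)
    then have j: "j < k" by simp
    have I: "\<tau> j \<in> {0..b}" "\<tau> (Suc j) \<in> {0..b}" using simple_process_nodes(3)[OF sp] Suc by auto
    have lt: "\<tau> j < \<tau> (Suc j)" using simple_process_nodes(1)[OF sp, of j "Suc j"] Suc by simp
    note err = simple_process_error[OF W sp j]
    have IH: "(\<lambda>\<omega>. \<Sum>i<j. m i \<omega>) \<in> borel_measurable (natural_filtration M W (\<tau> j))"
      "has_bochner_integral M (\<lambda>\<omega>. (\<Sum>i<j. m i \<omega>)\<^sup>2) (squared_error M W j \<tau> \<xi>)" using Suc by auto
    have "m j \<in> borel_measurable (natural_filtration M W (\<tau> (Suc j)))"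
      unfolding m_def[abs_def]
      using I lt by (intro borel_measurable_diff borel_measurable_times borel_measurable_divide borel_measurable_power
          natural_filtration_mono[OF _ err(1)] natural_filtration_value borel_measurable_const) auto
    moreover have "(\<lambda>\<omega>. \<Sum>i<j. m i \<omega>) \<in> borel_measurable (natural_filtration M W (\<tau> (Suc j)))"
      using natural_filtration_mono[OF _ IH(1)] lt by simp
    ultimately have "(\<lambda>\<omega>. \<Sum>i<Suc j. m i \<omega>) \<in> borel_measurable (natural_filtration M W (\<tau> (Suc j)))"
      by (simp add: borel_measurable_add)
    moreover have "has_bochner_integral M (\<lambda>\<omega>. ((\<Sum>i<j. m i \<omega>) + m j \<omega>)\<^sup>2) (squared_error M W (Suc j) \<tau> \<xi>)"
      using increment_square_error[OF W _ lt _ IH(1) _ err(1,2)] I IH(2)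
      unfolding m_def by (simp add: has_bochner_integral_iff squared_error_def)
    ultimately show ?case by simp
  qed
  from this[of k] have "has_bochner_integral M (\<lambda>\<omega>. (\<Sum>i<k. m i \<omega>)\<^sup>2) (squared_error M W k \<tau> \<xi>)" by simp
  moreover have "(\<Sum>i<k. m i \<omega>) = simple_integral W k \<tau> \<xi> \<omega> - ito_square W b \<omega>" for \<omega>
  proof -
    have "m i \<omega> = \<xi> i \<omega> * (W (\<tau> (Suc i)) \<omega> - W (\<tau> i) \<omega>)
        - (((W (\<tau> (Suc i)) \<omega>)\<^sup>2 - \<tau> (Suc i)) / 2 - ((W (\<tau> i) \<omega>)\<^sup>2 - \<tau> i) / 2)" for i
      by (simp add: m_def power2_eq_square field_simps)
    then have "(\<Sum>i<k. m i \<omega>) = simple_integral W k \<tau> \<xi> \<omega>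
        - (\<Sum>i<k. ((W (\<tau> (Suc i)) \<omega>)\<^sup>2 - \<tau> (Suc i)) / 2 - ((W (\<tau> i) \<omega>)\<^sup>2 - \<tau> i) / 2)"
      by (simp only: simple_integral_def sum_subtractf)
    also have "(\<Sum>i<k. ((W (\<tau> (Suc i)) \<omega>)\<^sup>2 - \<tau> (Suc i)) / 2 - ((W (\<tau> i) \<omega>)\<^sup>2 - \<tau> i) / 2)
        = ((W (\<tau> k) \<omega>)\<^sup>2 - \<tau> k) / 2 - ((W (\<tau> 0) \<omega>)\<^sup>2 - \<tau> 0) / 2"
      by (rule sum_lessThan_telescope)
    also have "\<dots> = ito_square W b \<omega>"
      using sp by (simp add: simple_process_def ito_square_def diff_divide_distrib)
    finally show ?thesis .
  qed
  ultimately show ?thesis by simp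
qed

lemma simple_value_on_cell:
  assumes sp: "simple_process M W b k \<tau> \<xi>" and i: "i < k" and t: "t \<in> {\<tau> i<..\<tau> (Suc i)}"
  shows "simple_value k \<tau> \<xi> t \<omega> = \<xi> i \<omega>" and "j < k \<Longrightarrow> j \<noteq> i \<Longrightarrow> t \<notin> {\<tau> j<..\<tau> (Suc j)}"
proof -
  show other: "t \<notin> {\<tau> j<..\<tau> (Suc j)}" if "j < k" "j \<noteq> i" for j
  proof (cases "j < i")
    case True
    then show ?thesis using simple_process_nodes(2)[OF sp, of "Suc j" i] i t by auto
  next
    case False
    then show ?thesis using simple_process_nodes(2)[OF sp, of "Suc i" j] that t by auto
  qed
  have "simple_value k \<tau> \<xi> t \<omega> = (\<Sum>j<k. if j = i then \<xi> i \<omega> else 0)"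
    unfolding simple_value_def using other t by (intro sum.cong) (auto simp: indicator_def)
  then show "simple_value k \<tau> \<xi> t \<omega> = \<xi> i \<omega>" using i by simp
qed

lemma simple_process_cell:
  assumes sp: "simple_process M W b k \<tau> \<xi>" and t: "t \<in> {0<..b}"
  obtains i where "i < k" "t \<in> {\<tau> i<..\<tau> (Suc i)}"
proof -
  have "\<exists>i<j. t \<in> {\<tau> i<..\<tau> (Suc i)}" if "j \<le> k" "t \<le> \<tau> j" for j
    using that
  proof (induction j)
    case 0
    then show ?case using sp t by (simp add: simple_process_def)
  next
    case (Suc j)
    show ?case
    proof (cases "t \<le> \<tau> j")
      case True
      then show ?thesis using Suc by (meson Suc_leD less_SucI)
    next
      case False
      then show ?thesis using Suc.prems by (intro exI[of _ j]) auto
    qed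
  qed
  from this[of k] show ?thesis using that sp t by (auto simp: simple_process_def)
qed

lemma integral_affine:
  fixes u v c :: real
  assumes "u \<le> v"
  shows "integral {u..v} (\<lambda>t. c + (t - u)) = c * (v - u) + (v - u)\<^sup>2 / 2"
proof -
  have "((\<lambda>t. c + (t - u)) has_integral (c * (v - u) + (v - u)\<^sup>2 / 2) - (c * (u - u) + (u - u)\<^sup>2 / 2)) {u..v}"
    using assms
    by (intro fundamental_theorem_of_calculus)
      (auto intro!: derivative_eq_intros simp: has_real_derivative_iff_has_vector_derivative[symmetric])
  then show ?thesis by (simp add: integral_unique)
qed

lemma AE_lborel_neq: "AE t in lborel. t \<noteq> (c::real)"
  by (rule AE_I'[of "{c}"]) (auto simp: null_sets_def)

text \<open>The same number as in \<open>simple_integral_error\<close>: on a cell of length \<open>\<delta>\<close> the error at time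
  \<open>\<tau> i + u\<close> has second moment \<open>E (\<xi> i - W (\<tau> i))\<^sup>2 + u\<close>, and integrating \<open>u\<close> gives \<open>\<delta>\<^sup>2 / 2\<close>. Hence the approximating integrals
  converge to \<open>ito_square\<close> exactly when the simple processes converge to \<open>W\<close>, which yields existence and uniqueness
  of the Ito integral without a refinement of partitions.\<close>

lemma simple_value_error:
  assumes W: "wiener_process M {0..b} W" and sp: "simple_process M W b k \<tau> \<xi>"
  shows "(\<integral>\<^sup>+\<omega>. (\<integral>\<^sup>+t\<in>{0..b}. ennreal ((W t \<omega> - simple_value k \<tau> \<xi> t \<omega>)\<^sup>2) \<partial>lborel) \<partial>M) = ennreal (squared_error M W k \<tau> \<xi>)"
proof -
  interpret prob_space M using W by (simp add: wiener_process_def)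
  let ?p = "\<lambda>i \<omega>. integral {\<tau> i..\<tau> (Suc i)} (\<lambda>t. (W t \<omega> - \<xi> i \<omega>)\<^sup>2)"
  have Wc: "continuous_on {0..b} (\<lambda>t. W t \<omega>)" if "\<omega> \<in> space M" for \<omega>
    using W that by (simp add: wiener_process_def continuous_process_def)
  have nodes: "\<tau> i \<in> {0..b}" "\<tau> (Suc i) \<in> {0..b}" "\<tau> i < \<tau> (Suc i)" if "i < k" for i
    using simple_process_nodes[OF sp] that by auto
  have path: "(\<integral>\<^sup>+t\<in>{0..b}. ennreal ((W t \<omega> - simple_value k \<tau> \<xi> t \<omega>)\<^sup>2) \<partial>lborel) = (\<Sum>i<k. ennreal (?p i \<omega>))"
    if w: "\<omega> \<in> space M" for \<omega>
  proof -
    define f where "f i t = ennreal ((W t \<omega> - \<xi> i \<omega>)\<^sup>2) * indicator {\<tau> i<..\<tau> (Suc i)} t" for i t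
    have sub: "continuous_on {\<tau> i..\<tau> (Suc i)} (\<lambda>t. (W t \<omega> - \<xi> i \<omega>)\<^sup>2)" if "i < k" for i
      using nodes[OF that] by (intro continuous_intros continuous_on_subset[OF Wc[OF w]]) auto
    have fm: "f i \<in> borel_measurable borel" if "i < k" for i
    proof -
      have "(\<lambda>t. indicator {\<tau> i<..\<tau> (Suc i)} t *\<^sub>R (W t \<omega> - \<xi> i \<omega>)\<^sup>2) \<in> borel_measurable borel"
        by (intro borel_measurable_continuous_on_indicator continuous_on_subset[OF sub[OF that]]) auto
      from measurable_compose[OF this measurable_ennreal] show ?thesis
        by (rule measurable_cong[THEN iffD1, rotated]) (auto simp: f_def indicator_def)
    qed
    have "(\<integral>\<^sup>+t\<in>{0..b}. ennreal ((W t \<omega> - simple_value k \<tau> \<xi> t \<omega>)\<^sup>2) \<partial>lborel) = (\<integral>\<^sup>+t. (\<Sum>i<k. f i t) \<partial>lborel)"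
    proof (rule nn_integral_cong_AE, use AE_lborel_neq[of 0] in eventually_elim)
      fix t :: real assume t0: "t \<noteq> 0"
      show "ennreal ((W t \<omega> - simple_value k \<tau> \<xi> t \<omega>)\<^sup>2) * indicator {0..b} t = (\<Sum>i<k. f i t)"
      proof (cases "t \<in> {0<..b}")
        case True
        obtain i where i: "i < k" "t \<in> {\<tau> i<..\<tau> (Suc i)}" by (rule simple_process_cell[OF sp True])
        have "(\<Sum>j<k. f j t) = (\<Sum>j<k. if j = i then f i t else 0)"
          using simple_value_on_cell(2)[OF sp i] by (intro sum.cong) (auto simp: f_def indicator_def)
        then show ?thesis using i True simple_value_on_cell(1)[OF sp i] by (simp add: f_def)
      next
        case False
        have "f i t = 0" if "i < k" for i
          using False nodes[OF that] by (auto simp: f_def indicator_def)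
        then show ?thesis using False t0 by (auto simp: indicator_def)
      qed
    qed
    also have "\<dots> = (\<Sum>i<k. \<integral>\<^sup>+t. f i t \<partial>lborel)"
      using fm by (intro nn_integral_sum) auto
    also have "\<dots> = (\<Sum>i<k. ennreal (?p i \<omega>))"
    proof (intro sum.cong refl)
      fix i assume "i \<in> {..<k}"
      then have i: "i < k" by simp
      have "(\<integral>\<^sup>+t. f i t \<partial>lborel) = (\<integral>\<^sup>+t\<in>{\<tau> i..\<tau> (Suc i)}. ennreal ((W t \<omega> - \<xi> i \<omega>)\<^sup>2) \<partial>lborel)"
        by (rule nn_integral_cong_AE, use AE_lborel_neq[of "\<tau> i"] in eventually_elim) (auto simp: f_def indicator_def)
      then show "(\<integral>\<^sup>+t. f i t \<partial>lborel) = ennreal (?p i \<omega>)"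
        using nn_integral_continuous_ivl[OF sub[OF i]] by simp
    qed
    finally show ?thesis .
  qed
  have piece_meas: "?p i \<in> borel_measurable M" if i: "i < k" for i
    using nodes[OF i] simple_process_error(3)[OF W sp i]
    by (intro borel_measurable_integral_process borel_measurable_power borel_measurable_diff wiener_measurable[OF W]
        continuous_intros continuous_on_subset[OF Wc]) auto
  have piece: "(\<integral>\<^sup>+\<omega>. ennreal (?p i \<omega>) \<partial>M)
      = ennreal ((\<integral>\<omega>. (\<xi> i \<omega> - W (\<tau> i) \<omega>)\<^sup>2 \<partial>M) * (\<tau> (Suc i) - \<tau> i) + (\<tau> (Suc i) - \<tau> i)\<^sup>2 / 2)" (is "_ = ennreal ?e")
    if i: "i < k" for i
  proof -
    note n = nodes[OF i] and err = simple_process_error[OF W sp i]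
    let ?c = "\<integral>\<omega>. (\<xi> i \<omega> - W (\<tau> i) \<omega>)\<^sup>2 \<partial>M"
    have sq: "(\<integral>\<^sup>+\<omega>. ennreal ((W t \<omega> - \<xi> i \<omega>)\<^sup>2) \<partial>M) = ennreal (?c + (t - \<tau> i))" if t: "t \<in> {\<tau> i..\<tau> (Suc i)}" for t
    proof (cases "t = \<tau> i")
      case True
      have "(\<integral>\<^sup>+\<omega>. ennreal ((W t \<omega> - \<xi> i \<omega>)\<^sup>2) \<partial>M) = (\<integral>\<^sup>+\<omega>. ennreal ((\<xi> i \<omega> - W (\<tau> i) \<omega>)\<^sup>2) \<partial>M)"
        unfolding True by (subst power2_commute) (rule refl)
      also have "\<dots> = ennreal ?c" by (rule nn_integral_eq_integral[OF err(2)]) simp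
      finally show ?thesis using True by simp
    next
      case False
      then have lt: "\<tau> i < t" "0 \<le> \<tau> i" "t \<le> b" "t \<in> {0..b}" using t n by auto
      have \<zeta>i: "integrable M (\<lambda>\<omega>. \<xi> i \<omega> - W (\<tau> i) \<omega>)"
        by (rule integrable_of_square[OF prob_space_axioms borel_measurable_diff[OF err(3) wiener_measurable[OF W n(1)]] err(2)])
      note mom = wiener_increment_moments[OF W n(1) lt(4,1)]
      note has_bochner_integral_add[OF has_bochner_integral_diff[OF has_bochner_integral_integrable[OF mom(1)[of 2]]
          has_bochner_integral_mult_right[OF has_integral_mult_increment_power[OF W lt(2,1,3) err(1) \<zeta>i, of 1], of 2]]
          has_bochner_integral_integrable[OF err(2)]]
      moreover have "(W t \<omega> - W (\<tau> i) \<omega>)\<^sup>2 - 2 * ((\<xi> i \<omega> - W (\<tau> i) \<omega>) * (W t \<omega> - W (\<tau> i) \<omega>) ^ 1)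
          + (\<xi> i \<omega> - W (\<tau> i) \<omega>)\<^sup>2 = (W t \<omega> - \<xi> i \<omega>)\<^sup>2" for \<omega>
        by (simp add: power2_eq_square algebra_simps)
      ultimately have "has_bochner_integral M (\<lambda>\<omega>. (W t \<omega> - \<xi> i \<omega>)\<^sup>2) (?c + (t - \<tau> i))"
        using mom(2,3) by (simp add: add.commute)
      then show ?thesis by (subst nn_integral_eq_integral) (auto simp: has_bochner_integral_iff)
    qed
    have "(\<integral>\<^sup>+\<omega>. ennreal (?p i \<omega>) \<partial>M) = (\<integral>\<^sup>+t\<in>{\<tau> i..\<tau> (Suc i)}. (\<integral>\<^sup>+\<omega>. ennreal ((W t \<omega> - \<xi> i \<omega>)\<^sup>2) \<partial>M) \<partial>lborel)"
      using n err(3)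
      by (intro expectation_integral_process borel_measurable_power borel_measurable_diff wiener_measurable[OF W]
          continuous_intros continuous_on_subset[OF Wc] sigma_finite_measure_axioms) auto
    also have "\<dots> = (\<integral>\<^sup>+t\<in>{\<tau> i..\<tau> (Suc i)}. ennreal (?c + (t - \<tau> i)) \<partial>lborel)"
      by (intro nn_integral_cong) (auto simp: sq split: split_indicator)
    also have "\<dots> = ennreal (integral {\<tau> i..\<tau> (Suc i)} (\<lambda>t. ?c + (t - \<tau> i)))"
      by (intro nn_integral_continuous_ivl continuous_intros) auto
    also have "\<dots> = ennreal ?e" using n by (subst integral_affine) auto
    finally show ?thesis .
  qed
  have "(\<integral>\<^sup>+\<omega>. (\<integral>\<^sup>+t\<in>{0..b}. ennreal ((W t \<omega> - simple_value k \<tau> \<xi> t \<omega>)\<^sup>2) \<partial>lborel) \<partial>M) = (\<integral>\<^sup>+\<omega>. (\<Sum>i<k. ennreal (?p i \<omega>)) \<partial>M)"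
    by (rule nn_integral_cong) (rule path)
  also have "\<dots> = (\<Sum>i<k. \<integral>\<^sup>+\<omega>. ennreal (?p i \<omega>) \<partial>M)"
    using piece_meas by (intro nn_integral_sum) auto
  also have "\<dots> = ennreal (squared_error M W k \<tau> \<xi>)"
    unfolding squared_error_def using nodes by (subst sum_ennreal[symmetric]) (auto simp: piece less_imp_le intro!: add_nonneg_nonneg mult_nonneg_nonneg)
  finally show ?thesis .
qed

definition uniform_node :: "real \<Rightarrow> nat \<Rightarrow> nat \<Rightarrow> real" where
  "uniform_node b n i = real i * (b / real (Suc n))"

lemma uniform_simple_process:
  assumes W: "wiener_process M {0..b} W" and b: "b > 0"
  shows "simple_process M W b (Suc n) (uniform_node b n) (\<lambda>i. W (uniform_node b n i))"
    and "squared_error M W (Suc n) (uniform_node b n) (\<lambda>i. W (uniform_node b n i)) = b\<^sup>2 / 2 / real (Suc n)"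
proof -
  have step: "uniform_node b n (Suc i) - uniform_node b n i = b / real (Suc n)" for i
    by (simp add: uniform_node_def add_divide_distrib distrib_right)
  have nodes: "uniform_node b n i \<in> {0..b}" if "i \<le> Suc n" for i
  proof -
    have "real i * b \<le> real (Suc n) * b" using that b by (intro mult_right_mono) auto
    then show ?thesis using b by (simp add: uniform_node_def pos_divide_le_eq mult.commute del: of_nat_Suc)
  qed
  show "simple_process M W b (Suc n) (uniform_node b n) (\<lambda>i. W (uniform_node b n i))"
    unfolding simple_process_def
  proof (intro conjI allI impI)
    show "uniform_node b n 0 = 0" "uniform_node b n (Suc n) = b" by (auto simp: uniform_node_def simp del: of_nat_Suc)
    fix i assume "i < Suc n"
    then have I: "uniform_node b n i \<in> {0..b}" using nodes[of i] by simp
    show "uniform_node b n i < uniform_node b n (Suc i)" using step[of i] b by (smt (verit) divide_pos_pos of_nat_0_less_iff zero_less_Suc)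
    show "W (uniform_node b n i) \<in> borel_measurable (natural_filtration M W (uniform_node b n i))"
      using I by (intro natural_filtration_value) auto
    show "integrable M (\<lambda>\<omega>. (W (uniform_node b n i) \<omega>)\<^sup>2)" by (rule wiener_square_integrable[OF W I])
  qed
  have "squared_error M W (Suc n) (uniform_node b n) (\<lambda>i. W (uniform_node b n i)) = real (Suc n) * ((b / real (Suc n))\<^sup>2 / 2)"
    unfolding squared_error_def step by simp
  also have "\<dots> = b\<^sup>2 / 2 / real (Suc n)"
  proof -
    have "x * ((b / x)\<^sup>2 / 2) = b\<^sup>2 / 2 / x" if "x \<noteq> 0" for x :: real
      using that by (simp add: power2_eq_square)
    then show ?thesis using of_nat_neq_0 by blast
  qed
  finally show "squared_error M W (Suc n) (uniform_node b n) (\<lambda>i. W (uniform_node b n i)) = b\<^sup>2 / 2 / real (Suc n)" .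
qed

lemma uniform_error_tendsto: "(\<lambda>n. ennreal (b\<^sup>2 / 2 / real (Suc n))) \<longlonglongrightarrow> 0"
proof -
  have "(\<lambda>n. b\<^sup>2 / 2 / real (Suc n)) \<longlonglongrightarrow> b\<^sup>2 / 2 * 0"
    unfolding divide_inverse[of _ "real (Suc _)"] by (intro tendsto_mult tendsto_const LIMSEQ_inverse_real_of_nat)
  from tendsto_ennrealI[OF this] show ?thesis by simp
qed

lemma simple_integral_error_nn:
  assumes W: "wiener_process M {0..b} W" and sp: "simple_process M W b k \<tau> \<xi>"
  shows "(\<integral>\<^sup>+\<omega>. ennreal ((ito_square W b \<omega> - simple_integral W k \<tau> \<xi> \<omega>)\<^sup>2) \<partial>M) = ennreal (squared_error M W k \<tau> \<xi>)"
  using simple_integral_error[OF W sp]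
  by (subst power2_commute, subst nn_integral_eq_integral) (auto simp: has_bochner_integral_iff)

lemma ito_square_measurable:
  assumes W: "wiener_process M {0..b} W" and b: "b > 0"
  shows "ito_square W b \<in> borel_measurable M"
proof -
  have [measurable]: "W b \<in> borel_measurable M" "W 0 \<in> borel_measurable M" using b by (auto intro!: wiener_measurable[OF W])
  show ?thesis unfolding ito_square_def[abs_def] by measurable
qed

lemma has_ito_integral_wiener:
  assumes W: "wiener_process M {0..b} W" and b: "b > 0"
  shows "has_ito_integral M W b W (ito_square W b)"
  unfolding has_ito_integral_def
proof (intro conjI ballI exI allI)
  show "ito_square W b \<in> borel_measurable M" by (rule ito_square_measurable[OF W b])
  show "(\<lambda>(t, \<omega>). W t \<omega>) \<in> borel_measurable (restrict_space borel {0..b} \<Otimes>\<^sub>M M)"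
    using W b by (intro borel_measurable_process_pair) (auto simp: wiener_process_def continuous_process_def)
  show "W t \<in> borel_measurable (natural_filtration M W t)" if "t \<in> {0..b}" for t
    using that by (intro natural_filtration_value) auto
  show "simple_process M W b (Suc n) (uniform_node b n) (\<lambda>i. W (uniform_node b n i))" for n
    by (rule uniform_simple_process[OF W b])
  show "(\<lambda>n. \<integral>\<^sup>+\<omega>. (\<integral>\<^sup>+t\<in>{0..b}. ennreal ((W t \<omega> - simple_value (Suc n) (uniform_node b n) (\<lambda>i. W (uniform_node b n i)) t \<omega>)\<^sup>2) \<partial>lborel) \<partial>M) \<longlonglongrightarrow> 0"
    unfolding simple_value_error[OF W uniform_simple_process(1)[OF W b]] uniform_simple_process(2)[OF W b]
    by (rule uniform_error_tendsto)
  show "(\<lambda>n. \<integral>\<^sup>+\<omega>. ennreal ((ito_square W b \<omega> - simple_integral W (Suc n) (uniform_node b n) (\<lambda>i. W (uniform_node b n i)) \<omega>)\<^sup>2) \<partial>M) \<longlonglongrightarrow> 0"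
    unfolding simple_integral_error_nn[OF W uniform_simple_process(1)[OF W b]] uniform_simple_process(2)[OF W b]
    by (rule uniform_error_tendsto)
qed

lemma has_ito_integral_wiener_unique:
  assumes W: "wiener_process M {0..b} W" and b: "b > 0" and Y: "has_ito_integral M W b W Y"
  shows "AE \<omega> in M. Y \<omega> = ito_square W b \<omega>"
proof -
  obtain k \<tau> \<xi> where sp: "\<And>n::nat. simple_process M W b (k n) (\<tau> n) (\<xi> n)"
    and l1: "(\<lambda>n. \<integral>\<^sup>+\<omega>. (\<integral>\<^sup>+t\<in>{0..b}. ennreal ((W t \<omega> - simple_value (k n) (\<tau> n) (\<xi> n) t \<omega>)\<^sup>2) \<partial>lborel) \<partial>M) \<longlonglongrightarrow> 0"
    and l2: "(\<lambda>n. \<integral>\<^sup>+\<omega>. ennreal ((Y \<omega> - simple_integral W (k n) (\<tau> n) (\<xi> n) \<omega>)\<^sup>2) \<partial>M) \<longlonglongrightarrow> 0"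
    and Ym [measurable]: "Y \<in> borel_measurable M"
    using Y unfolding has_ito_integral_def by blast
  note [measurable] = ito_square_measurable[OF W b]
  have SI [measurable]: "simple_integral W (k n) (\<tau> n) (\<xi> n) \<in> borel_measurable M" for n
    unfolding simple_integral_def[abs_def]
    using simple_process_error(3)[OF W sp[of n]] simple_process_nodes(3)[OF sp[of n]]
    by (intro borel_measurable_sum borel_measurable_times borel_measurable_diff wiener_measurable[OF W]) auto
  let ?d = "\<integral>\<^sup>+\<omega>. ennreal ((Y \<omega> - ito_square W b \<omega>)\<^sup>2) \<partial>M"
  have le: "?d \<le> 2 * (\<integral>\<^sup>+\<omega>. ennreal ((Y \<omega> - simple_integral W (k n) (\<tau> n) (\<xi> n) \<omega>)\<^sup>2) \<partial>M)
      + 2 * (\<integral>\<^sup>+\<omega>. (\<integral>\<^sup>+t\<in>{0..b}. ennreal ((W t \<omega> - simple_value (k n) (\<tau> n) (\<xi> n) t \<omega>)\<^sup>2) \<partial>lborel) \<partial>M)" for n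
  proof -
    have sq: "(x - y)\<^sup>2 \<le> 2 * (x - z)\<^sup>2 + 2 * (y - z)\<^sup>2" for x y z :: real
      using zero_le_power2[of "x + y - 2 * z"] by (simp add: power2_eq_square algebra_simps)
    have "?d \<le> (\<integral>\<^sup>+\<omega>. 2 * ennreal ((Y \<omega> - simple_integral W (k n) (\<tau> n) (\<xi> n) \<omega>)\<^sup>2)
        + 2 * ennreal ((ito_square W b \<omega> - simple_integral W (k n) (\<tau> n) (\<xi> n) \<omega>)\<^sup>2) \<partial>M)"
    proof (rule nn_integral_mono)
      fix \<omega>
      have dbl: "2 * ennreal x + 2 * ennreal y = ennreal (2 * x + 2 * y)" if "x \<ge> 0" "y \<ge> 0" for x y
        using that by (simp add: ennreal_mult)
      show "ennreal ((Y \<omega> - ito_square W b \<omega>)\<^sup>2) \<le> 2 * ennreal ((Y \<omega> - simple_integral W (k n) (\<tau> n) (\<xi> n) \<omega>)\<^sup>2)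
        + 2 * ennreal ((ito_square W b \<omega> - simple_integral W (k n) (\<tau> n) (\<xi> n) \<omega>)\<^sup>2)"
        unfolding dbl[OF zero_le_power2 zero_le_power2] by (rule ennreal_leI[OF sq])
    qed
    also have "\<dots> = 2 * (\<integral>\<^sup>+\<omega>. ennreal ((Y \<omega> - simple_integral W (k n) (\<tau> n) (\<xi> n) \<omega>)\<^sup>2) \<partial>M)
        + 2 * (\<integral>\<^sup>+\<omega>. ennreal ((ito_square W b \<omega> - simple_integral W (k n) (\<tau> n) (\<xi> n) \<omega>)\<^sup>2) \<partial>M)"
      by (subst nn_integral_add) (auto simp: nn_integral_cmult)
    finally show ?thesis unfolding simple_integral_error_nn[OF W sp] simple_value_error[OF W sp] .
  qed
  have "(\<lambda>n. 2 * (\<integral>\<^sup>+\<omega>. ennreal ((Y \<omega> - simple_integral W (k n) (\<tau> n) (\<xi> n) \<omega>)\<^sup>2) \<partial>M)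
      + 2 * (\<integral>\<^sup>+\<omega>. (\<integral>\<^sup>+t\<in>{0..b}. ennreal ((W t \<omega> - simple_value (k n) (\<tau> n) (\<xi> n) t \<omega>)\<^sup>2) \<partial>lborel) \<partial>M)) \<longlonglongrightarrow> 2 * 0 + 2 * 0"
    by (intro tendsto_add ennreal_tendsto_cmult l1 l2) auto
  then have "?d \<le> 0" using le by (intro LIMSEQ_le_const[of _ _ ?d]) auto
  then have "AE \<omega> in M. ennreal ((Y \<omega> - ito_square W b \<omega>)\<^sup>2) = 0"
    by (subst (asm) le_zero_eq, subst (asm) nn_integral_0_iff_AE) auto
  then show ?thesis by eventually_elim simp
qed

theorem ito_integral_wiener:
  assumes W: "wiener_process M {0..b} W" and b: "b > 0"
  shows "ito_integral M W b W \<in> borel_measurable M"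
    and "AE \<omega> in M. ito_integral M W b W \<omega> = ((W b \<omega>)\<^sup>2 - b) / 2"
proof -
  have Y: "has_ito_integral M W b W (ito_integral M W b W)"
    unfolding ito_integral_def by (rule someI[of "has_ito_integral M W b W", OF has_ito_integral_wiener[OF W b]])
  then show "ito_integral M W b W \<in> borel_measurable M" by (simp add: has_ito_integral_def)
  have "AE \<omega> in M. W 0 \<omega> = 0" using W by (simp add: wiener_process_def)
  with has_ito_integral_wiener_unique[OF W b Y]
  show "AE \<omega> in M. ito_integral M W b W \<omega> = ((W b \<omega>)\<^sup>2 - b) / 2"
    by eventually_elim (simp add: ito_square_def)
qed

section \<open>Convergence in probability and in distribution\<close>

text \<open>Boundedness in probability along the filter \<open>F\<close>.\<close>

definition tight :: "'o measure \<Rightarrow> ('i \<Rightarrow> 'o \<Rightarrow> real) \<Rightarrow> 'i filter \<Rightarrow> bool" where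
  "tight M S F \<longleftrightarrow> (\<forall>\<^sub>F i in F. S i \<in> borel_measurable M) \<and>
     (\<forall>\<delta>>0. \<exists>K. \<forall>\<^sub>F i in F. measure M {\<omega> \<in> space M. K < \<bar>S i \<omega>\<bar>} \<le> \<delta>)"

context prob_space
begin

abbreviation to_zero :: "('i \<Rightarrow> 'a \<Rightarrow> real) \<Rightarrow> 'i filter \<Rightarrow> bool" where
  "to_zero R F \<equiv> tends_to_zero_in_probability M R F"

lemma to_zeroD: "to_zero R F \<Longrightarrow> \<epsilon> > 0 \<Longrightarrow> ((\<lambda>i. prob {\<omega> \<in> space M. \<epsilon> < \<bar>R i \<omega>\<bar>}) \<longlongrightarrow> 0) F"
  and to_zero_measurable: "to_zero R F \<Longrightarrow> \<forall>\<^sub>F i in F. R i \<in> borel_measurable M"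
  by (auto simp: tends_to_zero_in_probability_def)

lemma to_zeroI:
  assumes "\<forall>\<^sub>F i in F. R i \<in> borel_measurable M"
    and "\<And>\<epsilon> \<delta>. \<epsilon> > 0 \<Longrightarrow> \<delta> > 0 \<Longrightarrow> \<forall>\<^sub>F i in F. prob {\<omega> \<in> space M. \<epsilon> < \<bar>R i \<omega>\<bar>} < \<delta>"
  shows "to_zero R F"
  unfolding tends_to_zero_in_probability_def
proof (intro conjI allI impI assms(1))
  fix \<epsilon> :: real assume "\<epsilon> > 0"
  show "((\<lambda>i. prob {\<omega> \<in> space M. \<epsilon> < \<bar>R i \<omega>\<bar>}) \<longlongrightarrow> 0) F"
  proof (rule order_tendstoI)
    show "\<forall>\<^sub>F i in F. prob {\<omega> \<in> space M. \<epsilon> < \<bar>R i \<omega>\<bar>} < \<delta>" if "0 < \<delta>" for \<delta>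
      by (rule assms(2)[OF \<open>\<epsilon> > 0\<close> that])
    show "\<forall>\<^sub>F i in F. \<delta> < prob {\<omega> \<in> space M. \<epsilon> < \<bar>R i \<omega>\<bar>}" if "\<delta> < 0" for \<delta>
      using that by (intro always_eventually allI) (meson measure_nonneg order_less_le_trans)
  qed
qed

lemma to_zero_less: "to_zero R F \<Longrightarrow> \<epsilon> > 0 \<Longrightarrow> \<delta> > 0 \<Longrightarrow> \<forall>\<^sub>F i in F. prob {\<omega> \<in> space M. \<epsilon> < \<bar>R i \<omega>\<bar>} < \<delta>"
  using order_tendstoD(2)[OF to_zeroD] by blast

lemma to_zero_bound:
  assumes S: "to_zero S F" and R: "\<forall>\<^sub>F i in F. R i \<in> borel_measurable M"
    and le: "\<forall>\<^sub>F i in F. AE \<omega> in M. \<bar>R i \<omega>\<bar> \<le> \<bar>S i \<omega>\<bar>"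
  shows "to_zero R F"
proof (rule to_zeroI[OF R])
  fix \<epsilon> \<delta> :: real assume "\<epsilon> > 0" "\<delta> > 0"
  from to_zero_less[OF S this] le R to_zero_measurable[OF S]
  show "\<forall>\<^sub>F i in F. prob {\<omega> \<in> space M. \<epsilon> < \<bar>R i \<omega>\<bar>} < \<delta>"
  proof eventually_elim
    case (elim i)
    note [measurable] = elim(3,4)
    have "prob {\<omega> \<in> space M. \<epsilon> < \<bar>R i \<omega>\<bar>} \<le> prob {\<omega> \<in> space M. \<epsilon> < \<bar>S i \<omega>\<bar>}"
      using elim(2) by (intro finite_measure_mono_AE) (auto elim!: eventually_mono)
    then show ?case using elim(1) by simp
  qed
qed

lemma to_zero_abs: "to_zero R F \<Longrightarrow> to_zero (\<lambda>i \<omega>. \<bar>R i \<omega>\<bar>) F"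
  by (rule to_zero_bound) (auto elim!: eventually_mono dest: to_zero_measurable)

lemma to_zero_add:
  assumes R: "to_zero R F" and S: "to_zero S F"
  shows "to_zero (\<lambda>i \<omega>. R i \<omega> + S i \<omega>) F"
proof (rule to_zeroI)
  show "\<forall>\<^sub>F i in F. (\<lambda>\<omega>. R i \<omega> + S i \<omega>) \<in> borel_measurable M"
    using to_zero_measurable[OF R] to_zero_measurable[OF S] by eventually_elim simp
  fix \<epsilon> \<delta> :: real assume "\<epsilon> > 0" "\<delta> > 0"
  then have h: "\<epsilon> / 2 > 0" "\<delta> / 2 > 0" by auto
  from to_zero_less[OF R h] to_zero_less[OF S h] to_zero_measurable[OF R] to_zero_measurable[OF S]
  show "\<forall>\<^sub>F i in F. prob {\<omega> \<in> space M. \<epsilon> < \<bar>R i \<omega> + S i \<omega>\<bar>} < \<delta>"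
  proof eventually_elim
    case (elim i)
    note [measurable] = elim(3,4)
    have "prob {\<omega> \<in> space M. \<epsilon> < \<bar>R i \<omega> + S i \<omega>\<bar>}
        \<le> prob ({\<omega> \<in> space M. \<epsilon> / 2 < \<bar>R i \<omega>\<bar>} \<union> {\<omega> \<in> space M. \<epsilon> / 2 < \<bar>S i \<omega>\<bar>})"
      by (intro finite_measure_mono) auto
    also have "\<dots> \<le> prob {\<omega> \<in> space M. \<epsilon> / 2 < \<bar>R i \<omega>\<bar>} + prob {\<omega> \<in> space M. \<epsilon> / 2 < \<bar>S i \<omega>\<bar>}"
      by (intro measure_subadditive) auto
    finally show ?case using elim(1,2) by simp
  qed
qed

lemma to_zero_tight_mult:
  assumes S: "tight M S F" and R: "to_zero R F"
  shows "to_zero (\<lambda>i \<omega>. S i \<omega> * R i \<omega>) F"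
proof (rule to_zeroI)
  have Sm: "\<forall>\<^sub>F i in F. S i \<in> borel_measurable M" using S by (simp add: tight_def)
  then show "\<forall>\<^sub>F i in F. (\<lambda>\<omega>. S i \<omega> * R i \<omega>) \<in> borel_measurable M"
    using to_zero_measurable[OF R] by eventually_elim simp
  fix \<epsilon> \<delta> :: real assume e: "\<epsilon> > 0" "\<delta> > 0"
  then have "\<delta> / 2 > 0" by simp
  then obtain K0 where K0: "\<forall>\<^sub>F i in F. prob {\<omega> \<in> space M. K0 < \<bar>S i \<omega>\<bar>} \<le> \<delta> / 2"
    using S unfolding tight_def by blast
  define K where "K = max K0 1"
  have K: "K > 0" "K \<ge> K0" by (auto simp: K_def)
  have "\<epsilon> / K > 0" "\<delta> / 2 > 0" using e K by auto
  from to_zero_less[OF R this] K0 Sm to_zero_measurable[OF R]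
  show "\<forall>\<^sub>F i in F. prob {\<omega> \<in> space M. \<epsilon> < \<bar>S i \<omega> * R i \<omega>\<bar>} < \<delta>"
  proof eventually_elim
    case (elim i)
    note [measurable] = elim(3,4)
    have "prob {\<omega> \<in> space M. \<epsilon> < \<bar>S i \<omega> * R i \<omega>\<bar>}
        \<le> prob ({\<omega> \<in> space M. K0 < \<bar>S i \<omega>\<bar>} \<union> {\<omega> \<in> space M. \<epsilon> / K < \<bar>R i \<omega>\<bar>})"
    proof (intro finite_measure_mono)
      show "{\<omega> \<in> space M. \<epsilon> < \<bar>S i \<omega> * R i \<omega>\<bar>} \<subseteq> {\<omega> \<in> space M. K0 < \<bar>S i \<omega>\<bar>} \<union> {\<omega> \<in> space M. \<epsilon> / K < \<bar>R i \<omega>\<bar>}"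
      proof safe
        fix \<omega> assume a: "\<epsilon> < \<bar>S i \<omega> * R i \<omega>\<bar>" "\<not> \<epsilon> / K < \<bar>R i \<omega>\<bar>"
        show "K0 < \<bar>S i \<omega>\<bar>"
        proof (rule ccontr)
          assume "\<not> K0 < \<bar>S i \<omega>\<bar>"
          then have "\<bar>S i \<omega>\<bar> * \<bar>R i \<omega>\<bar> \<le> K * (\<epsilon> / K)" using a K by (intro mult_mono) auto
          then show False using a K by (simp add: abs_mult)
        qed
      qed
    qed auto
    also have "\<dots> \<le> prob {\<omega> \<in> space M. K0 < \<bar>S i \<omega>\<bar>} + prob {\<omega> \<in> space M. \<epsilon> / K < \<bar>R i \<omega>\<bar>}"
      by (intro measure_subadditive) auto
    finally show ?case using elim(1,2) by simp
  qed
qed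

lemma to_zero_real:
  assumes "(e \<longlongrightarrow> 0) F"
  shows "to_zero (\<lambda>i \<omega>. e i) F"
proof (rule to_zeroI)
  fix \<epsilon> \<delta> :: real assume "\<epsilon> > 0" "\<delta> > 0"
  then have "\<forall>\<^sub>F i in F. \<bar>e i\<bar> < \<epsilon>" using assms by (simp add: tendsto_iff dist_real_def)
  then show "\<forall>\<^sub>F i in F. prob {\<omega> \<in> space M. \<epsilon> < \<bar>e i\<bar>} < \<delta>"
    by eventually_elim (use \<open>\<delta> > 0\<close> in auto)
qed auto

lemma markov_prob:
  assumes [measurable]: "R \<in> borel_measurable M" and le: "(\<integral>\<^sup>+\<omega>. ennreal \<bar>R \<omega>\<bar> \<partial>M) \<le> ennreal C" and C: "C \<ge> 0" and \<epsilon>: "\<epsilon> > 0"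
  shows "prob {\<omega> \<in> space M. \<epsilon> < \<bar>R \<omega>\<bar>} \<le> C / \<epsilon>"
proof -
  have "ennreal \<epsilon> * emeasure M {\<omega> \<in> space M. \<epsilon> < \<bar>R \<omega>\<bar>} = (\<integral>\<^sup>+\<omega>. ennreal \<epsilon> * indicator {\<omega> \<in> space M. \<epsilon> < \<bar>R \<omega>\<bar>} \<omega> \<partial>M)"
    by (subst nn_integral_cmult_indicator) auto
  also have "\<dots> \<le> (\<integral>\<^sup>+\<omega>. ennreal \<bar>R \<omega>\<bar> \<partial>M)"
    by (intro nn_integral_mono) (auto simp: indicator_def intro: ennreal_leI)
  also have "\<dots> \<le> ennreal C" by (rule le)
  finally have "ennreal (\<epsilon> * prob {\<omega> \<in> space M. \<epsilon> < \<bar>R \<omega>\<bar>}) \<le> ennreal C"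
    using \<epsilon> by (simp add: emeasure_eq_measure ennreal_mult)
  then have "\<epsilon> * prob {\<omega> \<in> space M. \<epsilon> < \<bar>R \<omega>\<bar>} \<le> C" using C by simp
  then show ?thesis using \<epsilon> by (simp add: pos_le_divide_eq mult.commute)
qed

lemma to_zero_L1:
  assumes R: "\<forall>\<^sub>F i in F. R i \<in> borel_measurable M"
    and le: "\<forall>\<^sub>F i in F. (\<integral>\<^sup>+\<omega>. ennreal \<bar>R i \<omega>\<bar> \<partial>M) \<le> ennreal (e i)" and e: "(e \<longlongrightarrow> 0) F"
  shows "to_zero R F"
proof (rule to_zeroI[OF R])
  fix \<epsilon> \<delta> :: real assume "\<epsilon> > 0" "\<delta> > 0"
  then have "\<forall>\<^sub>F i in F. \<bar>e i\<bar> < \<epsilon> * \<delta>" using e by (simp add: tendsto_iff dist_real_def)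
  with R le show "\<forall>\<^sub>F i in F. prob {\<omega> \<in> space M. \<epsilon> < \<bar>R i \<omega>\<bar>} < \<delta>"
  proof eventually_elim
    case (elim i)
    have "(\<integral>\<^sup>+\<omega>. ennreal \<bar>R i \<omega>\<bar> \<partial>M) \<le> ennreal \<bar>e i\<bar>"
      using elim(2) by (rule order_trans) (simp add: ennreal_leI)
    from markov_prob[OF elim(1) this _ \<open>\<epsilon> > 0\<close>]
    have "prob {\<omega> \<in> space M. \<epsilon> < \<bar>R i \<omega>\<bar>} \<le> \<bar>e i\<bar> / \<epsilon>" by simp
    also have "\<dots> < \<delta>" using elim(3) \<open>\<epsilon> > 0\<close> by (simp add: pos_divide_less_eq mult.commute)
    finally show ?case .
  qed
qed

lemma to_zero_sqrt:
  assumes R: "to_zero R F"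
  shows "to_zero (\<lambda>i \<omega>. sqrt \<bar>R i \<omega>\<bar>) F"
proof (rule to_zeroI)
  show "\<forall>\<^sub>F i in F. (\<lambda>\<omega>. sqrt \<bar>R i \<omega>\<bar>) \<in> borel_measurable M"
    using to_zero_measurable[OF R] by eventually_elim simp
  fix \<epsilon> \<delta> :: real assume e: "\<epsilon> > 0" "\<delta> > 0"
  have "(\<epsilon> < sqrt \<bar>x\<bar>) = (\<epsilon>\<^sup>2 < \<bar>x\<bar>)" for x
    using e real_less_lsqrt real_less_rsqrt[of \<epsilon> "\<bar>x\<bar>"] real_sqrt_less_iff[of "\<epsilon>\<^sup>2" "\<bar>x\<bar>"] by simp
  then show "\<forall>\<^sub>F i in F. prob {\<omega> \<in> space M. \<epsilon> < \<bar>sqrt \<bar>R i \<omega>\<bar>\<bar>} < \<delta>"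
    using to_zero_less[OF R, of "\<epsilon>\<^sup>2" \<delta>] e by simp
qed

lemma to_zero_L2:
  assumes R: "\<forall>\<^sub>F i in F. R i \<in> borel_measurable M"
    and le: "\<forall>\<^sub>F i in F. (\<integral>\<^sup>+\<omega>. ennreal ((R i \<omega>)\<^sup>2) \<partial>M) \<le> ennreal (e i)" and e: "(e \<longlongrightarrow> 0) F"
  shows "to_zero R F"
proof -
  have "to_zero (\<lambda>i \<omega>. (R i \<omega>)\<^sup>2) F"
  proof (rule to_zero_L1[OF _ _ e])
    show "\<forall>\<^sub>F i in F. (\<lambda>\<omega>. (R i \<omega>)\<^sup>2) \<in> borel_measurable M" using R by eventually_elim simp
  qed (use le in simp)
  from to_zero_sqrt[OF this] show ?thesis
    by (rule to_zero_bound[OF _ R]) simp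
qed

lemma tight_L1:
  assumes S: "\<forall>\<^sub>F i in F. S i \<in> borel_measurable M" and le: "\<forall>\<^sub>F i in F. (\<integral>\<^sup>+\<omega>. ennreal \<bar>S i \<omega>\<bar> \<partial>M) \<le> ennreal C"
  shows "tight M S F"
  unfolding tight_def
proof (intro conjI allI impI S)
  fix \<delta> :: real assume \<delta>: "\<delta> > 0"
  define C' where "C' = max C 0 + 1"
  have C': "C' > 0" "C \<le> C'" by (auto simp: C'_def)
  show "\<exists>K. \<forall>\<^sub>F i in F. prob {\<omega> \<in> space M. K < \<bar>S i \<omega>\<bar>} \<le> \<delta>"
  proof (rule exI[of _ "C' / \<delta>"])
    show "\<forall>\<^sub>F i in F. prob {\<omega> \<in> space M. C' / \<delta> < \<bar>S i \<omega>\<bar>} \<le> \<delta>"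
      using S le
    proof eventually_elim
      case (elim i)
      have "(\<integral>\<^sup>+\<omega>. ennreal \<bar>S i \<omega>\<bar> \<partial>M) \<le> ennreal C'"
        using elim(2) C' by (meson ennreal_leI order_trans)
      from markov_prob[OF elim(1) this _ divide_pos_pos[OF C'(1) \<delta>]] C' \<delta> show ?case by simp
    qed
  qed
qed

lemma tight_const:
  assumes Y [measurable]: "Y \<in> borel_measurable M"
  shows "tight M (\<lambda>_. Y) F"
  unfolding tight_def
proof (intro conjI allI impI)
  fix \<delta> :: real assume \<delta>: "\<delta> > 0"
  have "(\<lambda>n. prob {\<omega> \<in> space M. real n < \<bar>Y \<omega>\<bar>}) \<longlonglongrightarrow> prob (\<Inter>n. {\<omega> \<in> space M. real n < \<bar>Y \<omega>\<bar>})"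
    by (rule finite_Lim_measure_decseq) (auto simp: decseq_def)
  moreover have "(\<Inter>n. {\<omega> \<in> space M. real n < \<bar>Y \<omega>\<bar>}) = {}"
  proof -
    have "\<exists>n. \<not> real n < \<bar>Y \<omega>\<bar>" for \<omega>
      using reals_Archimedean2[of "\<bar>Y \<omega>\<bar>"] by (meson less_asym)
    then show ?thesis by blast
  qed
  ultimately have "(\<lambda>n. prob {\<omega> \<in> space M. real n < \<bar>Y \<omega>\<bar>}) \<longlonglongrightarrow> 0" by simp
  from order_tendstoD(2)[OF this \<delta>] obtain n where "prob {\<omega> \<in> space M. real n < \<bar>Y \<omega>\<bar>} < \<delta>"
    by (auto simp: eventually_sequentially)
  then show "\<exists>K. \<forall>\<^sub>F i in F. prob {\<omega> \<in> space M. K < \<bar>Y \<omega>\<bar>} \<le> \<delta>" by (intro exI[of _ "real n"]) simp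
qed simp

lemma tight_add_const:
  assumes S: "tight M S F"
  shows "tight M (\<lambda>i \<omega>. S i \<omega> + c) F"
  unfolding tight_def
proof (intro conjI allI impI)
  have Sm: "\<forall>\<^sub>F i in F. S i \<in> borel_measurable M" using S by (simp add: tight_def)
  then show "\<forall>\<^sub>F i in F. (\<lambda>\<omega>. S i \<omega> + c) \<in> borel_measurable M" by eventually_elim simp
  fix \<delta> :: real assume "\<delta> > 0"
  then obtain K where K: "\<forall>\<^sub>F i in F. prob {\<omega> \<in> space M. K < \<bar>S i \<omega>\<bar>} \<le> \<delta>" using S unfolding tight_def by blast
  show "\<exists>K. \<forall>\<^sub>F i in F. prob {\<omega> \<in> space M. K < \<bar>S i \<omega> + c\<bar>} \<le> \<delta>"
  proof (rule exI[of _ "K + \<bar>c\<bar>"])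
    show "\<forall>\<^sub>F i in F. prob {\<omega> \<in> space M. K + \<bar>c\<bar> < \<bar>S i \<omega> + c\<bar>} \<le> \<delta>"
      using K Sm
    proof eventually_elim
      case (elim i)
      note [measurable] = elim(2)
      have "prob {\<omega> \<in> space M. K + \<bar>c\<bar> < \<bar>S i \<omega> + c\<bar>} \<le> prob {\<omega> \<in> space M. K < \<bar>S i \<omega>\<bar>}"
        by (intro finite_measure_mono) auto
      then show ?case using elim(1) by simp
    qed
  qed
qed

lemma to_zero_fixed:
  assumes "Y \<in> borel_measurable M" "(e \<longlongrightarrow> 0) F"
  shows "to_zero (\<lambda>i \<omega>. Y \<omega> * e i) F"
  by (rule to_zero_tight_mult[OF tight_const[OF assms(1)] to_zero_real[OF assms(2)]])

text \<open>Slutsky's lemma. The test function is merely continuous, so its uniform continuity is available only on a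
  ball; convergence in distribution of \<open>Y'\<close>, tested with a continuous function \<open>tent\<close> that is \<open>1\<close> outside a ball, shows that
  \<open>Y'\<close> rarely leaves it.\<close>

lemma tends_in_distribution_perturb:
  fixes Y Y' :: "'i \<Rightarrow> 'a \<Rightarrow> 'b::euclidean_space" and Z :: "'l \<Rightarrow> 'b"
  assumes L: "prob_space L" and Z [measurable]: "Z \<in> borel_measurable L"
    and Y': "tends_in_distribution M Y' L Z F"
    and Ym: "\<forall>\<^sub>F i in F. Y i \<in> borel_measurable M" and Y'm: "\<forall>\<^sub>F i in F. Y' i \<in> borel_measurable M"
    and close: "to_zero (\<lambda>i \<omega>. dist (Y i \<omega>) (Y' i \<omega>)) F"
  shows "tends_in_distribution M Y L Z F"
  unfolding tends_in_distribution_def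
proof (intro allI impI)
  fix f :: "'b \<Rightarrow> real" assume f: "continuous_on UNIV f \<and> bounded (range f)"
  interpret L: prob_space L by fact
  obtain B where B: "\<And>x. \<bar>f x\<bar> \<le> B" using f unfolding bounded_iff by auto
  have B0: "B \<ge> 0" using B[of 0] by simp
  have fm [measurable]: "f \<in> borel_measurable borel" using f by (simp add: borel_measurable_continuous_onI)
  define tent where "tent K z = 1 - ramp 1 (norm z - real K)" for K and z :: 'b
  have tent_bounds: "0 \<le> tent K z" "tent K z \<le> 1" for K z using ramp_bounds by (auto simp: tent_def)
  have tent_m [measurable]: "tent K \<in> borel_measurable borel" for K unfolding tent_def[abs_def] by measurable
  have tent_cont: "continuous_on UNIV (tent K)" for K
    unfolding tent_def ramp_def by (intro continuous_intros)
  have tent_bdd: "bounded (range (tent K))" for K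
    unfolding bounded_iff using tent_bounds by (intro exI[of _ 1]) auto
  have "(\<lambda>K. \<integral>\<omega>. tent K (Z \<omega>) \<partial>L) \<longlonglongrightarrow> (\<integral>\<omega>. 0 \<partial>L)"
  proof (rule integral_dominated_convergence[where w = "\<lambda>_. 1"])
    show "AE \<omega> in L. (\<lambda>K. tent K (Z \<omega>)) \<longlonglongrightarrow> 0"
      unfolding tent_def using tendsto_diff[OF tendsto_const ramp_cutoff_tendsto, of 1] by simp
  qed (use tent_bounds in auto)
  then have tent_lim: "(\<lambda>K. \<integral>\<omega>. tent K (Z \<omega>) \<partial>L) \<longlonglongrightarrow> 0" by simp
  have "((\<lambda>i. (\<integral>\<omega>. f (Y i \<omega>) \<partial>M) - (\<integral>\<omega>. f (Y' i \<omega>) \<partial>M)) \<longlongrightarrow> 0) F"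
  proof (rule tendstoI)
    fix e :: real assume e: "e > 0"
    define \<epsilon> where "\<epsilon> = e / (2 + 4 * B)"
    have \<epsilon>: "\<epsilon> > 0" using e B0 by (simp add: \<epsilon>_def)
    obtain K where K: "(\<integral>\<omega>. tent K (Z \<omega>) \<partial>L) < \<epsilon>"
      using order_tendstoD(2)[OF tent_lim \<epsilon>] by (auto simp: eventually_sequentially)
    have "((\<lambda>i. \<integral>\<omega>. tent K (Y' i \<omega>) \<partial>M) \<longlongrightarrow> (\<integral>\<omega>. tent K (Z \<omega>) \<partial>L)) F"
      using Y' tent_cont tent_bdd unfolding tends_in_distribution_def by blast
    from order_tendstoD(2)[OF this K] have ev1: "\<forall>\<^sub>F i in F. (\<integral>\<omega>. tent K (Y' i \<omega>) \<partial>M) < \<epsilon>" .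
    have "uniformly_continuous_on (cball 0 (real K + 2)) f"
      by (rule compact_uniformly_continuous[OF continuous_on_subset[OF conjunct1[OF f] subset_UNIV] compact_cball])
    then obtain d where d: "d > 0" "\<And>x y. x \<in> cball 0 (real K + 2) \<Longrightarrow> y \<in> cball 0 (real K + 2) \<Longrightarrow> dist x y < d \<Longrightarrow> dist (f x) (f y) < \<epsilon>"
      unfolding uniformly_continuous_on_def using \<epsilon> by metis
    define \<eta> where "\<eta> = min (d / 2) 1"
    have \<eta>: "\<eta> > 0" "\<eta> < d" "\<eta> \<le> 1" using d by (auto simp: \<eta>_def)
    have pw: "\<bar>f x - f y\<bar> \<le> \<epsilon> + 2 * B * tent K y + 2 * B * indicator {r. \<eta> < r} (dist x y)" for x y
    proof (cases "\<eta> < dist x y")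
      case True
      have "\<bar>f x - f y\<bar> \<le> 2 * B" using B[of x] B[of y] by linarith
      moreover have "0 \<le> 2 * B * tent K y" using B0 tent_bounds by simp
      ultimately show ?thesis using True \<epsilon> by simp
    next
      case False
      show ?thesis
      proof (cases "norm y < real K + 1")
        case True
        then have "norm x < real K + 2"
          using False \<eta> norm_triangle_ineq2[of x y] by (simp add: dist_norm)
        then have "dist (f x) (f y) < \<epsilon>" using True False \<eta> by (intro d) auto
        moreover have "0 \<le> 2 * B * tent K y" using B0 tent_bounds by simp
        ultimately show ?thesis using False by (simp add: dist_real_def)
      next
        case False
        then have t1: "tent K y = 1" by (simp add: tent_def ramp_def)
        have "\<bar>f x - f y\<bar> \<le> 2 * B" using B[of x] B[of y] by linarith
        moreover have "0 \<le> 2 * B * indicator {r. \<eta> < r} (dist x y)" using B0 by simp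
        ultimately show ?thesis using \<epsilon> unfolding t1 by linarith
      qed
    qed
    from ev1 to_zero_less[OF close \<eta>(1) \<epsilon>] Ym Y'm
    show "\<forall>\<^sub>F i in F. dist ((\<integral>\<omega>. f (Y i \<omega>) \<partial>M) - (\<integral>\<omega>. f (Y' i \<omega>) \<partial>M)) 0 < e"
    proof eventually_elim
      case (elim i)
      note [measurable] = elim(3,4)
      have fi: "integrable M (\<lambda>\<omega>. f (Y i \<omega>))" "integrable M (\<lambda>\<omega>. f (Y' i \<omega>))"
        using B by (auto intro!: integrable_const_bound[of _ B])
      have ti: "integrable M (\<lambda>\<omega>. tent K (Y' i \<omega>))"
        using tent_bounds by (auto intro!: integrable_const_bound[of _ 1])
      have ii: "integrable M (\<lambda>\<omega>. indicator {r. \<eta> < r} (dist (Y i \<omega>) (Y' i \<omega>)) :: real)"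
        by (auto intro!: integrable_const_bound[of _ 1])
      have "\<bar>(\<integral>\<omega>. f (Y i \<omega>) \<partial>M) - (\<integral>\<omega>. f (Y' i \<omega>) \<partial>M)\<bar> = \<bar>\<integral>\<omega>. f (Y i \<omega>) - f (Y' i \<omega>) \<partial>M\<bar>"
        using fi by simp
      also have "\<dots> \<le> (\<integral>\<omega>. \<bar>f (Y i \<omega>) - f (Y' i \<omega>)\<bar> \<partial>M)" by (rule integral_abs_bound)
      also have "\<dots> \<le> (\<integral>\<omega>. \<epsilon> + 2 * B * tent K (Y' i \<omega>) + 2 * B * indicator {r. \<eta> < r} (dist (Y i \<omega>) (Y' i \<omega>)) \<partial>M)"
        using fi ti ii pw by (intro integral_mono) auto
      also have "\<dots> = \<epsilon> + 2 * B * (\<integral>\<omega>. tent K (Y' i \<omega>) \<partial>M) + 2 * B * (\<integral>\<omega>. indicator {r. \<eta> < r} (dist (Y i \<omega>) (Y' i \<omega>)) \<partial>M)"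
        using ti ii by (simp add: prob_space)
      also have "(\<integral>\<omega>. indicator {r. \<eta> < r} (dist (Y i \<omega>) (Y' i \<omega>)) \<partial>M) = prob {\<omega> \<in> space M. \<eta> < \<bar>dist (Y i \<omega>) (Y' i \<omega>)\<bar>}"
      proof -
        have "(\<integral>\<omega>. indicator {r. \<eta> < r} (dist (Y i \<omega>) (Y' i \<omega>)) \<partial>M)
            = (\<integral>\<omega>. indicator {\<omega> \<in> space M. \<eta> < \<bar>dist (Y i \<omega>) (Y' i \<omega>)\<bar>} \<omega> \<partial>M :: real)"
          by (intro Bochner_Integration.integral_cong) (auto simp: indicator_def)
        then show ?thesis by simp
      qed
      also have "\<epsilon> + 2 * B * (\<integral>\<omega>. tent K (Y' i \<omega>) \<partial>M) + 2 * B * prob {\<omega> \<in> space M. \<eta> < \<bar>dist (Y i \<omega>) (Y' i \<omega>)\<bar>}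
          \<le> \<epsilon> + 2 * B * \<epsilon> + 2 * B * \<epsilon>"
        using elim(1,2) B0 by (intro add_mono mult_left_mono) auto
      also have "\<dots> = \<epsilon> * (1 + 4 * B)" by (simp add: algebra_simps)
      also have "\<dots> = e * ((1 + 4 * B) / (2 + 4 * B))" by (simp add: \<epsilon>_def)
      also have "\<dots> < e * 1" using e B0 by (intro mult_strict_left_mono) (auto simp: divide_less_eq)
      finally show ?case by (simp add: dist_real_def)
    qed
  qed
  moreover have "((\<lambda>i. \<integral>\<omega>. f (Y' i \<omega>) \<partial>M) \<longlongrightarrow> (\<integral>\<omega>. f (Z \<omega>) \<partial>L)) F"
    using Y' f unfolding tends_in_distribution_def by blast
  ultimately show "((\<lambda>i. \<integral>\<omega>. f (Y i \<omega>) \<partial>M) \<longlongrightarrow> (\<integral>\<omega>. f (Z \<omega>) \<partial>L)) F"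
    by (rule Lim_transform[rotated])
qed

end

section \<open>Quadratic functionals of a Wiener process\<close>

text \<open>Pathwise substitute for the Ito formula: up to terms that stay bounded in probability, the score is half of the
  squared terminal value minus half of the quadratic variation at lag one.\<close>

lemma score_eq_squares:
  assumes f: "continuous_on {-1..T} f" and T: "T \<ge> 0"
  shows "score f T = (f T)\<^sup>2 / 2 - integral {T - 1..T} (\<lambda>t. (f T - f t)\<^sup>2) / 2
    + (integral {-1..0} (\<lambda>t. (f t)\<^sup>2) / 2 - past_mean f 0 * f 0) - integral {0..T} (\<lambda>t. (f t - f (t - 1))\<^sup>2) / 2"
proof -
  define Q where "Q A = integral A (\<lambda>t. (f t)\<^sup>2)" for A
  have sq: "continuous_on {-1..T} (\<lambda>t. (f t)\<^sup>2)" using f by (intro continuous_intros)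
  have sqi: "(\<lambda>t. (f t)\<^sup>2) integrable_on {u..v}" if "-1 \<le> u" "v \<le> T" for u v
    using that by (intro integrable_continuous_real continuous_on_subset[OF sq]) auto
  have fi: "f integrable_on {u..v}" if "-1 \<le> u" "v \<le> T" for u v
    using that by (intro integrable_continuous_real continuous_on_subset[OF f]) auto
  have f0: "continuous_on {0..T} f" "continuous_on {0..T} (\<lambda>t. f (t - 1))"
    by (auto intro!: continuous_on_subset[OF f] continuous_on_compose2[OF f] continuous_intros)
  have shift: "integral {0..T} (\<lambda>t. (f (t - 1))\<^sup>2) = Q {-1..T - 1}"
    using integral_shift_Icc_real[of 0 T "\<lambda>t. (f t)\<^sup>2" "-1"] by (simp add: comp_def Q_def)
  have "Q {-1..0} + Q {0..T} = Q {-1..T - 1} + Q {T - 1..T}"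
    unfolding Q_def using T
    by (subst (1 2) Henstock_Kurzweil_Integration.integral_combine) (auto intro!: sqi)
  then have ends: "Q {0..T} - Q {-1..T - 1} = Q {T - 1..T} - Q {-1..0}" by simp
  have i1: "(\<lambda>t. ((f t)\<^sup>2 - (f (t - 1))\<^sup>2) / 2) integrable_on {0..T}" "(\<lambda>t. (f t - f (t - 1))\<^sup>2 / 2) integrable_on {0..T}"
    using f0 by (auto intro!: integrable_continuous_real continuous_intros)
  have i2: "(\<lambda>t. (f t)\<^sup>2) integrable_on {0..T}" "(\<lambda>t. (f (t - 1))\<^sup>2) integrable_on {0..T}"
    using f0 by (auto intro!: integrable_continuous_real continuous_intros)
  have "integral {0..T} (\<lambda>t. f t * (f t - f (t - 1))) = integral {0..T} (\<lambda>t. ((f t)\<^sup>2 - (f (t - 1))\<^sup>2) / 2 + (f t - f (t - 1))\<^sup>2 / 2)"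
    by (intro integral_cong) (simp add: power2_eq_square field_simps)
  also have "\<dots> = integral {0..T} (\<lambda>t. ((f t)\<^sup>2 - (f (t - 1))\<^sup>2) / 2) + integral {0..T} (\<lambda>t. (f t - f (t - 1))\<^sup>2 / 2)"
    by (rule Henstock_Kurzweil_Integration.integral_add[OF i1])
  also have "integral {0..T} (\<lambda>t. ((f t)\<^sup>2 - (f (t - 1))\<^sup>2) / 2) = (Q {0..T} - Q {-1..T - 1}) / 2"
    using Henstock_Kurzweil_Integration.integral_diff[OF i2] shift by (simp add: Q_def)
  finally have cross: "integral {0..T} (\<lambda>t. f t * (f t - f (t - 1)))
      = (Q {T - 1..T} - Q {-1..0}) / 2 + integral {0..T} (\<lambda>t. (f t - f (t - 1))\<^sup>2) / 2" by (simp add: ends)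
  have ivl: "-1 \<le> T - 1" "T \<le> T" using T by auto
  have li: "(\<lambda>t. 2 * f T * f t) integrable_on {T - 1..T}"
    using continuous_on_subset[OF f, of "{T - 1..T}"] T by (intro integrable_continuous_real continuous_intros) auto
  have "integral {T - 1..T} (\<lambda>t. (f T - f t)\<^sup>2) = integral {T - 1..T} (\<lambda>t. ((f T)\<^sup>2 - 2 * f T * f t) + (f t)\<^sup>2)"
    by (intro integral_cong) (simp add: power2_diff)
  also have "\<dots> = integral {T - 1..T} (\<lambda>t. (f T)\<^sup>2 - 2 * f T * f t) + Q {T - 1..T}"
    unfolding Q_def
    by (rule Henstock_Kurzweil_Integration.integral_add[OF integrable_diff[OF integrable_const_ivl li] sqi[OF ivl]])
  also have "integral {T - 1..T} (\<lambda>t. (f T)\<^sup>2 - 2 * f T * f t) = (f T)\<^sup>2 - 2 * f T * past_mean f T"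
    unfolding past_mean_def by (subst Henstock_Kurzweil_Integration.integral_diff[OF integrable_const_ivl li]) simp
  finally show ?thesis
    unfolding score_def cross Q_def by (simp add: field_simps power2_eq_square)
qed

text \<open>Jensen's inequality on an interval of length one.\<close>

lemma square_integral_le_unit:
  fixes g :: "real \<Rightarrow> real"
  assumes g: "continuous_on {a..a + 1} g"
  shows "(integral {a..a + 1} g)\<^sup>2 \<le> integral {a..a + 1} (\<lambda>t. (g t)\<^sup>2)"
proof -
  define m where "m = integral {a..a + 1} g"
  have gi: "g integrable_on {a..a + 1}" "(\<lambda>t. (g t)\<^sup>2) integrable_on {a..a + 1}"
    using g by (auto intro!: integrable_continuous_real continuous_intros)
  have li: "(\<lambda>t. 2 * m * g t) integrable_on {a..a + 1}"
    using g by (intro integrable_continuous_real continuous_intros)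
  have "0 \<le> integral {a..a + 1} (\<lambda>t. (g t - m)\<^sup>2)"
    using g by (intro integral_nonneg integrable_continuous_real continuous_intros) auto
  also have "integral {a..a + 1} (\<lambda>t. (g t - m)\<^sup>2) = integral {a..a + 1} (\<lambda>t. (g t)\<^sup>2 - (2 * m * g t - m\<^sup>2))"
    by (intro integral_cong) (simp add: power2_diff mult_ac)
  also have "\<dots> = integral {a..a + 1} (\<lambda>t. (g t)\<^sup>2) - integral {a..a + 1} (\<lambda>t. 2 * m * g t - m\<^sup>2)"
    by (rule Henstock_Kurzweil_Integration.integral_diff[OF gi(2) integrable_diff[OF li integrable_const_ivl]])
  also have "integral {a..a + 1} (\<lambda>t. 2 * m * g t - m\<^sup>2) = 2 * m * m - m\<^sup>2"
    by (subst Henstock_Kurzweil_Integration.integral_diff[OF li integrable_const_ivl]) (simp add: m_def)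
  finally show ?thesis by (simp add: m_def power2_eq_square)
qed

text \<open>Weighted Young inequality with the weight \<open>sqrt R\<close>; it bounds the difference of the two integrals by a
  tight factor times a small one. For \<open>R = 0\<close> the weight is sent to zero.\<close>

lemma integral_square_diff_le:
  fixes u w :: "real \<Rightarrow> real"
  assumes u: "continuous_on {a..b} u" and w: "continuous_on {a..b} w" and s: "s > (0::real)"
  defines "R \<equiv> integral {a..b} (\<lambda>t. (u t - w t)\<^sup>2) / s" and "S \<equiv> integral {a..b} (\<lambda>t. (w t)\<^sup>2) / s"
  shows "\<bar>integral {a..b} (\<lambda>t. (u t)\<^sup>2) / s - S\<bar> \<le> (S + 1) * sqrt \<bar>R\<bar> + R"
proof -
  have ui: "(\<lambda>t. (u t)\<^sup>2) integrable_on {a..b}" and wi: "(\<lambda>t. (w t)\<^sup>2) integrable_on {a..b}"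
    and di: "(\<lambda>t. (u t - w t)\<^sup>2) integrable_on {a..b}"
    by (intro integrable_continuous_real continuous_intros u w)+
  have R0: "R \<ge> 0" and S0: "S \<ge> 0"
    using s ui wi di by (auto simp: R_def S_def intro!: divide_nonneg_pos integral_nonneg)
  have key: "\<bar>integral {a..b} (\<lambda>t. (u t)\<^sup>2) / s - S\<bar> \<le> c * S + (1 / c + 1) * R" if c: "c > 0" for c
  proof -
    have pw: "\<bar>x\<^sup>2 - y\<^sup>2\<bar> \<le> c * y\<^sup>2 + (1 / c + 1) * (x - y)\<^sup>2" for x y :: real
    proof -
      have "2 * \<bar>y\<bar> * \<bar>x - y\<bar> \<le> c * y\<^sup>2 + (x - y)\<^sup>2 / c"
      proof -
        have "0 \<le> (c * \<bar>y\<bar> - \<bar>x - y\<bar>)\<^sup>2 / c" using c by simp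
        also have "\<dots> = c * y\<^sup>2 + (x - y)\<^sup>2 / c - 2 * \<bar>y\<bar> * \<bar>x - y\<bar>"
        proof -
          have "(c * p - q)\<^sup>2 / c = c * p\<^sup>2 + q\<^sup>2 / c - 2 * p * q" for p q :: real
            using c by (simp add: power2_eq_square field_simps)
          from this[of "\<bar>y\<bar>" "\<bar>x - y\<bar>"] show ?thesis by simp
        qed
        finally show ?thesis by simp
      qed
      moreover have "\<bar>x\<^sup>2 - y\<^sup>2\<bar> \<le> 2 * \<bar>y\<bar> * \<bar>x - y\<bar> + (x - y)\<^sup>2"
      proof -
        have "x\<^sup>2 - y\<^sup>2 = 2 * y * (x - y) + (x - y)\<^sup>2" by (simp add: power2_eq_square algebra_simps)
        moreover have "\<bar>2 * y * (x - y) + (x - y)\<^sup>2\<bar> \<le> \<bar>2 * y * (x - y)\<bar> + \<bar>(x - y)\<^sup>2\<bar>" by (rule abs_triangle_ineq)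
        ultimately show ?thesis by (simp add: abs_mult)
      qed
      ultimately show ?thesis by (simp add: distrib_right)
    qed
    have "\<bar>integral {a..b} (\<lambda>t. (u t)\<^sup>2) - integral {a..b} (\<lambda>t. (w t)\<^sup>2)\<bar> = norm (integral {a..b} (\<lambda>t. (u t)\<^sup>2 - (w t)\<^sup>2))"
      using Henstock_Kurzweil_Integration.integral_diff[OF ui wi] by simp
    also have "\<dots> \<le> integral {a..b} (\<lambda>t. c * (w t)\<^sup>2 + (1 / c + 1) * (u t - w t)\<^sup>2)"
      using ui wi di pw
      by (intro integral_norm_bound_integral integrable_diff integrable_add integrable_on_mult_right) auto
    also have "\<dots> = c * integral {a..b} (\<lambda>t. (w t)\<^sup>2) + (1 / c + 1) * integral {a..b} (\<lambda>t. (u t - w t)\<^sup>2)"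
      using wi di by (subst Henstock_Kurzweil_Integration.integral_add) (auto intro!: integrable_on_mult_right)
    finally have "\<bar>integral {a..b} (\<lambda>t. (u t)\<^sup>2) - integral {a..b} (\<lambda>t. (w t)\<^sup>2)\<bar> / s
        \<le> (c * integral {a..b} (\<lambda>t. (w t)\<^sup>2) + (1 / c + 1) * integral {a..b} (\<lambda>t. (u t - w t)\<^sup>2)) / s"
      using s by (intro divide_right_mono) auto
    moreover have "\<bar>integral {a..b} (\<lambda>t. (u t)\<^sup>2) / s - S\<bar> = \<bar>integral {a..b} (\<lambda>t. (u t)\<^sup>2) - integral {a..b} (\<lambda>t. (w t)\<^sup>2)\<bar> / s"
      using s by (simp add: S_def diff_divide_distrib[symmetric] abs_divide)
    ultimately show ?thesis by (simp add: S_def R_def add_divide_distrib)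
  qed
  show ?thesis
  proof (cases "R = 0")
    case True
    have "\<bar>integral {a..b} (\<lambda>t. (u t)\<^sup>2) / s - S\<bar> \<le> 0"
    proof (rule field_le_epsilon)
      fix e :: real assume e: "e > 0"
      have "\<bar>integral {a..b} (\<lambda>t. (u t)\<^sup>2) / s - S\<bar> \<le> e / (S + 1) * S"
        using key[of "e / (S + 1)"] e S0 True by simp
      also have "\<dots> \<le> e" using e S0 by (simp add: pos_divide_le_eq mult_left_mono)
      finally show "\<bar>integral {a..b} (\<lambda>t. (u t)\<^sup>2) / s - S\<bar> \<le> 0 + e" by simp
    qed
    then show ?thesis using True by simp
  next
    case False
    then have r: "sqrt R > 0" using R0 by simp
    have "1 / sqrt R * R = sqrt R" using R0 r by (simp add: real_div_sqrt)
    then show ?thesis using key[OF r] R0 by (simp add: algebra_simps)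
  qed
qed

text \<open>The centred squares of independent standard normal increments are orthogonal with second moment \<open>2\<close>.\<close>

lemma unit_increments_variance:
  assumes W: "wiener_process M {0..b} W" and c: "c \<ge> 0"
  shows "c + real p \<le> b \<Longrightarrow> has_bochner_integral M
    (\<lambda>\<omega>. (\<Sum>j<p. (W (c + real j + 1) \<omega> - W (c + real j) \<omega>)\<^sup>2 - 1)\<^sup>2) (2 * real p)"
proof -
  define m where "m j \<omega> = - (((W (c + real j + 1) \<omega> - W (c + real j) \<omega>)\<^sup>2 - 1) / 2)" for j \<omega>
  have "(\<lambda>\<omega>. \<Sum>j<p. m j \<omega>) \<in> borel_measurable (natural_filtration M W (c + real p)) \<and>
      has_bochner_integral M (\<lambda>\<omega>. (\<Sum>j<p. m j \<omega>)\<^sup>2) (real p / 2)" if "c + real p \<le> b" for p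
    using that
  proof (induction p)
    case 0
    then show ?case by (simp add: has_bochner_integral_zero)
  next
    case (Suc p)
    then have IH: "(\<lambda>\<omega>. \<Sum>j<p. m j \<omega>) \<in> borel_measurable (natural_filtration M W (c + real p))"
      "has_bochner_integral M (\<lambda>\<omega>. (\<Sum>j<p. m j \<omega>)\<^sup>2) (real p / 2)" by auto
    let ?s = "c + real p" and ?t = "c + real p + 1"
    have st: "0 \<le> ?s" "?s < ?t" "?t \<le> b" using c Suc.prems by auto
    have "m p \<in> borel_measurable (natural_filtration M W ?t)"
      unfolding m_def[abs_def] using st
      by (intro borel_measurable_uminus borel_measurable_divide borel_measurable_diff borel_measurable_power
          natural_filtration_value borel_measurable_const) auto
    moreover have "(\<lambda>\<omega>. \<Sum>j<p. m j \<omega>) \<in> borel_measurable (natural_filtration M W ?t)"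
      using natural_filtration_mono[OF _ IH(1), of ?t] by simp
    ultimately have "(\<lambda>\<omega>. \<Sum>j<Suc p. m j \<omega>) \<in> borel_measurable (natural_filtration M W ?t)"
      by (simp add: borel_measurable_add)
    moreover have "has_bochner_integral M (\<lambda>\<omega>. ((\<Sum>j<p. m j \<omega>) + m p \<omega>)\<^sup>2) (real (Suc p) / 2)"
      using increment_square_error[OF W st IH(1) has_bochner_integral_iff[THEN iffD1, THEN conjunct1, OF IH(2)], of "\<lambda>_. 0"] IH(2)
      unfolding m_def by (simp add: has_bochner_integral_iff add_divide_distrib add.commute)
    ultimately show ?case by (simp add: add_ac)
  qed
  moreover assume "c + real p \<le> b"
  ultimately have "has_bochner_integral M (\<lambda>\<omega>. (\<Sum>j<p. m j \<omega>)\<^sup>2) (real p / 2)" by blast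
  from has_bochner_integral_mult_right[OF this, of 4]
  have "has_bochner_integral M (\<lambda>\<omega>. 4 * (\<Sum>j<p. m j \<omega>)\<^sup>2) (2 * real p)" by simp
  moreover have "4 * (\<Sum>j<p. m j \<omega>)\<^sup>2 = (\<Sum>j<p. (W (c + real j + 1) \<omega> - W (c + real j) \<omega>)\<^sup>2 - 1)\<^sup>2" for \<omega>
  proof -
    have "(\<Sum>j<p. (W (c + real j + 1) \<omega> - W (c + real j) \<omega>)\<^sup>2 - 1) = - 2 * (\<Sum>j<p. m j \<omega>)"
      unfolding sum_distrib_left by (intro sum.cong) (auto simp: m_def diff_divide_distrib)
    then show ?thesis by (simp add: power_mult_distrib)
  qed
  ultimately show ?thesis by simp
qed

lemma wiener_increment_square_nn:
  assumes W: "wiener_process M I W" and s: "s \<in> I" and t: "t \<in> I"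
  shows "(\<integral>\<^sup>+\<omega>. ennreal ((W t \<omega> - W s \<omega>)\<^sup>2) \<partial>M) = ennreal \<bar>t - s\<bar>"
proof -
  have *: "(\<integral>\<^sup>+\<omega>. ennreal ((W t \<omega> - W s \<omega>)\<^sup>2) \<partial>M) = ennreal (t - s)" if "s \<in> I" "t \<in> I" "s < t" for s t
    using wiener_increment_moments(1)[OF W that, of 2] wiener_increment_moments(3)[OF W that]
    by (subst nn_integral_eq_integral) auto
  consider "s < t" | "s = t" | "t < s" by linarith
  then show ?thesis
  proof cases
    case 3
    show ?thesis using *[OF t s 3] 3 by (subst power2_commute) simp
  qed (use *[OF s t] in auto)
qed

lemma integral_unit_blocks:
  fixes g :: "real \<Rightarrow> real"
  assumes g: "continuous_on {u..u + real p} g"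
  shows "integral {u..u + real p} g = integral {0..1} (\<lambda>s. \<Sum>j<p. g (u + real j + s))"
  using g
proof (induction p)
  case 0
  then show ?case by simp
next
  case (Suc p)
  have gp: "continuous_on {u..u + real p} g" by (rule continuous_on_subset[OF Suc.prems]) auto
  have block: "continuous_on {0..1} (\<lambda>s. g (u + real j + s))" if "j < Suc p" for j
    using that by (intro continuous_on_compose2[OF Suc.prems] continuous_intros) auto
  have "integral {u..u + real (Suc p)} g = integral {u..u + real p} g + integral {u + real p..u + real (Suc p)} g"
    by (intro Henstock_Kurzweil_Integration.integral_combine[symmetric] integrable_continuous_real Suc.prems) auto
  also have "integral {u + real p..u + real (Suc p)} g = integral {0..1} (\<lambda>s. g (u + real p + s))"
    using integral_shift_Icc_real[of 0 1 g "u + real p"] by (simp add: comp_def add_ac)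
  also have "integral {u..u + real p} g = integral {0..1} (\<lambda>s. \<Sum>j<p. g (u + real j + s))" by (rule Suc.IH[OF gp])
  also have "integral {0..1} (\<lambda>s. \<Sum>j<p. g (u + real j + s)) + integral {0..1} (\<lambda>s. g (u + real p + s))
      = integral {0..1} (\<lambda>s. \<Sum>j<Suc p. g (u + real j + s))"
    by (subst Henstock_Kurzweil_Integration.integral_add[symmetric])
      (auto intro!: integrable_continuous_real continuous_on_sum block)
  finally show ?case .
qed

context
  fixes M :: "'o measure" and W :: "real \<Rightarrow> 'o \<Rightarrow> real"
  assumes W: "wiener_process M {0..} W"
begin

lemma wiener_process_upto: "wiener_process M {0..b} W"
  by (rule wiener_process_mono[OF W]) auto

lemma wiener_prob_space: "prob_space M"
  using W by (simp add: wiener_process_def)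

lemma wiener_borel: "t \<ge> 0 \<Longrightarrow> W t \<in> borel_measurable M"
  by (rule wiener_measurable[OF W]) simp

lemma wiener_continuous: "\<omega> \<in> space M \<Longrightarrow> 0 \<le> a \<Longrightarrow> continuous_on {a..b} (\<lambda>t. W t \<omega>)"
  using W by (auto simp: wiener_process_def continuous_process_def intro: continuous_on_subset)

lemma wiener_sigma_finite: "sigma_finite_measure M"
  using wiener_prob_space by (simp add: prob_space_imp_sigma_finite)

text \<open>Law of large numbers for squared increments at lag one. Increments at overlapping times are dependent, but after
  cutting the interval into unit blocks, the increments at equal phase \<open>s\<close> are independent, and the average over
  the phases is handled by \<open>square_integral_le_unit\<close>.\<close>

lemma lag_square_integral_variance:
  assumes u: "u \<ge> 1"
  shows "(\<integral>\<^sup>+\<omega>. ennreal ((integral {u..u + real p} (\<lambda>t. (W t \<omega> - W (t - 1) \<omega>)\<^sup>2) - real p)\<^sup>2) \<partial>M) \<le> ennreal (2 * real p)"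
proof -
  define V where "V s \<omega> = (\<Sum>j<p. (W (u - 1 + s + real j + 1) \<omega> - W (u - 1 + s + real j) \<omega>)\<^sup>2 - 1)" for s \<omega>
  have lag: "continuous_on {u..u + real p} (\<lambda>t. (W t \<omega> - W (t - 1) \<omega>)\<^sup>2)" if "\<omega> \<in> space M" for \<omega>
    using u by (intro continuous_intros wiener_continuous that continuous_on_compose2[OF wiener_continuous[OF that, of 0 "u + real p"]]) auto
  have Vc: "continuous_on {0..1} (\<lambda>s. V s \<omega>)" if "\<omega> \<in> space M" for \<omega>
    unfolding V_def using u
    by (intro continuous_intros continuous_on_compose2[OF wiener_continuous[OF that, of 0 "u + real p + 1"]]) auto
  have Vm: "V s \<in> borel_measurable M" if "s \<in> {0..1}" for s
    unfolding V_def[abs_def] using u that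
    by (intro borel_measurable_sum borel_measurable_diff borel_measurable_power wiener_borel borel_measurable_const) auto
  have "(\<integral>\<^sup>+\<omega>. ennreal ((integral {u..u + real p} (\<lambda>t. (W t \<omega> - W (t - 1) \<omega>)\<^sup>2) - real p)\<^sup>2) \<partial>M)
      \<le> (\<integral>\<^sup>+\<omega>. ennreal (integral {0..1} (\<lambda>s. (V s \<omega>)\<^sup>2)) \<partial>M)"
  proof (intro nn_integral_mono ennreal_leI)
    fix \<omega> assume w: "\<omega> \<in> space M"
    let ?g = "\<lambda>s. \<Sum>j<p. (W (u + real j + s) \<omega> - W (u + real j + s - 1) \<omega>)\<^sup>2"
    have gV: "?g s = V s \<omega> + real p" for s
      by (simp add: V_def sum_subtractf algebra_simps)
    have "integral {u..u + real p} (\<lambda>t. (W t \<omega> - W (t - 1) \<omega>)\<^sup>2) = integral {0..1} ?g"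
      by (rule integral_unit_blocks[OF lag[OF w]])
    also have "\<dots> = integral {0..1} (\<lambda>s. V s \<omega>) + real p"
      unfolding gV using Vc[OF w] by (subst Henstock_Kurzweil_Integration.integral_add) (auto intro!: integrable_continuous_real)
    finally show "(integral {u..u + real p} (\<lambda>t. (W t \<omega> - W (t - 1) \<omega>)\<^sup>2) - real p)\<^sup>2 \<le> integral {0..1} (\<lambda>s. (V s \<omega>)\<^sup>2)"
      using square_integral_le_unit[of 0 "\<lambda>s. V s \<omega>"] Vc[OF w] by simp
  qed
  also have "\<dots> \<le> ennreal (2 * real p * (1 - 0))"
  proof (rule expectation_integral_process_le[OF wiener_sigma_finite])
    fix s :: real assume s: "s \<in> {0..1}"
    show "(\<lambda>\<omega>. (V s \<omega>)\<^sup>2) \<in> borel_measurable M" using Vm[OF s] by simp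
    have "has_bochner_integral M (\<lambda>\<omega>. (V s \<omega>)\<^sup>2) (2 * real p)"
      unfolding V_def using u s by (intro unit_increments_variance[OF wiener_process_upto[of "u - 1 + s + real p"]]) auto
    then show "(\<integral>\<^sup>+\<omega>. ennreal ((V s \<omega>)\<^sup>2) \<partial>M) \<le> ennreal (2 * real p)"
      by (subst nn_integral_eq_integral) (auto simp: has_bochner_integral_iff)
  qed (auto intro!: continuous_on_power Vc)
  finally show ?thesis by simp
qed

lemma last_unit_square_integral:
  assumes T: "T \<ge> 1"
  shows "(\<integral>\<^sup>+\<omega>. ennreal (integral {T - 1..T} (\<lambda>t. (W T \<omega> - W t \<omega>)\<^sup>2)) \<partial>M) \<le> ennreal 1"
proof -
  have "(\<integral>\<^sup>+\<omega>. ennreal (integral {T - 1..T} (\<lambda>t. (W T \<omega> - W t \<omega>)\<^sup>2)) \<partial>M) \<le> ennreal (1 * (T - (T - 1)))"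
  proof (rule expectation_integral_process_le[OF wiener_sigma_finite])
    fix t assume t: "t \<in> {T - 1..T}"
    show "(\<lambda>\<omega>. (W T \<omega> - W t \<omega>)\<^sup>2) \<in> borel_measurable M"
      using t T by (intro borel_measurable_power borel_measurable_diff wiener_borel) auto
    show "(\<integral>\<^sup>+\<omega>. ennreal ((W T \<omega> - W t \<omega>)\<^sup>2) \<partial>M) \<le> ennreal 1"
      using t T by (subst wiener_increment_square_nn[OF W]) (auto intro!: ennreal_leI)
  qed (use T in \<open>auto intro!: continuous_intros wiener_continuous\<close>)
  then show ?thesis by simp
qed

lemma window_square_continuous:
  assumes w: "\<omega> \<in> space M"
  shows "continuous_on {1..T} (\<lambda>t. integral {t - 1..t} (\<lambda>s. (W t \<omega> - W s \<omega>)\<^sup>2))"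
proof -
  have c: "continuous_on {0..T} (\<lambda>t. W t \<omega>)" "continuous_on {0..T} (\<lambda>t. (W t \<omega>)\<^sup>2)"
    using w by (auto intro!: continuous_intros wiener_continuous)
  have "continuous_on {1..T} (\<lambda>t. (W t \<omega>)\<^sup>2 - 2 * W t \<omega> * past_mean (\<lambda>s. W s \<omega>) t + past_mean (\<lambda>s. (W s \<omega>)\<^sup>2) t)"
    using continuous_past_mean_from[OF c(1)] continuous_past_mean_from[OF c(2)] w
    by (intro continuous_intros wiener_continuous) auto
  then show ?thesis
  proof (rule continuous_on_cong[THEN iffD1, OF refl, rotated])
    fix t assume t: "t \<in> {1..T}"
    have Wt: "continuous_on {t - 1..t} (\<lambda>s. W s \<omega>)" using t w by (intro wiener_continuous) auto
    have li: "(\<lambda>s. 2 * W t \<omega> * W s \<omega>) integrable_on {t - 1..t}" and i: "(\<lambda>s. (W s \<omega>)\<^sup>2) integrable_on {t - 1..t}"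
      by (intro integrable_continuous_real continuous_intros Wt)+
    have "integral {t - 1..t} (\<lambda>s. (W t \<omega> - W s \<omega>)\<^sup>2) = integral {t - 1..t} (\<lambda>s. ((W t \<omega>)\<^sup>2 - 2 * W t \<omega> * W s \<omega>) + (W s \<omega>)\<^sup>2)"
      by (intro integral_cong) (simp add: power2_diff)
    also have "\<dots> = integral {t - 1..t} (\<lambda>s. (W t \<omega>)\<^sup>2 - 2 * W t \<omega> * W s \<omega>) + integral {t - 1..t} (\<lambda>s. (W s \<omega>)\<^sup>2)"
      by (rule Henstock_Kurzweil_Integration.integral_add[OF integrable_diff[OF integrable_const_ivl li] i])
    also have "integral {t - 1..t} (\<lambda>s. (W t \<omega>)\<^sup>2 - 2 * W t \<omega> * W s \<omega>) = (W t \<omega>)\<^sup>2 - 2 * W t \<omega> * integral {t - 1..t} (\<lambda>s. W s \<omega>)"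
      by (subst Henstock_Kurzweil_Integration.integral_diff[OF integrable_const_ivl li]) simp
    finally show "(W t \<omega>)\<^sup>2 - 2 * W t \<omega> * past_mean (\<lambda>s. W s \<omega>) t + past_mean (\<lambda>s. (W s \<omega>)\<^sup>2) t
        = integral {t - 1..t} (\<lambda>s. (W t \<omega> - W s \<omega>)\<^sup>2)" by (simp add: past_mean_def)
  qed
qed

lemma window_square_measurable:
  assumes t: "t \<ge> 1"
  shows "(\<lambda>\<omega>. integral {t - 1..t} (\<lambda>s. (W t \<omega> - W s \<omega>)\<^sup>2)) \<in> borel_measurable M"
  using t by (intro borel_measurable_integral_process borel_measurable_power borel_measurable_diff wiener_borel continuous_intros wiener_continuous) auto

lemma window_square_integral:
  assumes T: "T \<ge> 1"
  shows "(\<integral>\<^sup>+\<omega>. ennreal (integral {1..T} (\<lambda>t. integral {t - 1..t} (\<lambda>s. (W t \<omega> - W s \<omega>)\<^sup>2))) \<partial>M) \<le> ennreal T"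
proof -
  have "(\<integral>\<^sup>+\<omega>. ennreal (integral {1..T} (\<lambda>t. integral {t - 1..t} (\<lambda>s. (W t \<omega> - W s \<omega>)\<^sup>2))) \<partial>M) \<le> ennreal (1 * (T - 1))"
  proof (rule expectation_integral_process_le[OF wiener_sigma_finite])
    fix t assume t: "t \<in> {1..T}"
    show "(\<integral>\<^sup>+\<omega>. ennreal (integral {t - 1..t} (\<lambda>s. (W t \<omega> - W s \<omega>)\<^sup>2)) \<partial>M) \<le> ennreal 1"
      using t by (intro last_unit_square_integral) auto
    fix \<omega> assume "\<omega> \<in> space M"
    then show "0 \<le> integral {t - 1..t} (\<lambda>s. (W t \<omega> - W s \<omega>)\<^sup>2)"
      using t by (intro integral_nonneg integrable_continuous_real continuous_intros wiener_continuous) auto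
  qed (use T in \<open>auto intro: window_square_continuous window_square_measurable\<close>)
  also have "\<dots> \<le> ennreal T" using T by (intro ennreal_leI) simp
  finally show ?thesis .
qed

lemma wiener_square_nn: "t \<ge> 0 \<Longrightarrow> (\<integral>\<^sup>+\<omega>. ennreal ((W t \<omega>)\<^sup>2) \<partial>M) = ennreal t"
  using wiener_square_integrable[OF wiener_process_upto[of t], of t] by (subst nn_integral_eq_integral) auto

lemma occupation_square_integral:
  assumes T: "T > 0"
  shows "(\<integral>\<^sup>+\<omega>. ennreal (integral {0..T} (\<lambda>t. (W t \<omega>)\<^sup>2)) \<partial>M) \<le> ennreal (T\<^sup>2)"
proof -
  have "(\<integral>\<^sup>+\<omega>. ennreal (integral {0..T} (\<lambda>t. (W t \<omega>)\<^sup>2)) \<partial>M) \<le> ennreal (T * (T - 0))"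
  proof (rule expectation_integral_process_le[OF wiener_sigma_finite])
    fix t assume t: "t \<in> {0..T}"
    show "(\<lambda>\<omega>. (W t \<omega>)\<^sup>2) \<in> borel_measurable M"
      using t T by (intro borel_measurable_power wiener_borel) auto
    show "(\<integral>\<^sup>+\<omega>. ennreal ((W t \<omega>)\<^sup>2) \<partial>M) \<le> ennreal T"
      using t by (subst wiener_square_nn) (auto intro!: ennreal_leI)
  qed (use T in \<open>auto intro!: continuous_intros wiener_continuous\<close>)
  then show ?thesis by (simp add: power2_eq_square)
qed

end

text \<open>The right-hand side is approximated by integrals over noise that depend neither on \<open>T\<close> nor on the Wiener
  process, because the increments are normalized by \<open>sqrt T\<close>. This is all that is needed for Brownian scaling.\<close>

lemma wiener_functional_limit:
  fixes g :: "real \<times> real \<Rightarrow> real"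
  assumes W: "wiener_process M {0..T} W" and T: "T > 0" and g: "continuous_on UNIV g" "bounded (range g)"
  shows "(\<lambda>n. \<integral>z. g (((\<Sum>i<n. z i)\<^sup>2 - 1) / 2, (\<Sum>k<n. (\<Sum>i<k. z i)\<^sup>2) / real n) \<partial>noise (1 / real n) n)
    \<longlonglongrightarrow> (\<integral>\<omega>. g (((W T \<omega>)\<^sup>2 / T - 1) / 2, integral {0..T} (\<lambda>t. (W t \<omega>)\<^sup>2) / T\<^sup>2) \<partial>M)"
proof -
  interpret prob_space M using W by (simp add: wiener_process_def)
  obtain B where B: "\<And>x. \<bar>g x\<bar> \<le> B" using g(2) unfolding bounded_iff by auto
  have gm [measurable]: "g \<in> borel_measurable borel" using g(1) by (simp add: borel_measurable_continuous_onI)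
  define G where "G n z = g (((\<Sum>i<n. z i)\<^sup>2 - 1) / 2, (\<Sum>k<n. (\<Sum>i<k. z i)\<^sup>2) / real n)" for n and z :: "nat \<Rightarrow> real"
  define node where "node n i = real i * (T / real n)" for n i :: nat
  define inc where "inc n \<omega> = (\<lambda>i\<in>{..<n}. (W (node n (Suc i)) \<omega> - W (node n i) \<omega>) / sqrt T)" for n \<omega>
  have node: "node n i \<in> {0..T}" if "i \<le> n" for n i
  proof -
    have "real i * T \<le> real n * T" using that T by (intro mult_right_mono) auto
    then show ?thesis using T that by (cases "n = 0") (auto simp: node_def pos_divide_le_eq mult.commute)
  qed
  have Wm: "W t \<in> borel_measurable M" if "t \<in> {0..T}" for t by (rule wiener_measurable[OF W that])
  have Wc: "continuous_on {0..T} (\<lambda>t. W t \<omega>)" if "\<omega> \<in> space M" for \<omega>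
    using W that by (simp add: wiener_process_def continuous_process_def)
  have incm: "inc n \<in> measurable M (PiM {..<n} (\<lambda>_. borel))" for n
    unfolding inc_def using node by (intro measurable_restrict borel_measurable_divide borel_measurable_diff Wm borel_measurable_const) auto
  have Gm: "G n \<in> borel_measurable (PiM {..<n} (\<lambda>_. borel))" for n
  proof -
    have "(\<lambda>z. (((\<Sum>i<n. z i)\<^sup>2 - 1) / 2, (\<Sum>k<n. (\<Sum>i<k. z i)\<^sup>2) / real n)) \<in> measurable (PiM {..<n} (\<lambda>_. borel :: real measure)) (borel \<Otimes>\<^sub>M borel)"
      by (intro measurable_Pair borel_measurable_divide borel_measurable_diff borel_measurable_power borel_measurable_sum
          borel_measurable_const measurable_component_singleton) auto
    then show ?thesis unfolding G_def[abs_def] by (intro measurable_compose[OF _ gm]) (simp add: borel_prod)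
  qed
  have "(\<lambda>n. \<integral>\<omega>. G n (inc n \<omega>) \<partial>M)
    \<longlonglongrightarrow> (\<integral>\<omega>. g (((W T \<omega>)\<^sup>2 / T - 1) / 2, integral {0..T} (\<lambda>t. (W t \<omega>)\<^sup>2) / T\<^sup>2) \<partial>M)"
  proof (rule integral_dominated_convergence[where w = "\<lambda>_. B"])
    have [measurable]: "W T \<in> borel_measurable M" using T by (intro Wm) auto
    have [measurable]: "(\<lambda>\<omega>. integral {0..T} (\<lambda>t. (W t \<omega>)\<^sup>2)) \<in> borel_measurable M"
      by (intro borel_measurable_integral_process borel_measurable_power Wm continuous_intros Wc)
    have "(\<lambda>\<omega>. (((W T \<omega>)\<^sup>2 / T - 1) / 2, integral {0..T} (\<lambda>t. (W t \<omega>)\<^sup>2) / T\<^sup>2)) \<in> borel_measurable M"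
      unfolding borel_prod[symmetric] by measurable
    then show "(\<lambda>\<omega>. g (((W T \<omega>)\<^sup>2 / T - 1) / 2, integral {0..T} (\<lambda>t. (W t \<omega>)\<^sup>2) / T\<^sup>2)) \<in> borel_measurable M"
      by (rule measurable_compose[OF _ gm])
    show "(\<lambda>\<omega>. G n (inc n \<omega>)) \<in> borel_measurable M" for n by (rule measurable_compose[OF incm Gm])
    have "AE \<omega> in M. W 0 \<omega> = 0" using W by (simp add: wiener_process_def)
    then show "AE \<omega> in M. (\<lambda>n. G n (inc n \<omega>)) \<longlonglongrightarrow> g (((W T \<omega>)\<^sup>2 / T - 1) / 2, integral {0..T} (\<lambda>t. (W t \<omega>)\<^sup>2) / T\<^sup>2)"
      using AE_space
    proof eventually_elim
      case (elim \<omega>)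
      have part: "(\<Sum>i<k. inc n \<omega> i) = W (node n k) \<omega> / sqrt T" if "k \<le> n" for n k
      proof -
        have "(\<Sum>i<k. inc n \<omega> i) = (\<Sum>i<k. W (node n (Suc i)) \<omega> - W (node n i) \<omega>) / sqrt T"
          unfolding sum_divide_distrib using that by (intro sum.cong) (auto simp: inc_def)
        also have "\<dots> = W (node n k) \<omega> / sqrt T"
          using elim(1) by (subst sum_lessThan_telescope) (simp add: node_def)
        finally show ?thesis .
      qed
      have "G n (inc n \<omega>) = g (((W T \<omega>)\<^sup>2 / T - 1) / 2, (T / real n * (\<Sum>k<n. (W (0 + real k * (T / real n)) \<omega>)\<^sup>2)) / T\<^sup>2)"
        if n: "n > 0" for n
      proof -
        have "node n n = T" using n by (simp add: node_def)
        then have "(\<Sum>i<n. inc n \<omega> i)\<^sup>2 = (W T \<omega>)\<^sup>2 / T" using part[of n n] T by (simp add: power_divide)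
        moreover have "(\<Sum>k<n. (\<Sum>i<k. inc n \<omega> i)\<^sup>2) / real n = (T / real n * (\<Sum>k<n. (W (0 + real k * (T / real n)) \<omega>)\<^sup>2)) / T\<^sup>2"
        proof -
          have "(\<Sum>k<n. (\<Sum>i<k. inc n \<omega> i)\<^sup>2) = (\<Sum>k<n. (W (node n k) \<omega>)\<^sup>2) / T"
            unfolding sum_divide_distrib using part T by (intro sum.cong) (auto simp: power_divide)
          then show ?thesis using T by (simp add: node_def power2_eq_square)
        qed
        ultimately show ?thesis by (simp add: G_def)
      qed
      then have ev: "\<forall>\<^sub>F n in sequentially. g (((W T \<omega>)\<^sup>2 / T - 1) / 2, (T / real n * (\<Sum>k<n. (W (0 + real k * (T / real n)) \<omega>)\<^sup>2)) / T\<^sup>2)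
          = G n (inc n \<omega>)"
        by (intro eventually_mono[OF eventually_gt_at_top[of 0]]) (rule sym)
      have sq: "continuous_on {0..T} (\<lambda>t. (W t \<omega>)\<^sup>2)" by (intro continuous_intros Wc elim)
      have "(\<lambda>n. (T / real n * (\<Sum>k<n. (W (0 + real k * (T / real n)) \<omega>)\<^sup>2)) / T\<^sup>2) \<longlonglongrightarrow> integral {0..T} (\<lambda>t. (W t \<omega>)\<^sup>2) / T\<^sup>2"
        using riemann_sums_tendsto[of 0 T "\<lambda>t. (W t \<omega>)\<^sup>2"] T sq by (intro tendsto_divide tendsto_const) auto
      then have "(\<lambda>n. g (((W T \<omega>)\<^sup>2 / T - 1) / 2, (T / real n * (\<Sum>k<n. (W (0 + real k * (T / real n)) \<omega>)\<^sup>2)) / T\<^sup>2))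
          \<longlonglongrightarrow> g (((W T \<omega>)\<^sup>2 / T - 1) / 2, integral {0..T} (\<lambda>t. (W t \<omega>)\<^sup>2) / T\<^sup>2)"
        by (intro continuous_on_tendsto_compose[OF g(1)] tendsto_Pair tendsto_const) auto
      from Lim_transform_eventually[OF this ev] show ?case .
    qed
    show "AE \<omega> in M. norm (G n (inc n \<omega>)) \<le> B" for n using B by (simp add: G_def)
  qed simp
  moreover have "\<forall>\<^sub>F n in sequentially. (\<integral>\<omega>. G n (inc n \<omega>) \<partial>M) = (\<integral>z. G n z \<partial>noise (1 / real n) n)"
    using eventually_gt_at_top[of 0]
  proof eventually_elim
    case (elim n)
    have "distr M (PiM {..<n} (\<lambda>_. borel)) (inc n) = noise (1 / real n) n"
      unfolding inc_def[abs_def]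
    proof (rule increments_law[OF W elim])
      show "node n (Suc i) - node n i = (sqrt T)\<^sup>2 * (1 / real n)" if "i < n" for i
        using T by (simp add: node_def add_divide_distrib distrib_right)
    qed (use T elim node in auto)
    then show ?case using integral_distr[OF incm Gm, of n] by simp
  qed
  ultimately show ?thesis
    unfolding G_def by (rule Lim_transform_eventually)
qed

lemma wiener_scaling:
  fixes g :: "real \<times> real \<Rightarrow> real"
  assumes W: "wiener_process M {0..T} W" and T: "T > 0" and V: "wiener_process L {0..1} V"
    and g: "continuous_on UNIV g" "bounded (range g)"
  shows "(\<integral>\<omega>. g (((W T \<omega>)\<^sup>2 / T - 1) / 2, integral {0..T} (\<lambda>t. (W t \<omega>)\<^sup>2) / T\<^sup>2) \<partial>M)
    = (\<integral>\<omega>. g (((V 1 \<omega>)\<^sup>2 - 1) / 2, integral {0..1} (\<lambda>t. (V t \<omega>)\<^sup>2)) \<partial>L)"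
  using LIMSEQ_unique[OF wiener_functional_limit[OF W T g] wiener_functional_limit[OF V zero_less_one g]] by simp

section \<open>Asymptotics of score and information\<close>

lemma abs_combination_le:
  fixes a x A C I G P i Cb Rb :: real
  assumes "\<bar>C\<bar> \<le> Cb" "0 \<le> I" "I \<le> Rb" "0 \<le> x" "\<bar>P\<bar> \<le> 2 * i"
  shows "\<bar>a + x / 2 - A / 2 + C - I / 2 - G / 2 - P / 2\<bar> \<le> \<bar>a\<bar> + (x + Cb + Rb + 2 * i) + (\<bar>A\<bar> + \<bar>G\<bar>)"
proof -
  have "\<bar>a + x / 2 - A / 2 + C - I / 2 - G / 2 - P / 2\<bar> \<le> \<bar>a\<bar> + x / 2 + \<bar>A\<bar> / 2 + \<bar>C\<bar> + I / 2 + \<bar>G\<bar> / 2 + \<bar>P\<bar> / 2"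
    using assms(2,4) abs_ge_self[of a] abs_ge_minus_self[of a] abs_ge_self[of A] abs_ge_minus_self[of A]
      abs_ge_self[of C] abs_ge_minus_self[of C] abs_ge_self[of G] abs_ge_minus_self[of G] abs_ge_self[of P] abs_ge_minus_self[of P]
    by (intro abs_leI) argo+
  then show ?thesis using assms by linarith
qed

context delay_model
begin

text \<open>By \<open>score_eq_squares\<close> the difference consists of terms that are fixed or have bounded moments,
  divided by \<open>T\<close>, and of the error in the law of large numbers for the squared increments.\<close>

lemma score_remainder:
  "to_zero (\<lambda>T \<omega>. score (\<lambda>t. X 0 t \<omega>) T / T - ((W T \<omega>)\<^sup>2 / T - 1) / 2) at_top"
proof -
  define C where "C \<omega> = integral {-1..0} (\<lambda>t. (X 0 t \<omega>)\<^sup>2) / 2 - past_mean (\<lambda>t. X 0 t \<omega>) 0 * X 0 0 \<omega>" for \<omega>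
  define R0 where "R0 \<omega> = integral {0..2} (\<lambda>t. (X 0 t \<omega> - X 0 (t - 1) \<omega>)\<^sup>2)" for \<omega>
  (* u T + p T = T with u T between 1 and 2, so that on [u T, T] the lagged times are nonnegative and only W enters *)
  define p where "p T = nat \<lfloor>T\<rfloor> - 1" for T :: real
  define u where "u T = T - real (p T)" for T
  define G where "G T \<omega> = integral {u T..u T + real (p T)} (\<lambda>t. (W t \<omega> - W (t - 1) \<omega>)\<^sup>2) - real (p T)" for T \<omega>
  define A where "A T \<omega> = integral {T - 1..T} (\<lambda>t. (W T \<omega> - W t \<omega>)\<^sup>2)" for T \<omega>
  have Xm: "X 0 t \<in> borel_measurable M" if "t \<ge> -1" for t by (rule X_measurable[OF that])
  have Xc: "continuous_on {-1..T} (\<lambda>t. X 0 t \<omega>)" if "\<omega> \<in> space M" for T \<omega> by (rule X_continuous[OF that])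
  have lag: "continuous_on {0..T} (\<lambda>t. (X 0 t \<omega> - X 0 (t - 1) \<omega>)\<^sup>2)" if "\<omega> \<in> space M" for T \<omega>
    by (intro continuous_on_power continuous_on_diff continuous_on_subset[OF Xc[OF that, of T]]
        continuous_on_compose2[OF Xc[OF that, of T]] continuous_on_id continuous_on_const) auto
  have Cm: "C \<in> borel_measurable M"
    unfolding C_def[abs_def] past_mean_def using Xc[of _ 0]
    by (intro borel_measurable_diff borel_measurable_divide borel_measurable_times borel_measurable_integral_process
        borel_measurable_power Xm continuous_on_power borel_measurable_const) auto
  have R0m: "R0 \<in> borel_measurable M"
    unfolding R0_def[abs_def]
    by (intro borel_measurable_integral_process borel_measurable_power borel_measurable_diff Xm lag) auto
  have uT: "1 \<le> u T" "u T \<le> 2" "u T + real (p T) = T" "\<bar>real (p T) / T - 1\<bar> \<le> 2 / T" "real (p T) \<le> T" if "T \<ge> 1" for T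
  proof -
    have "1 \<le> \<lfloor>T\<rfloor>" using that by simp
    then have "real (nat \<lfloor>T\<rfloor>) = real_of_int \<lfloor>T\<rfloor>" "1 \<le> nat \<lfloor>T\<rfloor>" by linarith+
    then have "real (p T) = real_of_int \<lfloor>T\<rfloor> - 1" unfolding p_def by (subst of_nat_diff) auto
    then have b: "real (p T) \<le> T - 1" "T - 2 \<le> real (p T)" by linarith+
    then show "1 \<le> u T" "u T \<le> 2" "u T + real (p T) = T" "real (p T) \<le> T" by (auto simp: u_def)
    have "real (p T) / T - 1 = (real (p T) - T) / T" using that by (simp add: diff_divide_distrib)
    then have "\<bar>real (p T) / T - 1\<bar> = \<bar>real (p T) - T\<bar> / T" using that by (simp add: abs_divide)
    then show "\<bar>real (p T) / T - 1\<bar> \<le> 2 / T" using b that by (simp add: divide_right_mono)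
  qed
  have Gm: "G T \<in> borel_measurable M" if "T \<ge> 1" for T
    unfolding G_def[abs_def] using uT[OF that]
    by (intro borel_measurable_diff borel_measurable_integral_process borel_measurable_power W_measurable borel_measurable_const
        continuous_on_power continuous_on_diff wiener_continuous[OF W] continuous_on_compose2[OF wiener_continuous[OF W, of _ 0 T]] continuous_on_id continuous_on_const) auto
  have Am: "A T \<in> borel_measurable M" if "T \<ge> 1" for T
    unfolding A_def[abs_def] using that
    by (intro borel_measurable_integral_process borel_measurable_power borel_measurable_diff W_measurable
        continuous_on_power continuous_on_diff wiener_continuous[OF W] continuous_on_const) auto
  have ge1: "\<forall>\<^sub>F T :: real in at_top. T \<ge> 1" by (rule eventually_ge_at_top)
  have inv: "((\<lambda>T::real. c / T) \<longlongrightarrow> 0) at_top" for c :: real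
    by (intro tendsto_divide_0[OF tendsto_const] filterlim_at_top_imp_at_infinity filterlim_ident)
  have z1: "to_zero (\<lambda>T \<omega>. W T \<omega> / T) at_top"
  proof (rule to_zero_L2[OF _ _ inv[of 1]])
    show "\<forall>\<^sub>F T in at_top. (\<lambda>\<omega>. W T \<omega> / T) \<in> borel_measurable M"
      using ge1 by eventually_elim (auto intro!: borel_measurable_divide W_measurable)
    show "\<forall>\<^sub>F T in at_top. (\<integral>\<^sup>+\<omega>. ennreal ((W T \<omega> / T)\<^sup>2) \<partial>M) \<le> ennreal (1 / T)"
      using ge1
    proof eventually_elim
      case (elim T)
      have "(\<integral>\<^sup>+\<omega>. ennreal ((W T \<omega> / T)\<^sup>2) \<partial>M) = (\<integral>\<^sup>+\<omega>. ennreal (1 / T\<^sup>2) * ennreal ((W T \<omega>)\<^sup>2) \<partial>M)"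
        by (intro nn_integral_cong) (simp add: power_divide ennreal_mult'[symmetric])
      also have "\<dots> = ennreal (1 / T\<^sup>2) * ennreal T"
        using elim wiener_square_nn[OF W, of T] W_measurable[of T] by (subst nn_integral_cmult) auto
      also have "\<dots> = ennreal (1 / T)" using elim by (simp add: ennreal_mult'[symmetric] power2_eq_square)
      finally show ?case by simp
    qed
  qed
  have z2: "to_zero (\<lambda>T \<omega>. A T \<omega> / T) at_top"
  proof (rule to_zero_L1[OF _ _ inv[of 1]])
    show "\<forall>\<^sub>F T in at_top. (\<lambda>\<omega>. A T \<omega> / T) \<in> borel_measurable M"
      using ge1 by eventually_elim (auto intro!: borel_measurable_divide Am)
    show "\<forall>\<^sub>F T in at_top. (\<integral>\<^sup>+\<omega>. ennreal \<bar>A T \<omega> / T\<bar> \<partial>M) \<le> ennreal (1 / T)"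
      using ge1
    proof eventually_elim
      case (elim T)
      have "(\<integral>\<^sup>+\<omega>. ennreal \<bar>A T \<omega> / T\<bar> \<partial>M) = (\<integral>\<^sup>+\<omega>. ennreal (1 / T) * ennreal (A T \<omega>) \<partial>M)"
      proof (rule nn_integral_cong)
        fix \<omega> assume w: "\<omega> \<in> space M"
        have "A T \<omega> \<ge> 0" unfolding A_def
          using elim by (intro integral_nonneg integrable_continuous_real continuous_on_power continuous_on_diff wiener_continuous[OF W w] continuous_on_const) auto
        then show "ennreal \<bar>A T \<omega> / T\<bar> = ennreal (1 / T) * ennreal (A T \<omega>)" using elim by (simp add: ennreal_mult'[symmetric])
      qed
      also have "\<dots> = ennreal (1 / T) * (\<integral>\<^sup>+\<omega>. ennreal (A T \<omega>) \<partial>M)"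
        using Am[OF elim] by (subst nn_integral_cmult) auto
      also have "\<dots> \<le> ennreal (1 / T) * ennreal 1"
        unfolding A_def by (intro mult_left_mono last_unit_square_integral[OF W elim]) simp
      finally show ?case by simp
    qed
  qed
  have z3: "to_zero (\<lambda>T \<omega>. G T \<omega> / T) at_top"
  proof (rule to_zero_L2[OF _ _ inv[of 2]])
    show "\<forall>\<^sub>F T in at_top. (\<lambda>\<omega>. G T \<omega> / T) \<in> borel_measurable M"
      using ge1 by eventually_elim (auto intro!: borel_measurable_divide Gm)
    show "\<forall>\<^sub>F T in at_top. (\<integral>\<^sup>+\<omega>. ennreal ((G T \<omega> / T)\<^sup>2) \<partial>M) \<le> ennreal (2 / T)"
      using ge1
    proof eventually_elim
      case (elim T)
      have "(\<integral>\<^sup>+\<omega>. ennreal ((G T \<omega> / T)\<^sup>2) \<partial>M) = (\<integral>\<^sup>+\<omega>. ennreal (1 / T\<^sup>2) * ennreal ((G T \<omega>)\<^sup>2) \<partial>M)"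
        by (intro nn_integral_cong) (simp add: power_divide ennreal_mult'[symmetric])
      also have "\<dots> = ennreal (1 / T\<^sup>2) * (\<integral>\<^sup>+\<omega>. ennreal ((G T \<omega>)\<^sup>2) \<partial>M)"
        using Gm[OF elim] by (subst nn_integral_cmult) auto
      also have "\<dots> \<le> ennreal (1 / T\<^sup>2) * ennreal (2 * real (p T))"
        unfolding G_def by (intro mult_left_mono lag_square_integral_variance[OF W] uT elim) simp
      also have "\<dots> \<le> ennreal (1 / T\<^sup>2) * ennreal (2 * T)"
        using uT[OF elim] by (intro mult_left_mono ennreal_leI) auto
      also have "\<dots> = ennreal (2 / T)" using elim by (simp add: ennreal_mult'[symmetric] power2_eq_square)
      finally show ?case .
    qed
  qed
  have X0m: "X0 0 \<in> borel_measurable M" by (rule X0_measurable) simp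
  have z4: "to_zero (\<lambda>T \<omega>. X0 0 \<omega> * (W T \<omega> / T)) at_top"
    by (rule to_zero_tight_mult[OF tight_const[OF X0m] z1])
  have z5: "to_zero (\<lambda>T \<omega>. ((X0 0 \<omega>)\<^sup>2 + \<bar>C \<omega>\<bar> + \<bar>R0 \<omega>\<bar> + 2) * (1 / T)) at_top"
    using X0m Cm R0m by (intro to_zero_fixed inv) auto
  note total = to_zero_add[OF to_zero_add[OF to_zero_abs[OF z4] z5] to_zero_add[OF to_zero_abs[OF z2] to_zero_abs[OF z3]]]
  show ?thesis
  proof (rule to_zero_bound[OF total])
    show "\<forall>\<^sub>F T in at_top. (\<lambda>\<omega>. score (\<lambda>t. X 0 t \<omega>) T / T - ((W T \<omega>)\<^sup>2 / T - 1) / 2) \<in> borel_measurable M"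
      using ge1
    proof eventually_elim
      case (elim T)
      then have "T > 0" "T \<ge> 0" by auto
      then show ?case
        by (intro borel_measurable_diff borel_measurable_divide borel_measurable_power borel_measurable_const
            X_integrals_measurable(2) W_measurable)
    qed
    show "\<forall>\<^sub>F T in at_top. AE \<omega> in M. \<bar>score (\<lambda>t. X 0 t \<omega>) T / T - ((W T \<omega>)\<^sup>2 / T - 1) / 2\<bar>
        \<le> \<bar>\<bar>X0 0 \<omega> * (W T \<omega> / T)\<bar> + ((X0 0 \<omega>)\<^sup>2 + \<bar>C \<omega>\<bar> + \<bar>R0 \<omega>\<bar> + 2) * (1 / T) + (\<bar>A T \<omega> / T\<bar> + \<bar>G T \<omega> / T\<bar>)\<bar>"
      using ge1
    proof eventually_elim
      case (elim T)
      show ?case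
        using X_AE_equation[of 0] AE_space
      proof eventually_elim
        case (elim \<omega>)
        note T = \<open>T \<ge> 1\<close> and w = elim(2)
        have Xt: "X 0 t \<omega> = X0 0 \<omega> + W t \<omega>" if "t \<ge> 0" for t using elim that by simp
        let ?f = "\<lambda>t. X 0 t \<omega>" and ?x = "X0 0 \<omega>" and ?w = "W T \<omega>"
        have IA: "integral {T - 1..T} (\<lambda>t. (?f T - ?f t)\<^sup>2) = A T \<omega>"
          unfolding A_def using T by (intro integral_cong) (auto simp: Xt)
        define I0 where "I0 = integral {0..u T} (\<lambda>t. (?f t - ?f (t - 1))\<^sup>2)"
        have lagi: "(\<lambda>t. (?f t - ?f (t - 1))\<^sup>2) integrable_on {a..b}" if "0 \<le> a" for a b
          using that by (intro integrable_continuous_real continuous_on_subset[OF lag[OF w, of b]]) auto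
        have "integral {0..T} (\<lambda>t. (?f t - ?f (t - 1))\<^sup>2) = I0 + integral {u T..T} (\<lambda>t. (?f t - ?f (t - 1))\<^sup>2)"
          unfolding I0_def using uT[OF T]
          by (intro Henstock_Kurzweil_Integration.integral_combine[symmetric] lagi) auto
        also have "integral {u T..T} (\<lambda>t. (?f t - ?f (t - 1))\<^sup>2) = integral {u T..T} (\<lambda>t. (W t \<omega> - W (t - 1) \<omega>)\<^sup>2)"
          using uT[OF T] by (intro integral_cong) (auto simp: Xt)
        also have "\<dots> = G T \<omega> + real (p T)" using uT[OF T] by (simp add: G_def)
        finally have IL: "integral {0..T} (\<lambda>t. (?f t - ?f (t - 1))\<^sup>2) = I0 + (G T \<omega> + real (p T))" .
        have I0: "0 \<le> I0" "I0 \<le> R0 \<omega>"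
        proof -
          show "0 \<le> I0" unfolding I0_def by (intro integral_nonneg lagi) auto
          show "I0 \<le> R0 \<omega>" unfolding I0_def R0_def using uT[OF T] by (intro integral_subset_le lagi) auto
        qed
        have "score ?f T = (?x + ?w)\<^sup>2 / 2 - A T \<omega> / 2 + C \<omega> - (I0 + (G T \<omega> + real (p T))) / 2"
        proof -
          have "T \<ge> 0" using T by simp
          note sq = score_eq_squares[OF Xc[OF w, of T] this]
          have XT: "?f T = ?x + ?w" using Xt[of T] T by simp
          show ?thesis unfolding sq IA IL C_def[of \<omega>] unfolding XT by (rule refl)
        qed
        then have "score ?f T / T - (?w\<^sup>2 / T - 1) / 2
            = ?x * (?w / T) + ?x\<^sup>2 * (1 / T) / 2 - A T \<omega> / T / 2 + C \<omega> * (1 / T)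
              - I0 * (1 / T) / 2 - G T \<omega> / T / 2 - (real (p T) / T - 1) / 2"
          by (simp add: power2_sum add_divide_distrib diff_divide_distrib)
        moreover have "\<bar>C \<omega> * (1 / T)\<bar> \<le> \<bar>C \<omega>\<bar> * (1 / T)" using T by (simp add: abs_mult)
        moreover have "I0 * (1 / T) \<le> \<bar>R0 \<omega>\<bar> * (1 / T)" using T I0 by (intro mult_right_mono) auto
        moreover have "0 \<le> I0 * (1 / T)" "0 \<le> ?x\<^sup>2 * (1 / T)" using T I0 by auto
        moreover have "\<bar>real (p T) / T - 1\<bar> \<le> 2 * (1 / T)" using uT[OF T] by simp
        ultimately have "\<bar>score ?f T / T - (?w\<^sup>2 / T - 1) / 2\<bar>
            \<le> \<bar>?x * (?w / T)\<bar> + (?x\<^sup>2 * (1 / T) + \<bar>C \<omega>\<bar> * (1 / T) + \<bar>R0 \<omega>\<bar> * (1 / T) + 2 * (1 / T)) + (\<bar>A T \<omega> / T\<bar> + \<bar>G T \<omega> / T\<bar>)"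
          by (simp only: abs_combination_le)
        also have "?x\<^sup>2 * (1 / T) + \<bar>C \<omega>\<bar> * (1 / T) + \<bar>R0 \<omega>\<bar> * (1 / T) + 2 * (1 / T)
            = (?x\<^sup>2 + \<bar>C \<omega>\<bar> + \<bar>R0 \<omega>\<bar> + 2) * (1 / T)"
          by (simp only: distrib_right)
        finally show ?case by (rule order_trans[OF _ abs_ge_self])
      qed
    qed
  qed
qed

text \<open>The past mean differs from the Wiener process by an amount whose square has bounded expectation, apart from the
  contribution of the initial segment. Its integral divided by \<open>T\<^sup>2\<close> therefore vanishes in probability, and
  \<open>integral_square_diff_le\<close> carries this over to the difference of the integrated squares.\<close>

lemma information_remainder:
  "to_zero (\<lambda>T \<omega>. information (\<lambda>t. X 0 t \<omega>) T / T\<^sup>2 - integral {0..T} (\<lambda>t. (W t \<omega>)\<^sup>2) / T\<^sup>2) at_top"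
proof -
  define S where "S T \<omega> = integral {0..T} (\<lambda>t. (W t \<omega>)\<^sup>2) / T\<^sup>2" for T \<omega>
  define D where "D T \<omega> = integral {0..T} (\<lambda>t. (past_mean (\<lambda>t. X 0 t \<omega>) t - W t \<omega>)\<^sup>2)" for T \<omega>
  define q where "q t \<omega> = integral {t - 1..t} (\<lambda>s. (W t \<omega> - W s \<omega>)\<^sup>2)" for t \<omega>
  define Q where "Q T \<omega> = integral {1..T} (\<lambda>t. q t \<omega>)" for T \<omega>
  have Wc: "continuous_on {a..b} (\<lambda>t. W t \<omega>)" if "\<omega> \<in> space M" "0 \<le> a" for a b \<omega> by (rule wiener_continuous[OF W that])
  have pc: "continuous_on {0..T} (past_mean (\<lambda>t. X 0 t \<omega>))" if "\<omega> \<in> space M" for T \<omega>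
    by (rule continuous_past_mean[OF X_continuous[OF that]])
  have dc: "continuous_on {0..T} (\<lambda>t. (past_mean (\<lambda>t. X 0 t \<omega>) t - W t \<omega>)\<^sup>2)" if "\<omega> \<in> space M" for T \<omega>
    by (intro continuous_on_power continuous_on_diff pc Wc that order_refl)
  have Sm: "S T \<in> borel_measurable M" for T
    unfolding S_def[abs_def]
    by (intro borel_measurable_divide borel_measurable_integral_process borel_measurable_power W_measurable borel_measurable_const continuous_on_power Wc) auto
  have Dm: "D T \<in> borel_measurable M" if T: "T \<ge> 0" for T
    unfolding D_def[abs_def]
  proof (intro borel_measurable_integral_process borel_measurable_power borel_measurable_diff dc)
    fix t assume t: "t \<in> {0..T}"
    show "(\<lambda>\<omega>. past_mean (\<lambda>t. X 0 t \<omega>) t) \<in> borel_measurable M"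
      by (rule borel_measurable_past_mean[OF T _ _ t]) (auto intro!: X_measurable X_continuous)
    show "W t \<in> borel_measurable M" using t by (intro W_measurable) auto
  qed
  have qc: "continuous_on {1..T} (\<lambda>t. q t \<omega>)" if "\<omega> \<in> space M" for T \<omega>
    unfolding q_def by (rule window_square_continuous[OF W that])
  have Qm: "Q T \<in> borel_measurable M" for T
    unfolding Q_def[abs_def]
    by (intro borel_measurable_integral_process qc) (auto simp: q_def[abs_def] intro!: window_square_measurable[OF W])
  have ge1: "\<forall>\<^sub>F T :: real in at_top. T \<ge> 1" by (rule eventually_ge_at_top)
  have inv: "((\<lambda>T::real. c / T) \<longlongrightarrow> 0) at_top" for c :: real
    by (intro tendsto_divide_0[OF tendsto_const] filterlim_at_top_imp_at_infinity filterlim_ident)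
  have tightS: "tight M S at_top"
  proof (rule tight_L1)
    show "\<forall>\<^sub>F T in at_top. (\<integral>\<^sup>+\<omega>. ennreal \<bar>S T \<omega>\<bar> \<partial>M) \<le> ennreal 1"
      using ge1
    proof eventually_elim
      case (elim T)
      have "(\<integral>\<^sup>+\<omega>. ennreal \<bar>S T \<omega>\<bar> \<partial>M) = (\<integral>\<^sup>+\<omega>. ennreal (1 / T\<^sup>2) * ennreal (integral {0..T} (\<lambda>t. (W t \<omega>)\<^sup>2)) \<partial>M)"
      proof (rule nn_integral_cong)
        fix \<omega> assume w: "\<omega> \<in> space M"
        have "integral {0..T} (\<lambda>t. (W t \<omega>)\<^sup>2) \<ge> 0"
          by (intro integral_nonneg integrable_continuous_real continuous_on_power Wc w order_refl) auto
        then show "ennreal \<bar>S T \<omega>\<bar> = ennreal (1 / T\<^sup>2) * ennreal (integral {0..T} (\<lambda>t. (W t \<omega>)\<^sup>2))"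
          by (simp add: S_def ennreal_mult'[symmetric])
      qed
      also have "\<dots> = ennreal (1 / T\<^sup>2) * (\<integral>\<^sup>+\<omega>. ennreal (integral {0..T} (\<lambda>t. (W t \<omega>)\<^sup>2)) \<partial>M)"
        by (intro nn_integral_cmult measurable_compose[OF _ measurable_ennreal] borel_measurable_integral_process
            borel_measurable_power W_measurable continuous_on_power Wc) auto
      also have "\<dots> \<le> ennreal (1 / T\<^sup>2) * ennreal (T\<^sup>2)"
        using elim by (intro mult_left_mono occupation_square_integral[OF W]) auto
      also have "\<dots> = ennreal 1" using elim by (simp add: ennreal_mult'[symmetric])
      finally show ?case .
    qed
  qed (simp add: Sm)
  have zQ: "to_zero (\<lambda>T \<omega>. Q T \<omega> / T\<^sup>2) at_top"
  proof (rule to_zero_L1[OF _ _ inv[of 1]])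
    show "\<forall>\<^sub>F T in at_top. (\<lambda>\<omega>. Q T \<omega> / T\<^sup>2) \<in> borel_measurable M"
      by (intro always_eventually allI borel_measurable_divide Qm borel_measurable_const)
    show "\<forall>\<^sub>F T in at_top. (\<integral>\<^sup>+\<omega>. ennreal \<bar>Q T \<omega> / T\<^sup>2\<bar> \<partial>M) \<le> ennreal (1 / T)"
      using ge1
    proof eventually_elim
      case (elim T)
      have "(\<integral>\<^sup>+\<omega>. ennreal \<bar>Q T \<omega> / T\<^sup>2\<bar> \<partial>M) = (\<integral>\<^sup>+\<omega>. ennreal (1 / T\<^sup>2) * ennreal (Q T \<omega>) \<partial>M)"
      proof (rule nn_integral_cong)
        fix \<omega> assume w: "\<omega> \<in> space M"
        have "q t \<omega> \<ge> 0" if "t \<ge> 1" for t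
          unfolding q_def using that
          by (intro integral_nonneg integrable_continuous_real continuous_on_power continuous_on_diff Wc[OF w] continuous_on_const) auto
        then have "Q T \<omega> \<ge> 0" unfolding Q_def
          by (intro integral_nonneg integrable_continuous_real qc[OF w]) auto
        then show "ennreal \<bar>Q T \<omega> / T\<^sup>2\<bar> = ennreal (1 / T\<^sup>2) * ennreal (Q T \<omega>)"
          by (simp add: ennreal_mult'[symmetric])
      qed
      also have "\<dots> = ennreal (1 / T\<^sup>2) * (\<integral>\<^sup>+\<omega>. ennreal (Q T \<omega>) \<partial>M)"
        by (intro nn_integral_cmult measurable_compose[OF _ measurable_ennreal] Qm)
      also have "\<dots> \<le> ennreal (1 / T\<^sup>2) * ennreal T"
        unfolding Q_def q_def using elim by (intro mult_left_mono window_square_integral[OF W]) auto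
      also have "\<dots> = ennreal (1 / T)" using elim by (simp add: ennreal_mult'[symmetric] power2_eq_square)
      finally show ?case .
    qed
  qed
  have X0m: "X0 0 \<in> borel_measurable M" by (rule X0_measurable) simp
  have zF: "to_zero (\<lambda>T \<omega>. (\<bar>D 1 \<omega>\<bar> + 2 * (X0 0 \<omega>)\<^sup>2) * (1 / T)) at_top"
    using X0m Dm[of 1] by (intro to_zero_fixed inv) auto
  have zD: "to_zero (\<lambda>T \<omega>. D T \<omega> / T\<^sup>2) at_top"
  proof (rule to_zero_bound[OF to_zero_add[OF zF to_zero_add[OF to_zero_abs[OF zQ] to_zero_abs[OF zQ]]]])
    show "\<forall>\<^sub>F T in at_top. (\<lambda>\<omega>. D T \<omega> / T\<^sup>2) \<in> borel_measurable M"
      using ge1 by eventually_elim (auto intro!: borel_measurable_divide Dm)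
    show "\<forall>\<^sub>F T in at_top. AE \<omega> in M. \<bar>D T \<omega> / T\<^sup>2\<bar>
        \<le> \<bar>(\<bar>D 1 \<omega>\<bar> + 2 * (X0 0 \<omega>)\<^sup>2) * (1 / T) + (\<bar>Q T \<omega> / T\<^sup>2\<bar> + \<bar>Q T \<omega> / T\<^sup>2\<bar>)\<bar>"
      using ge1
    proof eventually_elim
      case (elim T)
      show ?case
        using X_AE_equation[of 0] AE_space
      proof eventually_elim
        case (elim \<omega>)
        note T = \<open>T \<ge> 1\<close> and w = elim(2)
        have Xt: "X 0 t \<omega> = X0 0 \<omega> + W t \<omega>" if "t \<ge> 0" for t using elim that by simp
        let ?d = "\<lambda>t. past_mean (\<lambda>t. X 0 t \<omega>) t - W t \<omega>" and ?x = "X0 0 \<omega>"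
        have di: "(\<lambda>t. (?d t)\<^sup>2) integrable_on {a..b}" if "0 \<le> a" for a b
          using that by (intro integrable_continuous_real continuous_on_subset[OF dc[OF w, of b]]) auto
        have pw: "(?d t)\<^sup>2 \<le> 2 * ?x\<^sup>2 + 2 * q t \<omega>" if t: "t \<ge> 1" for t
        proof -
          have wi: "(\<lambda>s. W s \<omega>) integrable_on {t - 1..t}" using t by (intro integrable_continuous_real Wc[OF w]) auto
          have "past_mean (\<lambda>t. X 0 t \<omega>) t = integral {t - 1..t} (\<lambda>s. ?x + W s \<omega>)"
            unfolding past_mean_def using t by (intro integral_cong) (auto simp: Xt)
          also have "\<dots> = ?x + integral {t - 1..t} (\<lambda>s. W s \<omega>)"
            by (subst Henstock_Kurzweil_Integration.integral_add[OF integrable_const_ivl wi]) simp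
          moreover have "integral {t - 1..t - 1 + 1} (\<lambda>s. W s \<omega> - W t \<omega>) = integral {t - 1..t} (\<lambda>s. W s \<omega>) - W t \<omega>"
            by (subst Henstock_Kurzweil_Integration.integral_diff) (use wi in auto)
          ultimately have d: "?d t = ?x + integral {t - 1..t - 1 + 1} (\<lambda>s. W s \<omega> - W t \<omega>)" by simp
          have "continuous_on {t - 1..t - 1 + 1} (\<lambda>s. W s \<omega> - W t \<omega>)"
            using t by (intro continuous_on_diff Wc[OF w] continuous_on_const) auto
          from square_integral_le_unit[OF this]
          have y: "(integral {t - 1..t - 1 + 1} (\<lambda>s. W s \<omega> - W t \<omega>))\<^sup>2 \<le> q t \<omega>"
            by (simp add: q_def power2_commute[of "W t \<omega>"])
          have "(x + y)\<^sup>2 \<le> 2 * x\<^sup>2 + 2 * y\<^sup>2" for x y :: real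
            using zero_le_power2[of "x - y"] by (simp add: power2_eq_square algebra_simps)
          from this[of ?x "integral {t - 1..t - 1 + 1} (\<lambda>s. W s \<omega> - W t \<omega>)"] y
          show ?thesis unfolding d by linarith
        qed
        have "D T \<omega> = D 1 \<omega> + integral {1..T} (\<lambda>t. (?d t)\<^sup>2)"
          unfolding D_def using T by (intro Henstock_Kurzweil_Integration.integral_combine[symmetric] di) auto
        also have "integral {1..T} (\<lambda>t. (?d t)\<^sup>2) \<le> integral {1..T} (\<lambda>t. 2 * ?x\<^sup>2 + 2 * q t \<omega>)"
          using pw by (intro integral_le di integrable_continuous_real continuous_on_add continuous_on_mult continuous_on_const qc[OF w]) auto
        also have "\<dots> = 2 * ?x\<^sup>2 * (T - 1) + 2 * Q T \<omega>"
          unfolding Q_def using T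
          by (subst Henstock_Kurzweil_Integration.integral_add)
            (auto intro!: integrable_continuous_real continuous_on_mult continuous_on_const qc[OF w])
        finally have le: "D T \<omega> \<le> D 1 \<omega> + (2 * ?x\<^sup>2 * (T - 1) + 2 * Q T \<omega>)" by simp
        have D0: "D T \<omega> \<ge> 0" "D 1 \<omega> \<ge> 0" unfolding D_def by (intro integral_nonneg di; simp)+
        have T2: "T\<^sup>2 > 0" "1 / T\<^sup>2 \<le> 1 / T" "0 \<le> 1 / T" "(T - 1) / T\<^sup>2 \<le> 1 / T"
        proof -
          have "T \<le> T\<^sup>2" using T by (simp add: power2_eq_square)
          then show "1 / T\<^sup>2 \<le> 1 / T" using T by (simp add: frac_le)
          have "(T - 1) / T\<^sup>2 \<le> T / T\<^sup>2" using T by (intro divide_right_mono) auto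
          then show "(T - 1) / T\<^sup>2 \<le> 1 / T" using T by (simp add: power2_eq_square)
        qed (use T in auto)
        have "D T \<omega> / T\<^sup>2 \<le> (D 1 \<omega> + (2 * ?x\<^sup>2 * (T - 1) + 2 * Q T \<omega>)) / T\<^sup>2"
          using le by (intro divide_right_mono) auto
        also have "\<dots> = D 1 \<omega> * (1 / T\<^sup>2) + 2 * ?x\<^sup>2 * ((T - 1) / T\<^sup>2) + (Q T \<omega> / T\<^sup>2 + Q T \<omega> / T\<^sup>2)"
          by (simp add: add_divide_distrib)
        also have "\<dots> \<le> D 1 \<omega> * (1 / T) + 2 * ?x\<^sup>2 * (1 / T) + (\<bar>Q T \<omega> / T\<^sup>2\<bar> + \<bar>Q T \<omega> / T\<^sup>2\<bar>)"
          using D0 T2 by (intro add_mono mult_left_mono abs_ge_self) auto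
        also have "\<dots> = (\<bar>D 1 \<omega>\<bar> + 2 * ?x\<^sup>2) * (1 / T) + (\<bar>Q T \<omega> / T\<^sup>2\<bar> + \<bar>Q T \<omega> / T\<^sup>2\<bar>)"
          using D0 by (simp only: distrib_right abs_of_nonneg)
        finally show ?case using D0 by simp
      qed
    qed
  qed
  note total = to_zero_add[OF to_zero_tight_mult[OF tight_add_const[OF tightS, of 1] to_zero_sqrt[OF zD]] zD]
  show ?thesis
  proof (rule to_zero_bound[OF total])
    show "\<forall>\<^sub>F T in at_top. (\<lambda>\<omega>. information (\<lambda>t. X 0 t \<omega>) T / T\<^sup>2 - integral {0..T} (\<lambda>t. (W t \<omega>)\<^sup>2) / T\<^sup>2) \<in> borel_measurable M"
      using ge1
    proof eventually_elim
      case (elim T)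
      show ?case using Sm[of T] X_integrals_measurable(3)[of T 0] elim
        by (intro borel_measurable_diff) (auto simp: S_def[abs_def])
    qed
    show "\<forall>\<^sub>F T in at_top. AE \<omega> in M. \<bar>information (\<lambda>t. X 0 t \<omega>) T / T\<^sup>2 - integral {0..T} (\<lambda>t. (W t \<omega>)\<^sup>2) / T\<^sup>2\<bar>
        \<le> \<bar>(S T \<omega> + 1) * sqrt \<bar>D T \<omega> / T\<^sup>2\<bar> + D T \<omega> / T\<^sup>2\<bar>"
      using ge1
    proof (eventually_elim, intro AE_I2)
      fix T \<omega> assume T: "(1::real) \<le> T" and w: "\<omega> \<in> space M"
      have "T\<^sup>2 > 0" using T by simp
      from integral_square_diff_le[OF pc[OF w, of T] Wc[OF w order_refl, of T] this]
      show "\<bar>information (\<lambda>t. X 0 t \<omega>) T / T\<^sup>2 - integral {0..T} (\<lambda>t. (W t \<omega>)\<^sup>2) / T\<^sup>2\<bar>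
        \<le> \<bar>(S T \<omega> + 1) * sqrt \<bar>D T \<omega> / T\<^sup>2\<bar> + D T \<omega> / T\<^sup>2\<bar>"
        unfolding information_def S_def D_def by linarith
    qed
  qed
qed

lemma score_information_tend_in_distribution:
  assumes V: "wiener_process L {0..1} V"
  shows "tends_in_distribution M (\<lambda>T \<omega>. (score (\<lambda>t. X 0 t \<omega>) T / T, information (\<lambda>t. X 0 t \<omega>) T / T\<^sup>2))
    L (\<lambda>\<omega>. (((V 1 \<omega>)\<^sup>2 - 1) / 2, integral {0..1} (\<lambda>t. (V t \<omega>)\<^sup>2))) at_top"
proof (rule tends_in_distribution_perturb)
  let ?Y = "\<lambda>T \<omega>. (score (\<lambda>t. X 0 t \<omega>) T / T, information (\<lambda>t. X 0 t \<omega>) T / T\<^sup>2)"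
  let ?Y' = "\<lambda>T \<omega>. (((W T \<omega>)\<^sup>2 / T - 1) / 2, integral {0..T} (\<lambda>t. (W t \<omega>)\<^sup>2) / T\<^sup>2)"
  have ge1: "\<forall>\<^sub>F T :: real in at_top. T \<ge> 1" by (rule eventually_ge_at_top)
  show "prob_space L" using V by (simp add: wiener_process_def)
  have [measurable]: "V 1 \<in> borel_measurable L" by (rule wiener_measurable[OF V]) simp
  have [measurable]: "(\<lambda>\<omega>. integral {0..1} (\<lambda>t. (V t \<omega>)\<^sup>2)) \<in> borel_measurable L"
    using V by (intro borel_measurable_integral_process borel_measurable_power continuous_on_power)
      (auto simp: wiener_process_def continuous_process_def)
  show "(\<lambda>\<omega>. (((V 1 \<omega>)\<^sup>2 - 1) / 2, integral {0..1} (\<lambda>t. (V t \<omega>)\<^sup>2))) \<in> borel_measurable L"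
    unfolding borel_prod[symmetric] by measurable
  show "tends_in_distribution M ?Y' L (\<lambda>\<omega>. (((V 1 \<omega>)\<^sup>2 - 1) / 2, integral {0..1} (\<lambda>t. (V t \<omega>)\<^sup>2))) at_top"
    unfolding tends_in_distribution_def
  proof (intro allI impI)
    fix g :: "real \<times> real \<Rightarrow> real" assume g: "continuous_on UNIV g \<and> bounded (range g)"
    have "\<forall>\<^sub>F T in at_top. (\<integral>\<omega>. g (?Y' T \<omega>) \<partial>M) = (\<integral>\<omega>. g (((V 1 \<omega>)\<^sup>2 - 1) / 2, integral {0..1} (\<lambda>t. (V t \<omega>)\<^sup>2)) \<partial>L)"
      using ge1
    proof eventually_elim
      case (elim T)
      then have "T > 0" by simp
      from wiener_scaling[OF wiener_process_upto[OF W] this V] g show ?case by blast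
    qed
    then show "((\<lambda>T. \<integral>\<omega>. g (?Y' T \<omega>) \<partial>M) \<longlongrightarrow> (\<integral>\<omega>. g (((V 1 \<omega>)\<^sup>2 - 1) / 2, integral {0..1} (\<lambda>t. (V t \<omega>)\<^sup>2)) \<partial>L)) at_top"
      by (rule tendsto_eventually)
  qed
  show Ym: "\<forall>\<^sub>F T in at_top. ?Y T \<in> borel_measurable M"
    using ge1
  proof eventually_elim
    case (elim T)
    then have [measurable]: "(\<lambda>\<omega>. score (\<lambda>t. X 0 t \<omega>) T) \<in> borel_measurable M" "(\<lambda>\<omega>. information (\<lambda>t. X 0 t \<omega>) T) \<in> borel_measurable M"
      using X_integrals_measurable[of T] by auto
    show ?case unfolding borel_prod[symmetric] by measurable
  qed
  show Y'm: "\<forall>\<^sub>F T in at_top. ?Y' T \<in> borel_measurable M"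
    using ge1
  proof eventually_elim
    case (elim T)
    have [measurable]: "W T \<in> borel_measurable M" using elim by (intro W_measurable) simp
    have [measurable]: "(\<lambda>\<omega>. integral {0..T} (\<lambda>t. (W t \<omega>)\<^sup>2)) \<in> borel_measurable M"
      by (intro borel_measurable_integral_process borel_measurable_power W_measurable continuous_on_power wiener_continuous[OF W]) auto
    show ?case unfolding borel_prod[symmetric] by measurable
  qed
  show "to_zero (\<lambda>T \<omega>. dist (?Y T \<omega>) (?Y' T \<omega>)) at_top"
  proof (rule to_zero_bound[OF to_zero_add[OF to_zero_abs[OF score_remainder] to_zero_abs[OF information_remainder]]])
    show "\<forall>\<^sub>F T in at_top. (\<lambda>\<omega>. dist (?Y T \<omega>) (?Y' T \<omega>)) \<in> borel_measurable M"
      using Ym Y'm by eventually_elim (intro borel_measurable_dist)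
    have "dist (a, b) (c, d) \<le> \<bar>a - c\<bar> + \<bar>b - d\<bar>" for a b c d :: real
      using sqrt_sum_squares_le_sum_abs[of "a - c" "b - d"] by (simp add: dist_Pair_Pair dist_real_def)
    then show "\<forall>\<^sub>F T in at_top. AE \<omega> in M. \<bar>dist (?Y T \<omega>) (?Y' T \<omega>)\<bar>
        \<le> \<bar>\<bar>score (\<lambda>t. X 0 t \<omega>) T / T - ((W T \<omega>)\<^sup>2 / T - 1) / 2\<bar>
          + \<bar>information (\<lambda>t. X 0 t \<omega>) T / T\<^sup>2 - integral {0..T} (\<lambda>t. (W t \<omega>)\<^sup>2) / T\<^sup>2\<bar>\<bar>"
      by (intro always_eventually allI AE_I2) (simp add: order_trans[OF _ abs_ge_self])
  qed
qed

end

section \<open>The exponential moment of the limit\<close>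

definition partial_sum :: "(nat \<Rightarrow> real) \<Rightarrow> nat \<Rightarrow> real" where
  "partial_sum z k = (\<Sum>i<k. z i)"

text \<open>The drift that turns a random walk into the Euler scheme of the linear equation with coefficient \<open>h\<close>.\<close>

definition linear_drift :: "real \<Rightarrow> nat \<Rightarrow> (nat \<Rightarrow> real) \<Rightarrow> real" where
  "linear_drift h k z = h * partial_sum z k"

text \<open>Squared terminal value plus quadratic variation; it dominates the log density of the linear drift.\<close>

definition square_mass :: "nat \<Rightarrow> (nat \<Rightarrow> real) \<Rightarrow> real" where
  "square_mass k z = (partial_sum z k)\<^sup>2 + (\<Sum>i<k. (z i)\<^sup>2)"

lemma partial_sum_measurable:
  "(\<And>i. i < k \<Longrightarrow> (\<lambda>x. f x i) \<in> borel_measurable N) \<Longrightarrow> (\<lambda>x. partial_sum (f x) k) \<in> borel_measurable N"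
  unfolding partial_sum_def by (intro borel_measurable_sum) auto

lemma square_mass_measurable:
  "(\<And>i. i < k \<Longrightarrow> (\<lambda>x. f x i) \<in> borel_measurable N) \<Longrightarrow> (\<lambda>x. square_mass k (f x)) \<in> borel_measurable N"
  unfolding square_mass_def
  by (intro borel_measurable_add borel_measurable_power borel_measurable_sum partial_sum_measurable) auto

lemma predictable_linear_drift: "predictable (linear_drift h)"
  unfolding predictable_def
proof (intro conjI allI impI)
  fix k and z z' :: "nat \<Rightarrow> real" assume "\<forall>i<k. z i = z' i"
  then show "linear_drift h k z = linear_drift h k z'"
    unfolding linear_drift_def partial_sum_def by (intro arg_cong[of _ _ "(*) h"] sum.cong) auto
next
  fix k
  show "linear_drift h k \<in> borel_measurable (PiM {..<k} (\<lambda>_. borel))"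
    unfolding linear_drift_def
    by (intro borel_measurable_times borel_measurable_const partial_sum_measurable measurable_component_singleton) auto
qed

lemma square_mass_nonneg: "0 \<le> square_mass k z"
  unfolding square_mass_def by (intro add_nonneg_nonneg sum_nonneg) auto

text \<open>Summation by parts: the sum of \<open>partial_sum z k * z k\<close> is half of the squared terminal value minus
  half of the quadratic variation.\<close>

lemma log_density_linear_drift:
  "log_density v (linear_drift h) N z = h * ((partial_sum z N)\<^sup>2 - (\<Sum>i<N. (z i)\<^sup>2)) / 2 - h\<^sup>2 / 2 * (v * (\<Sum>k<N. (partial_sum z k)\<^sup>2))"
  unfolding log_density_def linear_drift_def
proof (induction N)
  case (Suc N)
  have "(partial_sum z (Suc N))\<^sup>2 = (partial_sum z N)\<^sup>2 + 2 * (partial_sum z N * z N) + (z N)\<^sup>2"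
    by (simp add: partial_sum_def power2_sum)
  moreover have "(h * (S\<^sup>2 - q) / 2 - h\<^sup>2 / 2 * (v * R)) + (h * S * u - v * (h * S)\<^sup>2 / 2)
      = h * ((S\<^sup>2 + 2 * (S * u) + u\<^sup>2) - (q + u\<^sup>2)) / 2 - h\<^sup>2 / 2 * (v * (R + S\<^sup>2))" for S q R u :: real
    by (simp add: power2_eq_square field_simps)
  ultimately show ?case using Suc.IH by (simp only: sum.lessThan_Suc)
qed (simp add: partial_sum_def)

lemma log_density_linear_drift_le:
  assumes "v \<ge> 0"
  shows "log_density v (linear_drift h) N z \<le> \<bar>h\<bar> / 2 * square_mass N z"
proof -
  define p q where "p = (partial_sum z N)\<^sup>2" and "q = (\<Sum>i<N. (z i)\<^sup>2)"
  have pq: "p \<ge> 0" "q \<ge> 0" by (auto simp: p_def q_def intro: sum_nonneg)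
  have "h * (p - q) \<le> \<bar>h\<bar> * \<bar>p - q\<bar>" unfolding abs_mult[symmetric] by (rule abs_ge_self)
  moreover have "\<bar>p - q\<bar> \<le> p + q" using pq by linarith
  then have "\<bar>h\<bar> * \<bar>p - q\<bar> \<le> \<bar>h\<bar> * (p + q)" by (rule mult_left_mono) simp
  ultimately have "h * (p - q) / 2 \<le> \<bar>h\<bar> / 2 * (p + q)" by simp
  moreover have "0 \<le> h\<^sup>2 / 2 * (v * (\<Sum>k<N. (partial_sum z k)\<^sup>2))"
    using assms by (intro mult_nonneg_nonneg sum_nonneg) auto
  ultimately show ?thesis
    unfolding log_density_linear_drift square_mass_def p_def[symmetric] q_def[symmetric] by linarith
qed

text \<open>Recursion over the steps: conditionally on the past, the expected mass grows in one step by at most the factor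
  \<open>r\<close> and twice the variance of the innovation.\<close>

lemma drifted_square_mass:
  fixes h :: real
  assumes v: "v > 0"
  defines "r \<equiv> 1 + 2 * \<bar>v * h\<bar> + 2 * (v * h)\<^sup>2"
  shows "(\<integral>\<^sup>+\<xi>. ennreal (square_mass N (drifted v (linear_drift h) \<xi>)) \<partial>noise v N) \<le> ennreal (2 * v * real N * r ^ N)"
proof (induction N)
  case 0
  then show ?case by (simp add: square_mass_def partial_sum_def)
next
  case (Suc N)
  let ?d = "drifted v (linear_drift h)" and ?c = "v * h"
  note b = predictable_linear_drift[of h]
  interpret normal: prob_space "normal_law v" by (rule prob_space_normal_law[OF v])
  interpret product_sigma_finite "\<lambda>_::nat. normal_law v" ..
  interpret noise: prob_space "noise v N" by (rule prob_space_noise[OF v])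
  have r1: "r \<ge> 1" by (simp add: r_def)
  have m: "(\<lambda>\<xi>. ennreal (square_mass k (?d \<xi>))) \<in> borel_measurable (PiM {..<k} (\<lambda>_. borel))" for k
    by (intro measurable_compose[OF _ measurable_ennreal] square_mass_measurable measurable_drifted[OF b] measurable_component_singleton) auto
  have "(\<integral>\<^sup>+\<xi>. ennreal (square_mass (Suc N) (?d \<xi>)) \<partial>noise v (Suc N))
      = (\<integral>\<^sup>+x. (\<integral>\<^sup>+y. ennreal (square_mass (Suc N) (?d (x(N := y)))) \<partial>normal_law v) \<partial>noise v N)"
    unfolding noise_def lessThan_Suc using m[of "Suc N"]
    by (intro product_nn_integral_insert) (simp_all add: lessThan_Suc cong: measurable_cong_sets sets_PiM_cong)
  also have "\<dots> \<le> (\<integral>\<^sup>+x. ennreal (r * square_mass N (?d x) + 2 * v) \<partial>noise v N)"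
  proof (rule nn_integral_mono)
    fix x
    define S where "S = partial_sum (?d x) N"
    define q where "q = (\<Sum>i<N. (?d x i)\<^sup>2)"
    have q0: "q \<ge> 0" by (simp add: q_def sum_nonneg)
    have "square_mass (Suc N) (?d (x(N := y))) = ((1 + ?c) * S + y)\<^sup>2 + ((?c * S + y)\<^sup>2 + q)" for y
    proof -
      have lt: "?d (x(N := y)) j = ?d x j" if "j < N" for j
        using that by (intro drifted_cong[OF b]) auto
      have pS: "partial_sum (?d (x(N := y))) N = S" "(\<Sum>i<N. (?d (x(N := y)) i)\<^sup>2) = q"
        unfolding S_def q_def partial_sum_def by (auto intro!: sum.cong simp: lt)
      have dN: "?d (x(N := y)) N = y + ?c * S"
        by (subst drifted_eq[OF b]) (simp add: linear_drift_def pS)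
      have "partial_sum (?d (x(N := y))) (Suc N) = S + (y + ?c * S)"
        using pS(1) dN by (simp add: partial_sum_def)
      then show ?thesis unfolding square_mass_def by (simp add: pS dN algebra_simps)
    qed
    then have "(\<integral>\<^sup>+y. ennreal (square_mass (Suc N) (?d (x(N := y)))) \<partial>normal_law v)
        = (\<integral>\<^sup>+y. ennreal (((1 + ?c) * S + y)\<^sup>2) + (ennreal ((?c * S + y)\<^sup>2) + ennreal q) \<partial>normal_law v)"
      using q0 by (intro nn_integral_cong) simp
    also have "\<dots> = ennreal (((1 + ?c) * S)\<^sup>2 + v) + (ennreal ((?c * S)\<^sup>2 + v) + ennreal q)"
      using normal.emeasure_space_1
      by (subst nn_integral_add, simp, simp, subst nn_integral_add, simp, simp)
        (simp add: nn_integral_normal_law_square[OF v] del: space_normal_law)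
    also have "\<dots> = ennreal ((((1 + ?c) * S)\<^sup>2 + v) + (((?c * S)\<^sup>2 + v) + q))"
      using q0 v by (simp add: ennreal_plus[symmetric] del: ennreal_plus)
    also have "\<dots> \<le> ennreal (r * square_mass N (?d x) + 2 * v)"
    proof (rule ennreal_leI)
      have "((1 + ?c) * S)\<^sup>2 + (?c * S)\<^sup>2 = (1 + 2 * ?c + 2 * ?c\<^sup>2) * S\<^sup>2"
        by (simp add: power2_eq_square algebra_simps)
      also have "\<dots> \<le> r * S\<^sup>2" unfolding r_def by (intro mult_right_mono) auto
      finally have "((1 + ?c) * S)\<^sup>2 + (?c * S)\<^sup>2 \<le> r * S\<^sup>2" .
      moreover have "q \<le> r * q" using r1 q0 by (simp add: mult_le_cancel_right1)
      moreover have "square_mass N (?d x) = S\<^sup>2 + q" by (simp add: square_mass_def S_def q_def)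
      ultimately show "(((1 + ?c) * S)\<^sup>2 + v) + (((?c * S)\<^sup>2 + v) + q) \<le> r * square_mass N (?d x) + 2 * v"
        by (simp add: distrib_left)
    qed
    finally show "(\<integral>\<^sup>+y. ennreal (square_mass (Suc N) (?d (x(N := y)))) \<partial>normal_law v) \<le> ennreal (r * square_mass N (?d x) + 2 * v)" .
  qed
  also have "\<dots> = (\<integral>\<^sup>+x. ennreal r * ennreal (square_mass N (?d x)) + ennreal (2 * v) \<partial>noise v N)"
    using r1 v square_mass_nonneg by (intro nn_integral_cong) (simp add: ennreal_mult'[symmetric])
  also have "\<dots> = ennreal r * (\<integral>\<^sup>+x. ennreal (square_mass N (?d x)) \<partial>noise v N) + ennreal (2 * v)"
  proof -
    have m': "(\<lambda>\<xi>. ennreal (square_mass N (?d \<xi>))) \<in> borel_measurable (noise v N)"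
      using m[of N] by (simp cong: measurable_cong_sets add: sets_noise)
    show ?thesis using m' noise.emeasure_space_1 by (subst nn_integral_add) (auto simp: nn_integral_cmult)
  qed
  also have "\<dots> \<le> ennreal r * ennreal (2 * v * real N * r ^ N) + ennreal (2 * v)"
    using Suc.IH by (intro add_mono mult_left_mono) auto
  also have "\<dots> = ennreal (r * (2 * v * real N * r ^ N) + 2 * v)"
    using r1 v by (simp add: ennreal_mult'[symmetric])
  also have "\<dots> \<le> ennreal (2 * v * real (Suc N) * r ^ Suc N)"
  proof (rule ennreal_leI)
    have "2 * v * 1 \<le> 2 * v * r ^ Suc N" using v r1 by (intro mult_left_mono one_le_power) auto
    then show "r * (2 * v * real N * r ^ N) + 2 * v \<le> 2 * v * real (Suc N) * r ^ Suc N"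
      by (simp add: algebra_simps)
  qed
  finally show ?case .
qed

lemma drifted_square_mass_uniform:
  assumes N: "N > 0"
  shows "(\<integral>\<^sup>+\<xi>. ennreal (square_mass N (drifted (1 / real N) (linear_drift h) \<xi>)) \<partial>noise (1 / real N) N)
    \<le> ennreal (2 * exp (2 * \<bar>h\<bar> + 2 * h\<^sup>2))"
proof -
  let ?r = "1 + 2 * \<bar>1 / real N * h\<bar> + 2 * (1 / real N * h)\<^sup>2"
  have "(1 / real N * h)\<^sup>2 \<le> h\<^sup>2 / real N"
  proof -
    have "(1 / real N * h)\<^sup>2 = h\<^sup>2 / real N / real N" by (simp add: power2_eq_square)
    also have "\<dots> \<le> h\<^sup>2 / real N / 1" using N by (intro divide_left_mono) auto
    finally show ?thesis by simp
  qed
  then have "?r \<le> 1 + (2 * \<bar>h\<bar> + 2 * h\<^sup>2) / real N"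
    by (simp add: abs_mult add_divide_distrib)
  also have "\<dots> \<le> exp ((2 * \<bar>h\<bar> + 2 * h\<^sup>2) / real N)" by (rule exp_ge_add_one_self)
  finally have "?r ^ N \<le> exp ((2 * \<bar>h\<bar> + 2 * h\<^sup>2) / real N) ^ N" by (intro power_mono) auto
  also have "\<dots> = exp (2 * \<bar>h\<bar> + 2 * h\<^sup>2)" using N by (simp add: exp_of_nat_mult[symmetric])
  finally have "2 * (1 / real N) * real N * ?r ^ N \<le> 2 * exp (2 * \<bar>h\<bar> + 2 * h\<^sup>2)" using N by simp
  then show ?thesis
    using drifted_square_mass[of "1 / real N" N h] N by (meson ennreal_leI order_trans of_nat_0_less_iff zero_less_divide_1_iff)
qed

text \<open>Under the drifted law the cutoff loses at most the probability that the log density exceeds \<open>K\<close>, which the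
  moment of \<open>square_mass\<close> controls uniformly in the number of steps. This is the uniform integrability behind
  \<open>wiener_exponential_moment\<close>, seen from the other side of the change of measure.\<close>

lemma truncated_mass_lower_bound:
  assumes N: "N > 0" and K: "K > 0"
  shows "1 \<le> (\<integral>\<^sup>+\<xi>. ennreal (ramp 1 (log_density (1 / real N) (linear_drift h) N \<xi> - K)
      * exp (log_density (1 / real N) (linear_drift h) N \<xi>)) \<partial>noise (1 / real N) N)
    + ennreal (\<bar>h\<bar> * exp (2 * \<bar>h\<bar> + 2 * h\<^sup>2) / K)"
    and "(\<integral>\<^sup>+\<xi>. ennreal (ramp 1 (log_density (1 / real N) (linear_drift h) N \<xi> - K)
      * exp (log_density (1 / real N) (linear_drift h) N \<xi>)) \<partial>noise (1 / real N) N) \<le> 1"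
proof -
  let ?v = "1 / real N" and ?b = "linear_drift h"
  let ?L = "log_density ?v ?b N"
  have v: "?v > 0" using N by simp
  note b = predictable_linear_drift[of h]
  interpret prob_space "noise ?v N" by (rule prob_space_noise[OF v])
  define G where "G \<xi> = ennreal (ramp 1 (?L \<xi> - K))" for \<xi>
  have G: "G \<in> borel_measurable (PiM {..<N} (\<lambda>_. borel))"
    unfolding G_def
    by (intro measurable_compose[OF _ measurable_ennreal] measurable_compose[OF _ borel_measurable_ramp] borel_measurable_diff
        borel_measurable_const measurable_log_density[OF b] measurable_component_singleton) auto
  have GL: "G (\<lambda>i\<in>{..<N}. z i) = ennreal (ramp 1 (?L z - K))" for z
  proof -
    have "?L (\<lambda>i\<in>{..<N}. z i) = ?L z" by (rule log_density_cong[OF b]) simp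
    then show ?thesis by (simp add: G_def)
  qed
  have eq: "(\<integral>\<^sup>+\<xi>. ennreal (ramp 1 (?L \<xi> - K) * exp (?L \<xi>)) \<partial>noise ?v N)
      = (\<integral>\<^sup>+\<xi>. ennreal (ramp 1 (?L (drifted ?v ?b \<xi>) - K)) \<partial>noise ?v N)"
    using discrete_girsanov[OF v b G] unfolding GL by (simp add: G_def ennreal_mult' ramp_bounds)
  have "(\<integral>\<^sup>+\<xi>. ennreal (ramp 1 (?L (drifted ?v ?b \<xi>) - K)) \<partial>noise ?v N) \<le> (\<integral>\<^sup>+\<xi>. 1 \<partial>noise ?v N)"
    using ramp_bounds by (intro nn_integral_mono) (simp add: ennreal_le_1)
  then show "(\<integral>\<^sup>+\<xi>. ennreal (ramp 1 (?L \<xi> - K) * exp (?L \<xi>)) \<partial>noise ?v N) \<le> 1"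
    unfolding eq using emeasure_space_1 by simp
  have cov: "(1::ennreal) \<le> ennreal (ramp 1 (?L (drifted ?v ?b \<xi>) - K)) + ennreal (\<bar>h\<bar> / 2 / K) * ennreal (square_mass N (drifted ?v ?b \<xi>))" for \<xi>
  proof (cases "?L (drifted ?v ?b \<xi>) \<le> K")
    case True
    then have "ramp 1 (?L (drifted ?v ?b \<xi>) - K) = 1" by (simp add: ramp_def)
    then show ?thesis by simp
  next
    case False
    then have "K \<le> \<bar>h\<bar> / 2 * square_mass N (drifted ?v ?b \<xi>)"
      using log_density_linear_drift_le[of ?v h N "drifted ?v ?b \<xi>"] v by simp
    then have "1 \<le> \<bar>h\<bar> / 2 / K * square_mass N (drifted ?v ?b \<xi>)" using K by (simp add: pos_le_divide_eq)
    then have "ennreal 1 \<le> ennreal (\<bar>h\<bar> / 2 / K * square_mass N (drifted ?v ?b \<xi>))" by (rule ennreal_leI)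
    also have "\<dots> = ennreal (\<bar>h\<bar> / 2 / K) * ennreal (square_mass N (drifted ?v ?b \<xi>))" using K by (intro ennreal_mult') simp
    finally show ?thesis by (simp add: add_increasing)
  qed
  have dm: "(\<lambda>\<xi>. drifted ?v ?b \<xi> i) \<in> borel_measurable (noise ?v N)" if "i < N" for i
  proof -
    have "(\<lambda>\<xi>. drifted ?v ?b \<xi> i) \<in> borel_measurable (PiM {..<N} (\<lambda>_. borel))"
      using that by (intro measurable_drifted[OF b] measurable_component_singleton) auto
    then show ?thesis by (simp cong: measurable_cong_sets add: sets_noise)
  qed
  have m1: "(\<lambda>\<xi>. ennreal (ramp 1 (?L (drifted ?v ?b \<xi>) - K))) \<in> borel_measurable (noise ?v N)"
    by (intro measurable_compose[OF _ measurable_ennreal] measurable_compose[OF _ borel_measurable_ramp] borel_measurable_diff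
        borel_measurable_const measurable_log_density[OF b] dm)
  have m2: "(\<lambda>\<xi>. ennreal (square_mass N (drifted ?v ?b \<xi>))) \<in> borel_measurable (noise ?v N)"
    by (intro measurable_compose[OF _ measurable_ennreal] square_mass_measurable dm)
  have "1 = (\<integral>\<^sup>+\<xi>. 1 \<partial>noise ?v N)" using emeasure_space_1 by simp
  also have "\<dots> \<le> (\<integral>\<^sup>+\<xi>. ennreal (ramp 1 (?L (drifted ?v ?b \<xi>) - K)) + ennreal (\<bar>h\<bar> / 2 / K) * ennreal (square_mass N (drifted ?v ?b \<xi>)) \<partial>noise ?v N)"
    by (intro nn_integral_mono cov)
  also have "\<dots> = (\<integral>\<^sup>+\<xi>. ennreal (ramp 1 (?L (drifted ?v ?b \<xi>) - K)) \<partial>noise ?v N)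
      + ennreal (\<bar>h\<bar> / 2 / K) * (\<integral>\<^sup>+\<xi>. ennreal (square_mass N (drifted ?v ?b \<xi>)) \<partial>noise ?v N)"
    using m1 m2 by (subst nn_integral_add) (auto simp: nn_integral_cmult)
  also have "\<dots> \<le> (\<integral>\<^sup>+\<xi>. ennreal (ramp 1 (?L (drifted ?v ?b \<xi>) - K)) \<partial>noise ?v N)
      + ennreal (\<bar>h\<bar> / 2 / K) * ennreal (2 * exp (2 * \<bar>h\<bar> + 2 * h\<^sup>2))"
    by (intro add_left_mono mult_left_mono drifted_square_mass_uniform N) simp
  also have "ennreal (\<bar>h\<bar> / 2 / K) * ennreal (2 * exp (2 * \<bar>h\<bar> + 2 * h\<^sup>2)) = ennreal (\<bar>h\<bar> * exp (2 * \<bar>h\<bar> + 2 * h\<^sup>2) / K)"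
    using K by (subst ennreal_mult'[symmetric]) auto
  finally show "1 \<le> (\<integral>\<^sup>+\<xi>. ennreal (ramp 1 (?L \<xi> - K) * exp (?L \<xi>)) \<partial>noise ?v N)
    + ennreal (\<bar>h\<bar> * exp (2 * \<bar>h\<bar> + 2 * h\<^sup>2) / K)" unfolding eq .
qed

lemma simple_integrals_AE_subseq:
  assumes V: "wiener_process L {0..1} V"
  obtains r :: "nat \<Rightarrow> nat" where "strict_mono r"
    "AE \<omega> in L. (\<lambda>n. simple_integral V (Suc (r n)) (uniform_node 1 (r n)) (\<lambda>i. V (uniform_node 1 (r n) i)) \<omega>) \<longlonglongrightarrow> ito_square V 1 \<omega>"
proof -
  interpret prob_space L using V by (simp add: wiener_process_def)
  define d where "d n \<omega> = simple_integral V (Suc n) (uniform_node 1 n) (\<lambda>i. V (uniform_node 1 n i)) \<omega> - ito_square V 1 \<omega>" for n \<omega>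
  have hb: "has_bochner_integral L (\<lambda>\<omega>. (d n \<omega>)\<^sup>2) (1\<^sup>2 / 2 / real (Suc n))" for n
    using simple_integral_error[OF V uniform_simple_process(1)[OF V zero_less_one, of n]]
    unfolding uniform_simple_process(2)[OF V zero_less_one] d_def .
  have "(\<lambda>n. 1 / 2 / real (Suc n)) \<longlonglongrightarrow> 1 / 2 * 0"
    unfolding divide_inverse[of _ "real (Suc _)"] by (intro tendsto_mult tendsto_const LIMSEQ_inverse_real_of_nat)
  then have lim: "(\<lambda>n. \<integral>\<omega>. norm ((d n \<omega>)\<^sup>2) \<partial>L) \<longlonglongrightarrow> 0"
    using hb by (simp add: has_bochner_integral_iff)
  have int: "integrable L (\<lambda>\<omega>. (d n \<omega>)\<^sup>2)" for n using hb by (simp add: has_bochner_integral_iff)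
  obtain r where r: "strict_mono r" "AE \<omega> in L. (\<lambda>n. (d (r n) \<omega>)\<^sup>2) \<longlonglongrightarrow> 0"
    using tendsto_L1_AE_subseq[OF int lim] by blast
  have "AE \<omega> in L. (\<lambda>n. simple_integral V (Suc (r n)) (uniform_node 1 (r n)) (\<lambda>i. V (uniform_node 1 (r n) i)) \<omega>) \<longlonglongrightarrow> ito_square V 1 \<omega>"
    using r(2)
  proof eventually_elim
    case (elim \<omega>)
    have "(\<lambda>n. sqrt ((d (r n) \<omega>)\<^sup>2)) \<longlonglongrightarrow> sqrt 0" by (intro tendsto_real_sqrt elim)
    then have "(\<lambda>n. d (r n) \<omega>) \<longlonglongrightarrow> 0" by (simp add: tendsto_rabs_zero_iff)
    then show ?case unfolding d_def by (rule LIM_zero_cancel)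
  qed
  then show ?thesis using r(1) that by blast
qed

text \<open>The discrete log densities converge to the exponent along a subsequence, because their stochastic sums are the
  simple integrals of the preceding section. The bounds of \<open>truncated_mass_lower_bound\<close> survive this limit, and then
  \<open>K\<close> tends to infinity.\<close>

theorem wiener_exponential_moment:
  assumes V: "wiener_process L {0..1} V"
  shows "(\<integral>\<omega>. exp (h * (((V 1 \<omega>)\<^sup>2 - 1) / 2) - h\<^sup>2 / 2 * integral {0..1} (\<lambda>t. (V t \<omega>)\<^sup>2)) \<partial>L) = 1"
proof -
  interpret prob_space L using V by (simp add: wiener_process_def)
  define \<Lambda> where "\<Lambda> \<omega> = h * (((V 1 \<omega>)\<^sup>2 - 1) / 2) - h\<^sup>2 / 2 * integral {0..1} (\<lambda>t. (V t \<omega>)\<^sup>2)" for \<omega>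
  define inc where "inc N \<omega> = (\<lambda>i\<in>{..<N}. V (real (Suc i) * (1 / real N)) \<omega> - V (real i * (1 / real N)) \<omega>)" for N \<omega>
  define D where "D N = log_density (1 / real N) (linear_drift h) N" for N
  note b = predictable_linear_drift[of h]
  have Vm: "V t \<in> borel_measurable L" if "t \<in> {0..1}" for t by (rule wiener_measurable[OF V that])
  have Vc: "continuous_on {0..1} (\<lambda>t. V t \<omega>)" if "\<omega> \<in> space L" for \<omega>
    using V that by (simp add: wiener_process_def continuous_process_def)
  have node: "real i * (1 / real N) \<in> {0..1}" if "i \<le> N" for i N
    using that by (cases "N = 0") auto
  have incm: "inc N \<in> measurable L (PiM {..<N} (\<lambda>_. borel))" for N
    unfolding inc_def using node by (intro measurable_restrict borel_measurable_diff Vm) auto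
  have Jm: "(\<lambda>\<omega>. integral {0..1} (\<lambda>t. (V t \<omega>)\<^sup>2)) \<in> borel_measurable L"
    by (intro borel_measurable_integral_process borel_measurable_power Vm continuous_on_power Vc)
  have \<Lambda>m [measurable]: "\<Lambda> \<in> borel_measurable L"
  proof -
    have [measurable]: "V 1 \<in> borel_measurable L" by (rule Vm) simp
    note [measurable] = Jm
    show ?thesis unfolding \<Lambda>_def[abs_def] by measurable
  qed
  have law: "distr L (PiM {..<N} (\<lambda>_. borel)) (inc N) = noise (1 / real N) N" if N: "N > 0" for N
    using increments_law[OF V N zero_less_one, of "1 / real N" "\<lambda>i. real i * (1 / real N)"] N node
    unfolding inc_def[abs_def] by (simp add: add_divide_distrib)
  have Dm: "D N \<in> borel_measurable (PiM {..<N} (\<lambda>_. borel))" for N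
    unfolding D_def by (intro measurable_log_density[OF b] measurable_component_singleton) auto
  have transfer: "(\<integral>\<^sup>+\<omega>. ennreal (ramp 1 (D N (inc N \<omega>) - K) * exp (D N (inc N \<omega>))) \<partial>L)
      = (\<integral>\<^sup>+\<xi>. ennreal (ramp 1 (D N \<xi> - K) * exp (D N \<xi>)) \<partial>noise (1 / real N) N)" if "N > 0" for N K
  proof -
    note [measurable] = Dm[of N]
    show ?thesis unfolding law[OF that, symmetric] by (subst nn_integral_distr[OF incm]) auto
  qed
  obtain r :: "nat \<Rightarrow> nat" where r: "strict_mono r"
    "AE \<omega> in L. (\<lambda>n. simple_integral V (Suc (r n)) (uniform_node 1 (r n)) (\<lambda>i. V (uniform_node 1 (r n) i)) \<omega>) \<longlonglongrightarrow> ito_square V 1 \<omega>"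
    by (rule simple_integrals_AE_subseq[OF V])
  have V0: "AE \<omega> in L. V 0 \<omega> = 0" using V by (simp add: wiener_process_def)
  have Dlim: "AE \<omega> in L. (\<lambda>n. D (Suc (r n)) (inc (Suc (r n)) \<omega>)) \<longlonglongrightarrow> \<Lambda> \<omega>"
    using r(2) V0 AE_space
  proof eventually_elim
    case (elim \<omega>)
    have part: "partial_sum (inc N \<omega>) k = V (real k * (1 / real N)) \<omega>" if "k \<le> N" for k N
    proof -
      have "partial_sum (inc N \<omega>) k = (\<Sum>i<k. V (real (Suc i) * (1 / real N)) \<omega> - V (real i * (1 / real N)) \<omega>)"
        unfolding partial_sum_def using that by (intro sum.cong) (auto simp: inc_def)
      also have "\<dots> = V (real k * (1 / real N)) \<omega>"
        using elim(2) by (subst sum_lessThan_telescope[of "\<lambda>i. V (real i * (1 / real N)) \<omega>"]) simp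
      finally show ?thesis .
    qed
    have D_eq: "D (Suc m) (inc (Suc m) \<omega>)
        = h * simple_integral V (Suc m) (uniform_node 1 m) (\<lambda>i. V (uniform_node 1 m i)) \<omega>
          - h\<^sup>2 / 2 * ((1 - 0) / real (Suc m) * (\<Sum>k<Suc m. (V (0 + real k * ((1 - 0) / real (Suc m))) \<omega>)\<^sup>2))" for m
    proof -
      have "D (Suc m) (inc (Suc m) \<omega>) = (\<Sum>k<Suc m. h * (V (uniform_node 1 m k) \<omega> * (V (uniform_node 1 m (Suc k)) \<omega> - V (uniform_node 1 m k) \<omega>))
          - h\<^sup>2 / 2 * (1 / real (Suc m) * (V (uniform_node 1 m k) \<omega>)\<^sup>2))"
        unfolding D_def log_density_def
      proof (intro sum.cong refl)
        fix k assume k: "k \<in> {..<Suc m}"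
        have "linear_drift h k (inc (Suc m) \<omega>) = h * V (uniform_node 1 m k) \<omega>"
          using k part[of k "Suc m"] by (simp add: linear_drift_def uniform_node_def del: of_nat_Suc)
        moreover have "inc (Suc m) \<omega> k = V (uniform_node 1 m (Suc k)) \<omega> - V (uniform_node 1 m k) \<omega>"
          using k by (simp add: inc_def uniform_node_def del: of_nat_Suc)
        ultimately show "linear_drift h k (inc (Suc m) \<omega>) * inc (Suc m) \<omega> k - 1 / real (Suc m) * (linear_drift h k (inc (Suc m) \<omega>))\<^sup>2 / 2
          = h * (V (uniform_node 1 m k) \<omega> * (V (uniform_node 1 m (Suc k)) \<omega> - V (uniform_node 1 m k) \<omega>))
            - h\<^sup>2 / 2 * (1 / real (Suc m) * (V (uniform_node 1 m k) \<omega>)\<^sup>2)"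
          by (simp add: power_mult_distrib del: of_nat_Suc)
      qed
      also have "\<dots> = h * simple_integral V (Suc m) (uniform_node 1 m) (\<lambda>i. V (uniform_node 1 m i)) \<omega>
          - h\<^sup>2 / 2 * ((1 - 0) / real (Suc m) * (\<Sum>k<Suc m. (V (0 + real k * ((1 - 0) / real (Suc m))) \<omega>)\<^sup>2))"
        unfolding sum_subtractf sum_distrib_left[symmetric] simple_integral_def uniform_node_def by simp
      finally show ?thesis .
    qed
    have "(\<lambda>m. (1 - 0) / real m * (\<Sum>k<m. (V (0 + real k * ((1 - 0) / real m)) \<omega>)\<^sup>2)) \<longlonglongrightarrow> integral {0..1} (\<lambda>t. (V t \<omega>)\<^sup>2)"
      using Vc[OF elim(3)] by (intro riemann_sums_tendsto continuous_on_power) auto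
    then have "((\<lambda>m. (1 - 0) / real m * (\<Sum>k<m. (V (0 + real k * ((1 - 0) / real m)) \<omega>)\<^sup>2)) \<circ> (\<lambda>n. Suc (r n)))
        \<longlonglongrightarrow> integral {0..1} (\<lambda>t. (V t \<omega>)\<^sup>2)"
      using r(1) by (intro LIMSEQ_subseq_LIMSEQ) (auto simp: strict_mono_def)
    then have R: "(\<lambda>n. (1 - 0) / real (Suc (r n)) * (\<Sum>k<Suc (r n). (V (0 + real k * ((1 - 0) / real (Suc (r n)))) \<omega>)\<^sup>2))
        \<longlonglongrightarrow> integral {0..1} (\<lambda>t. (V t \<omega>)\<^sup>2)" by (simp only: comp_def)
    have "(\<lambda>n. D (Suc (r n)) (inc (Suc (r n)) \<omega>)) \<longlonglongrightarrow> h * ito_square V 1 \<omega> - h\<^sup>2 / 2 * integral {0..1} (\<lambda>t. (V t \<omega>)\<^sup>2)"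
      unfolding D_eq by (intro tendsto_diff tendsto_mult tendsto_const elim(1) R)
    then show ?case using elim(2) by (simp add: \<Lambda>_def ito_square_def)
  qed
  have Klim: "(\<lambda>n. \<integral>\<^sup>+\<omega>. ennreal (ramp 1 (D (Suc (r n)) (inc (Suc (r n)) \<omega>) - K) * exp (D (Suc (r n)) (inc (Suc (r n)) \<omega>))) \<partial>L)
      \<longlonglongrightarrow> (\<integral>\<^sup>+\<omega>. ennreal (ramp 1 (\<Lambda> \<omega> - K) * exp (\<Lambda> \<omega>)) \<partial>L)" for K
  proof (rule nn_integral_dominated_convergence[where w = "\<lambda>_. ennreal (exp (K + 1))"])
    show "(\<lambda>\<omega>. ennreal (ramp 1 (D (Suc (r n)) (inc (Suc (r n)) \<omega>) - K) * exp (D (Suc (r n)) (inc (Suc (r n)) \<omega>)))) \<in> borel_measurable L" for n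
      using measurable_compose[OF incm Dm, of "Suc (r n)"] by measurable
    show "AE \<omega> in L. (\<lambda>n. ennreal (ramp 1 (D (Suc (r n)) (inc (Suc (r n)) \<omega>) - K) * exp (D (Suc (r n)) (inc (Suc (r n)) \<omega>))))
        \<longlonglongrightarrow> ennreal (ramp 1 (\<Lambda> \<omega> - K) * exp (\<Lambda> \<omega>))"
      using Dlim by eventually_elim (intro tendsto_ennrealI tendsto_mult tendsto_exp tendsto_ramp tendsto_diff tendsto_const)
  qed (use ramp_cutoff_exp emeasure_space_1 in \<open>auto intro!: ennreal_leI\<close>)
  let ?T = "\<lambda>K. \<integral>\<^sup>+\<omega>. ennreal (ramp 1 (\<Lambda> \<omega> - K) * exp (\<Lambda> \<omega>)) \<partial>L"
  have upper: "?T K \<le> 1" if K: "K > 0" for K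
  proof (rule LIMSEQ_le_const2[OF Klim])
    show "\<exists>M. \<forall>n\<ge>M. (\<integral>\<^sup>+\<omega>. ennreal (ramp 1 (D (Suc (r n)) (inc (Suc (r n)) \<omega>) - K) * exp (D (Suc (r n)) (inc (Suc (r n)) \<omega>))) \<partial>L) \<le> 1"
      unfolding transfer[OF zero_less_Suc] unfolding D_def using truncated_mass_lower_bound(2)[OF zero_less_Suc K] by blast
  qed
  have lower: "1 \<le> ?T K + ennreal (\<bar>h\<bar> * exp (2 * \<bar>h\<bar> + 2 * h\<^sup>2) / K)" if K: "K > 0" for K
  proof (rule LIMSEQ_le_const)
    show "(\<lambda>n. (\<integral>\<^sup>+\<omega>. ennreal (ramp 1 (D (Suc (r n)) (inc (Suc (r n)) \<omega>) - K) * exp (D (Suc (r n)) (inc (Suc (r n)) \<omega>))) \<partial>L)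
        + ennreal (\<bar>h\<bar> * exp (2 * \<bar>h\<bar> + 2 * h\<^sup>2) / K)) \<longlonglongrightarrow> ?T K + ennreal (\<bar>h\<bar> * exp (2 * \<bar>h\<bar> + 2 * h\<^sup>2) / K)"
      by (intro tendsto_add Klim tendsto_const)
    show "\<exists>M. \<forall>n\<ge>M. 1 \<le> (\<integral>\<^sup>+\<omega>. ennreal (ramp 1 (D (Suc (r n)) (inc (Suc (r n)) \<omega>) - K) * exp (D (Suc (r n)) (inc (Suc (r n)) \<omega>))) \<partial>L)
        + ennreal (\<bar>h\<bar> * exp (2 * \<bar>h\<bar> + 2 * h\<^sup>2) / K)"
      unfolding transfer[OF zero_less_Suc] unfolding D_def using truncated_mass_lower_bound(1)[OF zero_less_Suc K] by blast
  qed
  have mono_lim: "(\<lambda>K. ?T (real K)) \<longlonglongrightarrow> (\<integral>\<^sup>+\<omega>. ennreal (exp (\<Lambda> \<omega>)) \<partial>L)"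
  proof (rule nn_integral_LIMSEQ)
    show "mono (\<lambda>K \<omega>. ennreal (ramp 1 (\<Lambda> \<omega> - real K) * exp (\<Lambda> \<omega>)))"
      by (intro monoI le_funI ennreal_leI mult_right_mono ramp_cutoff_mono) auto
    show "(\<lambda>K. ennreal (ramp 1 (\<Lambda> \<omega> - real K) * exp (\<Lambda> \<omega>))) \<longlonglongrightarrow> ennreal (exp (\<Lambda> \<omega>))" for \<omega>
      using tendsto_ennrealI[OF tendsto_mult[OF ramp_cutoff_tendsto[of "\<Lambda> \<omega>"] tendsto_const[of "exp (\<Lambda> \<omega>)"]]] by simp
  qed auto
  have "(\<integral>\<^sup>+\<omega>. ennreal (exp (\<Lambda> \<omega>)) \<partial>L) = 1"
  proof (rule antisym)
    have "\<forall>K\<ge>1. ?T (real K) \<le> 1" using upper by auto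
    then show "(\<integral>\<^sup>+\<omega>. ennreal (exp (\<Lambda> \<omega>)) \<partial>L) \<le> 1"
      by (intro LIMSEQ_le_const2[OF mono_lim]) blast
    have "(\<lambda>K. \<bar>h\<bar> * exp (2 * \<bar>h\<bar> + 2 * h\<^sup>2) / real K) \<longlonglongrightarrow> 0" by (rule lim_const_over_n)
    from tendsto_add[OF mono_lim tendsto_ennrealI[OF this]]
    have "(\<lambda>K. ?T (real K) + ennreal (\<bar>h\<bar> * exp (2 * \<bar>h\<bar> + 2 * h\<^sup>2) / real K)) \<longlonglongrightarrow> (\<integral>\<^sup>+\<omega>. ennreal (exp (\<Lambda> \<omega>)) \<partial>L)" by simp
    moreover have "\<forall>K\<ge>1. 1 \<le> ?T (real K) + ennreal (\<bar>h\<bar> * exp (2 * \<bar>h\<bar> + 2 * h\<^sup>2) / real K)" using lower by auto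
    ultimately show "1 \<le> (\<integral>\<^sup>+\<omega>. ennreal (exp (\<Lambda> \<omega>)) \<partial>L)"
      by (intro LIMSEQ_le_const) blast+
  qed
  then have "(\<integral>\<omega>. exp (\<Lambda> \<omega>) \<partial>L) = 1"
    by (subst integral_eq_nn_integral) auto
  then show ?thesis by (simp add: \<Lambda>_def)
qed

text \<open>A path with vanishing integral is zero throughout, in particular at time \<open>1\<close>, where its value is normal.\<close>

lemma wiener_square_integral_pos:
  assumes V: "wiener_process L {0..1} V"
  shows "AE \<omega> in L. integral {0..1} (\<lambda>t. (V t \<omega>)\<^sup>2) > 0"
proof -
  interpret prob_space L using V by (simp add: wiener_process_def)
  have D: "distributed L lborel (\<lambda>\<omega>. V 1 \<omega> - V 0 \<omega>) (normal_density 0 (sqrt (1 - 0)))"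
  proof -
    have "\<forall>s\<in>{0..1}. \<forall>t\<in>{0..1}. s < t \<longrightarrow> distributed L lborel (\<lambda>\<omega>. V t \<omega> - V s \<omega>) (normal_density 0 (sqrt (t - s)))"
      using V unfolding wiener_process_def by blast
    from this[rule_format, of 0 1] show ?thesis by simp
  qed
  have "AE x in density lborel (\<lambda>x. ennreal (normal_density 0 (sqrt (1 - 0)) x)). x \<noteq> 0"
    by (subst AE_density) (use AE_lborel_neq[of 0] in \<open>auto elim!: eventually_mono\<close>)
  then have "AE x in distr L lborel (\<lambda>\<omega>. V 1 \<omega> - V 0 \<omega>). x \<noteq> 0"
    unfolding distributed_distr_eq_density[OF D] .
  then have "AE \<omega> in L. V 1 \<omega> - V 0 \<omega> \<noteq> 0"
    using distributed_measurable[OF D] by (subst (asm) AE_distr_iff) auto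
  moreover have "AE \<omega> in L. V 0 \<omega> = 0" using V by (simp add: wiener_process_def)
  ultimately show ?thesis using AE_space
  proof eventually_elim
    case (elim \<omega>)
    have c: "continuous_on {0..1} (\<lambda>t. (V t \<omega>)\<^sup>2)"
      using V elim by (intro continuous_on_power) (simp add: wiener_process_def continuous_process_def)
    have "integral {0..1} (\<lambda>t. (V t \<omega>)\<^sup>2) \<noteq> 0"
    proof
      assume "integral {0..1} (\<lambda>t. (V t \<omega>)\<^sup>2) = 0"
      then have "\<forall>t\<in>{0..1}. (V t \<omega>)\<^sup>2 = 0" using integral_eq_0_iff[OF c] by simp
      then show False using elim by simp
    qed
    moreover have "integral {0..1} (\<lambda>t. (V t \<omega>)\<^sup>2) \<ge> 0"
      by (intro integral_nonneg integrable_continuous_real c) auto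
    ultimately show ?case by simp
  qed
qed

section \<open>Local asymptotic quadraticity\<close>

theorem proposition4p2:
  fixes M :: "'o measure" and W X0 :: "real \<Rightarrow> 'o \<Rightarrow> real"
    and X :: "real \<Rightarrow> real \<Rightarrow> 'o \<Rightarrow> real"
    and L :: "'l measure" and \<W> :: "real \<Rightarrow> 'l \<Rightarrow> real"
  assumes "prob_space M"
    and "wiener_process M {0..} W"
    and "continuous_process M {-1..0} X0"
    and "prob_space.indep_var M
           (PiM {-1..0} (\<lambda>_. borel)) (\<lambda>\<omega>. \<lambda>t\<in>{-1..0}. X0 t \<omega>)
           (PiM {0..} (\<lambda>_. borel)) (\<lambda>\<omega>. \<lambda>t\<in>{0..}. W t \<omega>)"
    and "\<And>a. delay_solution M W X0 a (X a)"
    and "wiener_process L {0..1} \<W>"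
  shows "LAQ M X 0 (\<lambda>T. 1 / T) L
           (ito_integral L \<W> 1 \<W>)
           (\<lambda>\<omega>. integral {0..1} (\<lambda>t. (\<W> t \<omega>)\<^sup>2))"
proof -
  interpret M: prob_space M by fact
  interpret delay_model M W X0 X
    using assms by (intro delay_model.intro delay_model_axioms.intro)
  note V = \<open>wiener_process L {0..1} \<W>\<close>
  interpret L: prob_space L using V by (simp add: wiener_process_def)
  let ?I = "ito_integral L \<W> 1 \<W>" and ?J = "\<lambda>\<omega>. integral {0..1} (\<lambda>t. (\<W> t \<omega>)\<^sup>2)"
  have I [measurable]: "?I \<in> borel_measurable L" and I_eq: "AE \<omega> in L. ?I \<omega> = ((\<W> 1 \<omega>)\<^sup>2 - 1) / 2"
    using ito_integral_wiener[OF V zero_less_one] by auto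
  have V1 [measurable]: "\<W> 1 \<in> borel_measurable L" by (rule wiener_measurable[OF V]) simp
  have J [measurable]: "?J \<in> borel_measurable L"
    using V by (intro borel_measurable_integral_process borel_measurable_power continuous_on_power)
      (auto simp: wiener_process_def continuous_process_def)
  define \<Delta>T where "\<Delta>T T \<omega> = score (\<lambda>t. X 0 t \<omega>) T / T" for T \<omega>
  define JT where "JT T \<omega> = information (\<lambda>t. X 0 t \<omega>) T / T\<^sup>2" for T \<omega>
  have meas: "\<Delta>T T \<in> borel_measurable M" "JT T \<in> borel_measurable M" if "T > 0" for T
    using X_integrals_measurable(2,3)[OF that, of 0] by (auto simp: \<Delta>T_def[abs_def] JT_def[abs_def])
  have expansion: "tends_to_zero_in_probability M
      (\<lambda>T \<omega>. log_likelihood_ratio M X (0 + 1 / T * h T) 0 T \<omega> - (h T * \<Delta>T T \<omega> - 1 / 2 * (h T)\<^sup>2 * JT T \<omega>)) at_top"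
    for h :: "real \<Rightarrow> real"
  proof (rule M.to_zero_bound[OF M.to_zero_real[OF tendsto_const[of 0]]])
    have pos: "\<forall>\<^sub>F T :: real in at_top. T > 0" by (rule eventually_gt_at_top)
    show "\<forall>\<^sub>F T in at_top. (\<lambda>\<omega>. log_likelihood_ratio M X (0 + 1 / T * h T) 0 T \<omega> - (h T * \<Delta>T T \<omega> - 1 / 2 * (h T)\<^sup>2 * JT T \<omega>)) \<in> borel_measurable M"
      using pos by eventually_elim
        (intro borel_measurable_diff borel_measurable_times borel_measurable_const meas log_likelihood_ratio_eq(2))
    show "\<forall>\<^sub>F T in at_top. AE \<omega> in M. \<bar>log_likelihood_ratio M X (0 + 1 / T * h T) 0 T \<omega> - (h T * \<Delta>T T \<omega> - 1 / 2 * (h T)\<^sup>2 * JT T \<omega>)\<bar> \<le> \<bar>0\<bar>"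
      using pos
    proof eventually_elim
      case (elim T)
      show ?case
        using log_likelihood_ratio_eq(1)[OF elim, of "0 + 1 / T * h T"]
        by eventually_elim (simp add: \<Delta>T_def JT_def power_divide)
    qed
  qed
  have "tends_in_distribution M (\<lambda>T \<omega>. (\<Delta>T T \<omega>, JT T \<omega>)) L (\<lambda>\<omega>. (?I \<omega>, ?J \<omega>)) at_top"
    unfolding tends_in_distribution_def
  proof (intro allI impI)
    fix f :: "real \<times> real \<Rightarrow> real" assume f: "continuous_on UNIV f \<and> bounded (range f)"
    then have [measurable]: "f \<in> borel_measurable borel" by (simp add: borel_measurable_continuous_onI)
    have pm: "(\<lambda>\<omega>. (?I \<omega>, ?J \<omega>)) \<in> borel_measurable L" "(\<lambda>\<omega>. (((\<W> 1 \<omega>)\<^sup>2 - 1) / 2, ?J \<omega>)) \<in> borel_measurable L"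
      unfolding borel_prod[symmetric] by measurable
    have "(\<integral>\<omega>. f (?I \<omega>, ?J \<omega>) \<partial>L) = (\<integral>\<omega>. f (((\<W> 1 \<omega>)\<^sup>2 - 1) / 2, ?J \<omega>) \<partial>L)"
    proof (rule integral_cong_AE)
      show "(\<lambda>\<omega>. f (?I \<omega>, ?J \<omega>)) \<in> borel_measurable L" "(\<lambda>\<omega>. f (((\<W> 1 \<omega>)\<^sup>2 - 1) / 2, ?J \<omega>)) \<in> borel_measurable L"
        by (rule measurable_compose[OF pm(1)], simp) (rule measurable_compose[OF pm(2)], simp)
      show "AE \<omega> in L. f (?I \<omega>, ?J \<omega>) = f (((\<W> 1 \<omega>)\<^sup>2 - 1) / 2, ?J \<omega>)"
        using I_eq by eventually_elim (simp only:)
    qed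
    then show "((\<lambda>T. \<integral>\<omega>. f (\<Delta>T T \<omega>, JT T \<omega>) \<partial>M) \<longlongrightarrow> (\<integral>\<omega>. f (?I \<omega>, ?J \<omega>) \<partial>L)) at_top"
      using score_information_tend_in_distribution[OF V] f unfolding tends_in_distribution_def \<Delta>T_def JT_def by simp
  qed
  moreover have "(\<integral>\<omega>. exp (h * ?I \<omega> - 1 / 2 * h\<^sup>2 * ?J \<omega>) \<partial>L) = 1" for h
  proof -
    have "(\<integral>\<omega>. exp (h * ?I \<omega> - 1 / 2 * h\<^sup>2 * ?J \<omega>) \<partial>L)
        = (\<integral>\<omega>. exp (h * (((\<W> 1 \<omega>)\<^sup>2 - 1) / 2) - h\<^sup>2 / 2 * ?J \<omega>) \<partial>L)"
    proof (rule integral_cong_AE)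
      show "AE \<omega> in L. exp (h * ?I \<omega> - 1 / 2 * h\<^sup>2 * ?J \<omega>) = exp (h * (((\<W> 1 \<omega>)\<^sup>2 - 1) / 2) - h\<^sup>2 / 2 * ?J \<omega>)"
        using I_eq by eventually_elim (simp only: mult_1_left times_divide_eq_left)
    qed measurable
    then show ?thesis using wiener_exponential_moment[OF V, of h] by simp
  qed
  ultimately show ?thesis
    unfolding LAQ_def
    using L.prob_space_axioms I J meas expansion wiener_square_integral_pos[OF V] by blast
qed

end
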